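(* Let $n\ge1$, let $\mathcal{C}$ be a rigid C$^*$-tensor category with simple unit which is graded by $\mathbb{Z}/n\mathbb{Z}$, let $k\in\{0,1,\dots,n-1\}$, and let $\omega^k$ be the $3$-cocycle on $\mathbb{Z}/n\mathbb{Z}$ given by $$\omega^k(a,b,c)=\exp\left(2\pi\sqrt{-1}\,k\left(\left\lfloor\tfrac{a+b}{n}\right\rfloor-\left\lfloor\tfrac{a}{n}\right\rfloor-\left\lfloor\tfrac{b}{n}\right\rfloor\right)\tfrac{c}{n}\right).$$ Then $\mathcal{Z}(\mathrm{ind}\text{-}\mathcal{C}^{\omega^k})$ is unitarily monoidally equivalent to $(\mathcal{Z}(\mathrm{ind}\text{-}\mathcal{C}),\otimes^{(k)})^{\omega^k}$.
   Context: **Conventions.** C$^*$-categories are small and have finite direct sums and images of projections. C$^*$-tensor categories have unitary associators $\alpha_{X,Y,Z}\colon(X\otimes Y)\otimes Z\to X\otimes(Y\otimes Z)$, identity unit constraints, and simple unit $\mathbb{1}$; rigid ones are semisimple. A unitary monoidal equivalence is a C$^*$-tensor functor $(F,F_0,F_2)$ with unitary structure morphisms $F_0\colon\mathbb{1}\to F(\mathbb{1})$ and $F_2\colon F(X)\otimes F(Y)\to F(X\otimes Y)$ such that $F$ is an equivalence. **Grading and twisting.** A C$^*$-tensor category $\mathcal{C}$ is $\Gamma$-graded if $\mathcal{C}=\bigoplus_{\gamma\in\Gamma}\mathcal{C}_\gamma$ for mutually orthogonal full subcategories with $\mathcal{C}_\gamma\otimes\mathcal{C}_\eta\subset\mathcal{C}_{\gamma\eta}$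 up to isomorphism. For a normalized $\mathbb{T}$-valued $3$-cocycle $\omega$ on $\Gamma$, $\mathcal{C}^\omega$ is the same C$^*$-category with the same tensor bifunctor and unit constraints, and associator $\alpha^\omega_{X_1,X_2,X_3}=\omega(\gamma_1,\gamma_2,\gamma_3)\alpha_{X_1,X_2,X_3}$ for $X_i\in\mathcal{C}_{\gamma_i}$ (extended by direct sums). In the formula for $\omega^k$, classes in $\mathbb{Z}/n\mathbb{Z}$ are represented by integers (the value is independent of representatives); $\omega^{2k}$ denotes the same formula with $2k$ in place of $k$. **Ind-category and center.** For $\mathcal{C}$ semisimple with representatives $\mathcal{I}$ of the simple classes, $\mathrm{ind}\text{-}\mathcal{C}$ is the (non-rigid) C$^*$-tensor category of direct limits of inductive systems in $\mathcal{C}$ with isometric connecting maps; objects can be written $\bigoplus_{S\in\mathcal{I}}H_S\otimes S$ with Hilbert spaces $H_S$, and the morphism space from $\bigoplus_SH_S\otimes S$ to $\bigoplus_SH_S'\otimes S$ is the space of uniformly bounded families in $\prod_SB(H_S,H'_S)$; its tensor structure extends that of $\mathcal{C}$. A unitary half-braiding on $X\in\mathrm{ind}\text{-}\mathcal{C}$ is a natural family of unitaries $c_Y\colon Y\otimes X\to X\otimes Y$ ($Y\in\mathrm{Obj}(\mathcal{C})$) with $\alpha_{X,Y,Z}(c_Y\otimes1_Z)\alpha_{Y,X,Z}^{-1}(1_Y\otimes c_Z)\alpha_{Y,Z,X}=c_{Y\otimes Z}$. $\mathcal{Z}(\mathrm{ind}\text{-}\mathcal{C})$ is the category of pairs $(X,c)$,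 with morphisms $x\colon(X,c)\to(X',c')$ those $x\colon X\to X'$ satisfying $(x\otimes1_Y)c_Y=c'_Y(1_Y\otimes x)$. Its usual tensor product is $(X,c)\otimes(X',c')=(X\otimes X',c\otimes c')$ with $(c\otimes c')_Y=\alpha_{X,X',Y}^{-1}(1_X\otimes c'_Y)\alpha_{X,Y,X'}(c_Y\otimes1_{X'})\alpha_{Y,X,X'}^{-1}$, and with the associator of $\mathrm{ind}\text{-}\mathcal{C}$. If $\mathcal{C}$ is graded by $\mathbb{Z}/n\mathbb{Z}$, every $(X,c)\in\mathcal{Z}(\mathrm{ind}\text{-}\mathcal{C})$ is a direct sum of objects $(X_a,c^a)$ with $X_a\in\mathrm{ind}\text{-}\mathcal{C}_a$, so $\mathcal{Z}(\mathrm{ind}\text{-}\mathcal{C})$ is graded by $\mathbb{Z}/n\mathbb{Z}$. **The product $\otimes^{(k)}$.** For $(X,c),(X',c')\in\mathcal{Z}(\mathrm{ind}\text{-}\mathcal{C})$ with $X\in\mathrm{ind}\text{-}\mathcal{C}_a$, $X'\in\mathrm{ind}\text{-}\mathcal{C}_b$, set $(X,c)\otimes^{(k)}(X',c')=(X\otimes X',c\otimes^{(k)}c')$ where $(c\otimes^{(k)}c')_Y=\overline{\omega^{2k}(a,b,s)}\,(c\otimes c')_Y$ for $Y\in\mathcal{C}_s$, and extend linearly to general $Y$, $X$, $X'$. With the same associator as $\mathcal{Z}(\mathrm{ind}\text{-}\mathcal{C})$ this is a $\mathbb{Z}/n\mathbb{Z}$-graded monoidal structure, and $(\mathcal{Z}(\mathrm{ind}\text{-}\mathcal{C}),\otimes^{(k)})^{\omega^k}$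 denotes its twist by $\omega^k$. *)

theory Defs
  imports Complex_Main "HOL-Library.FuncSet" "HOL-Algebra.FiniteProduct"
    "HOL-Algebra.Elementary_Groups"
begin

section \<open>C*-categories\<close>

text \<open>A small category enriched over normed complex vector spaces with an involution. Arrows know
  their domain and codomain, so that composition needs no object arguments; only the zero morphism
  is indexed by a pair of objects.\<close>

record ('o, 'a) star_cat =
  Obj :: "'o set"
  Arr :: "'a set"
  Dom :: "'a \<Rightarrow> 'o"
  Cod :: "'a \<Rightarrow> 'o"
  Id :: "'o \<Rightarrow> 'a"
  Comp :: "'a \<Rightarrow> 'a \<Rightarrow> 'a" (infixl "\<cdot>\<index>" 70)
  Zero :: "'o \<Rightarrow> 'o \<Rightarrow> 'a"
  Plus :: "'a \<Rightarrow> 'a \<Rightarrow> 'a" (infixl "\<boxplus>\<index>" 65)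
  Scale :: "complex \<Rightarrow> 'a \<Rightarrow> 'a" (infixr "\<bullet>\<index>" 68)
  Adj :: "'a \<Rightarrow> 'a" ("(_\<^sup>\<dagger>\<index>)" [1000] 999)
  Norm :: "'a \<Rightarrow> real"

definition Hom :: "('o, 'a, 'z) star_cat_scheme \<Rightarrow> 'o \<Rightarrow> 'o \<Rightarrow> 'a set" where
  "Hom C X Y = {f \<in> Arr C. Dom C f = X \<and> Cod C f = Y}"

definition Diff :: "('o, 'a, 'z) star_cat_scheme \<Rightarrow> 'a \<Rightarrow> 'a \<Rightarrow> 'a" where
  "Diff C f g = f \<boxplus>\<^bsub>C\<^esub> (- 1) \<bullet>\<^bsub>C\<^esub> g"

text \<open>Finite sums in a morphism space: \<^const>\<open>finprod\<close> for the additive group of that space.\<close>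

definition Sum ::
  "('o, 'a, 'z) star_cat_scheme \<Rightarrow> 'o \<Rightarrow> 'o \<Rightarrow> ('b \<Rightarrow> 'a) \<Rightarrow> 'b set \<Rightarrow> 'a" where
  "Sum C X Y f A =
     finprod \<lparr>carrier = Hom C X Y, monoid.mult = Plus C, one = Zero C X Y\<rparr> f A"

definition isometry :: "('o, 'a, 'z) star_cat_scheme \<Rightarrow> 'o \<Rightarrow> 'o \<Rightarrow> 'a \<Rightarrow> bool" where
  "isometry C X Y v \<longleftrightarrow> v \<in> Hom C X Y \<and> v\<^sup>\<dagger>\<^bsub>C\<^esub> \<cdot>\<^bsub>C\<^esub> v = Id C X"

definition unitary :: "('o, 'a, 'z) star_cat_scheme \<Rightarrow> 'o \<Rightarrow> 'o \<Rightarrow> 'a \<Rightarrow> bool" where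
  "unitary C X Y u \<longleftrightarrow> u \<in> Hom C X Y \<and>
     u\<^sup>\<dagger>\<^bsub>C\<^esub> \<cdot>\<^bsub>C\<^esub> u = Id C X \<and> u \<cdot>\<^bsub>C\<^esub> u\<^sup>\<dagger>\<^bsub>C\<^esub> = Id C Y"

definition isomorphic :: "('o, 'a, 'z) star_cat_scheme \<Rightarrow> 'o \<Rightarrow> 'o \<Rightarrow> bool" where
  "isomorphic C X Y \<longleftrightarrow> (\<exists>f\<in>Hom C X Y. \<exists>g\<in>Hom C Y X.
     g \<cdot>\<^bsub>C\<^esub> f = Id C X \<and> f \<cdot>\<^bsub>C\<^esub> g = Id C Y)"

locale cstar_category =
  fixes C :: "('o, 'a, 'z) star_cat_scheme" (structure)
  assumes Dom_Cod: "f \<in> Arr C \<Longrightarrow> Dom C f \<in> Obj C \<and> Cod C f \<in> Obj C"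
    and Id_Hom: "X \<in> Obj C \<Longrightarrow> Id C X \<in> Hom C X X"
    and Comp_Hom: "\<lbrakk>f \<in> Hom C X Y; g \<in> Hom C Y Z\<rbrakk> \<Longrightarrow> g \<cdot> f \<in> Hom C X Z"
    and Comp_Id: "f \<in> Hom C X Y \<Longrightarrow> f \<cdot> Id C X = f"
    and Id_Comp: "f \<in> Hom C X Y \<Longrightarrow> Id C Y \<cdot> f = f"
    and Comp_assoc:
      "\<lbrakk>f \<in> Hom C X Y; g \<in> Hom C Y Z; h \<in> Hom C Z W\<rbrakk> \<Longrightarrow> (h \<cdot> g) \<cdot> f = h \<cdot> (g \<cdot> f)"
    \<comment> \<open>morphism spaces are complex vector spaces\<close>
    and Zero_Hom: "\<lbrakk>X \<in> Obj C; Y \<in> Obj C\<rbrakk> \<Longrightarrow> Zero C X Y \<in> Hom C X Y"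
    and Plus_Hom: "\<lbrakk>f \<in> Hom C X Y; g \<in> Hom C X Y\<rbrakk> \<Longrightarrow> f \<boxplus> g \<in> Hom C X Y"
    and Scale_Hom: "f \<in> Hom C X Y \<Longrightarrow> z \<bullet> f \<in> Hom C X Y"
    and Plus_assoc: "\<lbrakk>f \<in> Hom C X Y; g \<in> Hom C X Y; h \<in> Hom C X Y\<rbrakk> \<Longrightarrow>
      (f \<boxplus> g) \<boxplus> h = f \<boxplus> (g \<boxplus> h)"
    and Plus_comm: "\<lbrakk>f \<in> Hom C X Y; g \<in> Hom C X Y\<rbrakk> \<Longrightarrow> f \<boxplus> g = g \<boxplus> f"
    and Plus_Zero: "f \<in> Hom C X Y \<Longrightarrow> f \<boxplus> Zero C X Y = f"
    and Plus_minus: "f \<in> Hom C X Y \<Longrightarrow> f \<boxplus> (- 1) \<bullet> f = Zero C X Y"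
    and Scale_Plus: "\<lbrakk>f \<in> Hom C X Y; g \<in> Hom C X Y\<rbrakk> \<Longrightarrow> z \<bullet> (f \<boxplus> g) = z \<bullet> f \<boxplus> z \<bullet> g"
    and plus_Scale: "f \<in> Hom C X Y \<Longrightarrow> (z + w) \<bullet> f = z \<bullet> f \<boxplus> w \<bullet> f"
    and Scale_Scale: "f \<in> Hom C X Y \<Longrightarrow> z \<bullet> (w \<bullet> f) = (z * w) \<bullet> f"
    and one_Scale: "f \<in> Hom C X Y \<Longrightarrow> 1 \<bullet> f = f"
    \<comment> \<open>composition is bilinear\<close>
    and Comp_Plus: "\<lbrakk>f \<in> Hom C X Y; f' \<in> Hom C X Y; g \<in> Hom C Y Z\<rbrakk> \<Longrightarrow>
      g \<cdot> (f \<boxplus> f') = g \<cdot> f \<boxplus> g \<cdot> f'"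
    and Plus_Comp: "\<lbrakk>f \<in> Hom C X Y; g \<in> Hom C Y Z; g' \<in> Hom C Y Z\<rbrakk> \<Longrightarrow>
      (g \<boxplus> g') \<cdot> f = g \<cdot> f \<boxplus> g' \<cdot> f"
    and Comp_Scale: "\<lbrakk>f \<in> Hom C X Y; g \<in> Hom C Y Z\<rbrakk> \<Longrightarrow> g \<cdot> (z \<bullet> f) = z \<bullet> (g \<cdot> f)"
    and Scale_Comp: "\<lbrakk>f \<in> Hom C X Y; g \<in> Hom C Y Z\<rbrakk> \<Longrightarrow> (z \<bullet> g) \<cdot> f = z \<bullet> (g \<cdot> f)"
    \<comment> \<open>the involution\<close>
    and Adj_Hom: "f \<in> Hom C X Y \<Longrightarrow> f\<^sup>\<dagger> \<in> Hom C Y X"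
    and Adj_Adj: "f \<in> Hom C X Y \<Longrightarrow> (f\<^sup>\<dagger>)\<^sup>\<dagger> = f"
    and Adj_Comp: "\<lbrakk>f \<in> Hom C X Y; g \<in> Hom C Y Z\<rbrakk> \<Longrightarrow> (g \<cdot> f)\<^sup>\<dagger> = f\<^sup>\<dagger> \<cdot> g\<^sup>\<dagger>"
    and Adj_Plus: "\<lbrakk>f \<in> Hom C X Y; g \<in> Hom C X Y\<rbrakk> \<Longrightarrow> (f \<boxplus> g)\<^sup>\<dagger> = f\<^sup>\<dagger> \<boxplus> g\<^sup>\<dagger>"
    and Adj_Scale: "f \<in> Hom C X Y \<Longrightarrow> (z \<bullet> f)\<^sup>\<dagger> = cnj z \<bullet> f\<^sup>\<dagger>"
    \<comment> \<open>the complete C*-norm\<close>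
    and Norm_eq_0: "f \<in> Hom C X Y \<Longrightarrow> Norm C f = 0 \<longleftrightarrow> f = Zero C X Y"
    and Norm_nonneg: "f \<in> Hom C X Y \<Longrightarrow> 0 \<le> Norm C f"
    and Norm_Plus: "\<lbrakk>f \<in> Hom C X Y; g \<in> Hom C X Y\<rbrakk> \<Longrightarrow> Norm C (f \<boxplus> g) \<le> Norm C f + Norm C g"
    and Norm_Scale: "f \<in> Hom C X Y \<Longrightarrow> Norm C (z \<bullet> f) = cmod z * Norm C f"
    and Norm_Comp: "\<lbrakk>f \<in> Hom C X Y; g \<in> Hom C Y Z\<rbrakk> \<Longrightarrow> Norm C (g \<cdot> f) \<le> Norm C g * Norm C f"
    and Norm_Adj_Comp: "f \<in> Hom C X Y \<Longrightarrow> Norm C (f\<^sup>\<dagger> \<cdot> f) = (Norm C f)\<^sup>2"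
    and complete: "\<lbrakk>X \<in> Obj C; Y \<in> Obj C; \<And>m. s m \<in> Hom C X Y;
      \<And>e. e > 0 \<Longrightarrow> \<exists>N. \<forall>m\<ge>N. \<forall>m'\<ge>N. Norm C (Diff C (s m) (s m')) < e\<rbrakk> \<Longrightarrow>
      \<exists>l\<in>Hom C X Y. (\<lambda>m. Norm C (Diff C (s m) l)) \<longlonglongrightarrow> 0"
    \<comment> \<open>\<open>f* f\<close> is a positive element of the C*-algebra \<open>End X\<close>\<close>
    and positive: "f \<in> Hom C X Y \<Longrightarrow> \<exists>g\<in>Hom C X X. f\<^sup>\<dagger> \<cdot> f = g\<^sup>\<dagger> \<cdot> g"
    \<comment> \<open>finite direct sums (the empty one included) and images of projections\<close>
    and zero_object: "\<exists>Z\<in>Obj C. Id C Z = Zero C Z Z"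
    and direct_sum: "\<lbrakk>X \<in> Obj C; Y \<in> Obj C\<rbrakk> \<Longrightarrow> \<exists>W\<in>Obj C. \<exists>v w.
      isometry C X W v \<and> isometry C Y W w \<and> v \<cdot> v\<^sup>\<dagger> \<boxplus> w \<cdot> w\<^sup>\<dagger> = Id C W"
    and projection_image: "\<lbrakk>p \<in> Hom C X X; p \<cdot> p = p; p\<^sup>\<dagger> = p\<rbrakk> \<Longrightarrow>
      \<exists>Y\<in>Obj C. \<exists>v. isometry C Y X v \<and> v \<cdot> v\<^sup>\<dagger> = p"


section \<open>C*-tensor categories\<close>

record ('o, 'a) tensor_cat = "('o, 'a) star_cat" +
  TensO :: "'o \<Rightarrow> 'o \<Rightarrow> 'o" (infixr "\<otimes>\<^sub>o\<index>" 75)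
  TensA :: "'a \<Rightarrow> 'a \<Rightarrow> 'a" (infixr "\<otimes>\<^sub>a\<index>" 75)
  Unit :: "'o"
  Assoc :: "'o \<Rightarrow> 'o \<Rightarrow> 'o \<Rightarrow> 'a"

text \<open>The unit constraints are identities, that is, the unit is strict on objects and on morphisms.\<close>

locale cstar_tensor_category = cstar_category C
  for C :: "('o, 'a, 'z) tensor_cat_scheme" (structure) +
  assumes TensO_Obj: "\<lbrakk>X \<in> Obj C; Y \<in> Obj C\<rbrakk> \<Longrightarrow> X \<otimes>\<^sub>o Y \<in> Obj C"
    and TensA_Hom: "\<lbrakk>f \<in> Hom C X Y; g \<in> Hom C X' Y'\<rbrakk> \<Longrightarrow> f \<otimes>\<^sub>a g \<in> Hom C (X \<otimes>\<^sub>o X') (Y \<otimes>\<^sub>o Y')"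
    and TensA_Id: "\<lbrakk>X \<in> Obj C; Y \<in> Obj C\<rbrakk> \<Longrightarrow> Id C X \<otimes>\<^sub>a Id C Y = Id C (X \<otimes>\<^sub>o Y)"
    and TensA_Comp: "\<lbrakk>f \<in> Hom C X Y; g \<in> Hom C Y Z; f' \<in> Hom C X' Y'; g' \<in> Hom C Y' Z'\<rbrakk> \<Longrightarrow>
      (g \<cdot> f) \<otimes>\<^sub>a (g' \<cdot> f') = (g \<otimes>\<^sub>a g') \<cdot> (f \<otimes>\<^sub>a f')"
    and TensA_Plus: "\<lbrakk>f \<in> Hom C X Y; g \<in> Hom C X' Y'; g' \<in> Hom C X' Y'\<rbrakk> \<Longrightarrow>
      f \<otimes>\<^sub>a (g \<boxplus> g') = f \<otimes>\<^sub>a g \<boxplus> f \<otimes>\<^sub>a g'"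
    and Plus_TensA: "\<lbrakk>f \<in> Hom C X Y; f' \<in> Hom C X Y; g \<in> Hom C X' Y'\<rbrakk> \<Longrightarrow>
      (f \<boxplus> f') \<otimes>\<^sub>a g = f \<otimes>\<^sub>a g \<boxplus> f' \<otimes>\<^sub>a g"
    and TensA_Scale: "\<lbrakk>f \<in> Hom C X Y; g \<in> Hom C X' Y'\<rbrakk> \<Longrightarrow> f \<otimes>\<^sub>a (z \<bullet> g) = z \<bullet> (f \<otimes>\<^sub>a g)"
    and Scale_TensA: "\<lbrakk>f \<in> Hom C X Y; g \<in> Hom C X' Y'\<rbrakk> \<Longrightarrow> (z \<bullet> f) \<otimes>\<^sub>a g = z \<bullet> (f \<otimes>\<^sub>a g)"
    and TensA_Adj: "\<lbrakk>f \<in> Hom C X Y; g \<in> Hom C X' Y'\<rbrakk> \<Longrightarrow> (f \<otimes>\<^sub>a g)\<^sup>\<dagger> = f\<^sup>\<dagger> \<otimes>\<^sub>a g\<^sup>\<dagger>"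
    and Unit_Obj: "Unit C \<in> Obj C"
    and Unit_TensO: "X \<in> Obj C \<Longrightarrow> Unit C \<otimes>\<^sub>o X = X"
    and TensO_Unit: "X \<in> Obj C \<Longrightarrow> X \<otimes>\<^sub>o Unit C = X"
    and Unit_TensA: "f \<in> Hom C X Y \<Longrightarrow> Id C (Unit C) \<otimes>\<^sub>a f = f"
    and TensA_Unit: "f \<in> Hom C X Y \<Longrightarrow> f \<otimes>\<^sub>a Id C (Unit C) = f"
    and Unit_nonzero: "Id C (Unit C) \<noteq> Zero C (Unit C) (Unit C)"
    and Unit_simple: "f \<in> Hom C (Unit C) (Unit C) \<Longrightarrow> \<exists>z. f = z \<bullet> Id C (Unit C)"
    and Assoc_unitary: "\<lbrakk>X \<in> Obj C; Y \<in> Obj C; Z \<in> Obj C\<rbrakk> \<Longrightarrow>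
      unitary C ((X \<otimes>\<^sub>o Y) \<otimes>\<^sub>o Z) (X \<otimes>\<^sub>o (Y \<otimes>\<^sub>o Z)) (Assoc C X Y Z)"
    and Assoc_natural: "\<lbrakk>f \<in> Hom C X X'; g \<in> Hom C Y Y'; h \<in> Hom C Z Z'\<rbrakk> \<Longrightarrow>
      Assoc C X' Y' Z' \<cdot> ((f \<otimes>\<^sub>a g) \<otimes>\<^sub>a h) = (f \<otimes>\<^sub>a (g \<otimes>\<^sub>a h)) \<cdot> Assoc C X Y Z"
    and pentagon: "\<lbrakk>X \<in> Obj C; Y \<in> Obj C; Z \<in> Obj C; W \<in> Obj C\<rbrakk> \<Longrightarrow>
      Assoc C X Y (Z \<otimes>\<^sub>o W) \<cdot> Assoc C (X \<otimes>\<^sub>o Y) Z W =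
      (Id C X \<otimes>\<^sub>a Assoc C Y Z W) \<cdot> Assoc C X (Y \<otimes>\<^sub>o Z) W \<cdot> (Assoc C X Y Z \<otimes>\<^sub>a Id C W)"
    and triangle: "\<lbrakk>X \<in> Obj C; Y \<in> Obj C\<rbrakk> \<Longrightarrow> Assoc C X (Unit C) Y = Id C (X \<otimes>\<^sub>o Y)"

text \<open>Rigidity: every \<open>X\<close> has a conjugate \<open>X'\<close> with solutions \<open>R\<close>, \<open>R'\<close> of the conjugate equations.
  The adjoint of the unitary associator is its inverse.\<close>

locale rigid_cstar_tensor_category = cstar_tensor_category +
  assumes rigid: "X \<in> Obj C \<Longrightarrow> \<exists>X'\<in>Obj C.
    \<exists>R\<in>Hom C (Unit C) (X' \<otimes>\<^sub>o X). \<exists>R'\<in>Hom C (Unit C) (X \<otimes>\<^sub>o X').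
      (R'\<^sup>\<dagger> \<otimes>\<^sub>a Id C X) \<cdot> (Assoc C X X' X)\<^sup>\<dagger> \<cdot> (Id C X \<otimes>\<^sub>a R) = Id C X \<and>
      (R\<^sup>\<dagger> \<otimes>\<^sub>a Id C X') \<cdot> (Assoc C X' X X')\<^sup>\<dagger> \<cdot> (Id C X' \<otimes>\<^sub>a R') = Id C X'"


section \<open>Gradings and twists\<close>

text \<open>Gradings by a finite group \<open>\<Gamma>\<close>; a full subcategory is given by its set of objects.
  A decomposition of \<open>X\<close> writes it as the direct sum of homogeneous objects \<open>Y \<gamma>\<close> along
  isometries \<open>v \<gamma>\<close>; the orthogonality of the ranges follows from the last equation.\<close>

definition homogeneous_decomposition :: "('o, 'a, 'z) star_cat_scheme \<Rightarrow> 'g monoid \<Rightarrow> ('g \<Rightarrow> 'o set) \<Rightarrow>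
    'o \<Rightarrow> ('g \<Rightarrow> 'o) \<Rightarrow> ('g \<Rightarrow> 'a) \<Rightarrow> bool" where
  "homogeneous_decomposition C \<Gamma> G X Y v \<longleftrightarrow>
     (\<forall>\<gamma>\<in>carrier \<Gamma>. Y \<gamma> \<in> G \<gamma> \<and> isometry C (Y \<gamma>) X (v \<gamma>)) \<and>
     Sum C X X (\<lambda>\<gamma>. v \<gamma> \<cdot>\<^bsub>C\<^esub> (v \<gamma>)\<^sup>\<dagger>\<^bsub>C\<^esub>) (carrier \<Gamma>) = Id C X"

definition graded :: "('o, 'a, 'z) tensor_cat_scheme \<Rightarrow> 'g monoid \<Rightarrow> ('g \<Rightarrow> 'o set) \<Rightarrow> bool" where
  "graded C \<Gamma> G \<longleftrightarrow> group \<Gamma> \<and> finite (carrier \<Gamma>) \<and>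
     (\<forall>\<gamma>\<in>carrier \<Gamma>. G \<gamma> \<subseteq> Obj C) \<and>
     (\<forall>\<gamma>\<in>carrier \<Gamma>. \<forall>\<eta>\<in>carrier \<Gamma>. \<gamma> \<noteq> \<eta> \<longrightarrow>
        (\<forall>X\<in>G \<gamma>. \<forall>Y\<in>G \<eta>. Hom C X Y = {Zero C X Y})) \<and>
     (\<forall>X\<in>Obj C. \<exists>Y v. homogeneous_decomposition C \<Gamma> G X Y v) \<and>
     (\<forall>\<gamma>\<in>carrier \<Gamma>. \<forall>\<eta>\<in>carrier \<Gamma>. \<forall>X\<in>G \<gamma>. \<forall>Y\<in>G \<eta>.
        \<exists>Z\<in>G (\<gamma> \<otimes>\<^bsub>\<Gamma>\<^esub> \<eta>). isomorphic C (X \<otimes>\<^sub>o\<^bsub>C\<^esub> Y) Z)"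

text \<open>The projection of \<open>X\<close> onto its component of degree \<open>\<gamma>\<close>. By orthogonality it does not depend on
  the decomposition. Linear extension from homogeneous objects to arbitrary ones is expressed by
  means of these projections.\<close>

definition grade_proj ::
  "('o, 'a, 'z) star_cat_scheme \<Rightarrow> 'g monoid \<Rightarrow> ('g \<Rightarrow> 'o set) \<Rightarrow> 'g \<Rightarrow> 'o \<Rightarrow> 'a" where
  "grade_proj C \<Gamma> G \<gamma> X =
     (THE p. \<exists>Y v. homogeneous_decomposition C \<Gamma> G X Y v \<and> p = v \<gamma> \<cdot>\<^bsub>C\<^esub> (v \<gamma>)\<^sup>\<dagger>\<^bsub>C\<^esub>)"

definition twist :: "('o, 'a) tensor_cat \<Rightarrow> 'g monoid \<Rightarrow> ('g \<Rightarrow> 'o set) \<Rightarrow>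
    ('g \<Rightarrow> 'g \<Rightarrow> 'g \<Rightarrow> complex) \<Rightarrow> ('o, 'a) tensor_cat" where
  "twist C \<Gamma> G \<omega> = C\<lparr>Assoc := \<lambda>X Y Z.
     Sum C ((X \<otimes>\<^sub>o\<^bsub>C\<^esub> Y) \<otimes>\<^sub>o\<^bsub>C\<^esub> Z) (X \<otimes>\<^sub>o\<^bsub>C\<^esub> (Y \<otimes>\<^sub>o\<^bsub>C\<^esub> Z))
       (\<lambda>(a, b, c). \<omega> a b c \<bullet>\<^bsub>C\<^esub> (Assoc C X Y Z \<cdot>\<^bsub>C\<^esub>
          ((grade_proj C \<Gamma> G a X \<otimes>\<^sub>a\<^bsub>C\<^esub> grade_proj C \<Gamma> G b Y) \<otimes>\<^sub>a\<^bsub>C\<^esub> grade_proj C \<Gamma> G c Z)))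
       (carrier \<Gamma> \<times> carrier \<Gamma> \<times> carrier \<Gamma>)\<rparr>"

text \<open>The cocycle \<open>\<omega>\<^sup>k\<close>; \<open>\<int>/n\<int>\<close> is \<^term>\<open>integer_mod_group n\<close>, whose elements are the
  representatives \<open>0, \<dots>, n - 1\<close>.\<close>

definition omega :: "nat \<Rightarrow> nat \<Rightarrow> int \<Rightarrow> int \<Rightarrow> int \<Rightarrow> complex" where
  "omega n k a b c = exp (2 * of_real pi * \<i> * of_nat k *
     of_int (\<lfloor>of_int (a + b) / (of_nat n :: real)\<rfloor> - \<lfloor>of_int a / (of_nat n :: real)\<rfloor>
             - \<lfloor>of_int b / (of_nat n :: real)\<rfloor>) *
     (of_int c / of_nat n))"


section \<open>The ind-category\<close>

text \<open>An ind-object is an inductive system \<open>X i\<close> of objects of \<open>C\<close> over a (nonempty) directed set, with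
  isometric connecting maps \<open>Con j i : X i \<rightarrow> X j\<close> for \<open>i \<le> j\<close>.

  The index set consists of lists of one fixed length \<open>Len\<close> over a type \<open>'i\<close>. For length 1 these are
  arbitrary directed sets in \<open>'i\<close>; the tensor product of systems indexed by \<open>I\<close> and \<open>J\<close> is
  indexed by the product \<open>I \<times> J\<close>, and as concatenation of lists is strictly associative and has
  the empty list as unit, identifying \<open>(i, j)\<close> with \<open>i @ j\<close> makes the unit of the ind-category strict
  and lets the associator be given without reindexing. All functions are \<^const>\<open>undefined\<close> outside
  their intended domain, so that equality of systems and of morphisms is equality in HOL.
  The type \<open>'i\<close> bounds the size of the index sets, which keeps
  the ind-category small; it is meant to be arbitrary.\<close>

record ('o, 'a, 'i) ind_obj =
  Len :: nat
  Ix :: "'i list set"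
  Leq :: "('i list \<times> 'i list) set"
  Ob :: "'i list \<Rightarrow> 'o"
  Con :: "'i list \<Rightarrow> 'i list \<Rightarrow> 'a"

definition ind_objects :: "('o, 'a, 'z) star_cat_scheme \<Rightarrow> ('o, 'a, 'i) ind_obj set" where
  "ind_objects C = {X.
     Ix X \<noteq> {} \<and> (\<forall>i\<in>Ix X. length i = Len X) \<and> preorder_on (Ix X) (Leq X) \<and>
     (\<forall>i\<in>Ix X. \<forall>j\<in>Ix X. \<exists>l. (i, l) \<in> Leq X \<and> (j, l) \<in> Leq X) \<and>
     (\<forall>i\<in>Ix X. Ob X i \<in> Obj C \<and> Con X i i = Id C (Ob X i)) \<and>
     (\<forall>i j. (i, j) \<in> Leq X \<longrightarrow> isometry C (Ob X i) (Ob X j) (Con X j i)) \<and>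
     (\<forall>i j l. (i, j) \<in> Leq X \<and> (j, l) \<in> Leq X \<longrightarrow> Con X l j \<cdot>\<^bsub>C\<^esub> Con X j i = Con X l i) \<and>
     (\<forall>i. i \<notin> Ix X \<longrightarrow> Ob X i = undefined) \<and>
     (\<forall>i j. (i, j) \<notin> Leq X \<longrightarrow> Con X j i = undefined)}"

text \<open>A morphism between the limits of \<open>X\<close> and \<open>Y\<close> is a uniformly bounded family of
  \<open>T k i : X i \<rightarrow> Y k\<close>, the compressions \<open>w\<^sub>k\<^sup>\<dagger> T v\<^sub>i\<close> of the morphism along the isometries
  \<open>v\<^sub>i : X i \<rightarrow> lim X\<close> and \<open>w\<^sub>k : Y k \<rightarrow> lim Y\<close>. When \<open>C\<close> is semisimple and the limits are written
  as direct sums of \<open>H\<^sub>S \<otimes> S\<close> and of \<open>H'\<^sub>S \<otimes> S\<close>, such families are the bounded families in the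
  product of the spaces \<open>B(H\<^sub>S, H'\<^sub>S)\<close>.\<close>

record ('o, 'a, 'i) ind_arr =
  Src :: "('o, 'a, 'i) ind_obj"
  Tgt :: "('o, 'a, 'i) ind_obj"
  Cmp :: "'i list \<Rightarrow> 'i list \<Rightarrow> 'a"

definition ind_arrows :: "('o, 'a, 'z) star_cat_scheme \<Rightarrow> ('o, 'a, 'i) ind_arr set" where
  "ind_arrows C = {T. Src T \<in> ind_objects C \<and> Tgt T \<in> ind_objects C \<and>
     (\<forall>k\<in>Ix (Tgt T). \<forall>i\<in>Ix (Src T). Cmp T k i \<in> Hom C (Ob (Src T) i) (Ob (Tgt T) k)) \<and>
     (\<forall>k l. \<forall>i\<in>Ix (Src T). (k, l) \<in> Leq (Tgt T) \<longrightarrow>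
        (Con (Tgt T) l k)\<^sup>\<dagger>\<^bsub>C\<^esub> \<cdot>\<^bsub>C\<^esub> Cmp T l i = Cmp T k i) \<and>
     (\<forall>k\<in>Ix (Tgt T). \<forall>i j. (i, j) \<in> Leq (Src T) \<longrightarrow>
        Cmp T k j \<cdot>\<^bsub>C\<^esub> Con (Src T) j i = Cmp T k i) \<and>
     (\<exists>M. \<forall>k\<in>Ix (Tgt T). \<forall>i\<in>Ix (Src T). Norm C (Cmp T k i) \<le> M) \<and>
     (\<forall>k i. k \<notin> Ix (Tgt T) \<or> i \<notin> Ix (Src T) \<longrightarrow> Cmp T k i = undefined)}"

definition mk_ind_arr :: "('o, 'a, 'i) ind_obj \<Rightarrow> ('o, 'a, 'i) ind_obj \<Rightarrow>
    ('i list \<Rightarrow> 'i list \<Rightarrow> 'a) \<Rightarrow> ('o, 'a, 'i) ind_arr" where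
  "mk_ind_arr X Y T = \<lparr>Src = X, Tgt = Y,
     Cmp = (\<lambda>k i. if k \<in> Ix Y \<and> i \<in> Ix X then T k i else undefined)\<rparr>"

text \<open>The morphism of limits induced by a family \<open>f i : X i \<rightarrow> Y i\<close> that is compatible with the
  connecting maps, where \<open>X\<close> and \<open>Y\<close> have the same index set. Its \<open>(k, i)\<close> component does not depend on
  the upper bound \<open>l\<close> of \<open>k\<close> and \<open>i\<close>.\<close>

definition ind_map :: "('o, 'a, 'z) star_cat_scheme \<Rightarrow> ('o, 'a, 'i) ind_obj \<Rightarrow> ('o, 'a, 'i) ind_obj \<Rightarrow>
    ('i list \<Rightarrow> 'a) \<Rightarrow> ('o, 'a, 'i) ind_arr" where
  "ind_map C X Y f = mk_ind_arr X Y (\<lambda>k i.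
     let l = (SOME l. (k, l) \<in> Leq Y \<and> (i, l) \<in> Leq Y)
     in (Con Y l k)\<^sup>\<dagger>\<^bsub>C\<^esub> \<cdot>\<^bsub>C\<^esub> Con Y l i \<cdot>\<^bsub>C\<^esub> f i)"

text \<open>Norm limit in \<^term>\<open>Hom C A B\<close> of a net indexed by a directed set \<open>I\<close> with order \<open>r\<close>.
  It is only used for rigid \<open>C\<close>, where the morphism spaces are finite-dimensional, so that norm limits
  and strong limits agree.\<close>

definition net_limit :: "('o, 'a, 'z) star_cat_scheme \<Rightarrow> 'o \<Rightarrow> 'o \<Rightarrow> 'j set \<Rightarrow> ('j \<times> 'j) set \<Rightarrow>
    ('j \<Rightarrow> 'a) \<Rightarrow> 'a" where
  "net_limit C A B I r s = (THE l. l \<in> Hom C A B \<and>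
     (\<forall>e>0. \<exists>k\<^sub>0\<in>I. \<forall>k. (k\<^sub>0, k) \<in> r \<longrightarrow> Norm C (Diff C (s k) l) < e))"

definition ind_comp :: "('o, 'a, 'z) star_cat_scheme \<Rightarrow> ('o, 'a, 'i) ind_arr \<Rightarrow> ('o, 'a, 'i) ind_arr \<Rightarrow>
    ('o, 'a, 'i) ind_arr" where
  "ind_comp C S T = mk_ind_arr (Src T) (Tgt S) (\<lambda>m i.
     net_limit C (Ob (Src T) i) (Ob (Tgt S) m) (Ix (Tgt T)) (Leq (Tgt T))
       (\<lambda>k. Cmp S m k \<cdot>\<^bsub>C\<^esub> Cmp T k i))"

definition ind_tens_obj :: "('o, 'a, 'z) tensor_cat_scheme \<Rightarrow> ('o, 'a, 'i) ind_obj \<Rightarrow>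
    ('o, 'a, 'i) ind_obj \<Rightarrow> ('o, 'a, 'i) ind_obj" where
  "ind_tens_obj C X Y =
     (let p = take (Len X); q = drop (Len X);
          I = {i @ j | i j. i \<in> Ix X \<and> j \<in> Ix Y};
          r = {(i @ j, i' @ j') | i j i' j'. (i, i') \<in> Leq X \<and> (j, j') \<in> Leq Y}
      in \<lparr>Len = Len X + Len Y, Ix = I, Leq = r,
          Ob = (\<lambda>m. if m \<in> I then Ob X (p m) \<otimes>\<^sub>o\<^bsub>C\<^esub> Ob Y (q m) else undefined),
          Con = (\<lambda>m' m. if (m, m') \<in> r
                   then Con X (p m') (p m) \<otimes>\<^sub>a\<^bsub>C\<^esub> Con Y (q m') (q m) else undefined)\<rparr>)"

definition ind_tens_arr :: "('o, 'a, 'z) tensor_cat_scheme \<Rightarrow> ('o, 'a, 'i) ind_arr \<Rightarrow>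
    ('o, 'a, 'i) ind_arr \<Rightarrow> ('o, 'a, 'i) ind_arr" where
  "ind_tens_arr C S T =
     mk_ind_arr (ind_tens_obj C (Src S) (Src T)) (ind_tens_obj C (Tgt S) (Tgt T)) (\<lambda>m' m.
       Cmp S (take (Len (Tgt S)) m') (take (Len (Src S)) m) \<otimes>\<^sub>a\<^bsub>C\<^esub>
       Cmp T (drop (Len (Tgt S)) m') (drop (Len (Src S)) m))"

text \<open>The embedding of \<open>C\<close> by constant systems over a one-point set.\<close>

definition emb_obj :: "('o, 'a, 'z) star_cat_scheme \<Rightarrow> 'o \<Rightarrow> ('o, 'a, 'i) ind_obj" where
  "emb_obj C Y = \<lparr>Len = 0, Ix = {[]}, Leq = {([], [])},
     Ob = (\<lambda>i. if i = [] then Y else undefined),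
     Con = (\<lambda>j i. if i = [] \<and> j = [] then Id C Y else undefined)\<rparr>"

definition emb_arr :: "('o, 'a, 'z) star_cat_scheme \<Rightarrow> 'a \<Rightarrow> ('o, 'a, 'i) ind_arr" where
  "emb_arr C f = mk_ind_arr (emb_obj C (Dom C f)) (emb_obj C (Cod C f)) (\<lambda>k i. f)"

definition ind :: "('o, 'a) tensor_cat \<Rightarrow>
    (('o, 'a, 'i) ind_obj, ('o, 'a, 'i) ind_arr) tensor_cat" where
  "ind C = \<lparr>Obj = ind_objects C, Arr = ind_arrows C, Dom = Src, Cod = Tgt,
     Id = (\<lambda>X. ind_map C X X (\<lambda>i. Id C (Ob X i))),
     Comp = ind_comp C,
     Zero = (\<lambda>X Y. mk_ind_arr X Y (\<lambda>k i. Zero C (Ob X i) (Ob Y k))),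
     Plus = (\<lambda>S T. mk_ind_arr (Src S) (Tgt S) (\<lambda>k i. Cmp S k i \<boxplus>\<^bsub>C\<^esub> Cmp T k i)),
     Scale = (\<lambda>z T. mk_ind_arr (Src T) (Tgt T) (\<lambda>k i. z \<bullet>\<^bsub>C\<^esub> Cmp T k i)),
     Adj = (\<lambda>T. mk_ind_arr (Tgt T) (Src T) (\<lambda>i k. (Cmp T k i)\<^sup>\<dagger>\<^bsub>C\<^esub>)),
     Norm = (\<lambda>T. SUP (k, i) \<in> Ix (Tgt T) \<times> Ix (Src T). Norm C (Cmp T k i)),
     TensO = ind_tens_obj C, TensA = ind_tens_arr C, Unit = emb_obj C (Unit C),
     Assoc = (\<lambda>X Y Z. ind_map C
       (ind_tens_obj C (ind_tens_obj C X Y) Z) (ind_tens_obj C X (ind_tens_obj C Y Z))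
       (\<lambda>m. Assoc C (Ob X (take (Len X) m)) (Ob Y (take (Len Y) (drop (Len X) m)))
                    (Ob Z (drop (Len X + Len Y) m))))\<rparr>"

text \<open>The grading of the ind-category: \<open>ind-C\<^sub>\<gamma>\<close> as a full subcategory.\<close>

definition ind_grading :: "('o, 'a, 'z) star_cat_scheme \<Rightarrow> ('g \<Rightarrow> 'o set) \<Rightarrow>
    'g \<Rightarrow> ('o, 'a, 'i) ind_obj set" where
  "ind_grading C G \<gamma> = {X \<in> ind_objects C. \<forall>i\<in>Ix X. Ob X i \<in> G \<gamma>}"


section \<open>The center of the ind-category\<close>

type_synonym ('o, 'a, 'i) half_braiding = "'o \<Rightarrow> ('o, 'a, 'i) ind_arr"
type_synonym ('o, 'a, 'i) center_obj = "('o, 'a, 'i) ind_obj \<times> ('o, 'a, 'i) half_braiding"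

record ('o, 'a, 'i) center_arr =
  CSrc :: "('o, 'a, 'i) center_obj"
  CTgt :: "('o, 'a, 'i) center_obj"
  Und :: "('o, 'a, 'i) ind_arr"

text \<open>Unitary half-braidings \<open>c\<^sub>Y : Y \<otimes> X \<rightarrow> X \<otimes> Y\<close>, for \<open>Y\<close> in \<open>C\<close> and \<open>X\<close> in the ind-category;
  inverses of associators are written as adjoints.\<close>

definition half_braiding ::
  "('o, 'a) tensor_cat \<Rightarrow> ('o, 'a, 'i) ind_obj \<Rightarrow> ('o, 'a, 'i) half_braiding \<Rightarrow> bool" where
  "half_braiding C X c \<longleftrightarrow> (let D = ind C; J = emb_obj C in
     c \<in> extensional (Obj C) \<and>
     (\<forall>Y\<in>Obj C. unitary D (J Y \<otimes>\<^sub>o\<^bsub>D\<^esub> X) (X \<otimes>\<^sub>o\<^bsub>D\<^esub> J Y) (c Y)) \<and>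
     (\<forall>Y\<in>Obj C. \<forall>Z\<in>Obj C. \<forall>f\<in>Hom C Y Z.
        c Z \<cdot>\<^bsub>D\<^esub> (emb_arr C f \<otimes>\<^sub>a\<^bsub>D\<^esub> Id D X) = (Id D X \<otimes>\<^sub>a\<^bsub>D\<^esub> emb_arr C f) \<cdot>\<^bsub>D\<^esub> c Y) \<and>
     (\<forall>Y\<in>Obj C. \<forall>Z\<in>Obj C.
        Assoc D X (J Y) (J Z) \<cdot>\<^bsub>D\<^esub> (c Y \<otimes>\<^sub>a\<^bsub>D\<^esub> Id D (J Z)) \<cdot>\<^bsub>D\<^esub> (Assoc D (J Y) X (J Z))\<^sup>\<dagger>\<^bsub>D\<^esub>
          \<cdot>\<^bsub>D\<^esub> (Id D (J Y) \<otimes>\<^sub>a\<^bsub>D\<^esub> c Z) \<cdot>\<^bsub>D\<^esub> Assoc D (J Y) (J Z) X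
        = c (Y \<otimes>\<^sub>o\<^bsub>C\<^esub> Z)))"

definition center_objects :: "('o, 'a) tensor_cat \<Rightarrow> ('o, 'a, 'i) center_obj set" where
  "center_objects C = {(X, c). X \<in> ind_objects C \<and> half_braiding C X c}"

definition center_arrows :: "('o, 'a) tensor_cat \<Rightarrow> ('o, 'a, 'i) center_arr set" where
  "center_arrows C = {x. CSrc x \<in> center_objects C \<and> CTgt x \<in> center_objects C \<and>
     Und x \<in> Hom (ind C) (fst (CSrc x)) (fst (CTgt x)) \<and>
     (\<forall>Y\<in>Obj C. (Und x \<otimes>\<^sub>a\<^bsub>ind C\<^esub> Id (ind C) (emb_obj C Y)) \<cdot>\<^bsub>ind C\<^esub> snd (CSrc x) Y
        = snd (CTgt x) Y \<cdot>\<^bsub>ind C\<^esub> (Id (ind C) (emb_obj C Y) \<otimes>\<^sub>a\<^bsub>ind C\<^esub> Und x))}"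

text \<open>The half-braiding \<open>c \<otimes> c'\<close> on \<open>X \<otimes> X'\<close>.\<close>

definition hb_tensor :: "('o, 'a) tensor_cat \<Rightarrow> ('o, 'a, 'i) center_obj \<Rightarrow> ('o, 'a, 'i) center_obj \<Rightarrow>
    ('o, 'a, 'i) half_braiding" where
  "hb_tensor C = (\<lambda>(X, c) (X', c'). let D = ind C; J = emb_obj C in
     (\<lambda>Y\<in>Obj C. (Assoc D X X' (J Y))\<^sup>\<dagger>\<^bsub>D\<^esub> \<cdot>\<^bsub>D\<^esub> (Id D X \<otimes>\<^sub>a\<^bsub>D\<^esub> c' Y) \<cdot>\<^bsub>D\<^esub> Assoc D X (J Y) X'
       \<cdot>\<^bsub>D\<^esub> (c Y \<otimes>\<^sub>a\<^bsub>D\<^esub> Id D X') \<cdot>\<^bsub>D\<^esub> (Assoc D (J Y) X X')\<^sup>\<dagger>\<^bsub>D\<^esub>))"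

text \<open>The center, with \<open>(X, c) \<otimes> (X', c') = (X \<otimes> X', \<beta> (X, c) (X', c'))\<close> for a given rule \<open>\<beta>\<close>, and
  everything else inherited from the ind-category.\<close>

definition center_with :: "('o, 'a) tensor_cat \<Rightarrow>
    (('o, 'a, 'i) center_obj \<Rightarrow> ('o, 'a, 'i) center_obj \<Rightarrow> ('o, 'a, 'i) half_braiding) \<Rightarrow>
    (('o, 'a, 'i) center_obj, ('o, 'a, 'i) center_arr) tensor_cat" where
  "center_with C \<beta> =
     (let D = ind C;
          tens = (\<lambda>A B. (fst A \<otimes>\<^sub>o\<^bsub>D\<^esub> fst B, \<beta> A B))
      in \<lparr>Obj = center_objects C, Arr = center_arrows C, Dom = CSrc, Cod = CTgt,
          Id = (\<lambda>A. \<lparr>CSrc = A, CTgt = A, Und = Id D (fst A)\<rparr>),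
          Comp = (\<lambda>y x. \<lparr>CSrc = CSrc x, CTgt = CTgt y, Und = Und y \<cdot>\<^bsub>D\<^esub> Und x\<rparr>),
          Zero = (\<lambda>A B. \<lparr>CSrc = A, CTgt = B, Und = Zero D (fst A) (fst B)\<rparr>),
          Plus = (\<lambda>x y. \<lparr>CSrc = CSrc x, CTgt = CTgt x, Und = Und x \<boxplus>\<^bsub>D\<^esub> Und y\<rparr>),
          Scale = (\<lambda>z x. \<lparr>CSrc = CSrc x, CTgt = CTgt x, Und = z \<bullet>\<^bsub>D\<^esub> Und x\<rparr>),
          Adj = (\<lambda>x. \<lparr>CSrc = CTgt x, CTgt = CSrc x, Und = (Und x)\<^sup>\<dagger>\<^bsub>D\<^esub>\<rparr>),
          Norm = (\<lambda>x. Norm D (Und x)),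
          TensO = tens,
          TensA = (\<lambda>x y. \<lparr>CSrc = tens (CSrc x) (CSrc y), CTgt = tens (CTgt x) (CTgt y),
                           Und = Und x \<otimes>\<^sub>a\<^bsub>D\<^esub> Und y\<rparr>),
          Unit = (Unit D, \<lambda>Y\<in>Obj C. Id D (emb_obj C Y)),
          Assoc = (\<lambda>A B E. \<lparr>CSrc = tens (tens A B) E, CTgt = tens A (tens B E),
                             Und = Assoc D (fst A) (fst B) (fst E)\<rparr>)\<rparr>)"

definition center :: "('o, 'a) tensor_cat \<Rightarrow>
    (('o, 'a, 'i) center_obj, ('o, 'a, 'i) center_arr) tensor_cat" where
  "center C = center_with C (hb_tensor C)"

text \<open>The half-braiding \<open>c \<otimes>\<^sup>(\<^sup>k\<^sup>) c'\<close> for a category graded by \<open>\<int>/n\<int>\<close>, and the center with the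
  resulting tensor product.\<close>

definition hb_tensor_k :: "nat \<Rightarrow> nat \<Rightarrow> ('o, 'a) tensor_cat \<Rightarrow> (int \<Rightarrow> 'o set) \<Rightarrow>
    ('o, 'a, 'i) center_obj \<Rightarrow> ('o, 'a, 'i) center_obj \<Rightarrow> ('o, 'a, 'i) half_braiding" where
  "hb_tensor_k n k C G A B =
     (let D = ind C; J = emb_obj C; X = fst A; X' = fst B; \<Gamma> = integer_mod_group n;
          p = grade_proj D \<Gamma> (ind_grading C G)
      in (\<lambda>Y\<in>Obj C. Sum D (J Y \<otimes>\<^sub>o\<^bsub>D\<^esub> (X \<otimes>\<^sub>o\<^bsub>D\<^esub> X')) ((X \<otimes>\<^sub>o\<^bsub>D\<^esub> X') \<otimes>\<^sub>o\<^bsub>D\<^esub> J Y)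
           (\<lambda>(a, b, s). cnj (omega n (2 * k) a b s) \<bullet>\<^bsub>D\<^esub>
              (hb_tensor C A B Y \<cdot>\<^bsub>D\<^esub> (p s (J Y) \<otimes>\<^sub>a\<^bsub>D\<^esub> (p a X \<otimes>\<^sub>a\<^bsub>D\<^esub> p b X'))))
           (carrier \<Gamma> \<times> carrier \<Gamma> \<times> carrier \<Gamma>)))"

definition center_k :: "nat \<Rightarrow> nat \<Rightarrow> ('o, 'a) tensor_cat \<Rightarrow> (int \<Rightarrow> 'o set) \<Rightarrow>
    (('o, 'a, 'i) center_obj, ('o, 'a, 'i) center_arr) tensor_cat" where
  "center_k n k C G = center_with C (hb_tensor_k n k C G)"

definition center_grading :: "('o, 'a) tensor_cat \<Rightarrow> ('g \<Rightarrow> 'o set) \<Rightarrow>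
    'g \<Rightarrow> ('o, 'a, 'i) center_obj set" where
  "center_grading C G \<gamma> = {(X, c) \<in> center_objects C. X \<in> ind_grading C G \<gamma>}"


section \<open>Unitary monoidal equivalence\<close>

definition star_functor :: "('o, 'a, 'z) star_cat_scheme \<Rightarrow> ('p, 'b, 'y) star_cat_scheme \<Rightarrow>
    ('o \<Rightarrow> 'p) \<Rightarrow> ('a \<Rightarrow> 'b) \<Rightarrow> bool" where
  "star_functor C D F\<^sub>o F\<^sub>a \<longleftrightarrow>
     (\<forall>X\<in>Obj C. F\<^sub>o X \<in> Obj D \<and> F\<^sub>a (Id C X) = Id D (F\<^sub>o X)) \<and>
     (\<forall>X\<in>Obj C. \<forall>Y\<in>Obj C. \<forall>f\<in>Hom C X Y.
        F\<^sub>a f \<in> Hom D (F\<^sub>o X) (F\<^sub>o Y) \<and> F\<^sub>a (f\<^sup>\<dagger>\<^bsub>C\<^esub>) = (F\<^sub>a f)\<^sup>\<dagger>\<^bsub>D\<^esub> \<and>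
        (\<forall>z. F\<^sub>a (z \<bullet>\<^bsub>C\<^esub> f) = z \<bullet>\<^bsub>D\<^esub> F\<^sub>a f) \<and>
        (\<forall>g\<in>Hom C X Y. F\<^sub>a (f \<boxplus>\<^bsub>C\<^esub> g) = F\<^sub>a f \<boxplus>\<^bsub>D\<^esub> F\<^sub>a g) \<and>
        (\<forall>Z\<in>Obj C. \<forall>g\<in>Hom C Y Z. F\<^sub>a (g \<cdot>\<^bsub>C\<^esub> f) = F\<^sub>a g \<cdot>\<^bsub>D\<^esub> F\<^sub>a f))"

definition unitary_natural_iso :: "('o, 'a, 'z) star_cat_scheme \<Rightarrow> ('p, 'b, 'y) star_cat_scheme \<Rightarrow>
    ('o \<Rightarrow> 'p) \<Rightarrow> ('a \<Rightarrow> 'b) \<Rightarrow> ('o \<Rightarrow> 'p) \<Rightarrow> ('a \<Rightarrow> 'b) \<Rightarrow> ('o \<Rightarrow> 'b) \<Rightarrow> bool" where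
  "unitary_natural_iso C D F\<^sub>o F\<^sub>a G\<^sub>o G\<^sub>a u \<longleftrightarrow>
     (\<forall>X\<in>Obj C. unitary D (F\<^sub>o X) (G\<^sub>o X) (u X)) \<and>
     (\<forall>X\<in>Obj C. \<forall>Y\<in>Obj C. \<forall>f\<in>Hom C X Y. u Y \<cdot>\<^bsub>D\<^esub> F\<^sub>a f = G\<^sub>a f \<cdot>\<^bsub>D\<^esub> u X)"

definition star_equivalence :: "('o, 'a, 'z) star_cat_scheme \<Rightarrow> ('p, 'b, 'y) star_cat_scheme \<Rightarrow>
    ('o \<Rightarrow> 'p) \<Rightarrow> ('a \<Rightarrow> 'b) \<Rightarrow> bool" where
  "star_equivalence C D F\<^sub>o F\<^sub>a \<longleftrightarrow> star_functor C D F\<^sub>o F\<^sub>a \<and>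
     (\<exists>G\<^sub>o G\<^sub>a \<eta> \<epsilon>. star_functor D C G\<^sub>o G\<^sub>a \<and>
        unitary_natural_iso C C (\<lambda>X. X) (\<lambda>f. f) (\<lambda>X. G\<^sub>o (F\<^sub>o X)) (\<lambda>f. G\<^sub>a (F\<^sub>a f)) \<eta> \<and>
        unitary_natural_iso D D (\<lambda>X. F\<^sub>o (G\<^sub>o X)) (\<lambda>f. F\<^sub>a (G\<^sub>a f)) (\<lambda>X. X) (\<lambda>f. f) \<epsilon>)"

text \<open>The unit constraints being identities, the unit axioms for \<open>(F, F\<^sub>0, F\<^sub>2)\<close> read
  \<open>F\<^sub>2(1, X) (F\<^sub>0 \<otimes> id) = id\<close> and \<open>F\<^sub>2(X, 1) (id \<otimes> F\<^sub>0) = id\<close> on \<open>F(X)\<close>.\<close>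

definition cstar_tensor_functor :: "('o, 'a, 'z) tensor_cat_scheme \<Rightarrow> ('p, 'b, 'y) tensor_cat_scheme \<Rightarrow>
    ('o \<Rightarrow> 'p) \<Rightarrow> ('a \<Rightarrow> 'b) \<Rightarrow> 'b \<Rightarrow> ('o \<Rightarrow> 'o \<Rightarrow> 'b) \<Rightarrow> bool" where
  "cstar_tensor_functor C D F\<^sub>o F\<^sub>a F\<^sub>0 F\<^sub>2 \<longleftrightarrow> star_functor C D F\<^sub>o F\<^sub>a \<and>
     unitary D (Unit D) (F\<^sub>o (Unit C)) F\<^sub>0 \<and>
     (\<forall>X\<in>Obj C. \<forall>Y\<in>Obj C. unitary D (F\<^sub>o X \<otimes>\<^sub>o\<^bsub>D\<^esub> F\<^sub>o Y) (F\<^sub>o (X \<otimes>\<^sub>o\<^bsub>C\<^esub> Y)) (F\<^sub>2 X Y)) \<and>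
     (\<forall>X\<in>Obj C. \<forall>X'\<in>Obj C. \<forall>Y\<in>Obj C. \<forall>Y'\<in>Obj C. \<forall>f\<in>Hom C X X'. \<forall>g\<in>Hom C Y Y'.
        F\<^sub>2 X' Y' \<cdot>\<^bsub>D\<^esub> (F\<^sub>a f \<otimes>\<^sub>a\<^bsub>D\<^esub> F\<^sub>a g) = F\<^sub>a (f \<otimes>\<^sub>a\<^bsub>C\<^esub> g) \<cdot>\<^bsub>D\<^esub> F\<^sub>2 X Y) \<and>
     (\<forall>X\<in>Obj C. \<forall>Y\<in>Obj C. \<forall>Z\<in>Obj C.
        F\<^sub>2 X (Y \<otimes>\<^sub>o\<^bsub>C\<^esub> Z) \<cdot>\<^bsub>D\<^esub> (Id D (F\<^sub>o X) \<otimes>\<^sub>a\<^bsub>D\<^esub> F\<^sub>2 Y Z) \<cdot>\<^bsub>D\<^esub> Assoc D (F\<^sub>o X) (F\<^sub>o Y) (F\<^sub>o Z)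
        = F\<^sub>a (Assoc C X Y Z) \<cdot>\<^bsub>D\<^esub> F\<^sub>2 (X \<otimes>\<^sub>o\<^bsub>C\<^esub> Y) Z \<cdot>\<^bsub>D\<^esub> (F\<^sub>2 X Y \<otimes>\<^sub>a\<^bsub>D\<^esub> Id D (F\<^sub>o Z))) \<and>
     (\<forall>X\<in>Obj C. F\<^sub>2 (Unit C) X \<cdot>\<^bsub>D\<^esub> (F\<^sub>0 \<otimes>\<^sub>a\<^bsub>D\<^esub> Id D (F\<^sub>o X)) = Id D (F\<^sub>o X) \<and>
                 F\<^sub>2 X (Unit C) \<cdot>\<^bsub>D\<^esub> (Id D (F\<^sub>o X) \<otimes>\<^sub>a\<^bsub>D\<^esub> F\<^sub>0) = Id D (F\<^sub>o X))"

definition unitarily_monoidally_equivalent ::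
  "('o, 'a, 'z) tensor_cat_scheme \<Rightarrow> ('p, 'b, 'y) tensor_cat_scheme \<Rightarrow> bool" where
  "unitarily_monoidally_equivalent C D \<longleftrightarrow>
     (\<exists>F\<^sub>o F\<^sub>a F\<^sub>0 F\<^sub>2. cstar_tensor_functor C D F\<^sub>o F\<^sub>a F\<^sub>0 F\<^sub>2 \<and> star_equivalence C D F\<^sub>o F\<^sub>a)"

end

theory Submission
  imports Defs
begin

text \<open>For degrees \<open>0 \<le> a, s < n\<close> put \<open>f(a, s) = exp (2 \<pi> i k a s / n\<^sup>2)\<close>. A half-braiding
  \<open>Y \<otimes> X \<rightarrow> X \<otimes> Y\<close> preserves the degrees of \<open>X\<close> and \<open>Y\<close>, so it can be multiplied by
  \<open>f(a, s)\<close> on the component with \<open>X\<close> of degree \<open>a\<close> and \<open>Y\<close> of degree \<open>s\<close>. As \<open>f\<close> fails to be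
  bimultiplicative exactly by the carry that defines \<open>\<omega>\<close>, this turns the hexagon for the twisted
  associator into the original one: the identity on underlying morphisms is an isomorphism of the
  two centers. It becomes strictly monoidal once the product of half-braidings is multiplied by the
  conjugate of \<open>\<omega>(a, b, s)\<^sup>2\<close>. The ind-category of the twist is the twist of the ind-category since
  degree projections act termwise.\<close>

section \<open>Star categories\<close>

text \<open>The scalars are the light part; the weight lies in the ind-category. Its composition is
  a norm limit over the intermediate index. Rigidity makes the limits exist: Frobenius reciprocity
  embeds the columns of a morphism into Hilbert spaces with bounds uniform in the target, and there
  an increasing bounded net of compressions is Cauchy. Tensor products of ind-morphisms need the
  norm of \<open>f \<otimes> g\<close> to be at most \<open>|f| |g|\<close>. This is no axiom; it
  follows from contractivity of star functors, for which a square root is built by iteration. The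
  weighted product of half-braidings is never checked to be coherent by hand: it is the usual
  product of the twisted center, pulled back along the isomorphism, and its properties are
  transported. The representative of \<open>a + b\<close> below \<open>n\<close> is
  \<open>a + b - n\<close> times the carry, so dividing by \<open>n^2\<close> in \<open>f\<close>
  makes the defect of multiplicativity exactly the exponent of \<open>\<omega>\<close>. Of the two
  conjugate factors \<open>\<omega>(a, b, s)\<close> in the product, one is this defect of
  \<open>f\<close> at the total degree of \<open>X \<otimes> X'\<close>, the other is left over from
  the twisted associators; hence \<open>2k\<close>.\<close>

text \<open>The algebraic part of the C*-axioms; the norm of an ind-category is never needed.\<close>

locale star_category =
  fixes C :: "('o, 'a, 'z) star_cat_scheme" (structure)
  assumes dom_cod: "f \<in> Arr C \<Longrightarrow> Dom C f \<in> Obj C \<and> Cod C f \<in> Obj C"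
    and id_hom: "X \<in> Obj C \<Longrightarrow> Id C X \<in> Hom C X X"
    and comp_hom: "\<lbrakk>f \<in> Hom C X Y; g \<in> Hom C Y Z\<rbrakk> \<Longrightarrow> g \<cdot> f \<in> Hom C X Z"
    and comp_id: "f \<in> Hom C X Y \<Longrightarrow> f \<cdot> Id C X = f"
    and id_comp: "f \<in> Hom C X Y \<Longrightarrow> Id C Y \<cdot> f = f"
    and comp_assoc: "\<lbrakk>f \<in> Hom C X Y; g \<in> Hom C Y Z; h \<in> Hom C Z W\<rbrakk> \<Longrightarrow> (h \<cdot> g) \<cdot> f = h \<cdot> (g \<cdot> f)"
    and zero_hom: "\<lbrakk>X \<in> Obj C; Y \<in> Obj C\<rbrakk> \<Longrightarrow> Zero C X Y \<in> Hom C X Y"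
    and plus_hom: "\<lbrakk>f \<in> Hom C X Y; g \<in> Hom C X Y\<rbrakk> \<Longrightarrow> f \<boxplus> g \<in> Hom C X Y"
    and scale_hom: "f \<in> Hom C X Y \<Longrightarrow> z \<bullet> f \<in> Hom C X Y"
    and plus_assoc: "\<lbrakk>f \<in> Hom C X Y; g \<in> Hom C X Y; h \<in> Hom C X Y\<rbrakk> \<Longrightarrow>
      (f \<boxplus> g) \<boxplus> h = f \<boxplus> (g \<boxplus> h)"
    and plus_comm: "\<lbrakk>f \<in> Hom C X Y; g \<in> Hom C X Y\<rbrakk> \<Longrightarrow> f \<boxplus> g = g \<boxplus> f"
    and plus_zero: "f \<in> Hom C X Y \<Longrightarrow> f \<boxplus> Zero C X Y = f"
    and plus_minus: "f \<in> Hom C X Y \<Longrightarrow> f \<boxplus> (- 1) \<bullet> f = Zero C X Y"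
    and scale_plus: "\<lbrakk>f \<in> Hom C X Y; g \<in> Hom C X Y\<rbrakk> \<Longrightarrow> z \<bullet> (f \<boxplus> g) = z \<bullet> f \<boxplus> z \<bullet> g"
    and plus_scale: "f \<in> Hom C X Y \<Longrightarrow> (z + w) \<bullet> f = z \<bullet> f \<boxplus> w \<bullet> f"
    and scale_scale: "f \<in> Hom C X Y \<Longrightarrow> z \<bullet> (w \<bullet> f) = (z * w) \<bullet> f"
    and scale_one: "f \<in> Hom C X Y \<Longrightarrow> 1 \<bullet> f = f"
    and comp_plus: "\<lbrakk>f \<in> Hom C X Y; f' \<in> Hom C X Y; g \<in> Hom C Y Z\<rbrakk> \<Longrightarrow>
      g \<cdot> (f \<boxplus> f') = g \<cdot> f \<boxplus> g \<cdot> f'"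
    and plus_comp: "\<lbrakk>f \<in> Hom C X Y; g \<in> Hom C Y Z; g' \<in> Hom C Y Z\<rbrakk> \<Longrightarrow>
      (g \<boxplus> g') \<cdot> f = g \<cdot> f \<boxplus> g' \<cdot> f"
    and comp_scale: "\<lbrakk>f \<in> Hom C X Y; g \<in> Hom C Y Z\<rbrakk> \<Longrightarrow> g \<cdot> (z \<bullet> f) = z \<bullet> (g \<cdot> f)"
    and scale_comp: "\<lbrakk>f \<in> Hom C X Y; g \<in> Hom C Y Z\<rbrakk> \<Longrightarrow> (z \<bullet> g) \<cdot> f = z \<bullet> (g \<cdot> f)"
    and adj_hom: "f \<in> Hom C X Y \<Longrightarrow> f\<^sup>\<dagger> \<in> Hom C Y X"
    and adj_adj: "f \<in> Hom C X Y \<Longrightarrow> (f\<^sup>\<dagger>)\<^sup>\<dagger> = f"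
    and adj_comp: "\<lbrakk>f \<in> Hom C X Y; g \<in> Hom C Y Z\<rbrakk> \<Longrightarrow> (g \<cdot> f)\<^sup>\<dagger> = f\<^sup>\<dagger> \<cdot> g\<^sup>\<dagger>"
    and adj_plus: "\<lbrakk>f \<in> Hom C X Y; g \<in> Hom C X Y\<rbrakk> \<Longrightarrow> (f \<boxplus> g)\<^sup>\<dagger> = f\<^sup>\<dagger> \<boxplus> g\<^sup>\<dagger>"
    and adj_scale: "f \<in> Hom C X Y \<Longrightarrow> (z \<bullet> f)\<^sup>\<dagger> = cnj z \<bullet> f\<^sup>\<dagger>"
begin

lemma Hom_iff: "f \<in> Hom C X Y \<longleftrightarrow> f \<in> Arr C \<and> Dom C f = X \<and> Cod C f = Y"
  by (auto simp: Hom_def)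

lemma HomD [dest]:
  assumes "f \<in> Hom C X Y"
  shows "f \<in> Arr C" "Dom C f = X" "Cod C f = Y"
  using assms by (auto simp: Hom_def)

lemma Hom_Obj:
  assumes "f \<in> Hom C X Y"
  shows "X \<in> Obj C" "Y \<in> Obj C"
  using assms dom_cod[of f] by (auto simp: Hom_def)

lemma Hom_self: "f \<in> Arr C \<Longrightarrow> f \<in> Hom C (Dom C f) (Cod C f)"
  by (simp add: Hom_def)

lemma Obj_dom [simp]: "f \<in> Arr C \<Longrightarrow> Dom C f \<in> Obj C"
  and Obj_cod [simp]: "f \<in> Arr C \<Longrightarrow> Cod C f \<in> Obj C"
  using dom_cod by auto

lemma arr_Id [simp]:
  assumes "X \<in> Obj C"
  shows "Id C X \<in> Arr C" "Dom C (Id C X) = X" "Cod C (Id C X) = X"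
  using id_hom[OF assms] by auto

lemma arr_comp [simp]:
  assumes "f \<in> Arr C" "g \<in> Arr C" "Cod C f = Dom C g"
  shows "g \<cdot> f \<in> Arr C" "Dom C (g \<cdot> f) = Dom C f" "Cod C (g \<cdot> f) = Cod C g"
  using comp_hom[of f "Dom C f" "Cod C f" g "Cod C g"] assms by (auto simp: Hom_def)

lemma arr_plus [simp]:
  assumes "f \<in> Arr C" "g \<in> Arr C" "Dom C g = Dom C f" "Cod C g = Cod C f"
  shows "f \<boxplus> g \<in> Arr C" "Dom C (f \<boxplus> g) = Dom C f" "Cod C (f \<boxplus> g) = Cod C f"
  using plus_hom[of f "Dom C f" "Cod C f" g] assms by (auto simp: Hom_def)

lemma arr_scale [simp]:
  assumes "f \<in> Arr C"
  shows "z \<bullet> f \<in> Arr C" "Dom C (z \<bullet> f) = Dom C f" "Cod C (z \<bullet> f) = Cod C f"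
  using scale_hom[OF Hom_self[OF assms]] by auto

lemma arr_adj [simp]:
  assumes "f \<in> Arr C"
  shows "f\<^sup>\<dagger> \<in> Arr C" "Dom C (f\<^sup>\<dagger>) = Cod C f" "Cod C (f\<^sup>\<dagger>) = Dom C f"
  using adj_hom[OF Hom_self[OF assms]] by auto

lemma comp_arr_id [simp]: "\<lbrakk>f \<in> Arr C; Dom C f = X\<rbrakk> \<Longrightarrow> f \<cdot> Id C X = f"
  and id_comp_arr [simp]: "\<lbrakk>f \<in> Arr C; Cod C f = Y\<rbrakk> \<Longrightarrow> Id C Y \<cdot> f = f"
  using comp_id id_comp Hom_self by blast+

lemma comp_assoc_arr [simp]:
  "\<lbrakk>f \<in> Arr C; g \<in> Arr C; h \<in> Arr C; Cod C f = Dom C g; Cod C g = Dom C h\<rbrakk> \<Longrightarrow>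
   (h \<cdot> g) \<cdot> f = h \<cdot> (g \<cdot> f)"
  by (rule comp_assoc[of f "Dom C f" "Dom C g" g "Dom C h" h "Cod C h"]) (auto simp: Hom_def)

lemma adj_adj_arr [simp]: "f \<in> Arr C \<Longrightarrow> (f\<^sup>\<dagger>)\<^sup>\<dagger> = f"
  using adj_adj Hom_self by blast

lemma adj_comp_arr [simp]:
  "\<lbrakk>f \<in> Arr C; g \<in> Arr C; Cod C f = Dom C g\<rbrakk> \<Longrightarrow> (g \<cdot> f)\<^sup>\<dagger> = f\<^sup>\<dagger> \<cdot> g\<^sup>\<dagger>"
  by (rule adj_comp[of f "Dom C f" "Dom C g" g "Cod C g"]) (auto simp: Hom_def)

lemma adj_scale_arr [simp]: "f \<in> Arr C \<Longrightarrow> (z \<bullet> f)\<^sup>\<dagger> = cnj z \<bullet> f\<^sup>\<dagger>"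
  using adj_scale Hom_self by blast

lemma adj_plus_arr [simp]:
  "\<lbrakk>f \<in> Arr C; g \<in> Arr C; Dom C g = Dom C f; Cod C g = Cod C f\<rbrakk> \<Longrightarrow> (f \<boxplus> g)\<^sup>\<dagger> = f\<^sup>\<dagger> \<boxplus> g\<^sup>\<dagger>"
  by (rule adj_plus[of f "Dom C f" "Cod C f"]) (auto simp: Hom_def)

text \<open>The adjoint of \<open>1\<^sup>\<dagger> 1\<close>, computed once after and once before
  simplifying, is \<open>1\<close> and \<open>1\<^sup>\<dagger>\<close>.\<close>

lemma adj_Id [simp]:
  assumes "X \<in> Obj C"
  shows "(Id C X)\<^sup>\<dagger> = Id C X"
proof -
  have "((Id C X)\<^sup>\<dagger> \<cdot> Id C X)\<^sup>\<dagger> = (Id C X)\<^sup>\<dagger> \<cdot> ((Id C X)\<^sup>\<dagger>)\<^sup>\<dagger>"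
    by (rule adj_comp[OF id_hom adj_hom[OF id_hom]]) (use assms in auto)
  then show ?thesis
    using assms by simp
qed

lemma scale_comp_arr [simp]:
  "\<lbrakk>f \<in> Arr C; g \<in> Arr C; Cod C f = Dom C g\<rbrakk> \<Longrightarrow> (z \<bullet> g) \<cdot> f = z \<bullet> (g \<cdot> f)"
  by (rule scale_comp[of f "Dom C f" "Dom C g" g "Cod C g"]) (auto simp: Hom_def)

lemma comp_scale_arr [simp]:
  "\<lbrakk>f \<in> Arr C; g \<in> Arr C; Cod C f = Dom C g\<rbrakk> \<Longrightarrow> g \<cdot> (z \<bullet> f) = z \<bullet> (g \<cdot> f)"
  by (rule comp_scale[of f "Dom C f" "Dom C g" g "Cod C g"]) (auto simp: Hom_def)

lemma scale_scale_arr [simp]: "f \<in> Arr C \<Longrightarrow> z \<bullet> (w \<bullet> f) = (z * w) \<bullet> f"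
  using scale_scale Hom_self by blast

lemma scale_one_arr [simp]: "f \<in> Arr C \<Longrightarrow> 1 \<bullet> f = f"
  using scale_one Hom_self by blast

lemma plus_comp_arr:
  "\<lbrakk>f \<in> Arr C; g \<in> Arr C; g' \<in> Arr C; Cod C f = Dom C g; Dom C g' = Dom C g; Cod C g' = Cod C g\<rbrakk> \<Longrightarrow>
   (g \<boxplus> g') \<cdot> f = g \<cdot> f \<boxplus> g' \<cdot> f"
  by (rule plus_comp[of f "Dom C f" "Dom C g" g "Cod C g"]) (auto simp: Hom_def)

lemma comp_plus_arr:
  "\<lbrakk>f \<in> Arr C; f' \<in> Arr C; g \<in> Arr C; Cod C f = Dom C g; Dom C f' = Dom C f; Cod C f' = Cod C f\<rbrakk> \<Longrightarrow>
   g \<cdot> (f \<boxplus> f') = g \<cdot> f \<boxplus> g \<cdot> f'"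
  by (rule comp_plus[of f "Dom C f" "Dom C g" f' g "Cod C g"]) (auto simp: Hom_def)

lemma plus_cancel:
  assumes "f \<in> Hom C X Y" "g \<in> Hom C X Y" "h \<in> Hom C X Y" "f \<boxplus> g = f \<boxplus> h"
  shows "g = h"
proof -
  have "g = (f \<boxplus> g) \<boxplus> (- 1) \<bullet> f" if "g \<in> Hom C X Y" for g
  proof -
    have "(f \<boxplus> g) \<boxplus> (- 1) \<bullet> f = (g \<boxplus> f) \<boxplus> (- 1) \<bullet> f"
      using plus_comm[OF assms(1) that] by simp
    also have "\<dots> = g \<boxplus> (f \<boxplus> (- 1) \<bullet> f)"
      by (rule plus_assoc[OF that assms(1) scale_hom[OF assms(1)]])
    also have "\<dots> = g"
      using plus_minus[OF assms(1)] plus_zero[OF that] by simp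
    finally show ?thesis by simp
  qed
  from this[OF assms(2)] this[OF assms(3)] assms(4) show ?thesis by simp
qed

text \<open>The axioms relate \<open>0 \<bullet> f\<close> to \<open>Zero\<close> only through
  distributivity: \<open>f + 0 f = f\<close>. The facts on zero morphisms below all come from
  writing \<open>Zero\<close> as \<open>0 \<bullet> Zero\<close>.\<close>

lemma scale_zero_num:
  assumes "f \<in> Hom C X Y"
  shows "0 \<bullet> f = Zero C X Y"
proof -
  have "f \<boxplus> 0 \<bullet> f = f \<boxplus> Zero C X Y"
    using plus_scale[OF assms, of 1 0] scale_one[OF assms] plus_zero[OF assms] by simp
  then show ?thesis
    using plus_cancel assms scale_hom zero_hom Hom_Obj by meson
qed

lemma scale_zero: "\<lbrakk>X \<in> Obj C; Y \<in> Obj C\<rbrakk> \<Longrightarrow> z \<bullet> Zero C X Y = Zero C X Y"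
  using scale_zero_num[OF zero_hom, of X Y] scale_scale[OF zero_hom, of X Y z 0] by simp

lemma comp_zero:
  assumes "f \<in> Hom C Y Z" "X \<in> Obj C"
  shows "f \<cdot> Zero C X Y = Zero C X Z"
proof -
  have z: "Zero C X Y \<in> Hom C X Y"
    using assms Hom_Obj zero_hom by blast
  have "f \<cdot> Zero C X Y = f \<cdot> (0 \<bullet> Zero C X Y)"
    using scale_zero_num[OF z] by simp
  also have "\<dots> = 0 \<bullet> (f \<cdot> Zero C X Y)"
    by (rule comp_scale[OF z assms(1)])
  also have "\<dots> = Zero C X Z"
    by (rule scale_zero_num[OF comp_hom[OF z assms(1)]])
  finally show ?thesis .
qed

lemma zero_comp:
  assumes "f \<in> Hom C X Y" "Z \<in> Obj C"
  shows "Zero C Y Z \<cdot> f = Zero C X Z"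
proof -
  have z: "Zero C Y Z \<in> Hom C Y Z"
    using assms Hom_Obj zero_hom by blast
  have "Zero C Y Z \<cdot> f = (0 \<bullet> Zero C Y Z) \<cdot> f"
    using scale_zero_num[OF z] by simp
  also have "\<dots> = 0 \<bullet> (Zero C Y Z \<cdot> f)"
    by (rule scale_comp[OF assms(1) z])
  also have "\<dots> = Zero C X Z"
    by (rule scale_zero_num[OF comp_hom[OF assms(1) z]])
  finally show ?thesis .
qed

lemma adj_zero:
  assumes "X \<in> Obj C" "Y \<in> Obj C"
  shows "(Zero C X Y)\<^sup>\<dagger> = Zero C Y X"
proof -
  have z: "Zero C X Y \<in> Hom C X Y"
    using assms zero_hom by blast
  have "(Zero C X Y)\<^sup>\<dagger> = (0 \<bullet> Zero C X Y)\<^sup>\<dagger>"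
    using scale_zero_num[OF z] by simp
  also have "\<dots> = 0 \<bullet> (Zero C X Y)\<^sup>\<dagger>"
    using adj_scale[OF z, of 0] by simp
  also have "\<dots> = Zero C Y X"
    by (rule scale_zero_num[OF adj_hom[OF z]])
  finally show ?thesis .
qed

section \<open>Finite sums of parallel morphisms\<close>

abbreviation Hom_monoid :: "'o \<Rightarrow> 'o \<Rightarrow> 'a monoid" where
  "Hom_monoid X Y \<equiv> \<lparr>carrier = Hom C X Y, monoid.mult = Plus C, one = Zero C X Y\<rparr>"

lemma comm_monoid_Hom:
  assumes "X \<in> Obj C" "Y \<in> Obj C"
  shows "comm_monoid (Hom_monoid X Y)"
proof (rule comm_monoidI)
  fix f assume "f \<in> carrier (Hom_monoid X Y)"
  then show "\<one>\<^bsub>Hom_monoid X Y\<^esub> \<otimes>\<^bsub>Hom_monoid X Y\<^esub> f = f"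
    using assms plus_comm[OF zero_hom] plus_zero by auto
qed (use assms in \<open>auto intro: plus_hom zero_hom plus_assoc plus_comm\<close>)

lemma plus_left_comm:
  assumes "f \<in> Hom C X Y" "g \<in> Hom C X Y" "h \<in> Hom C X Y"
  shows "f \<boxplus> (g \<boxplus> h) = g \<boxplus> (f \<boxplus> h)"
  using plus_assoc[OF assms] plus_assoc[OF assms(2,1,3)] plus_comm[OF assms(1,2)] by simp

lemma Sum_empty: "\<lbrakk>X \<in> Obj C; Y \<in> Obj C\<rbrakk> \<Longrightarrow> Sum C X Y f {} = Zero C X Y"
  using comm_monoid.finprod_empty[OF comm_monoid_Hom] by (simp add: Sum_def)

lemma Sum_insert:
  assumes "X \<in> Obj C" "Y \<in> Obj C" "finite A" "a \<notin> A" "\<And>i. i \<in> insert a A \<Longrightarrow> f i \<in> Hom C X Y"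
  shows "Sum C X Y f (insert a A) = f a \<boxplus> Sum C X Y f A"
  using comm_monoid.finprod_insert[OF comm_monoid_Hom[OF assms(1,2)] assms(3,4), of f] assms(5)
  by (simp add: Sum_def Pi_def)

lemma Sum_hom:
  assumes "X \<in> Obj C" "Y \<in> Obj C" "\<And>i. i \<in> A \<Longrightarrow> f i \<in> Hom C X Y"
  shows "Sum C X Y f A \<in> Hom C X Y"
  using comm_monoid.finprod_closed[OF comm_monoid_Hom[OF assms(1,2)], of f A] assms(3)
  by (simp add: Sum_def Pi_def)

lemma Sum_cong:
  assumes "X \<in> Obj C" "Y \<in> Obj C" "\<And>i. i \<in> A \<Longrightarrow> f i = g i" "\<And>i. i \<in> A \<Longrightarrow> g i \<in> Hom C X Y"
  shows "Sum C X Y f A = Sum C X Y g A"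
  using comm_monoid.finprod_cong'[OF comm_monoid_Hom[OF assms(1,2)] refl, of g A f] assms(3,4)
  by (simp add: Sum_def Pi_def)

text \<open>Stated for an arbitrary additive map \<open>F\<close> between morphism spaces, so that
  composing and tensoring with a fixed morphism, on either side, are all instances.\<close>

lemma Sum_additive:
  assumes "finite A" "X \<in> Obj C" "Y \<in> Obj C" "X' \<in> Obj C" "Y' \<in> Obj C"
    and "\<And>i. i \<in> A \<Longrightarrow> f i \<in> Hom C X Y"
    and F: "\<And>u. u \<in> Hom C X Y \<Longrightarrow> F u \<in> Hom C X' Y'"
    and "\<And>u w. \<lbrakk>u \<in> Hom C X Y; w \<in> Hom C X Y\<rbrakk> \<Longrightarrow> F (u \<boxplus> w) = F u \<boxplus> F w"
    and "F (Zero C X Y) = Zero C X' Y'"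
  shows "F (Sum C X Y f A) = Sum C X' Y' (\<lambda>i. F (f i)) A"
  using assms(1,6)
proof (induction A)
  case empty
  then show ?case using assms by (simp add: Sum_empty)
next
  case (insert a A)
  then have h: "Sum C X Y f A \<in> Hom C X Y" "f a \<in> Hom C X Y"
    using assms(2-5) by (auto intro!: Sum_hom)
  have "F (Sum C X Y f (insert a A)) = F (f a) \<boxplus> F (Sum C X Y f A)"
    using insert assms h by (subst Sum_insert) auto
  also have "\<dots> = Sum C X' Y' (\<lambda>i. F (f i)) (insert a A)"
    using insert assms h by (subst Sum_insert) auto
  finally show ?case .
qed

lemma comp_Sum:
  assumes "finite A" "X \<in> Obj C" "\<And>i. i \<in> A \<Longrightarrow> f i \<in> Hom C X Y" "g \<in> Hom C Y Z"
  shows "g \<cdot> Sum C X Y f A = Sum C X Z (\<lambda>i. g \<cdot> f i) A"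
  by (rule Sum_additive)
    (use assms Hom_Obj[OF assms(4)] in \<open>auto intro: comp_hom comp_plus comp_zero\<close>)

lemma Sum_comp:
  assumes "finite A" "Z \<in> Obj C" "\<And>i. i \<in> A \<Longrightarrow> f i \<in> Hom C Y Z" "g \<in> Hom C X Y"
  shows "Sum C Y Z f A \<cdot> g = Sum C X Z (\<lambda>i. f i \<cdot> g) A"
  by (rule Sum_additive[where F = "\<lambda>u. u \<cdot> g"])
    (use assms Hom_Obj[OF assms(4)] in \<open>auto intro: comp_hom plus_comp zero_comp\<close>)

lemma Sum_zero:
  assumes "X \<in> Obj C" "Y \<in> Obj C" "\<And>i. i \<in> A \<Longrightarrow> f i = Zero C X Y"
  shows "Sum C X Y f A = Zero C X Y"
  using comm_monoid.finprod_one_eqI[OF comm_monoid_Hom[OF assms(1,2)], of A f] assms(3)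
  by (simp add: Sum_def)

lemma Sum_single:
  assumes "finite A" "X \<in> Obj C" "Y \<in> Obj C" "a \<in> A" "f a \<in> Hom C X Y"
    and z: "\<And>i. \<lbrakk>i \<in> A; i \<noteq> a\<rbrakk> \<Longrightarrow> f i = Zero C X Y"
  shows "Sum C X Y f A = f a"
proof -
  have A: "A = insert a (A - {a})"
    using assms(4) by auto
  have h: "f i \<in> Hom C X Y" if "i \<in> A" for i
    using that assms zero_hom by (cases "i = a") auto
  have "Sum C X Y f (insert a (A - {a})) = f a \<boxplus> Sum C X Y f (A - {a})"
    by (rule Sum_insert) (use assms h in auto)
  also have "Sum C X Y f (A - {a}) = Zero C X Y"
    by (rule Sum_zero) (use assms in auto)
  finally show ?thesis
    using A assms plus_zero by simp
qed

text \<open>The device that replaces a basis: two morphisms agree as soon as they agree after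
  composition with each \<open>e i\<close>. It is applied to degree projections and their tensor
  products.\<close>

definition id_resolution :: "'o \<Rightarrow> 'i set \<Rightarrow> ('i \<Rightarrow> 'a) \<Rightarrow> bool" where
  "id_resolution X I e \<longleftrightarrow> finite I \<and> X \<in> Obj C \<and> (\<forall>i\<in>I. e i \<in> Hom C X X) \<and> Sum C X X e I = Id C X"

lemma id_resolution_eqI:
  assumes "id_resolution X I e" "f \<in> Hom C X Y" "g \<in> Hom C X Y"
    and eq: "\<And>i. i \<in> I \<Longrightarrow> f \<cdot> e i = g \<cdot> e i"
  shows "f = g"
proof -
  have r: "finite I" "X \<in> Obj C" "\<And>i. i \<in> I \<Longrightarrow> e i \<in> Hom C X X" "Sum C X X e I = Id C X"
    using assms(1) by (auto simp: id_resolution_def)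
  have Y: "Y \<in> Obj C"
    using assms Hom_Obj by blast
  have "f = f \<cdot> Sum C X X e I"
    using r comp_id[OF assms(2)] by simp
  also have "\<dots> = Sum C X Y (\<lambda>i. f \<cdot> e i) I"
    by (rule comp_Sum) (use r assms in auto)
  also have "\<dots> = Sum C X Y (\<lambda>i. g \<cdot> e i) I"
    by (rule Sum_cong) (use r assms Y in \<open>auto intro: comp_hom\<close>)
  also have "\<dots> = g \<cdot> Sum C X X e I"
    by (rule comp_Sum[symmetric]) (use r assms in auto)
  also have "\<dots> = g"
    using r comp_id[OF assms(3)] by simp
  finally show ?thesis .
qed

lemma isometry_cancel:
  assumes "isometry C X Y v" "f \<in> Arr C" "Cod C f = X"
  shows "v\<^sup>\<dagger> \<cdot> (v \<cdot> f) = f"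
proof -
  have v: "v \<in> Hom C X Y" "v\<^sup>\<dagger> \<cdot> v = Id C X"
    using assms(1) by (auto simp: isometry_def)
  show ?thesis
    using comp_assoc_arr[of f v "v\<^sup>\<dagger>"] v assms(2,3) by (auto simp: Hom_iff)
qed

lemma unitary_Id: "X \<in> Obj C \<Longrightarrow> unitary C X X (Id C X)"
  by (simp add: unitary_def id_hom)

lemma unitary_adj: "unitary C X Y u \<Longrightarrow> unitary C Y X (u\<^sup>\<dagger>)"
  unfolding unitary_def using adj_hom adj_adj by auto

lemma unitary_comp:
  assumes u: "unitary C X Y u" and w: "unitary C Y Z w"
  shows "unitary C X Z (w \<cdot> u)"
proof -
  have h: "u \<in> Hom C X Y" "w \<in> Hom C Y Z"
    using assms by (auto simp: unitary_def)
  have u': "u\<^sup>\<dagger> \<cdot> u = Id C X" "u \<cdot> u\<^sup>\<dagger> = Id C Y" "w\<^sup>\<dagger> \<cdot> w = Id C Y" "w \<cdot> w\<^sup>\<dagger> = Id C Z"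
    using assms by (auto simp: unitary_def)
  have "(w \<cdot> u)\<^sup>\<dagger> \<cdot> (w \<cdot> u) = u\<^sup>\<dagger> \<cdot> ((w\<^sup>\<dagger> \<cdot> w) \<cdot> u)"
    using h by (auto simp: Hom_iff)
  also have "\<dots> = Id C X"
    using u' h by (auto simp: Hom_iff)
  moreover have "(w \<cdot> u) \<cdot> (w \<cdot> u)\<^sup>\<dagger> = w \<cdot> ((u \<cdot> u\<^sup>\<dagger>) \<cdot> w\<^sup>\<dagger>)"
    using h by (auto simp: Hom_iff)
  moreover have "\<dots> = Id C Z"
    using u' h by (auto simp: Hom_iff)
  ultimately show ?thesis
    using comp_hom[OF h] by (simp add: unitary_def)
qed

lemma unitary_cancel:
  assumes "unitary C X Y u"
  shows "\<lbrakk>f \<in> Arr C; Cod C f = X\<rbrakk> \<Longrightarrow> u\<^sup>\<dagger> \<cdot> (u \<cdot> f) = f"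
    and "\<lbrakk>g \<in> Arr C; Cod C g = Y\<rbrakk> \<Longrightarrow> u \<cdot> (u\<^sup>\<dagger> \<cdot> g) = g"
proof -
  have h: "u \<in> Hom C X Y" and e: "u\<^sup>\<dagger> \<cdot> u = Id C X" "u \<cdot> u\<^sup>\<dagger> = Id C Y"
    using assms by (auto simp: unitary_def)
  show "u\<^sup>\<dagger> \<cdot> (u \<cdot> f) = f" if "f \<in> Arr C" "Cod C f = X"
    using comp_assoc_arr[of f u "u\<^sup>\<dagger>"] h e that by (auto simp: Hom_iff)
  show "u \<cdot> (u\<^sup>\<dagger> \<cdot> g) = g" if "g \<in> Arr C" "Cod C g = Y"
    using comp_assoc_arr[of g "u\<^sup>\<dagger>" u] h e that by (auto simp: Hom_iff)
qed

end


section \<open>Monoidal star categories\<close>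

abbreviation lwhisker :: "('o, 'a, 'z) tensor_cat_scheme \<Rightarrow> 'o \<Rightarrow> 'a \<Rightarrow> 'a" (infixr "\<lhd>\<index>" 75) where
  "X \<lhd>\<^bsub>C\<^esub> f \<equiv> Id C X \<otimes>\<^sub>a\<^bsub>C\<^esub> f"

abbreviation rwhisker :: "('o, 'a, 'z) tensor_cat_scheme \<Rightarrow> 'a \<Rightarrow> 'o \<Rightarrow> 'a" (infixr "\<rhd>\<index>" 75) where
  "f \<rhd>\<^bsub>C\<^esub> X \<equiv> f \<otimes>\<^sub>a\<^bsub>C\<^esub> Id C X"

locale star_tensor_category = star_category C
  for C :: "('o, 'a, 'z) tensor_cat_scheme" (structure) +
  assumes tens_obj: "\<lbrakk>X \<in> Obj C; Y \<in> Obj C\<rbrakk> \<Longrightarrow> X \<otimes>\<^sub>o Y \<in> Obj C"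
    and tens_hom: "\<lbrakk>f \<in> Hom C X Y; g \<in> Hom C X' Y'\<rbrakk> \<Longrightarrow> f \<otimes>\<^sub>a g \<in> Hom C (X \<otimes>\<^sub>o X') (Y \<otimes>\<^sub>o Y')"
    and tens_id: "\<lbrakk>X \<in> Obj C; Y \<in> Obj C\<rbrakk> \<Longrightarrow> X \<lhd> Id C Y = Id C (X \<otimes>\<^sub>o Y)"
    and tens_comp: "\<lbrakk>f \<in> Hom C X Y; g \<in> Hom C Y Z; f' \<in> Hom C X' Y'; g' \<in> Hom C Y' Z'\<rbrakk> \<Longrightarrow>
      (g \<cdot> f) \<otimes>\<^sub>a (g' \<cdot> f') = (g \<otimes>\<^sub>a g') \<cdot> (f \<otimes>\<^sub>a f')"
    and tens_plus: "\<lbrakk>f \<in> Hom C X Y; g \<in> Hom C X' Y'; g' \<in> Hom C X' Y'\<rbrakk> \<Longrightarrow>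
      f \<otimes>\<^sub>a (g \<boxplus> g') = f \<otimes>\<^sub>a g \<boxplus> f \<otimes>\<^sub>a g'"
    and plus_tens: "\<lbrakk>f \<in> Hom C X Y; f' \<in> Hom C X Y; g \<in> Hom C X' Y'\<rbrakk> \<Longrightarrow>
      (f \<boxplus> f') \<otimes>\<^sub>a g = f \<otimes>\<^sub>a g \<boxplus> f' \<otimes>\<^sub>a g"
    and tens_scale: "\<lbrakk>f \<in> Hom C X Y; g \<in> Hom C X' Y'\<rbrakk> \<Longrightarrow> f \<otimes>\<^sub>a (z \<bullet> g) = z \<bullet> (f \<otimes>\<^sub>a g)"
    and scale_tens: "\<lbrakk>f \<in> Hom C X Y; g \<in> Hom C X' Y'\<rbrakk> \<Longrightarrow> (z \<bullet> f) \<otimes>\<^sub>a g = z \<bullet> (f \<otimes>\<^sub>a g)"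
    and tens_adj: "\<lbrakk>f \<in> Hom C X Y; g \<in> Hom C X' Y'\<rbrakk> \<Longrightarrow> (f \<otimes>\<^sub>a g)\<^sup>\<dagger> = f\<^sup>\<dagger> \<otimes>\<^sub>a g\<^sup>\<dagger>"
    and unit_obj: "Unit C \<in> Obj C"
    and unit_tens_obj: "X \<in> Obj C \<Longrightarrow> Unit C \<otimes>\<^sub>o X = X"
    and tens_unit_obj: "X \<in> Obj C \<Longrightarrow> X \<otimes>\<^sub>o Unit C = X"
    and unit_tens: "f \<in> Hom C X Y \<Longrightarrow> Unit C \<lhd> f = f"
    and tens_unit: "f \<in> Hom C X Y \<Longrightarrow> f \<rhd> Unit C = f"
    and assoc_unitary: "\<lbrakk>X \<in> Obj C; Y \<in> Obj C; Z \<in> Obj C\<rbrakk> \<Longrightarrow>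
      unitary C ((X \<otimes>\<^sub>o Y) \<otimes>\<^sub>o Z) (X \<otimes>\<^sub>o (Y \<otimes>\<^sub>o Z)) (Assoc C X Y Z)"
    and assoc_natural: "\<lbrakk>f \<in> Hom C X X'; g \<in> Hom C Y Y'; h \<in> Hom C Z Z'\<rbrakk> \<Longrightarrow>
      Assoc C X' Y' Z' \<cdot> ((f \<otimes>\<^sub>a g) \<otimes>\<^sub>a h) = (f \<otimes>\<^sub>a (g \<otimes>\<^sub>a h)) \<cdot> Assoc C X Y Z"
    and pentagon_eq: "\<lbrakk>X \<in> Obj C; Y \<in> Obj C; Z \<in> Obj C; W \<in> Obj C\<rbrakk> \<Longrightarrow>
      Assoc C X Y (Z \<otimes>\<^sub>o W) \<cdot> Assoc C (X \<otimes>\<^sub>o Y) Z W =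
      (X \<lhd> Assoc C Y Z W) \<cdot> Assoc C X (Y \<otimes>\<^sub>o Z) W \<cdot> (Assoc C X Y Z \<rhd> W)"
    and triangle_eq: "\<lbrakk>X \<in> Obj C; Y \<in> Obj C\<rbrakk> \<Longrightarrow> Assoc C X (Unit C) Y = Id C (X \<otimes>\<^sub>o Y)"
begin

lemma obj_tens [simp]: "\<lbrakk>X \<in> Obj C; Y \<in> Obj C\<rbrakk> \<Longrightarrow> X \<otimes>\<^sub>o Y \<in> Obj C"
  by (rule tens_obj)

lemma arr_tens [simp]:
  assumes "f \<in> Arr C" "g \<in> Arr C"
  shows "f \<otimes>\<^sub>a g \<in> Arr C" "Dom C (f \<otimes>\<^sub>a g) = Dom C f \<otimes>\<^sub>o Dom C g"
    "Cod C (f \<otimes>\<^sub>a g) = Cod C f \<otimes>\<^sub>o Cod C g"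
  using tens_hom[OF Hom_self Hom_self, OF assms] by auto

lemma tens_id_arr [simp]: "\<lbrakk>X \<in> Obj C; Y \<in> Obj C\<rbrakk> \<Longrightarrow> X \<lhd> Id C Y = Id C (X \<otimes>\<^sub>o Y)"
  by (rule tens_id)

lemma interchange [simp]:
  "\<lbrakk>f \<in> Arr C; g \<in> Arr C; f' \<in> Arr C; g' \<in> Arr C; Cod C f = Dom C g; Cod C f' = Dom C g'\<rbrakk> \<Longrightarrow>
   (g \<otimes>\<^sub>a g') \<cdot> (f \<otimes>\<^sub>a f') = (g \<cdot> f) \<otimes>\<^sub>a (g' \<cdot> f')"
  by (rule tens_comp[symmetric]) (auto simp: Hom_def)

text \<open>Simplification keeps composites nested to the right, so the interchange law must also
  match in front of a trailing factor \<open>h\<close>.\<close>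

lemma interchange_left [simp]:
  "\<lbrakk>f \<in> Arr C; g \<in> Arr C; f' \<in> Arr C; g' \<in> Arr C; h \<in> Arr C;
    Cod C f = Dom C g; Cod C f' = Dom C g'; Cod C h = Dom C f \<otimes>\<^sub>o Dom C f'\<rbrakk> \<Longrightarrow>
   (g \<otimes>\<^sub>a g') \<cdot> ((f \<otimes>\<^sub>a f') \<cdot> h) = ((g \<cdot> f) \<otimes>\<^sub>a (g' \<cdot> f')) \<cdot> h"
  by (subst comp_assoc_arr[symmetric]) auto

lemma tens_adj_arr [simp]: "\<lbrakk>f \<in> Arr C; g \<in> Arr C\<rbrakk> \<Longrightarrow> (f \<otimes>\<^sub>a g)\<^sup>\<dagger> = f\<^sup>\<dagger> \<otimes>\<^sub>a g\<^sup>\<dagger>"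
  using tens_adj Hom_self by blast

lemma scale_tens_arr [simp]: "\<lbrakk>f \<in> Arr C; g \<in> Arr C\<rbrakk> \<Longrightarrow> (z \<bullet> f) \<otimes>\<^sub>a g = z \<bullet> (f \<otimes>\<^sub>a g)"
  using scale_tens Hom_self by blast

lemma tens_scale_arr [simp]: "\<lbrakk>f \<in> Arr C; g \<in> Arr C\<rbrakk> \<Longrightarrow> f \<otimes>\<^sub>a (z \<bullet> g) = z \<bullet> (f \<otimes>\<^sub>a g)"
  using tens_scale Hom_self by blast

lemma obj_unit [simp]: "Unit C \<in> Obj C"
  by (rule unit_obj)

lemma unit_simps [simp]:
  "X \<in> Obj C \<Longrightarrow> Unit C \<otimes>\<^sub>o X = X" "X \<in> Obj C \<Longrightarrow> X \<otimes>\<^sub>o Unit C = X"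
  "f \<in> Arr C \<Longrightarrow> Unit C \<lhd> f = f" "f \<in> Arr C \<Longrightarrow> f \<rhd> Unit C = f"
  using unit_tens_obj tens_unit_obj unit_tens tens_unit Hom_self by blast+

lemma arr_assoc [simp]:
  assumes "X \<in> Obj C" "Y \<in> Obj C" "Z \<in> Obj C"
  shows "Assoc C X Y Z \<in> Arr C" "Dom C (Assoc C X Y Z) = (X \<otimes>\<^sub>o Y) \<otimes>\<^sub>o Z"
    "Cod C (Assoc C X Y Z) = X \<otimes>\<^sub>o (Y \<otimes>\<^sub>o Z)"
  using assoc_unitary[OF assms] by (auto simp: unitary_def)

lemma assoc_cancel [simp]:
  assumes "X \<in> Obj C" "Y \<in> Obj C" "Z \<in> Obj C"
  shows "(Assoc C X Y Z)\<^sup>\<dagger> \<cdot> Assoc C X Y Z = Id C ((X \<otimes>\<^sub>o Y) \<otimes>\<^sub>o Z)"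
    "Assoc C X Y Z \<cdot> (Assoc C X Y Z)\<^sup>\<dagger> = Id C (X \<otimes>\<^sub>o (Y \<otimes>\<^sub>o Z))"
  using assoc_unitary[OF assms] by (auto simp: unitary_def)

lemma assoc_cancel_left [simp]:
  assumes "X \<in> Obj C" "Y \<in> Obj C" "Z \<in> Obj C"
  shows "\<lbrakk>f \<in> Arr C; Cod C f = (X \<otimes>\<^sub>o Y) \<otimes>\<^sub>o Z\<rbrakk> \<Longrightarrow> (Assoc C X Y Z)\<^sup>\<dagger> \<cdot> (Assoc C X Y Z \<cdot> f) = f"
    "\<lbrakk>g \<in> Arr C; Cod C g = X \<otimes>\<^sub>o (Y \<otimes>\<^sub>o Z)\<rbrakk> \<Longrightarrow> Assoc C X Y Z \<cdot> ((Assoc C X Y Z)\<^sup>\<dagger> \<cdot> g) = g"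
  using unitary_cancel[OF assoc_unitary[OF assms]] by auto

lemma assoc_nat:
  "\<lbrakk>f \<in> Arr C; g \<in> Arr C; h \<in> Arr C\<rbrakk> \<Longrightarrow>
    Assoc C (Cod C f) (Cod C g) (Cod C h) \<cdot> ((f \<otimes>\<^sub>a g) \<otimes>\<^sub>a h) =
    (f \<otimes>\<^sub>a (g \<otimes>\<^sub>a h)) \<cdot> Assoc C (Dom C f) (Dom C g) (Dom C h)"
  by (rule assoc_natural) (auto simp: Hom_def)

text \<open>Naturality of the inverse associator: apply naturality to the adjoints of
  \<open>f\<close>, \<open>g\<close>, \<open>h\<close> and take the adjoint of the equation.\<close>

lemma assoc_adj_nat:
  assumes "f \<in> Arr C" "g \<in> Arr C" "h \<in> Arr C"
  shows "(Assoc C (Cod C f) (Cod C g) (Cod C h))\<^sup>\<dagger> \<cdot> (f \<otimes>\<^sub>a (g \<otimes>\<^sub>a h)) =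
    ((f \<otimes>\<^sub>a g) \<otimes>\<^sub>a h) \<cdot> (Assoc C (Dom C f) (Dom C g) (Dom C h))\<^sup>\<dagger>"
proof -
  have "(Assoc C (Dom C f) (Dom C g) (Dom C h) \<cdot> ((f\<^sup>\<dagger> \<otimes>\<^sub>a g\<^sup>\<dagger>) \<otimes>\<^sub>a h\<^sup>\<dagger>))\<^sup>\<dagger> =
    ((f\<^sup>\<dagger> \<otimes>\<^sub>a (g\<^sup>\<dagger> \<otimes>\<^sub>a h\<^sup>\<dagger>)) \<cdot> Assoc C (Cod C f) (Cod C g) (Cod C h))\<^sup>\<dagger>"
    using assoc_nat[of "f\<^sup>\<dagger>" "g\<^sup>\<dagger>" "h\<^sup>\<dagger>"] assms by simp
  then show ?thesis
    using assms by simp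
qed

lemma tens_zero:
  assumes "f \<in> Hom C X Y" "X' \<in> Obj C" "Y' \<in> Obj C"
  shows "f \<otimes>\<^sub>a Zero C X' Y' = Zero C (X \<otimes>\<^sub>o X') (Y \<otimes>\<^sub>o Y')"
    "Zero C X' Y' \<otimes>\<^sub>a f = Zero C (X' \<otimes>\<^sub>o X) (Y' \<otimes>\<^sub>o Y)"
proof -
  have z: "Zero C X' Y' \<in> Hom C X' Y'"
    using assms by (simp add: zero_hom)
  show "f \<otimes>\<^sub>a Zero C X' Y' = Zero C (X \<otimes>\<^sub>o X') (Y \<otimes>\<^sub>o Y')"
    using tens_scale[OF assms(1) z, of 0] scale_zero_num[OF z]
      scale_zero_num[OF tens_hom[OF assms(1) z]] by simp
  show "Zero C X' Y' \<otimes>\<^sub>a f = Zero C (X' \<otimes>\<^sub>o X) (Y' \<otimes>\<^sub>o Y)"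
    using scale_tens[OF z assms(1), of 0] scale_zero_num[OF z]
      scale_zero_num[OF tens_hom[OF z assms(1)]] by simp
qed

lemma tens_Sum:
  assumes "finite A" "X' \<in> Obj C" "Y' \<in> Obj C" "\<And>i. i \<in> A \<Longrightarrow> g i \<in> Hom C X' Y'" "f \<in> Hom C X Y"
  shows "f \<otimes>\<^sub>a Sum C X' Y' g A = Sum C (X \<otimes>\<^sub>o X') (Y \<otimes>\<^sub>o Y') (\<lambda>i. f \<otimes>\<^sub>a g i) A"
  by (rule Sum_additive)
    (use assms Hom_Obj[OF assms(5)] in \<open>auto intro: tens_hom tens_plus tens_zero tens_obj\<close>)

lemma Sum_tens:
  assumes "finite A" "X' \<in> Obj C" "Y' \<in> Obj C" "\<And>i. i \<in> A \<Longrightarrow> g i \<in> Hom C X' Y'" "f \<in> Hom C X Y"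
  shows "Sum C X' Y' g A \<otimes>\<^sub>a f = Sum C (X' \<otimes>\<^sub>o X) (Y' \<otimes>\<^sub>o Y) (\<lambda>i. g i \<otimes>\<^sub>a f) A"
  by (rule Sum_additive[where F = "\<lambda>u. u \<otimes>\<^sub>a f"])
    (use assms Hom_Obj[OF assms(5)] in \<open>auto intro: tens_hom plus_tens tens_zero tens_obj\<close>)

lemma id_resolution_tens:
  assumes "id_resolution X I e" "id_resolution Y K h"
  shows "id_resolution (X \<otimes>\<^sub>o Y) (I \<times> K) (\<lambda>(i, k). e i \<otimes>\<^sub>a h k)"
proof -
  have X: "finite I" "X \<in> Obj C" "\<And>i. i \<in> I \<Longrightarrow> e i \<in> Hom C X X" "Sum C X X e I = Id C X"
    and Y: "finite K" "Y \<in> Obj C" "\<And>k. k \<in> K \<Longrightarrow> h k \<in> Hom C Y Y" "Sum C Y Y h K = Id C Y"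
    using assms by (auto simp: id_resolution_def)
  let ?H = "Hom_monoid (X \<otimes>\<^sub>o Y) (X \<otimes>\<^sub>o Y)"
  interpret H: comm_monoid ?H
    by (rule comm_monoid_Hom) (use X Y in auto)
  have t: "e i \<otimes>\<^sub>a h k \<in> Hom C (X \<otimes>\<^sub>o Y) (X \<otimes>\<^sub>o Y)" if "i \<in> I" "k \<in> K" for i k
    using that X Y tens_hom by blast
  \<comment> \<open>The double sum is cut into slices \<open>{i} \<times> K\<close>; on each slice
    the sum over \<open>K\<close> is \<open>e i\<close> tensored with the identity of
    \<open>Y\<close>.\<close>
  have "finprod ?H (\<lambda>(i, k). e i \<otimes>\<^sub>a h k) (\<Union>i\<in>I. {i} \<times> K) =
      finprod ?H (\<lambda>i. finprod ?H (\<lambda>(i, k). e i \<otimes>\<^sub>a h k) ({i} \<times> K)) I"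
    by (rule H.finprod_UN_disjoint) (use X Y t in \<open>auto simp: pairwise_def disjnt_def\<close>)
  also have "\<dots> = finprod ?H (\<lambda>i. e i \<rhd> Y) I"
  proof (rule H.finprod_cong')
    fix i assume i: "i \<in> I"
    have "finprod ?H (\<lambda>(i, k). e i \<otimes>\<^sub>a h k) ({i} \<times> K) =
        finprod ?H (\<lambda>(i, k). e i \<otimes>\<^sub>a h k) (Pair i ` K)"
      by (rule arg_cong[where f = "finprod _ _"]) auto
    also have "\<dots> = finprod ?H (\<lambda>k. e i \<otimes>\<^sub>a h k) K"
      by (subst H.finprod_reindex) (use i t in \<open>auto simp: inj_on_def\<close>)
    also have "\<dots> = e i \<rhd> Y"
      using tens_Sum[of K Y Y h "e i" X X] i X Y by (simp add: Sum_def)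
    finally show "finprod ?H (\<lambda>(i, k). e i \<otimes>\<^sub>a h k) ({i} \<times> K) = e i \<rhd> Y" .
  qed (use X Y in \<open>auto intro!: tens_hom id_hom\<close>)
  also have "\<dots> = X \<lhd> Id C Y"
    using Sum_tens[of I X X e "Id C Y" Y Y] X Y by (simp add: Sum_def id_hom)
  finally have "finprod ?H (\<lambda>(i, k). e i \<otimes>\<^sub>a h k) (\<Union>i\<in>I. {i} \<times> K) = X \<lhd> Id C Y" .
  moreover have "(\<Union>i\<in>I. {i} \<times> K) = I \<times> K" by auto
  ultimately show ?thesis
    using X Y t by (auto simp: id_resolution_def Sum_def)
qed

end

section \<open>Norm estimates in C*-tensor categories\<close>

sublocale cstar_category \<subseteq> star_category C
  by unfold_locales (fact Dom_Cod Id_Hom Comp_Hom Comp_Id Id_Comp Comp_assoc Zero_Hom Plus_Hom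
      Scale_Hom Plus_assoc Plus_comm Plus_Zero Plus_minus Scale_Plus plus_Scale Scale_Scale
      one_Scale Comp_Plus Plus_Comp Comp_Scale Scale_Comp Adj_Hom Adj_Adj Adj_Comp Adj_Plus
      Adj_Scale)+

sublocale cstar_tensor_category \<subseteq> star_tensor_category C
  by unfold_locales (fact TensO_Obj TensA_Hom TensA_Id TensA_Comp TensA_Plus Plus_TensA
      TensA_Scale Scale_TensA TensA_Adj Unit_Obj Unit_TensO TensO_Unit Unit_TensA TensA_Unit
      Assoc_unitary Assoc_natural pentagon triangle)+

section \<open>Differences of parallel morphisms\<close>

context star_category
begin

lemma Diff_hom: "\<lbrakk>f \<in> Hom C X Y; g \<in> Hom C X Y\<rbrakk> \<Longrightarrow> Diff C f g \<in> Hom C X Y"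
  unfolding Diff_def by (intro plus_hom scale_hom)

lemma Diff_self: "f \<in> Hom C X Y \<Longrightarrow> Diff C f f = Zero C X Y"
  unfolding Diff_def by (rule plus_minus)

lemma plus_Diff:
  assumes "f \<in> Hom C X Y" "g \<in> Hom C X Y"
  shows "g \<boxplus> Diff C f g = f"
proof -
  have m: "(- 1) \<bullet> g \<in> Hom C X Y"
    using assms scale_hom by blast
  have "g \<boxplus> Diff C f g = Diff C f g \<boxplus> g"
    using assms by (intro plus_comm Diff_hom)
  also have "\<dots> = f \<boxplus> ((- 1) \<bullet> g \<boxplus> g)"
    unfolding Diff_def by (rule plus_assoc[OF assms(1) m assms(2)])
  also have "(- 1) \<bullet> g \<boxplus> g = Zero C X Y"
    using plus_comm[OF m assms(2)] plus_minus[OF assms(2)] by simp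
  finally show ?thesis
    using plus_zero[OF assms(1)] by simp
qed

lemma Diff_eqI:
  assumes "g \<in> Hom C X Y" "h \<in> Hom C X Y" "g \<boxplus> h = f"
  shows "Diff C f g = h"
  using plus_cancel[OF assms(1) _ assms(2)] plus_Diff[of f X Y g] Diff_hom[of f X Y g] assms plus_hom
  by blast

lemma Diff_plus_Diff:
  assumes "f \<in> Hom C X Y" "g \<in> Hom C X Y" "h \<in> Hom C X Y"
  shows "Diff C f g \<boxplus> Diff C g h = Diff C f h"
proof -
  note h = assms Diff_hom[OF assms(1,2)] Diff_hom[OF assms(2,3)]
  have "h \<boxplus> (Diff C f g \<boxplus> Diff C g h) = h \<boxplus> (Diff C g h \<boxplus> Diff C f g)"
    using plus_comm h by metis
  also have "\<dots> = (h \<boxplus> Diff C g h) \<boxplus> Diff C f g"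
    using plus_assoc h by metis
  also have "\<dots> = f"
    using plus_Diff h by metis
  finally show ?thesis
    using Diff_eqI[OF assms(3) plus_hom[OF h(4,5)]] by simp
qed

lemma Diff_plus_left:
  assumes "f \<in> Hom C X Y" "g \<in> Hom C X Y" "k \<in> Hom C X Y"
  shows "Diff C (k \<boxplus> f) (k \<boxplus> g) = Diff C f g"
proof -
  have "(k \<boxplus> g) \<boxplus> Diff C f g = k \<boxplus> f"
    using plus_assoc[OF assms(3,2) Diff_hom[OF assms(1,2)]] plus_Diff[OF assms(1,2)] by simp
  then show ?thesis
    using Diff_eqI[OF plus_hom[OF assms(3,2)] Diff_hom[OF assms(1,2)]] by simp
qed

lemma comp_Diff:
  assumes "f \<in> Hom C X Y" "g \<in> Hom C X Y" "h \<in> Hom C Y Z"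
  shows "h \<cdot> Diff C f g = Diff C (h \<cdot> f) (h \<cdot> g)"
  unfolding Diff_def using assms
  by (simp add: comp_plus[OF assms(1) scale_hom[OF assms(2)] assms(3)] comp_scale[OF assms(2,3)])

lemma Diff_comp:
  assumes "f \<in> Hom C Y Z" "g \<in> Hom C Y Z" "h \<in> Hom C X Y"
  shows "Diff C f g \<cdot> h = Diff C (f \<cdot> h) (g \<cdot> h)"
  unfolding Diff_def using assms
  by (simp add: plus_comp[OF assms(3,1) scale_hom[OF assms(2)]] scale_comp[OF assms(3,2)])

lemma scale_Diff:
  assumes "f \<in> Hom C X Y" "g \<in> Hom C X Y"
  shows "z \<bullet> Diff C f g = Diff C (z \<bullet> f) (z \<bullet> g)"
  unfolding Diff_def using assms
  by (simp add: scale_plus[OF assms(1) scale_hom[OF assms(2)]] scale_scale mult.commute)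

lemma adj_Diff:
  assumes "f \<in> Hom C X Y" "g \<in> Hom C X Y"
  shows "(Diff C f g)\<^sup>\<dagger> = Diff C (f\<^sup>\<dagger>) (g\<^sup>\<dagger>)"
  unfolding Diff_def using assms
  by (simp add: adj_plus[OF assms(1) scale_hom[OF assms(2)]] adj_scale)

lemma Diff_zero:
  assumes "f \<in> Hom C X Y"
  shows "Diff C f (Zero C X Y) = f"
proof -
  have "X \<in> Obj C" "Y \<in> Obj C"
    using Hom_Obj[OF assms] by auto
  then show ?thesis
    by (simp add: Diff_def scale_zero plus_zero[OF assms])
qed

end

section \<open>Norms of adjoints and isometries; contractivity of star functors\<close>

context cstar_category
begin

lemma Norm_zero: "\<lbrakk>X \<in> Obj C; Y \<in> Obj C\<rbrakk> \<Longrightarrow> Norm C (Zero C X Y) = 0"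
  using Norm_eq_0 zero_hom by blast

text \<open>The C*-identity and submultiplicativity give
  \<open>|f|^2 \<le> |f\<^sup>\<dagger>| |f|\<close>; divide by \<open>|f|\<close>.\<close>

lemma Norm_Adj_le: "f \<in> Hom C X Y \<Longrightarrow> Norm C f \<le> Norm C (f\<^sup>\<dagger>)"
proof -
  assume f: "f \<in> Hom C X Y"
  have "(Norm C f)\<^sup>2 \<le> Norm C (f\<^sup>\<dagger>) * Norm C f"
    using Norm_Adj_Comp[OF f] Norm_Comp[OF f adj_hom[OF f]] by simp
  then show ?thesis
    using Norm_nonneg[OF f] Norm_nonneg[OF adj_hom[OF f]]
    by (cases "Norm C f = 0") (auto simp: power2_eq_square)
qed

lemma Norm_Adj: "f \<in> Hom C X Y \<Longrightarrow> Norm C (f\<^sup>\<dagger>) = Norm C f"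
  using Norm_Adj_le[of f X Y] Norm_Adj_le[OF adj_hom, of f X Y] adj_adj[of f X Y] by force

lemma Norm_isometry_le:
  assumes "isometry C X Y v"
  shows "Norm C v \<le> 1"
proof -
  have v: "v \<in> Hom C X Y" "v\<^sup>\<dagger> \<cdot> v = Id C X"
    using assms by (auto simp: isometry_def)
  have i: "Id C X \<in> Hom C X X"
    using v Hom_Obj id_hom by blast
  \<comment> \<open>The norm of an identity is an idempotent real number, hence 0 or 1. The value 0
    occurs for zero objects, so only an inequality can be claimed.\<close>
  have "(Norm C (Id C X))\<^sup>2 = Norm C (Id C X)"
    using Norm_Adj_Comp[OF i] Hom_Obj[OF i] by simp
  then have "Norm C (Id C X) \<le> 1"
    by (metis mult_cancel_left1 power2_eq_square order_refl zero_le_one)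
  then have "(Norm C v)\<^sup>2 \<le> 1"
    using Norm_Adj_Comp[OF v(1)] v(2) by simp
  then show ?thesis
    using power2_le_imp_le[of "Norm C v" 1] by simp
qed

lemma Norm_Id_le: "X \<in> Obj C \<Longrightarrow> Norm C (Id C X) \<le> 1"
  by (rule Norm_isometry_le[of X X]) (simp add: isometry_def id_hom)

abbreviation cdist :: "'a \<Rightarrow> 'a \<Rightarrow> real" where
  "cdist f g \<equiv> Norm C (Diff C f g)"

lemma cdist_nonneg: "\<lbrakk>f \<in> Hom C X Y; g \<in> Hom C X Y\<rbrakk> \<Longrightarrow> 0 \<le> cdist f g"
  using Norm_nonneg Diff_hom by blast

lemma cdist_triangle:
  assumes "f \<in> Hom C X Y" "g \<in> Hom C X Y" "h \<in> Hom C X Y"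
  shows "cdist f h \<le> cdist f g + cdist g h"
  using Norm_Plus[OF Diff_hom[OF assms(1,2)] Diff_hom[OF assms(2,3)]] Diff_plus_Diff[OF assms]
  by simp

lemma cdist_self: "f \<in> Hom C X Y \<Longrightarrow> cdist f f = 0"
  using Diff_self Norm_zero Hom_Obj by metis

lemma cdist_commute:
  assumes "f \<in> Hom C X Y" "g \<in> Hom C X Y"
  shows "cdist f g = cdist g f"
proof -
  have "(- 1) \<bullet> Diff C g f = Diff C f g"
  proof -
    have "Diff C g f \<boxplus> Diff C f g = Zero C X Y"
      using Diff_plus_Diff[OF assms(2,1,2)] Diff_self[OF assms(2)] by simp
    then show ?thesis
      using plus_minus[OF Diff_hom[OF assms(2,1)]]
        plus_cancel[OF Diff_hom[OF assms(2,1)] scale_hom[OF Diff_hom[OF assms(2,1)]] Diff_hom[OF assms]]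
      by simp
  qed
  then show ?thesis
    using Norm_Scale[OF Diff_hom[OF assms(2,1)], of "- 1"] by simp
qed

lemma cdist_eq_0:
  assumes "f \<in> Hom C X Y" "g \<in> Hom C X Y" "cdist f g = 0"
  shows "f = g"
  using Norm_eq_0[OF Diff_hom[OF assms(1,2)]] assms plus_Diff[OF assms(1,2)] plus_zero[OF assms(2)]
  by simp

lemma cdist_comp_le:
  assumes "f \<in> Hom C X Y" "g \<in> Hom C X Y" "h \<in> Hom C Y Z"
  shows "cdist (h \<cdot> f) (h \<cdot> g) \<le> Norm C h * cdist f g"
  using Norm_Comp[OF Diff_hom[OF assms(1,2)] assms(3)] comp_Diff[OF assms] by simp

lemma comp_cdist_le:
  assumes "f \<in> Hom C Y Z" "g \<in> Hom C Y Z" "h \<in> Hom C X Y"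
  shows "cdist (f \<cdot> h) (g \<cdot> h) \<le> cdist f g * Norm C h"
  using Norm_Comp[OF assms(3) Diff_hom[OF assms(1,2)]] Diff_comp[OF assms] by simp

lemma limit_unique:
  assumes "\<And>m::nat. s m \<in> Hom C X Y" "l \<in> Hom C X Y" "l' \<in> Hom C X Y"
    and "(\<lambda>m. cdist (s m) l) \<longlonglongrightarrow> 0" "(\<lambda>m. cdist (s m) l') \<longlonglongrightarrow> 0"
  shows "l = l'"
proof -
  have "(\<lambda>m. cdist (s m) l + cdist (s m) l') \<longlonglongrightarrow> 0 + 0"
    by (intro tendsto_add assms)
  moreover have "cdist l l' \<le> cdist (s m) l + cdist (s m) l'" for m
    using cdist_triangle[OF assms(2) assms(1) assms(3), of m] cdist_commute[OF assms(2) assms(1), of m]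
    by simp
  ultimately have "cdist l l' \<le> 0"
    by (intro LIMSEQ_le_const[of _ 0]) auto
  then show ?thesis
    using cdist_eq_0[OF assms(2,3)] cdist_nonneg[OF assms(2,3)] by simp
qed

text \<open>The square root \<open>d = 1 - l\<close> of \<open>1 - h\<close> comes from the fixed point \<open>l = (h + l\<^sup>2) / 2\<close>, which
  the iteration from \<open>0\<close> reaches because it contracts by the factor \<open>\<parallel>h\<parallel> < 1\<close>.\<close>

lemma one_minus_positive:
  assumes h: "h \<in> Hom C X X" "h\<^sup>\<dagger> = h" and less: "Norm C h < 1"
  shows "\<exists>d\<in>Hom C X X. d\<^sup>\<dagger> \<cdot> d \<boxplus> h = Id C X"
proof -
  have X: "X \<in> Obj C"
    using h Hom_Obj by blast
  define a where "a = Norm C h"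
  have a: "0 \<le> a" "a < 1"
    using less Norm_nonneg[OF h(1)] by (auto simp: a_def)
  define step where "step y = (1/2) \<bullet> (h \<boxplus> y \<cdot> y)" for y
  have step_hom: "step y \<in> Hom C X X" if "y \<in> Hom C X X" for y
    unfolding step_def using that h by (intro scale_hom plus_hom comp_hom)
  \<comment> \<open>From \<open>y y - z z = y (y - z) + (y - z) z\<close>, halved.\<close>
  have step_dist: "cdist (step y) (step z) \<le> (Norm C y + Norm C z) / 2 * cdist y z"
    if y: "y \<in> Hom C X X" and z: "z \<in> Hom C X X" for y z
  proof -
    have hom: "y \<cdot> y \<in> Hom C X X" "z \<cdot> z \<in> Hom C X X" "y \<cdot> z \<in> Hom C X X"
      using y z comp_hom by auto
    have "cdist (step y) (step z) = cdist (y \<cdot> y) (z \<cdot> z) / 2"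
      unfolding step_def
      using scale_Diff[OF plus_hom[OF h(1) hom(1)] plus_hom[OF h(1) hom(2)], of "1/2"]
        Diff_plus_left[OF hom(1,2) h(1)] Norm_Scale[OF Diff_hom[OF hom(1,2)], of "1/2"] by simp
    also have "cdist (y \<cdot> y) (z \<cdot> z) \<le> cdist (y \<cdot> y) (y \<cdot> z) + cdist (y \<cdot> z) (z \<cdot> z)"
      by (rule cdist_triangle[OF hom(1,3,2)])
    also have "\<dots> \<le> Norm C y * cdist y z + cdist y z * Norm C z"
      by (intro add_mono cdist_comp_le comp_cdist_le) (use y z in auto)
    finally show ?thesis by (simp add: algebra_simps)
  qed
  define y where "y = (\<lambda>n. (step ^^ n) (Zero C X X))"
  have y0: "y 0 = Zero C X X" and yS: "y (Suc n) = step (y n)" for n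
    by (auto simp: y_def)
  have y_hom: "y n \<in> Hom C X X" for n
    by (induction n) (auto simp: y0 yS step_hom zero_hom X)
  have y_adj: "(y n)\<^sup>\<dagger> = y n" for n
  proof (induction n)
    case 0
    then show ?case using X by (simp add: y0 adj_zero)
  next
    case (Suc n)
    have "(step (y n))\<^sup>\<dagger> = (1/2) \<bullet> (h\<^sup>\<dagger> \<boxplus> (y n)\<^sup>\<dagger> \<cdot> (y n)\<^sup>\<dagger>)"
      unfolding step_def using y_hom[of n] h by (auto simp: Hom_iff)
    then show ?case using Suc h by (simp add: yS step_def)
  qed
  \<comment> \<open>The iterates stay in the ball of radius \<open>a\<close> because
    \<open>(a + a^2) / 2 \<le> a\<close>. On that ball the factor \<open>(|y| + |z|) / 2\<close> of
    \<open>step_dist\<close> is at most \<open>a\<close>, which makes \<open>step\<close> a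
    contraction there.\<close>
  have y_norm: "Norm C (y n) \<le> a" for n
  proof (induction n)
    case 0
    then show ?case using X a by (simp add: y0 Norm_zero)
  next
    case (Suc n)
    have "Norm C (y (Suc n)) \<le> (a + Norm C (y n \<cdot> y n)) / 2"
      unfolding yS step_def a_def
      using Norm_Scale[OF plus_hom[OF h(1) comp_hom[OF y_hom y_hom]], of "1/2" n n]
        Norm_Plus[OF h(1) comp_hom[OF y_hom y_hom], of n n] by simp
    also have "Norm C (y n \<cdot> y n) \<le> Norm C (y n) * Norm C (y n)"
      by (rule Norm_Comp[OF y_hom y_hom])
    also have "\<dots> \<le> a * 1"
      by (intro mult_mono) (use Suc a Norm_nonneg[OF y_hom] in auto)
    finally show ?case by simp
  qed
  have step_contract: "cdist (step (y m)) (step (y n)) \<le> a * cdist (y m) (y n)" for m n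
    using step_dist[OF y_hom y_hom, of m n] y_norm[of m] y_norm[of n]
      mult_right_mono[OF _ cdist_nonneg[OF y_hom y_hom], of "(Norm C (y m) + Norm C (y n)) / 2" a m n]
    by simp
  define c where "c = cdist (y 1) (y 0)"
  have c: "0 \<le> c"
    unfolding c_def by (rule cdist_nonneg[OF y_hom y_hom])
  have y_Suc: "cdist (y (Suc n)) (y n) \<le> a ^ n * c" for n
  proof (induction n)
    case (Suc n)
    have "cdist (y (Suc (Suc n))) (y (Suc n)) \<le> a * cdist (y (Suc n)) (y n)"
      using step_contract[of "Suc n" n] by (simp add: yS)
    also have "\<dots> \<le> a * (a ^ n * c)"
      using Suc a by (intro mult_left_mono)
    finally show ?case by simp
  qed (simp add: c_def)
  \<comment> \<open>The constant is the sum of a geometric series. The induction splits off the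
    first step, from \<open>n\<close> to \<open>n + 1\<close>, and so needs the claim for all
    starting points.\<close>
  have y_add: "cdist (y (n + k)) (y n) \<le> a ^ n * c / (1 - a)" for n k
  proof (induction k arbitrary: n)
    case 0
    then show ?case using a c by (simp add: cdist_self[OF y_hom])
  next
    case (Suc k)
    have "cdist (y (n + Suc k)) (y n) \<le> cdist (y (Suc n + k)) (y (Suc n)) + cdist (y (Suc n)) (y n)"
      using cdist_triangle[OF y_hom[of "Suc n + k"] y_hom[of "Suc n"] y_hom[of n]] by simp
    also have "\<dots> \<le> a ^ Suc n * c / (1 - a) + a ^ n * c"
      by (intro add_mono Suc.IH y_Suc)
    also have "\<dots> = a ^ n * c / (1 - a)"
      using a by (simp add: field_simps)
    finally show ?case .
  qed
  have "\<exists>N. \<forall>m\<ge>N. \<forall>m'\<ge>N. cdist (y m) (y m') < e" if e: "e > 0" for e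
  proof -
    have "(\<lambda>n. a ^ n * (c / (1 - a))) \<longlonglongrightarrow> 0 * (c / (1 - a))"
      using a by (intro tendsto_mult LIMSEQ_power_zero tendsto_const) auto
    then have "eventually (\<lambda>n. a ^ n * (c / (1 - a)) < e / 2) sequentially"
      using e by (intro order_tendstoD(2)) auto
    then obtain N where N: "a ^ N * (c / (1 - a)) < e / 2"
      by (auto simp: eventually_sequentially)
    have "cdist (y m) (y m') < e" if "m \<ge> N" "m' \<ge> N" for m m'
    proof -
      have "cdist (y m) (y N) < e / 2" "cdist (y m') (y N) < e / 2"
        using y_add[of N "m - N"] y_add[of N "m' - N"] that N
        by (simp_all only: le_add_diff_inverse times_divide_eq_right)
      then show ?thesis
        using cdist_triangle[OF y_hom[of m] y_hom[of N] y_hom[of m']] cdist_commute[OF y_hom[of N] y_hom[of m']]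
        by simp
    qed
    then show ?thesis by blast
  qed
  then obtain l where l: "l \<in> Hom C X X" and lim: "(\<lambda>m. cdist (y m) l) \<longlonglongrightarrow> 0"
    using complete[OF X X, of y] y_hom by blast
  have "l\<^sup>\<dagger> = l"
  proof (rule limit_unique[OF y_hom adj_hom[OF l] l _ lim])
    have "cdist (y m) (l\<^sup>\<dagger>) = cdist (y m) l" for m
      using adj_Diff[OF y_hom l, of m] Norm_Adj[OF Diff_hom[OF y_hom l], of m] y_adj by simp
    then show "(\<lambda>m. cdist (y m) (l\<^sup>\<dagger>)) \<longlonglongrightarrow> 0"
      using lim by simp
  qed
  \<comment> \<open>Both sides are limits of the shifted sequence, as \<open>step\<close> is
    Lipschitz between the iterates and \<open>l\<close>.\<close>
  have "l = step l"
  proof (rule limit_unique[OF y_hom l step_hom[OF l], of Suc])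
    show "(\<lambda>m. cdist (y (Suc m)) l) \<longlonglongrightarrow> 0"
      using lim by (rule LIMSEQ_Suc)
    have *: "cdist (y (Suc m)) (step l) \<le> (a + Norm C l) / 2 * cdist (y m) l" for m
      unfolding yS
      by (rule order_trans[OF step_dist[OF y_hom l]])
        (use y_norm cdist_nonneg[OF y_hom l] in \<open>auto intro!: mult_right_mono divide_right_mono\<close>)
    have lim0: "(\<lambda>m. (a + Norm C l) / 2 * cdist (y m) l) \<longlonglongrightarrow> 0"
      using tendsto_mult_right_zero[OF lim] by simp
    show "(\<lambda>m. cdist (y (Suc m)) (step l)) \<longlonglongrightarrow> 0"
      by (rule real_tendsto_sandwich[OF _ _ tendsto_const lim0])
        (use * cdist_nonneg[OF y_hom step_hom[OF l]] in auto)
  qed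
  then have "2 \<bullet> l = 2 \<bullet> (1/2) \<bullet> (h \<boxplus> l \<cdot> l)"
    by (simp add: step_def)
  then have two: "2 \<bullet> l = h \<boxplus> l \<cdot> l"
    using l h by (simp add: Hom_iff)
  define d where "d = Diff C (Id C X) l"
  have i: "Id C X \<in> Hom C X X"
    using X by (rule id_hom)
  have d: "d \<in> Hom C X X"
    unfolding d_def by (rule Diff_hom[OF i l])
  have d_adj: "d\<^sup>\<dagger> = d"
    unfolding d_def using adj_Diff[OF i l] \<open>l\<^sup>\<dagger> = l\<close> X by simp
  have ll: "l \<cdot> l \<in> Hom C X X"
    using l comp_hom by blast
  have dl: "d \<cdot> l = Diff C l (l \<cdot> l)"
    unfolding d_def using Diff_comp[OF i l l] id_comp[OF l] by simp
  have dld: "d \<cdot> l \<boxplus> d \<cdot> d = d"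
    using comp_plus[OF l d d] plus_Diff[OF i l] comp_id[OF d] by (simp add: d_def)
  have dd: "d \<cdot> d \<in> Hom C X X" and dl_hom: "d \<cdot> l \<in> Hom C X X"
    using d l comp_hom by auto
  have two': "2 \<bullet> l = l \<boxplus> l"
    using plus_scale[OF l, of 1 1] scale_one[OF l] by simp
  \<comment> \<open>The claim \<open>d d + h = 1\<close> is proved after adding \<open>l\<close> to
    both sides, so that only sums occur: \<open>l = l l + d l\<close>, \<open>d l + d d = d\<close>,
    \<open>h + l l = 2 l\<close> and finally \<open>l + d = 1\<close>.\<close>
  have "l \<boxplus> (d \<cdot> d \<boxplus> h) = (l \<cdot> l \<boxplus> d \<cdot> l) \<boxplus> (d \<cdot> d \<boxplus> h)"
    using plus_Diff[OF l ll] dl by simp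
  also have "\<dots> = (d \<cdot> l \<boxplus> d \<cdot> d) \<boxplus> (h \<boxplus> l \<cdot> l)"
    using ll dl_hom dd h(1)
    by (simp add: plus_hom plus_assoc[where X = X and Y = X] plus_comm[where X = X and Y = X]
        plus_left_comm[where X = X and Y = X])
  also have "\<dots> = d \<boxplus> (l \<boxplus> l)"
    using dld two two' by simp
  also have "\<dots> = l \<boxplus> Id C X"
    using d l plus_Diff[OF i l] plus_left_comm[OF d l l] plus_comm[OF d l] by (simp add: d_def)
  finally have "d \<cdot> d \<boxplus> h = Id C X"
    using plus_cancel[OF l plus_hom[OF dd h(1)] i] by simp
  then show ?thesis
    using d d_adj by metis
qed

text \<open>The column with entries \<open>A\<close> and \<open>B\<close> is an isometry into the direct sum of the targets.\<close>

lemma Norm_le_one_of_column: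
  assumes A: "A \<in> Hom C X Y" and B: "B \<in> Hom C X Y'" and eq: "A\<^sup>\<dagger> \<cdot> A \<boxplus> B\<^sup>\<dagger> \<cdot> B = Id C X"
  shows "Norm C A \<le> 1"
proof -
  obtain W v w where W: "W \<in> Obj C" "isometry C Y W v" "isometry C Y' W w"
    and vw: "v \<cdot> v\<^sup>\<dagger> \<boxplus> w \<cdot> w\<^sup>\<dagger> = Id C W"
    using direct_sum[of Y Y'] Hom_Obj A B by metis
  have v: "v \<in> Hom C Y W" "v\<^sup>\<dagger> \<cdot> v = Id C Y" and w: "w \<in> Hom C Y' W" "w\<^sup>\<dagger> \<cdot> w = Id C Y'"
    using W by (auto simp: isometry_def)
  have obj: "X \<in> Obj C" "Y \<in> Obj C" "Y' \<in> Obj C"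
    using Hom_Obj A B by auto
  \<comment> \<open>Orthogonality of the two ranges is hidden in
    \<open>v v\<^sup>\<dagger> + w w\<^sup>\<dagger> = 1\<close>: multiplying by
    \<open>v\<^sup>\<dagger>\<close> on the left and cancelling gives
    \<open>v\<^sup>\<dagger> w w\<^sup>\<dagger> = 0\<close>; then multiply by \<open>w\<close> on
    the right.\<close>
  have orth: "v\<^sup>\<dagger> \<cdot> w = Zero C Y' Y"
  proof -
    have "v\<^sup>\<dagger> \<boxplus> v\<^sup>\<dagger> \<cdot> (w \<cdot> w\<^sup>\<dagger>) = v\<^sup>\<dagger> \<cdot> (v \<cdot> v\<^sup>\<dagger>) \<boxplus> v\<^sup>\<dagger> \<cdot> (w \<cdot> w\<^sup>\<dagger>)"
      using isometry_cancel[OF W(2), of "v\<^sup>\<dagger>"] v(1) by (simp add: Hom_iff)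
    also have "\<dots> = v\<^sup>\<dagger> \<cdot> (v \<cdot> v\<^sup>\<dagger> \<boxplus> w \<cdot> w\<^sup>\<dagger>)"
      using v(1) w(1) by (subst comp_plus_arr) (auto simp: Hom_iff)
    also have "\<dots> = v\<^sup>\<dagger> \<boxplus> Zero C W Y"
      using v W obj plus_zero[OF adj_hom[OF v(1)]] by (simp add: vw Hom_iff)
    finally have "v\<^sup>\<dagger> \<cdot> (w \<cdot> w\<^sup>\<dagger>) = Zero C W Y"
      using plus_cancel[OF adj_hom[OF v(1)]] comp_hom[OF comp_hom[OF adj_hom[OF w(1)] w(1)] adj_hom[OF v(1)]]
        zero_hom W obj by metis
    then have "(v\<^sup>\<dagger> \<cdot> (w \<cdot> w\<^sup>\<dagger>)) \<cdot> w = Zero C Y' Y"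
      using zero_comp[OF w(1)] obj by simp
    moreover have "(v\<^sup>\<dagger> \<cdot> (w \<cdot> w\<^sup>\<dagger>)) \<cdot> w = v\<^sup>\<dagger> \<cdot> w"
      using v w obj by (simp add: Hom_iff)
    ultimately show ?thesis by simp
  qed
  have orth': "w\<^sup>\<dagger> \<cdot> v = Zero C Y Y'"
    using arg_cong[OF orth, of "Adj C"] v w obj by (simp add: Hom_iff adj_zero)
  define V where "V = v \<cdot> A \<boxplus> w \<cdot> B"
  have vA: "v \<cdot> A \<in> Hom C X W" and wB: "w \<cdot> B \<in> Hom C X W"
    using A B v w comp_hom by auto
  have V: "V \<in> Hom C X W"
    unfolding V_def using vA wB by (rule plus_hom)
  have vV: "v\<^sup>\<dagger> \<cdot> V = A"
  proof -
    have "v\<^sup>\<dagger> \<cdot> V = (v\<^sup>\<dagger> \<cdot> v) \<cdot> A \<boxplus> (v\<^sup>\<dagger> \<cdot> w) \<cdot> B"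
      unfolding V_def using A B v(1) w(1)
      by (simp add: comp_plus[OF vA wB adj_hom[OF v(1)]] Hom_iff)
    then show ?thesis
      using v orth zero_comp[OF B, of Y] plus_zero[OF A] id_comp[OF A] obj by simp
  qed
  have wV: "w\<^sup>\<dagger> \<cdot> V = B"
  proof -
    have "w\<^sup>\<dagger> \<cdot> V = (w\<^sup>\<dagger> \<cdot> v) \<cdot> A \<boxplus> (w\<^sup>\<dagger> \<cdot> w) \<cdot> B"
      unfolding V_def using A B v(1) w(1)
      by (simp add: comp_plus[OF vA wB adj_hom[OF w(1)]] Hom_iff)
    also have "\<dots> = Zero C X Y' \<boxplus> B"
      using w orth' zero_comp[OF A, of Y'] id_comp[OF B] obj by simp
    finally show ?thesis
      using plus_comm[OF zero_hom B] plus_zero[OF B] obj by simp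
  qed
  have "V\<^sup>\<dagger> \<cdot> V = A\<^sup>\<dagger> \<cdot> (v\<^sup>\<dagger> \<cdot> V) \<boxplus> B\<^sup>\<dagger> \<cdot> (w\<^sup>\<dagger> \<cdot> V)"
  proof -
    have "V\<^sup>\<dagger> = A\<^sup>\<dagger> \<cdot> v\<^sup>\<dagger> \<boxplus> B\<^sup>\<dagger> \<cdot> w\<^sup>\<dagger>"
      unfolding V_def using A B v(1) w(1) by (simp add: adj_plus[OF vA wB] Hom_iff)
    then show ?thesis
      using V A B v(1) w(1) by (simp add: plus_comp_arr Hom_iff)
  qed
  then have "isometry C X W V"
    using V vV wV eq by (simp add: isometry_def)
  then have "Norm C V \<le> 1"
    by (rule Norm_isometry_le)
  have "Norm C A \<le> Norm C (v\<^sup>\<dagger>) * Norm C V"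
    using Norm_Comp[OF V adj_hom[OF v(1)]] vV by simp
  also have "\<dots> \<le> 1 * 1"
    using \<open>Norm C V \<le> 1\<close> Norm_isometry_le[OF W(2)] Norm_Adj[OF v(1)] Norm_nonneg[OF V]
    by (intro mult_mono) auto
  finally show ?thesis by simp
qed

text \<open>If \<open>|g| < 1\<close>, then
  \<open>1 - g\<^sup>\<dagger> g = d\<^sup>\<dagger> d\<close> for some \<open>d\<close>. The
  functor preserves this equation, so \<open>F g\<close> and \<open>F d\<close> are the entries of
  an isometric column and \<open>|F g| \<le> 1\<close>. Scaling gives the general bound. The
  argument avoids spectra altogether; it is applied to tensoring with a fixed object.\<close>

lemma star_functor_contractive:
  assumes F: "star_functor C C Fo F"
    and f: "f \<in> Hom C X Y"
  shows "Norm C (F f) \<le> Norm C f"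
proof -
  have obj: "X \<in> Obj C" "Y \<in> Obj C"
    using f Hom_Obj by auto
  have Fh: "F g \<in> Hom C (Fo X) (Fo Y)" "F (g\<^sup>\<dagger>) = (F g)\<^sup>\<dagger>" "F (z \<bullet> g) = z \<bullet> F g"
    if "g \<in> Hom C X Y" "X \<in> Obj C" "Y \<in> Obj C" for g X Y z
    using F that unfolding star_functor_def by blast+
  have Fp: "F (g \<boxplus> h) = F g \<boxplus> F h" if "g \<in> Hom C X Y" "h \<in> Hom C X Y" "X \<in> Obj C" "Y \<in> Obj C" for g h X Y
    using F that unfolding star_functor_def by blast
  have Fc: "F (h \<cdot> g) = F h \<cdot> F g" if "g \<in> Hom C X Y" "h \<in> Hom C Y Z" "X \<in> Obj C" "Y \<in> Obj C" "Z \<in> Obj C"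
    for g h X Y Z
    using F that unfolding star_functor_def by blast
  have Fi: "F (Id C X) = Id C (Fo X)" "Fo X \<in> Obj C"
    using F obj unfolding star_functor_def by auto
  have unit_ball: "Norm C (F g) \<le> 1" if g: "g \<in> Hom C X Y" and less: "Norm C g < 1" for g
  proof -
    have gg: "g\<^sup>\<dagger> \<cdot> g \<in> Hom C X X"
      using g adj_hom comp_hom by blast
    have "Norm C (g\<^sup>\<dagger> \<cdot> g) < 1"
      using Norm_Adj_Comp[OF g] less Norm_nonneg[OF g] by (simp add: power_less_one_iff abs_square_less_1)
    moreover have "(g\<^sup>\<dagger> \<cdot> g)\<^sup>\<dagger> = g\<^sup>\<dagger> \<cdot> g"
      using g by (simp add: Hom_iff)
    ultimately obtain d where d: "d \<in> Hom C X X" "d\<^sup>\<dagger> \<cdot> d \<boxplus> g\<^sup>\<dagger> \<cdot> g = Id C X"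
      using one_minus_positive[OF gg] by blast
    have dd: "d\<^sup>\<dagger> \<cdot> d \<in> Hom C X X"
      using d adj_hom comp_hom by blast
    have "F (g\<^sup>\<dagger> \<cdot> g) = (F g)\<^sup>\<dagger> \<cdot> F g"
      using Fc[OF g adj_hom[OF g]] Fh(2)[OF g] obj by simp
    moreover have "F (d\<^sup>\<dagger> \<cdot> d) = (F d)\<^sup>\<dagger> \<cdot> F d"
      using Fc[OF d(1) adj_hom[OF d(1)]] Fh(2)[OF d(1)] obj by simp
    moreover have "F (g\<^sup>\<dagger> \<cdot> g) \<boxplus> F (d\<^sup>\<dagger> \<cdot> d) = Id C (Fo X)"
      using Fp[OF gg dd] plus_comm[OF gg dd] d(2) Fi obj by simp
    ultimately show ?thesis
      using Norm_le_one_of_column[OF Fh(1)[OF g] Fh(1)[OF d(1)]] obj by simp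
  qed
  show ?thesis
  \<comment> \<open>A number \<open>t\<close> strictly above the norm puts \<open>f / t\<close> into
    the open unit ball, where the square root exists; it is also positive, which covers
    \<open>f = 0\<close>.\<close>
  proof (rule dense_ge)
    fix t assume t: "Norm C f < t"
    have "0 < t"
      using t Norm_nonneg[OF f] by simp
    have "Norm C ((1 / of_real t) \<bullet> f) < 1"
      using Norm_Scale[OF f, of "1 / of_real t"] t \<open>0 < t\<close> by (simp add: norm_divide)
    then have "Norm C (F ((1 / of_real t) \<bullet> f)) \<le> 1"
      using unit_ball scale_hom[OF f] by blast
    then show "Norm C (F f) \<le> t"
      using Fh(3)[OF f obj] Norm_Scale[OF Fh(1)[OF f obj], of "1 / of_real t"] \<open>0 < t\<close>
      by (simp add: norm_divide field_simps)
  qed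
qed

end

section \<open>Norms of tensor products; the Hilbert spaces of morphisms out of the unit\<close>

context cstar_tensor_category
begin

text \<open>Tensoring with a fixed object is a star functor, so the algebraic axioms alone bound its
  effect on norms.\<close>

lemma Norm_tens_Id:
  assumes "f \<in> Hom C X Y" "Z \<in> Obj C"
  shows "Norm C (Z \<lhd> f) \<le> Norm C f" "Norm C (f \<rhd> Z) \<le> Norm C f"
proof -
  have "star_functor C C (\<lambda>X. Z \<otimes>\<^sub>o X) (\<lambda>f. Z \<lhd> f)"
    using assms(2) unfolding star_functor_def
    by (auto simp: Hom_iff tens_plus[OF id_hom] Hom_self)
  then show "Norm C (Z \<lhd> f) \<le> Norm C f"
    using star_functor_contractive assms(1) by blast
  have "star_functor C C (\<lambda>X. X \<otimes>\<^sub>o Z) (\<lambda>f. f \<rhd> Z)"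
    using assms(2) unfolding star_functor_def
    by (auto simp: Hom_iff plus_tens[OF _ _ id_hom])
  then show "Norm C (f \<rhd> Z) \<le> Norm C f"
    using star_functor_contractive assms(1) by blast
qed

text \<open>Factor \<open>f \<otimes> g\<close> as \<open>(f \<otimes> 1) (1 \<otimes> g)\<close>.
  This bound keeps tensor products of ind-morphisms uniformly bounded and makes the tensor product
  continuous along nets.\<close>

lemma Norm_tens_le:
  assumes "f \<in> Hom C X Y" "g \<in> Hom C X' Y'"
  shows "Norm C (f \<otimes>\<^sub>a g) \<le> Norm C f * Norm C g"
proof -
  have obj: "X \<in> Obj C" "Y \<in> Obj C" "X' \<in> Obj C" "Y' \<in> Obj C"
    using assms Hom_Obj by auto
  have h: "f \<rhd> Y' \<in> Hom C (X \<otimes>\<^sub>o Y') (Y \<otimes>\<^sub>o Y')" "X \<lhd> g \<in> Hom C (X \<otimes>\<^sub>o X') (X \<otimes>\<^sub>o Y')"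
    using assms obj by (auto intro!: tens_hom id_hom)
  have "Norm C (f \<otimes>\<^sub>a g) = Norm C ((f \<rhd> Y') \<cdot> (X \<lhd> g))"
    using assms obj by (simp add: Hom_iff)
  also have "\<dots> \<le> Norm C (f \<rhd> Y') * Norm C (X \<lhd> g)"
    by (rule Norm_Comp[OF h(2,1)])
  also have "\<dots> \<le> Norm C f * Norm C g"
    by (intro mult_mono Norm_tens_Id(2)[OF assms(1)] Norm_tens_Id(1)[OF assms(2)]
        Norm_nonneg[OF assms(1)] Norm_nonneg[OF h(2)] obj)
  finally show ?thesis .
qed

lemma Norm_Unit: "Norm C (Id C (Unit C)) = 1"
proof -
  have i: "Id C (Unit C) \<in> Hom C (Unit C) (Unit C)"
    by (simp add: id_hom)
  have "(Norm C (Id C (Unit C)))\<^sup>2 = Norm C (Id C (Unit C))"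
    using Norm_Adj_Comp[OF i] by simp
  moreover have "Norm C (Id C (Unit C)) \<noteq> 0"
    using Norm_eq_0[OF i] Unit_nonzero by simp
  ultimately show ?thesis
    by (simp add: power2_eq_square)
qed

text \<open>\<open>Hom (1, Z)\<close> is a Hilbert space with inner product \<open>f\<^sup>\<dagger> g\<close>, whose norm is that of the category.\<close>

lemma adj_comp_Unit:
  assumes "f \<in> Hom C (Unit C) Z"
  shows "f\<^sup>\<dagger> \<cdot> f = of_real ((Norm C f)\<^sup>2) \<bullet> Id C (Unit C)"
proof -
  have i: "Id C (Unit C) \<in> Hom C (Unit C) (Unit C)"
    by (simp add: id_hom)
  \<comment> \<open>Simplicity of the unit only says that \<open>f\<^sup>\<dagger> f\<close> is some
    complex multiple of the identity. Positivity turns the multiple into \<open>|w|^2\<close>, which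
    the norm then determines.\<close>
  obtain g where g: "g \<in> Hom C (Unit C) (Unit C)" "f\<^sup>\<dagger> \<cdot> f = g\<^sup>\<dagger> \<cdot> g"
    using positive assms by blast
  obtain w where "g = w \<bullet> Id C (Unit C)"
    using Unit_simple g by blast
  then have eq: "f\<^sup>\<dagger> \<cdot> f = of_real ((cmod w)\<^sup>2) \<bullet> Id C (Unit C)"
    using g by (simp add: complex_norm_square[symmetric] mult.commute del: of_real_power)
  have "(Norm C f)\<^sup>2 = Norm C (of_real ((cmod w)\<^sup>2) \<bullet> Id C (Unit C))"
    using Norm_Adj_Comp[OF assms] eq by simp
  also have "\<dots> = (cmod w)\<^sup>2"
    using Norm_Scale[OF i, of "of_real ((cmod w)\<^sup>2)"] Norm_Unit by (simp add: norm_power)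
  finally show ?thesis using eq by simp
qed

text \<open>Expand \<open>f\<^sup>\<dagger> f\<close> for \<open>f = g + u k\<close>: the cross
  terms vanish because \<open>g\<close> is orthogonal to the range of \<open>u\<close>, and
  \<open>u\<^sup>\<dagger> u = 1\<close> leaves \<open>k\<^sup>\<dagger> k\<close>.\<close>

lemma pythagoras_Unit:
  assumes g: "g \<in> Hom C (Unit C) Z" and k: "k \<in> Hom C (Unit C) Y" and u: "isometry C Y Z u"
    and orth: "u\<^sup>\<dagger> \<cdot> g = Zero C (Unit C) Y"
  shows "(Norm C (g \<boxplus> u \<cdot> k))\<^sup>2 = (Norm C g)\<^sup>2 + (Norm C k)\<^sup>2"
proof -
  have uh: "u \<in> Hom C Y Z" "u\<^sup>\<dagger> \<cdot> u = Id C Y"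
    using u by (auto simp: isometry_def)
  have obj: "Y \<in> Obj C" "Z \<in> Obj C"
    using uh Hom_Obj by auto
  define f where "f = g \<boxplus> u \<cdot> k"
  have uk: "u \<cdot> k \<in> Hom C (Unit C) Z"
    using k uh comp_hom by blast
  have f: "f \<in> Hom C (Unit C) Z"
    unfolding f_def by (rule plus_hom[OF g uk])
  have uf: "u\<^sup>\<dagger> \<cdot> f = k"
  proof -
    have "u\<^sup>\<dagger> \<cdot> f = u\<^sup>\<dagger> \<cdot> g \<boxplus> (u\<^sup>\<dagger> \<cdot> u) \<cdot> k"
      unfolding f_def using g k uh(1) by (simp add: comp_plus[OF g uk adj_hom[OF uh(1)]] Hom_iff)
    also have "\<dots> = Zero C (Unit C) Y \<boxplus> k"
      using orth uh id_comp[OF k] by simp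
    finally show ?thesis
      using plus_comm[OF zero_hom k] plus_zero[OF k] obj by simp
  qed
  have "g\<^sup>\<dagger> \<cdot> (u \<cdot> k) = Zero C (Unit C) (Unit C)"
  proof -
    have "g\<^sup>\<dagger> \<cdot> u = Zero C Y (Unit C)"
      using arg_cong[OF orth, of "Adj C"] g uh(1) obj by (simp add: adj_zero Hom_iff)
    then have "(g\<^sup>\<dagger> \<cdot> u) \<cdot> k = Zero C (Unit C) (Unit C)"
      using zero_comp[OF k, of "Unit C"] by simp
    then show ?thesis
      using g k uh(1) by (simp add: Hom_iff)
  qed
  then have gf: "g\<^sup>\<dagger> \<cdot> f = g\<^sup>\<dagger> \<cdot> g"
    unfolding f_def using comp_plus[OF g uk adj_hom[OF g]] plus_zero[OF comp_hom[OF g adj_hom[OF g]]]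
    by simp
  have "f\<^sup>\<dagger> = g\<^sup>\<dagger> \<boxplus> k\<^sup>\<dagger> \<cdot> u\<^sup>\<dagger>"
    unfolding f_def using adj_plus[OF g uk] k uh(1) by (simp add: Hom_iff)
  then have "f\<^sup>\<dagger> \<cdot> f = g\<^sup>\<dagger> \<cdot> f \<boxplus> k\<^sup>\<dagger> \<cdot> (u\<^sup>\<dagger> \<cdot> f)"
    using f g k uh(1) by (simp add: plus_comp_arr Hom_iff)
  then have "f\<^sup>\<dagger> \<cdot> f = g\<^sup>\<dagger> \<cdot> g \<boxplus> k\<^sup>\<dagger> \<cdot> k"
    using gf uf by simp
  then have eq: "of_real ((Norm C f)\<^sup>2) \<bullet> Id C (Unit C) =
      of_real ((Norm C g)\<^sup>2 + (Norm C k)\<^sup>2) \<bullet> Id C (Unit C)"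
    using adj_comp_Unit f g k plus_scale[OF id_hom[OF obj_unit]] by simp
  have "cmod (of_real ((Norm C f)\<^sup>2)) = cmod (of_real ((Norm C g)\<^sup>2 + (Norm C k)\<^sup>2))"
    using arg_cong[OF eq, of "Norm C"] Norm_Scale[OF id_hom[OF obj_unit]] Norm_Unit
    by (simp del: of_real_add of_real_power)
  then show ?thesis
    unfolding f_def by (simp del: of_real_add of_real_power)
qed

end

text \<open>By Frobenius reciprocity, \<open>T \<mapsto> (1 \<otimes> T) R\<close> embeds \<open>Hom (X, Y)\<close> into a Hilbert space, with bounds
  that do not depend on \<open>Y\<close>. This is what makes bounded nets of compressions converge in norm.\<close>

lemma (in rigid_cstar_tensor_category) hilbert_norm:
  assumes X: "X \<in> Obj C"
  obtains q and K :: real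
  where "\<And>Y T. T \<in> Hom C X Y \<Longrightarrow> 0 \<le> q T" "0 \<le> K"
    and "\<And>Y T. T \<in> Hom C X Y \<Longrightarrow> q T \<le> K * (Norm C T)\<^sup>2"
    and "\<And>Y T. T \<in> Hom C X Y \<Longrightarrow> (Norm C T)\<^sup>2 \<le> K * q T"
    and "\<And>Y Z T v. \<lbrakk>T \<in> Hom C X Z; isometry C Y Z v\<rbrakk> \<Longrightarrow>
      q T = q (Diff C T (v \<cdot> (v\<^sup>\<dagger> \<cdot> T))) + q (v\<^sup>\<dagger> \<cdot> T)"
proof -
  obtain X' R R' where X': "X' \<in> Obj C" and R: "R \<in> Hom C (Unit C) (X' \<otimes>\<^sub>o X)"
    and R': "R' \<in> Hom C (Unit C) (X \<otimes>\<^sub>o X')"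
    and conj: "(R'\<^sup>\<dagger> \<rhd> X) \<cdot> (Assoc C X X' X)\<^sup>\<dagger> \<cdot> (X \<lhd> R) = Id C X"
    using rigid[OF X] by blast
  define e where "e T = (X' \<lhd> T) \<cdot> R" for T
  have e: "e T \<in> Hom C (Unit C) (X' \<otimes>\<^sub>o Y)" if "T \<in> Hom C X Y" for T Y
    unfolding e_def using that X' R by (intro comp_hom[OF R] tens_hom id_hom)
  define q where "q T = (Norm C (e T))\<^sup>2" for T
  \<comment> \<open>One constant for both estimates: \<open>|R|^2\<close> bounds the embedding
    \<open>e\<close>, and \<open>|R'|^2\<close> bounds its inverse.\<close>
  define K where "K = (Norm C R)\<^sup>2 + (Norm C R')\<^sup>2"
  have upper: "q T \<le> K * (Norm C T)\<^sup>2" if T: "T \<in> Hom C X Y" for T Y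
  proof -
    have h: "X' \<lhd> T \<in> Hom C (X' \<otimes>\<^sub>o X) (X' \<otimes>\<^sub>o Y)"
      using T X' by (intro tens_hom id_hom)
    have "Norm C (e T) \<le> Norm C (X' \<lhd> T) * Norm C R"
      unfolding e_def by (rule Norm_Comp[OF R h])
    also have "\<dots> \<le> Norm C T * Norm C R"
      using Norm_tens_Id[OF T X'] Norm_nonneg[OF R] by (intro mult_right_mono)
    finally have "q T \<le> (Norm C T * Norm C R)\<^sup>2"
      unfolding q_def using Norm_nonneg[OF e[OF T]] by (rule power_mono)
    also have "\<dots> \<le> K * (Norm C T)\<^sup>2"
      by (simp add: K_def power_mult_distrib algebra_simps)
    finally show ?thesis .
  qed
  have lower: "(Norm C T)\<^sup>2 \<le> K * q T" if T: "T \<in> Hom C X Y" for T Y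
  proof -
    have Y: "Y \<in> Obj C"
      using T Hom_Obj by blast
    note s = T R R' X X' Y
    \<comment> \<open>The inverse of the embedding: capping off \<open>e T\<close> with the adjoint
      of \<open>R'\<close> produces a zigzag. Naturality moves \<open>T\<close> out of it and the
      conjugate equation straightens the rest, so that \<open>T\<close> is recovered from
      \<open>e T\<close>.\<close>
    have "(R'\<^sup>\<dagger> \<rhd> Y) \<cdot> ((Assoc C X X' Y)\<^sup>\<dagger> \<cdot> (X \<lhd> e T))
       = (R'\<^sup>\<dagger> \<rhd> Y) \<cdot> ((Assoc C X X' Y)\<^sup>\<dagger> \<cdot> (X \<lhd> (X' \<lhd> T))) \<cdot> (X \<lhd> R)"
      using s by (simp add: e_def Hom_iff)
    also have "(Assoc C X X' Y)\<^sup>\<dagger> \<cdot> (X \<lhd> (X' \<lhd> T)) =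
        ((X \<lhd> Id C X') \<otimes>\<^sub>a T) \<cdot> (Assoc C X X' X)\<^sup>\<dagger>"
      using assoc_adj_nat[of "Id C X" "Id C X'" T] s by (simp add: Hom_iff)
    also have "(R'\<^sup>\<dagger> \<rhd> Y) \<cdot> (((X \<lhd> Id C X') \<otimes>\<^sub>a T) \<cdot> (Assoc C X X' X)\<^sup>\<dagger>) \<cdot> (X \<lhd> R)
        = (R'\<^sup>\<dagger> \<otimes>\<^sub>a T) \<cdot> ((Assoc C X X' X)\<^sup>\<dagger> \<cdot> (X \<lhd> R))"
      using s by (simp add: Hom_iff)
    also have "R'\<^sup>\<dagger> \<otimes>\<^sub>a T = (Unit C \<lhd> T) \<cdot> (R'\<^sup>\<dagger> \<rhd> X)"
      using s by (subst interchange) (auto simp: Hom_iff)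
    also have "(Unit C \<lhd> T) \<cdot> (R'\<^sup>\<dagger> \<rhd> X) \<cdot> ((Assoc C X X' X)\<^sup>\<dagger> \<cdot> (X \<lhd> R))
        = T \<cdot> ((R'\<^sup>\<dagger> \<rhd> X) \<cdot> (Assoc C X X' X)\<^sup>\<dagger> \<cdot> (X \<lhd> R))"
    proof -
      have "Unit C \<lhd> T = T"
        using s by (simp add: Hom_iff)
      then show ?thesis using s by (simp add: Hom_iff)
    qed
    finally have eq: "T = (R'\<^sup>\<dagger> \<rhd> Y) \<cdot> ((Assoc C X X' Y)\<^sup>\<dagger> \<cdot> (X \<lhd> e T))"
      using conj comp_id[OF T] by simp
    have h1: "R'\<^sup>\<dagger> \<rhd> Y \<in> Hom C ((X \<otimes>\<^sub>o X') \<otimes>\<^sub>o Y) Y"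
      using tens_hom[OF adj_hom[OF R'] id_hom[OF Y]] Y by simp
    have h2: "(Assoc C X X' Y)\<^sup>\<dagger> \<in> Hom C (X \<otimes>\<^sub>o (X' \<otimes>\<^sub>o Y)) ((X \<otimes>\<^sub>o X') \<otimes>\<^sub>o Y)"
      using s by (simp add: Hom_iff)
    have h3: "X \<lhd> e T \<in> Hom C X (X \<otimes>\<^sub>o (X' \<otimes>\<^sub>o Y))"
      using tens_hom[OF id_hom[OF X] e[OF T]] X by simp
    have h2': "isometry C (X \<otimes>\<^sub>o (X' \<otimes>\<^sub>o Y)) ((X \<otimes>\<^sub>o X') \<otimes>\<^sub>o Y) ((Assoc C X X' Y)\<^sup>\<dagger>)"
      using h2 s by (simp add: isometry_def)
    have "Norm C T \<le> Norm C (R'\<^sup>\<dagger> \<rhd> Y) * Norm C ((Assoc C X X' Y)\<^sup>\<dagger> \<cdot> (X \<lhd> e T))"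
      by (subst eq) (rule Norm_Comp[OF comp_hom[OF h3 h2] h1])
    also have "\<dots> \<le> Norm C R' * (1 * Norm C (e T))"
    proof (rule mult_mono)
      show "Norm C (R'\<^sup>\<dagger> \<rhd> Y) \<le> Norm C R'"
        using Norm_tens_Id(2)[OF adj_hom[OF R'] Y] Norm_Adj[OF R'] by simp
      have "Norm C ((Assoc C X X' Y)\<^sup>\<dagger> \<cdot> (X \<lhd> e T)) \<le>
          Norm C ((Assoc C X X' Y)\<^sup>\<dagger>) * Norm C (X \<lhd> e T)"
        by (rule Norm_Comp[OF h3 h2])
      also have "\<dots> \<le> 1 * Norm C (e T)"
        using Norm_isometry_le[OF h2'] Norm_tens_Id(1)[OF e[OF T] X] Norm_nonneg[OF h3]
        by (intro mult_mono) auto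
      finally show "Norm C ((Assoc C X X' Y)\<^sup>\<dagger> \<cdot> (X \<lhd> e T)) \<le> 1 * Norm C (e T)" .
    qed (use Norm_nonneg[OF R'] Norm_nonneg[OF comp_hom[OF h3 h2]] in auto)
    finally have "(Norm C T)\<^sup>2 \<le> (Norm C R' * (1 * Norm C (e T)))\<^sup>2"
      using Norm_nonneg[OF T] by (rule power_mono)
    also have "\<dots> \<le> K * q T"
      by (simp add: K_def q_def power_mult_distrib algebra_simps)
    finally show ?thesis .
  qed
  \<comment> \<open>\<open>T\<close> is the sum of its part in the range of \<open>v\<close> and a
    part \<open>g\<close> killed by \<open>v\<^sup>\<dagger>\<close>. Whiskering with
    \<open>X'\<close> preserves this orthogonality, so Pythagoras applies to
    \<open>e T\<close>.\<close>
  have pyth: "q T = q (Diff C T (v \<cdot> (v\<^sup>\<dagger> \<cdot> T))) + q (v\<^sup>\<dagger> \<cdot> T)"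
    if T: "T \<in> Hom C X Z" and iso: "isometry C Y Z v" for T v Y Z
  proof -
    have v: "v \<in> Hom C Y Z" "v\<^sup>\<dagger> \<cdot> v = Id C Y"
      using iso by (auto simp: isometry_def)
    have obj: "Y \<in> Obj C" "Z \<in> Obj C"
      using v Hom_Obj by auto
    define k where "k = v\<^sup>\<dagger> \<cdot> T"
    define g where "g = Diff C T (v \<cdot> k)"
    have k: "k \<in> Hom C X Y" and vk: "v \<cdot> k \<in> Hom C X Z"
      unfolding k_def using T v comp_hom adj_hom by meson+
    have g: "g \<in> Hom C X Z"
      unfolding g_def by (rule Diff_hom[OF T vk])
    have vg: "v\<^sup>\<dagger> \<cdot> g = Zero C X Y"
    proof -
      have "v\<^sup>\<dagger> \<cdot> g = Diff C (v\<^sup>\<dagger> \<cdot> T) ((v\<^sup>\<dagger> \<cdot> v) \<cdot> k)"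
        unfolding g_def using comp_Diff[OF T vk adj_hom[OF v(1)]] k v(1) by (simp add: Hom_iff)
      also have "\<dots> = Zero C X Y"
        using v(2) id_comp[OF k] Diff_self[OF k] by (simp add: k_def)
      finally show ?thesis .
    qed
    have T_eq: "T = g \<boxplus> v \<cdot> k"
      using plus_Diff[OF T vk] plus_comm[OF vk g] by (simp add: g_def)
    have u: "isometry C (X' \<otimes>\<^sub>o Y) (X' \<otimes>\<^sub>o Z) (X' \<lhd> v)"
      unfolding isometry_def
      using tens_hom[OF id_hom[OF X'] v(1)] v X' obj by (simp add: Hom_iff)
    have eT: "e T = e g \<boxplus> (X' \<lhd> v) \<cdot> e k"
    proof -
      have "e T = (X' \<lhd> g \<boxplus> X' \<lhd> (v \<cdot> k)) \<cdot> R"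
        unfolding e_def by (subst T_eq) (simp add: tens_plus[OF id_hom[OF X'] g vk])
      also have "\<dots> = e g \<boxplus> (X' \<lhd> (v \<cdot> k)) \<cdot> R"
        unfolding e_def
        by (rule plus_comp[OF R]) (use X' g vk in \<open>auto intro!: tens_hom id_hom\<close>)
      also have "(X' \<lhd> (v \<cdot> k)) \<cdot> R = (X' \<lhd> v) \<cdot> e k"
        unfolding e_def using R X' v(1) k by (simp add: Hom_iff)
      finally show ?thesis .
    qed
    have "(X' \<lhd> v)\<^sup>\<dagger> \<cdot> e g = (X' \<lhd> (v\<^sup>\<dagger> \<cdot> g)) \<cdot> R"
      unfolding e_def using R X' v(1) g by (simp add: Hom_iff)
    also have "\<dots> = Zero C (Unit C) (X' \<otimes>\<^sub>o Y)"
      using tens_zero(1)[OF id_hom[OF X'] X obj(1)] zero_comp[OF R] X' obj vg by simp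
    finally show ?thesis
      unfolding q_def using eT pythagoras_Unit[OF e[OF g] e[OF k] u]
      by (simp add: g_def k_def)
  qed
  show thesis
    by (rule that[of q K]) (use upper lower pyth in \<open>auto simp: q_def K_def\<close>)
qed

section \<open>Gradings and twists\<close>

text \<open>A morphism defined by linear extension, with weight \<open>z i\<close> on the
  \<open>i\<close>-th component, acts as multiplication by a single weight on anything concentrated
  in one component. Twisted associators, twisted half-braidings and the weighted product are all
  evaluated in this way.\<close>

lemma (in star_category) weighted_Sum_comp:
  assumes "finite I" "T \<in> Hom C W V" "\<And>i. i \<in> I \<Longrightarrow> e i \<in> Hom C W W" "x \<in> Hom C U W" "i\<^sub>0 \<in> I"
    and e: "\<And>i. i \<in> I \<Longrightarrow> e i \<cdot> x = (if i = i\<^sub>0 then x else Zero C U W)"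
  shows "Sum C W V (\<lambda>i. z i \<bullet> (T \<cdot> e i)) I \<cdot> x = z i\<^sub>0 \<bullet> (T \<cdot> x)"
proof -
  have obj: "W \<in> Obj C" "V \<in> Obj C" "U \<in> Obj C"
    using assms Hom_Obj by metis+
  have "(z i \<bullet> (T \<cdot> e i)) \<cdot> x = z i \<bullet> (T \<cdot> (e i \<cdot> x))" if "i \<in> I" for i
    using that assms(2,4) assms(3)[OF that] by (simp add: Hom_iff)
  then have val: "(z i \<bullet> (T \<cdot> e i)) \<cdot> x = (if i = i\<^sub>0 then z i \<bullet> (T \<cdot> x) else Zero C U V)" if "i \<in> I" for i
    using that e comp_zero[OF assms(2), of U] scale_zero obj by simp
  have "Sum C W V (\<lambda>i. z i \<bullet> (T \<cdot> e i)) I \<cdot> x = Sum C U V (\<lambda>i. (z i \<bullet> (T \<cdot> e i)) \<cdot> x) I"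
    by (rule Sum_comp) (use assms obj in \<open>auto intro!: scale_hom comp_hom\<close>)
  also have "\<dots> = (z i\<^sub>0 \<bullet> (T \<cdot> e i\<^sub>0)) \<cdot> x"
    by (rule Sum_single) (use assms obj val in \<open>auto intro!: scale_hom comp_hom\<close>)
  finally show ?thesis
    using val assms(5) by simp
qed

text \<open>The part of a grading that does not mention tensor products. It is used for
  \<open>C\<close>, for its ind-category, and for the center with the weighted product, where no
  monoidal axioms have been established.\<close>

locale graded_star_category = star_category C
  for C :: "('o, 'a, 'z) star_cat_scheme" (structure) +
  fixes \<Gamma> :: "'g monoid" and G :: "'g \<Rightarrow> 'o set"
  assumes grading_group: "group \<Gamma>"
    and finite_grading [simp]: "finite (carrier \<Gamma>)"
    and homogeneous_orthogonal: "\<lbrakk>\<gamma> \<in> carrier \<Gamma>; \<eta> \<in> carrier \<Gamma>; \<gamma> \<noteq> \<eta>; X \<in> G \<gamma>; Y \<in> G \<eta>\<rbrakk> \<Longrightarrow>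
      Hom C X Y \<subseteq> {Zero C X Y}"
    and ex_decomposition: "X \<in> Obj C \<Longrightarrow> \<exists>Y v. homogeneous_decomposition C \<Gamma> G X Y v"
begin

abbreviation proj :: "'g \<Rightarrow> 'o \<Rightarrow> 'a" where
  "proj \<equiv> grade_proj C \<Gamma> G"

lemma decompositionD:
  assumes "homogeneous_decomposition C \<Gamma> G X Y v" "\<gamma> \<in> carrier \<Gamma>"
  shows "Y \<gamma> \<in> G \<gamma>" "isometry C (Y \<gamma>) X (v \<gamma>)" "v \<gamma> \<in> Hom C (Y \<gamma>) X" "(v \<gamma>)\<^sup>\<dagger> \<cdot> v \<gamma> = Id C (Y \<gamma>)"
  using assms by (auto simp: homogeneous_decomposition_def isometry_def)

lemma decomposition_resolution:
  assumes "homogeneous_decomposition C \<Gamma> G X Y v" "X \<in> Obj C"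
  shows "id_resolution X (carrier \<Gamma>) (\<lambda>\<gamma>. v \<gamma> \<cdot> (v \<gamma>)\<^sup>\<dagger>)"
  using assms decompositionD[OF assms(1)]
  by (auto simp: id_resolution_def homogeneous_decomposition_def intro!: comp_hom[OF adj_hom])

text \<open>The off-diagonal blocks of \<open>f\<close> are morphisms between different degrees and
  vanish. Inserting a resolution of the identity on either side of \<open>f\<close> therefore leaves
  the same diagonal block. For \<open>f = 1\<close> this shows that projections do not depend on the
  decomposition; in general it is their naturality.\<close>

lemma decomposition_natural:
  assumes d: "homogeneous_decomposition C \<Gamma> G X Y v" and d': "homogeneous_decomposition C \<Gamma> G X' Y' v'"
    and f: "f \<in> Hom C X X'" and \<gamma>: "\<gamma> \<in> carrier \<Gamma>"
  shows "(v' \<gamma> \<cdot> (v' \<gamma>)\<^sup>\<dagger>) \<cdot> f = f \<cdot> (v \<gamma> \<cdot> (v \<gamma>)\<^sup>\<dagger>)"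
proof -
  have X: "X \<in> Obj C" "X' \<in> Obj C"
    using f Hom_Obj by auto
  define e where "e \<gamma> = v \<gamma> \<cdot> (v \<gamma>)\<^sup>\<dagger>" for \<gamma>
  define e' where "e' \<gamma> = v' \<gamma> \<cdot> (v' \<gamma>)\<^sup>\<dagger>" for \<gamma>
  have e: "e \<eta> \<in> Hom C X X" and e': "e' \<eta> \<in> Hom C X' X'" if "\<eta> \<in> carrier \<Gamma>" for \<eta>
    unfolding e_def e'_def using decompositionD[OF d that] decompositionD[OF d' that]
    by (auto intro!: comp_hom[OF adj_hom])
  have sum: "Sum C X X e (carrier \<Gamma>) = Id C X" "Sum C X' X' e' (carrier \<Gamma>) = Id C X'"
    using d d' unfolding homogeneous_decomposition_def e_def[abs_def] e'_def[abs_def] by auto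
  have zero: "e' \<eta> \<cdot> (f \<cdot> e \<xi>) = Zero C X X'"
    if "\<eta> \<in> carrier \<Gamma>" "\<xi> \<in> carrier \<Gamma>" "\<eta> \<noteq> \<xi>" for \<eta> \<xi>
  proof -
    note v = decompositionD[OF d that(2)] and v' = decompositionD[OF d' that(1)]
    have "(v' \<eta>)\<^sup>\<dagger> \<cdot> (f \<cdot> v \<xi>) \<in> Hom C (Y \<xi>) (Y' \<eta>)"
      using v v' f adj_hom comp_hom by meson
    then have z: "(v' \<eta>)\<^sup>\<dagger> \<cdot> (f \<cdot> v \<xi>) = Zero C (Y \<xi>) (Y' \<eta>)"
      using homogeneous_orthogonal[of \<xi> \<eta> "Y \<xi>" "Y' \<eta>"] that v(1) v'(1) by auto
    have "e' \<eta> \<cdot> (f \<cdot> e \<xi>) = v' \<eta> \<cdot> (((v' \<eta>)\<^sup>\<dagger> \<cdot> (f \<cdot> v \<xi>)) \<cdot> (v \<xi>)\<^sup>\<dagger>)"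
      unfolding e_def e'_def using f v(3) v'(3) by (simp add: Hom_iff)
    also have "\<dots> = v' \<eta> \<cdot> Zero C X (Y' \<eta>)"
      using z zero_comp[OF adj_hom[OF v(3)], of "Y' \<eta>"] Hom_Obj[OF v'(3)] by simp
    also have "\<dots> = Zero C X X'"
      by (rule comp_zero[OF v'(3) X(1)])
    finally show ?thesis .
  qed
  have fe: "f \<cdot> e \<eta> \<in> Hom C X X'" if "\<eta> \<in> carrier \<Gamma>" for \<eta>
    using e[OF that] f comp_hom by blast
  have "e' \<gamma> \<cdot> f = (e' \<gamma> \<cdot> f) \<cdot> Sum C X X e (carrier \<Gamma>)"
    unfolding sum using f e'[OF \<gamma>] by (simp add: Hom_iff)
  also have "\<dots> = Sum C X X' (\<lambda>\<eta>. (e' \<gamma> \<cdot> f) \<cdot> e \<eta>) (carrier \<Gamma>)"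
    by (rule comp_Sum) (use X e e' f \<gamma> comp_hom in auto)
  also have "\<dots> = Sum C X X' (\<lambda>\<eta>. e' \<gamma> \<cdot> (f \<cdot> e \<eta>)) (carrier \<Gamma>)"
    by (rule Sum_cong) (use X e e' f fe \<gamma> in \<open>auto intro: comp_hom comp_assoc\<close>)
  also have "\<dots> = e' \<gamma> \<cdot> (f \<cdot> e \<gamma>)"
    by (rule Sum_single) (use X \<gamma> zero comp_hom[OF fe[OF \<gamma>] e'[OF \<gamma>]] in auto)
  also have "\<dots> = Sum C X X' (\<lambda>\<eta>. e' \<eta> \<cdot> (f \<cdot> e \<gamma>)) (carrier \<Gamma>)"
    by (rule Sum_single[symmetric]) (use X \<gamma> zero comp_hom[OF fe[OF \<gamma>] e'[OF \<gamma>]] in auto)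
  also have "\<dots> = Sum C X' X' e' (carrier \<Gamma>) \<cdot> (f \<cdot> e \<gamma>)"
    by (rule Sum_comp[symmetric]) (use X e' fe \<gamma> in auto)
  also have "\<dots> = f \<cdot> e \<gamma>"
    unfolding sum by (rule id_comp[OF fe[OF \<gamma>]])
  finally show ?thesis
    unfolding e_def e'_def .
qed

lemma proj_eq:
  assumes "homogeneous_decomposition C \<Gamma> G X Y v" "X \<in> Obj C" "\<gamma> \<in> carrier \<Gamma>"
  shows "proj \<gamma> X = v \<gamma> \<cdot> (v \<gamma>)\<^sup>\<dagger>"
  unfolding grade_proj_def
proof (rule the_equality)
  show "\<exists>Y v'. homogeneous_decomposition C \<Gamma> G X Y v' \<and> v \<gamma> \<cdot> (v \<gamma>)\<^sup>\<dagger> = v' \<gamma> \<cdot> (v' \<gamma>)\<^sup>\<dagger>"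
    using assms by blast
next
  fix p assume "\<exists>Y v. homogeneous_decomposition C \<Gamma> G X Y v \<and> p = v \<gamma> \<cdot> (v \<gamma>)\<^sup>\<dagger>"
  then obtain Y' v' where d': "homogeneous_decomposition C \<Gamma> G X Y' v'" "p = v' \<gamma> \<cdot> (v' \<gamma>)\<^sup>\<dagger>"
    by blast
  show "p = v \<gamma> \<cdot> (v \<gamma>)\<^sup>\<dagger>"
    using decomposition_natural[OF assms(1) d'(1) id_hom[OF assms(2)] assms(3)] d'(2)
      decompositionD[OF assms(1,3)] decompositionD[OF d'(1) assms(3)]
    by (simp add: Hom_iff)
qed

lemma proj_hom:
  assumes "X \<in> Obj C" "\<gamma> \<in> carrier \<Gamma>"
  shows "proj \<gamma> X \<in> Hom C X X"
proof -
  obtain Y v where d: "homogeneous_decomposition C \<Gamma> G X Y v"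
    using ex_decomposition assms by blast
  show ?thesis
    unfolding proj_eq[OF d assms] using decompositionD[OF d assms(2)]
    by (auto intro: comp_hom[OF adj_hom])
qed

lemma arr_proj [simp]:
  assumes "X \<in> Obj C" "\<gamma> \<in> carrier \<Gamma>"
  shows "proj \<gamma> X \<in> Arr C" "Dom C (proj \<gamma> X) = X" "Cod C (proj \<gamma> X) = X"
  using proj_hom[OF assms] by (auto simp: Hom_iff)

lemma proj_natural:
  assumes "f \<in> Hom C X Y" "\<gamma> \<in> carrier \<Gamma>"
  shows "proj \<gamma> Y \<cdot> f = f \<cdot> proj \<gamma> X"
proof -
  have obj: "X \<in> Obj C" "Y \<in> Obj C"
    using assms Hom_Obj by auto
  obtain V v where d: "homogeneous_decomposition C \<Gamma> G X V v"
    using ex_decomposition obj by blast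
  obtain W w where e: "homogeneous_decomposition C \<Gamma> G Y W w"
    using ex_decomposition obj by blast
  show ?thesis
    using decomposition_natural[OF d e assms] proj_eq[OF d _ assms(2)] proj_eq[OF e _ assms(2)] obj
    by simp
qed

lemma proj_adj [simp]:
  assumes "X \<in> Obj C" "\<gamma> \<in> carrier \<Gamma>"
  shows "(proj \<gamma> X)\<^sup>\<dagger> = proj \<gamma> X"
proof -
  obtain Y v where d: "homogeneous_decomposition C \<Gamma> G X Y v"
    using ex_decomposition assms by blast
  show ?thesis
    unfolding proj_eq[OF d assms] using decompositionD(3)[OF d assms(2)] by (simp add: Hom_iff)
qed

lemma proj_resolution: "X \<in> Obj C \<Longrightarrow> id_resolution X (carrier \<Gamma>) (\<lambda>\<gamma>. proj \<gamma> X)"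
proof -
  assume X: "X \<in> Obj C"
  then obtain Y v where d: "homogeneous_decomposition C \<Gamma> G X Y v"
    using ex_decomposition by blast
  have "Sum C X X (\<lambda>\<gamma>. proj \<gamma> X) (carrier \<Gamma>) = Sum C X X (\<lambda>\<gamma>. v \<gamma> \<cdot> (v \<gamma>)\<^sup>\<dagger>) (carrier \<Gamma>)"
    by (rule Sum_cong) (use X proj_eq[OF d X] proj_hom[OF X] in auto)
  then show ?thesis
    using decomposition_resolution[OF d X] X by (auto simp: id_resolution_def proj_hom)
qed

text \<open>In a decomposition of \<open>X\<close> the isometry of any degree other than
  \<open>\<gamma>\<close> is a morphism between orthogonal subcategories, hence zero; the component
  of degree \<open>\<gamma>\<close> must then be everything.\<close>

lemma proj_homogeneous:
  assumes X: "X \<in> Obj C" "X \<in> G \<gamma>" and \<gamma>: "\<gamma> \<in> carrier \<Gamma>" "\<eta> \<in> carrier \<Gamma>"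
  shows "proj \<eta> X = (if \<eta> = \<gamma> then Id C X else Zero C X X)"
proof -
  obtain Y v where d: "homogeneous_decomposition C \<Gamma> G X Y v"
    using ex_decomposition X by blast
  have zero: "proj \<xi> X = Zero C X X" if "\<xi> \<in> carrier \<Gamma>" "\<xi> \<noteq> \<gamma>" for \<xi>
  proof -
    note v = decompositionD[OF d that(1)]
    have "v \<xi> = Zero C (Y \<xi>) X"
      using homogeneous_orthogonal[of \<xi> \<gamma> "Y \<xi>" X] that X \<gamma> v by blast
    then show ?thesis
      unfolding proj_eq[OF d X(1) that(1)] using zero_comp[OF adj_hom[OF v(3)], of X] X by simp
  qed
  have "Id C X = Sum C X X (\<lambda>\<eta>. proj \<eta> X) (carrier \<Gamma>)"
    using proj_resolution[OF X(1)] by (simp add: id_resolution_def)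
  also have "\<dots> = proj \<gamma> X"
    by (rule Sum_single) (use X \<gamma> zero proj_hom in auto)
  finally show ?thesis
    using zero \<gamma> by auto
qed

lemma proj_proj:
  assumes X: "X \<in> Obj C" and \<gamma>: "\<gamma> \<in> carrier \<Gamma>" "\<eta> \<in> carrier \<Gamma>"
  shows "proj \<gamma> X \<cdot> proj \<eta> X = (if \<gamma> = \<eta> then proj \<eta> X else Zero C X X)"
proof -
  obtain Y v where d: "homogeneous_decomposition C \<Gamma> G X Y v"
    using ex_decomposition X by blast
  note v = decompositionD[OF d \<gamma>(2)]
  have Y: "Y \<eta> \<in> Obj C"
    using v Hom_Obj by blast
  have "proj \<gamma> X \<cdot> proj \<eta> X = (proj \<gamma> X \<cdot> v \<eta>) \<cdot> (v \<eta>)\<^sup>\<dagger>"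
    unfolding proj_eq[OF d X \<gamma>(2)] using v(3) X \<gamma> by (simp add: Hom_iff)
  also have "proj \<gamma> X \<cdot> v \<eta> = v \<eta> \<cdot> proj \<gamma> (Y \<eta>)"
    by (rule proj_natural[OF v(3) \<gamma>(1)])
  also have "\<dots> = (if \<gamma> = \<eta> then v \<eta> else Zero C (Y \<eta>) X)"
    using proj_homogeneous[OF Y v(1) \<gamma>(2,1)] comp_zero[OF v(3) Y] comp_id[OF v(3)] by simp
  finally show ?thesis
    using proj_eq[OF d X \<gamma>(2)] zero_comp[OF adj_hom[OF v(3)] X] by simp
qed

text \<open>A self-adjoint test morphism supported in one degree. The notion is wider than that of a
  degree projection because a tensor product of projections has a definite degree but is in general
  smaller than the projection of that degree on the tensor product.\<close>

definition homogeneous :: "'g \<Rightarrow> 'o \<Rightarrow> 'a \<Rightarrow> bool" where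
  "homogeneous \<gamma> X e \<longleftrightarrow> \<gamma> \<in> carrier \<Gamma> \<and> e \<in> Hom C X X \<and> e\<^sup>\<dagger> = e \<and> proj \<gamma> X \<cdot> e = e"

lemma homogeneous_proj: "\<lbrakk>X \<in> Obj C; \<gamma> \<in> carrier \<Gamma>\<rbrakk> \<Longrightarrow> homogeneous \<gamma> X (proj \<gamma> X)"
  by (simp add: homogeneous_def proj_proj proj_hom)

lemma homogeneousD:
  assumes "homogeneous \<gamma> X e"
  shows "\<gamma> \<in> carrier \<Gamma>" "e \<in> Hom C X X" "e\<^sup>\<dagger> = e" "X \<in> Obj C"
  using assms Hom_Obj by (auto simp: homogeneous_def)

lemma proj_comp_homogeneous:
  assumes "homogeneous \<gamma> X e" "\<eta> \<in> carrier \<Gamma>"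
  shows "proj \<eta> X \<cdot> e = (if \<eta> = \<gamma> then e else Zero C X X)"
proof -
  note e = homogeneousD[OF assms(1)]
  have pe: "proj \<gamma> X \<cdot> e = e"
    using assms by (simp add: homogeneous_def)
  have "proj \<eta> X \<cdot> e = (proj \<eta> X \<cdot> proj \<gamma> X) \<cdot> e"
    using pe e assms by (simp add: Hom_iff)
  then show ?thesis
    using proj_proj[OF e(4) assms(2) e(1)] zero_comp[OF e(2,4)] pe by simp
qed

end

text \<open>Multiplicativity of the grading is phrased through projections rather than objects: a
  product of homogeneous objects is homogeneous only up to isomorphism, whereas identities between
  projections pass termwise to inductive systems.\<close>

locale graded_star_tensor_category = star_tensor_category C + graded_star_category C \<Gamma> G
  for C :: "('o, 'a, 'z) tensor_cat_scheme" (structure) and \<Gamma> :: "'g monoid" and G :: "'g \<Rightarrow> 'o set" +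
  assumes proj_tens: "\<lbrakk>X \<in> Obj C; Y \<in> Obj C; \<gamma> \<in> carrier \<Gamma>; \<eta> \<in> carrier \<Gamma>\<rbrakk> \<Longrightarrow>
      grade_proj C \<Gamma> G (\<gamma> \<otimes>\<^bsub>\<Gamma>\<^esub> \<eta>) (X \<otimes>\<^sub>o Y) \<cdot> (grade_proj C \<Gamma> G \<gamma> X \<otimes>\<^sub>a grade_proj C \<Gamma> G \<eta> Y) =
      grade_proj C \<Gamma> G \<gamma> X \<otimes>\<^sub>a grade_proj C \<Gamma> G \<eta> Y"
    and proj_Unit: "grade_proj C \<Gamma> G \<one>\<^bsub>\<Gamma>\<^esub> (Unit C) = Id C (Unit C)"
begin

sublocale \<Gamma>: group \<Gamma>
  by (rule grading_group)

lemma homogeneous_tens: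
  assumes "homogeneous \<gamma> X e" "homogeneous \<eta> Y f"
  shows "homogeneous (\<gamma> \<otimes>\<^bsub>\<Gamma>\<^esub> \<eta>) (X \<otimes>\<^sub>o Y) (e \<otimes>\<^sub>a f)"
proof -
  note e = homogeneousD[OF assms(1)] and f = homogeneousD[OF assms(2)]
  have pe: "proj \<gamma> X \<cdot> e = e" "proj \<eta> Y \<cdot> f = f"
    using assms by (auto simp: homogeneous_def)
  have "proj (\<gamma> \<otimes>\<^bsub>\<Gamma>\<^esub> \<eta>) (X \<otimes>\<^sub>o Y) \<cdot> (e \<otimes>\<^sub>a f) =
      (proj (\<gamma> \<otimes>\<^bsub>\<Gamma>\<^esub> \<eta>) (X \<otimes>\<^sub>o Y) \<cdot> (proj \<gamma> X \<otimes>\<^sub>a proj \<eta> Y)) \<cdot> (e \<otimes>\<^sub>a f)"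
    using e f pe by (simp add: Hom_iff)
  also have "\<dots> = e \<otimes>\<^sub>a f"
    unfolding proj_tens[OF e(4) f(4) e(1) f(1)] using e f pe by (simp add: Hom_iff)
  finally show ?thesis
    using e f by (simp add: homogeneous_def Hom_iff)
qed

lemma homogeneous_Unit: "homogeneous \<one>\<^bsub>\<Gamma>\<^esub> (Unit C) (Id C (Unit C))"
  by (simp add: homogeneous_def proj_Unit id_hom)

lemma resolution2:
  assumes "X \<in> Obj C" "Y \<in> Obj C"
  shows "id_resolution (X \<otimes>\<^sub>o Y) (carrier \<Gamma> \<times> carrier \<Gamma>) (\<lambda>(a, b). proj a X \<otimes>\<^sub>a proj b Y)"
  using id_resolution_tens[OF proj_resolution proj_resolution, OF assms] .

lemma resolution3:
  assumes "X \<in> Obj C" "Y \<in> Obj C" "Z \<in> Obj C"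
  shows "id_resolution ((X \<otimes>\<^sub>o Y) \<otimes>\<^sub>o Z) ((carrier \<Gamma> \<times> carrier \<Gamma>) \<times> carrier \<Gamma>)
      (\<lambda>((a, b), c). (proj a X \<otimes>\<^sub>a proj b Y) \<otimes>\<^sub>a proj c Z)"
    and "id_resolution (X \<otimes>\<^sub>o (Y \<otimes>\<^sub>o Z)) (carrier \<Gamma> \<times> (carrier \<Gamma> \<times> carrier \<Gamma>))
      (\<lambda>(a, (b, c)). proj a X \<otimes>\<^sub>a (proj b Y \<otimes>\<^sub>a proj c Z))"
  using id_resolution_tens[OF resolution2[OF assms(1,2)] proj_resolution[OF assms(3)]]
    id_resolution_tens[OF proj_resolution[OF assms(1)] resolution2[OF assms(2,3)]]
  by (simp_all add: case_prod_unfold)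

lemma tens2_eqI:
  assumes "X \<in> Obj C" "Y \<in> Obj C" "f \<in> Hom C (X \<otimes>\<^sub>o Y) V" "g \<in> Hom C (X \<otimes>\<^sub>o Y) V"
    and "\<And>a b. \<lbrakk>a \<in> carrier \<Gamma>; b \<in> carrier \<Gamma>\<rbrakk> \<Longrightarrow> f \<cdot> (proj a X \<otimes>\<^sub>a proj b Y) = g \<cdot> (proj a X \<otimes>\<^sub>a proj b Y)"
  shows "f = g"
  by (rule id_resolution_eqI[OF resolution2[OF assms(1,2)] assms(3,4)]) (use assms(5) in auto)

lemma tens3_eqI:
  assumes "X \<in> Obj C" "Y \<in> Obj C" "Z \<in> Obj C" "f \<in> Hom C ((X \<otimes>\<^sub>o Y) \<otimes>\<^sub>o Z) V" "g \<in> Hom C ((X \<otimes>\<^sub>o Y) \<otimes>\<^sub>o Z) V"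
    and "\<And>a b c. \<lbrakk>a \<in> carrier \<Gamma>; b \<in> carrier \<Gamma>; c \<in> carrier \<Gamma>\<rbrakk> \<Longrightarrow>
      f \<cdot> ((proj a X \<otimes>\<^sub>a proj b Y) \<otimes>\<^sub>a proj c Z) = g \<cdot> ((proj a X \<otimes>\<^sub>a proj b Y) \<otimes>\<^sub>a proj c Z)"
  shows "f = g"
  by (rule id_resolution_eqI[OF resolution3(1)[OF assms(1-3)] assms(4,5)]) (use assms(6) in auto)

lemma tens3_eqI':
  assumes "X \<in> Obj C" "Y \<in> Obj C" "Z \<in> Obj C" "f \<in> Hom C (X \<otimes>\<^sub>o (Y \<otimes>\<^sub>o Z)) V" "g \<in> Hom C (X \<otimes>\<^sub>o (Y \<otimes>\<^sub>o Z)) V"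
    and "\<And>a b c. \<lbrakk>a \<in> carrier \<Gamma>; b \<in> carrier \<Gamma>; c \<in> carrier \<Gamma>\<rbrakk> \<Longrightarrow>
      f \<cdot> (proj a X \<otimes>\<^sub>a (proj b Y \<otimes>\<^sub>a proj c Z)) = g \<cdot> (proj a X \<otimes>\<^sub>a (proj b Y \<otimes>\<^sub>a proj c Z))"
  shows "f = g"
  by (rule id_resolution_eqI[OF resolution3(2)[OF assms(1-3)] assms(4,5)]) (use assms(6) in auto)

lemma proj_tens3_comp:
  assumes "homogeneous a X e" "homogeneous b Y f" "homogeneous c Z g"
    and "a' \<in> carrier \<Gamma>" "b' \<in> carrier \<Gamma>" "c' \<in> carrier \<Gamma>"
  shows "((proj a' X \<otimes>\<^sub>a proj b' Y) \<otimes>\<^sub>a proj c' Z) \<cdot> ((e \<otimes>\<^sub>a f) \<otimes>\<^sub>a g) =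
      (if (a', b', c') = (a, b, c) then (e \<otimes>\<^sub>a f) \<otimes>\<^sub>a g
       else Zero C ((X \<otimes>\<^sub>o Y) \<otimes>\<^sub>o Z) ((X \<otimes>\<^sub>o Y) \<otimes>\<^sub>o Z))"
    and "(proj a' X \<otimes>\<^sub>a (proj b' Y \<otimes>\<^sub>a proj c' Z)) \<cdot> (e \<otimes>\<^sub>a (f \<otimes>\<^sub>a g)) =
      (if (a', b', c') = (a, b, c) then e \<otimes>\<^sub>a (f \<otimes>\<^sub>a g)
       else Zero C (X \<otimes>\<^sub>o (Y \<otimes>\<^sub>o Z)) (X \<otimes>\<^sub>o (Y \<otimes>\<^sub>o Z)))"
proof -
  note e = homogeneousD[OF assms(1)] and f = homogeneousD[OF assms(2)] and g = homogeneousD[OF assms(3)]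
  note p = proj_comp_homogeneous[OF assms(1,4)] proj_comp_homogeneous[OF assms(2,5)]
    proj_comp_homogeneous[OF assms(3,6)]
  note h = tens_hom[OF e(2) f(2)] tens_hom[OF f(2) g(2)]
  have "((proj a' X \<otimes>\<^sub>a proj b' Y) \<otimes>\<^sub>a proj c' Z) \<cdot> ((e \<otimes>\<^sub>a f) \<otimes>\<^sub>a g) =
      ((proj a' X \<cdot> e) \<otimes>\<^sub>a (proj b' Y \<cdot> f)) \<otimes>\<^sub>a (proj c' Z \<cdot> g)"
    using e f g assms(4-6) by (simp add: Hom_iff)
  then show "((proj a' X \<otimes>\<^sub>a proj b' Y) \<otimes>\<^sub>a proj c' Z) \<cdot> ((e \<otimes>\<^sub>a f) \<otimes>\<^sub>a g) =
      (if (a', b', c') = (a, b, c) then (e \<otimes>\<^sub>a f) \<otimes>\<^sub>a g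
       else Zero C ((X \<otimes>\<^sub>o Y) \<otimes>\<^sub>o Z) ((X \<otimes>\<^sub>o Y) \<otimes>\<^sub>o Z))"
    using p e f g tens_zero[OF e(2)] tens_zero[OF f(2)] tens_zero[OF g(2)] tens_zero[OF h(1)]
      tens_zero[OF zero_hom[OF e(4) e(4)]] tens_zero[OF zero_hom[OF f(4) f(4)]]
      tens_zero[OF zero_hom[OF g(4) g(4)]] by auto
  have "(proj a' X \<otimes>\<^sub>a (proj b' Y \<otimes>\<^sub>a proj c' Z)) \<cdot> (e \<otimes>\<^sub>a (f \<otimes>\<^sub>a g)) =
      (proj a' X \<cdot> e) \<otimes>\<^sub>a ((proj b' Y \<cdot> f) \<otimes>\<^sub>a (proj c' Z \<cdot> g))"
    using e f g assms(4-6) by (simp add: Hom_iff)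
  then show "(proj a' X \<otimes>\<^sub>a (proj b' Y \<otimes>\<^sub>a proj c' Z)) \<cdot> (e \<otimes>\<^sub>a (f \<otimes>\<^sub>a g)) =
      (if (a', b', c') = (a, b, c) then e \<otimes>\<^sub>a (f \<otimes>\<^sub>a g)
       else Zero C (X \<otimes>\<^sub>o (Y \<otimes>\<^sub>o Z)) (X \<otimes>\<^sub>o (Y \<otimes>\<^sub>o Z)))"
    using p e f g tens_zero[OF e(2)] tens_zero[OF f(2)] tens_zero[OF g(2)] tens_zero[OF h(2)]
      tens_zero[OF zero_hom[OF e(4) e(4)]] tens_zero[OF zero_hom[OF f(4) f(4)]]
      tens_zero[OF zero_hom[OF g(4) g(4)]] by auto
qed

end

text \<open>\<open>A'\<close> is \<open>z\<close> times \<open>A\<close> on the summand cut out by \<open>P\<close>, and both carry this summand to the one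
  cut out by \<open>P'\<close>. Such pairs compose, so that twisted composites are compared factor by factor.\<close>

definition (in star_category) scalar_multiple ::
  "'o \<Rightarrow> 'o \<Rightarrow> 'a \<Rightarrow> 'a \<Rightarrow> complex \<Rightarrow> 'a \<Rightarrow> 'a \<Rightarrow> bool" where
  "scalar_multiple X Y A' A z P P' \<longleftrightarrow> A' \<in> Hom C X Y \<and> A \<in> Hom C X Y \<and> P \<in> Hom C X X \<and> P' \<in> Hom C Y Y \<and>
     P\<^sup>\<dagger> = P \<and> P'\<^sup>\<dagger> = P' \<and> A' \<cdot> P = z \<bullet> (A \<cdot> P) \<and> A \<cdot> P = P' \<cdot> A \<and> A' \<cdot> P = P' \<cdot> A'"

context star_category
begin

lemma scalar_multipleD:
  assumes "scalar_multiple X Y A' A z P P'"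
  shows "A' \<in> Hom C X Y" "A \<in> Hom C X Y" "P \<in> Hom C X X" "P' \<in> Hom C Y Y" "P\<^sup>\<dagger> = P" "P'\<^sup>\<dagger> = P'"
    "A' \<cdot> P = z \<bullet> (A \<cdot> P)" "A \<cdot> P = P' \<cdot> A" "A' \<cdot> P = P' \<cdot> A'"
  using assms by (auto simp: scalar_multiple_def)

text \<open>As \<open>A\<close> carries the summand of \<open>P\<close> into that of
  \<open>P'\<close>, the scalar of the second factor can be read off on \<open>P'\<close> and the
  two scalars multiply.\<close>

lemma scalar_multiple_comp:
  assumes "scalar_multiple Y Z B' B w P' P''" "scalar_multiple X Y A' A z P P'"
  shows "scalar_multiple X Z (B' \<cdot> A') (B \<cdot> A) (w * z) P P''"
proof -
  note a = scalar_multipleD[OF assms(2)] and b = scalar_multipleD[OF assms(1)]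
  have "(B' \<cdot> A') \<cdot> P = B' \<cdot> (A' \<cdot> P)"
    using a b by (simp add: Hom_iff del: a(7,8,9) b(7,8,9))
  also have "\<dots> = z \<bullet> (B' \<cdot> (P' \<cdot> A))"
    unfolding a(7) a(8) by (rule comp_scale[OF comp_hom[OF a(2) a(4)] b(1)])
  also have "\<dots> = z \<bullet> ((B' \<cdot> P') \<cdot> A)"
    using comp_assoc[OF a(2) a(4) b(1)] by simp
  also have "\<dots> = (w * z) \<bullet> ((B \<cdot> P') \<cdot> A)"
    unfolding b(7) using a(2) b(2) a(4) by (simp add: Hom_iff mult.commute)
  also have "(B \<cdot> P') \<cdot> A = (B \<cdot> A) \<cdot> P"
    using comp_assoc[OF a(2) a(4) b(2)] comp_assoc[OF a(3) a(2) b(2)] a(8) by simp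
  finally have 1: "(B' \<cdot> A') \<cdot> P = (w * z) \<bullet> ((B \<cdot> A) \<cdot> P)" .
  have 2: "(B \<cdot> A) \<cdot> P = P'' \<cdot> (B \<cdot> A)"
    using comp_assoc[OF a(3) a(2) b(2)] comp_assoc[OF a(2) a(4) b(2)] comp_assoc[OF a(2) b(2) b(4)]
      a(8) b(8) by simp
  have 3: "(B' \<cdot> A') \<cdot> P = P'' \<cdot> (B' \<cdot> A')"
    using comp_assoc[OF a(3) a(1) b(1)] comp_assoc[OF a(1) a(4) b(1)] comp_assoc[OF a(1) b(1) b(4)]
      a(9) b(9) by simp
  show ?thesis
    unfolding scalar_multiple_def using 1 2 3 a(3,5) b(4,6) comp_hom[OF a(1) b(1)] comp_hom[OF a(2) b(2)]
    by blast
qed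

lemma scalar_multiple_adj:
  assumes "scalar_multiple X Y A' A z P P'"
  shows "scalar_multiple Y X (A'\<^sup>\<dagger>) (A\<^sup>\<dagger>) (cnj z) P' P"
proof -
  note a = scalar_multipleD[OF assms]
  have 1: "A\<^sup>\<dagger> \<cdot> P' = P \<cdot> A\<^sup>\<dagger>"
    using adj_comp[OF a(3) a(2)] adj_comp[OF a(2) a(4)] a by simp
  have 2: "A'\<^sup>\<dagger> \<cdot> P' = P \<cdot> A'\<^sup>\<dagger>"
    using adj_comp[OF a(3) a(1)] adj_comp[OF a(1) a(4)] a(5,6,9) by simp
  have "P \<cdot> A'\<^sup>\<dagger> = (z \<bullet> (A \<cdot> P))\<^sup>\<dagger>"
    using adj_comp[OF a(3) a(1)] a(5,7) by simp
  also have "\<dots> = cnj z \<bullet> (P \<cdot> A\<^sup>\<dagger>)"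
    using adj_scale[OF comp_hom[OF a(3,2)]] adj_comp[OF a(3) a(2)] a(5) by simp
  finally show ?thesis
    unfolding scalar_multiple_def using 1 2 a(3-6) adj_hom[OF a(1)] adj_hom[OF a(2)] by simp
qed

lemma scalar_multiple_Id:
  "\<lbrakk>P \<in> Hom C X X; P\<^sup>\<dagger> = P\<rbrakk> \<Longrightarrow> scalar_multiple X X (Id C X) (Id C X) 1 P P"
  unfolding scalar_multiple_def using Hom_Obj[of P X X] by (auto simp: Hom_iff)

text \<open>How a coherence law survives a twist: the untwisted law gives \<open>A = B\<close>, and
  an identity between scalars gives \<open>z = w\<close>.\<close>

lemma scalar_multiple_eqI:
  assumes "scalar_multiple X Y A' A z P P'" "scalar_multiple X Y B' B w P P''" "A = B" "z = w"
  shows "A' \<cdot> P = B' \<cdot> P"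
  using scalar_multipleD(7)[OF assms(1)] scalar_multipleD(7)[OF assms(2)] assms(3,4) by simp

end

lemma (in star_tensor_category) scalar_multiple_tens:
  assumes "scalar_multiple X Y A' A z P P'" "scalar_multiple V W B' B w Q Q'"
  shows "scalar_multiple (X \<otimes>\<^sub>o V) (Y \<otimes>\<^sub>o W) (A' \<otimes>\<^sub>a B') (A \<otimes>\<^sub>a B) (z * w) (P \<otimes>\<^sub>a Q) (P' \<otimes>\<^sub>a Q')"
proof -
  note a = scalar_multipleD[OF assms(1)] and b = scalar_multipleD[OF assms(2)]
  have 1: "(A \<otimes>\<^sub>a B) \<cdot> (P \<otimes>\<^sub>a Q) = (P' \<otimes>\<^sub>a Q') \<cdot> (A \<otimes>\<^sub>a B)"
    using tens_comp[OF a(3,2) b(3,2)] tens_comp[OF a(2,4) b(2,4)] a(8) b(8) by simp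
  have 2: "(A' \<otimes>\<^sub>a B') \<cdot> (P \<otimes>\<^sub>a Q) = (P' \<otimes>\<^sub>a Q') \<cdot> (A' \<otimes>\<^sub>a B')"
    using tens_comp[OF a(3,1) b(3,1)] tens_comp[OF a(1,4) b(1,4)] a(9) b(9) by simp
  have "(A' \<otimes>\<^sub>a B') \<cdot> (P \<otimes>\<^sub>a Q) = (z \<bullet> (A \<cdot> P)) \<otimes>\<^sub>a (w \<bullet> (B \<cdot> Q))"
    using tens_comp[OF a(3,1) b(3,1)] a(7) b(7) by simp
  also have "\<dots> = (z * w) \<bullet> ((A \<cdot> P) \<otimes>\<^sub>a (B \<cdot> Q))"
    using comp_hom[OF a(3,2)] comp_hom[OF b(3,2)] by (simp add: Hom_iff mult.commute)
  also have "(A \<cdot> P) \<otimes>\<^sub>a (B \<cdot> Q) = (A \<otimes>\<^sub>a B) \<cdot> (P \<otimes>\<^sub>a Q)"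
    by (rule tens_comp[OF a(3,2) b(3,2)])
  finally show ?thesis
    unfolding scalar_multiple_def using 1 2 a(1-6) b(1-6) tens_adj[OF a(3) b(3)] tens_adj[OF a(4) b(4)]
    by (auto intro: tens_hom)
qed

section \<open>Twisting the associator by a cocycle\<close>

lemma twist_simps [simp]:
  "Obj (twist C \<Gamma> G \<omega>) = Obj C" "Arr (twist C \<Gamma> G \<omega>) = Arr C" "Dom (twist C \<Gamma> G \<omega>) = Dom C"
  "Cod (twist C \<Gamma> G \<omega>) = Cod C" "Id (twist C \<Gamma> G \<omega>) = Id C" "Comp (twist C \<Gamma> G \<omega>) = Comp C"
  "Zero (twist C \<Gamma> G \<omega>) = Zero C" "Plus (twist C \<Gamma> G \<omega>) = Plus C" "Scale (twist C \<Gamma> G \<omega>) = Scale C"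
  "Adj (twist C \<Gamma> G \<omega>) = Adj C" "Norm (twist C \<Gamma> G \<omega>) = Norm C" "TensO (twist C \<Gamma> G \<omega>) = TensO C"
  "TensA (twist C \<Gamma> G \<omega>) = TensA C" "Unit (twist C \<Gamma> G \<omega>) = Unit C"
  by (simp_all add: twist_def)

lemma Hom_twist [simp]: "Hom (twist C \<Gamma> G \<omega>) = Hom C"
  by (simp add: Hom_def fun_eq_iff)

lemma unitary_twist [simp]: "unitary (twist C \<Gamma> G \<omega>) = unitary C"
  by (simp add: unitary_def fun_eq_iff)

text \<open>Normalization is required in the middle argument, the place where the triangle axiom
  puts the unit object, whose degree is \<open>\<one>\<close>.\<close>

locale twisted_star_tensor_category = graded_star_tensor_category C \<Gamma> G
  for C :: "('o, 'a) tensor_cat" (structure) and \<Gamma> :: "'g monoid" and G :: "'g \<Rightarrow> 'o set" +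
  fixes \<omega> :: "'g \<Rightarrow> 'g \<Rightarrow> 'g \<Rightarrow> complex"
  assumes cmod_cocycle: "\<lbrakk>a \<in> carrier \<Gamma>; b \<in> carrier \<Gamma>; c \<in> carrier \<Gamma>\<rbrakk> \<Longrightarrow> cmod (\<omega> a b c) = 1"
    and cocycle: "\<lbrakk>a \<in> carrier \<Gamma>; b \<in> carrier \<Gamma>; c \<in> carrier \<Gamma>; d \<in> carrier \<Gamma>\<rbrakk> \<Longrightarrow>
      \<omega> a b (c \<otimes>\<^bsub>\<Gamma>\<^esub> d) * \<omega> (a \<otimes>\<^bsub>\<Gamma>\<^esub> b) c d = \<omega> b c d * \<omega> a (b \<otimes>\<^bsub>\<Gamma>\<^esub> c) d * \<omega> a b c"
    and cocycle_normalized: "\<lbrakk>a \<in> carrier \<Gamma>; c \<in> carrier \<Gamma>\<rbrakk> \<Longrightarrow> \<omega> a \<one>\<^bsub>\<Gamma>\<^esub> c = 1"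
begin

abbreviation assoc\<omega> :: "'o \<Rightarrow> 'o \<Rightarrow> 'o \<Rightarrow> 'a" where
  "assoc\<omega> \<equiv> Assoc (twist C \<Gamma> G \<omega>)"

lemma assoc\<omega>_hom:
  assumes "X \<in> Obj C" "Y \<in> Obj C" "Z \<in> Obj C"
  shows "assoc\<omega> X Y Z \<in> Hom C ((X \<otimes>\<^sub>o Y) \<otimes>\<^sub>o Z) (X \<otimes>\<^sub>o (Y \<otimes>\<^sub>o Z))"
proof -
  have "Sum C ((X \<otimes>\<^sub>o Y) \<otimes>\<^sub>o Z) (X \<otimes>\<^sub>o (Y \<otimes>\<^sub>o Z))
      (\<lambda>(a, b, c). \<omega> a b c \<bullet> (Assoc C X Y Z \<cdot> ((proj a X \<otimes>\<^sub>a proj b Y) \<otimes>\<^sub>a proj c Z)))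
      (carrier \<Gamma> \<times> carrier \<Gamma> \<times> carrier \<Gamma>) \<in> Hom C ((X \<otimes>\<^sub>o Y) \<otimes>\<^sub>o Z) (X \<otimes>\<^sub>o (Y \<otimes>\<^sub>o Z))"
    by (rule Sum_hom) (use assms in \<open>auto simp: Hom_iff\<close>)
  then show ?thesis
    by (simp add: twist_def)
qed

lemma assoc\<omega>_comp:
  assumes "homogeneous a X e" "homogeneous b Y f" "homogeneous c Z g"
  shows "assoc\<omega> X Y Z \<cdot> ((e \<otimes>\<^sub>a f) \<otimes>\<^sub>a g) = \<omega> a b c \<bullet> (Assoc C X Y Z \<cdot> ((e \<otimes>\<^sub>a f) \<otimes>\<^sub>a g))"
proof -
  note e = homogeneousD[OF assms(1)] and f = homogeneousD[OF assms(2)] and g = homogeneousD[OF assms(3)]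
  let ?W = "(X \<otimes>\<^sub>o Y) \<otimes>\<^sub>o Z" and ?V = "X \<otimes>\<^sub>o (Y \<otimes>\<^sub>o Z)"
  let ?p = "\<lambda>(a, b, c). (proj a X \<otimes>\<^sub>a proj b Y) \<otimes>\<^sub>a proj c Z"
  let ?x = "(e \<otimes>\<^sub>a f) \<otimes>\<^sub>a g"
  have "Sum C ?W ?V (\<lambda>i. (case i of (a, b, c) \<Rightarrow> \<omega> a b c) \<bullet> (Assoc C X Y Z \<cdot> ?p i))
      (carrier \<Gamma> \<times> carrier \<Gamma> \<times> carrier \<Gamma>) \<cdot> ?x =
      (case (a, b, c) of (a, b, c) \<Rightarrow> \<omega> a b c) \<bullet> (Assoc C X Y Z \<cdot> ?x)"
  proof (rule weighted_Sum_comp[where W = ?W and U = ?W])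
    fix i assume "i \<in> carrier \<Gamma> \<times> carrier \<Gamma> \<times> carrier \<Gamma>"
    then obtain a' b' c' where i: "i = (a', b', c')" "a' \<in> carrier \<Gamma>" "b' \<in> carrier \<Gamma>" "c' \<in> carrier \<Gamma>"
      by blast
    show "?p i \<cdot> ?x = (if i = (a, b, c) then ?x else Zero C ?W ?W)"
      using proj_tens3_comp(1)[OF assms i(2-4)] by (simp add: i(1))
  qed (use e f g in \<open>auto simp: Hom_iff\<close>)
  moreover have "assoc\<omega> X Y Z = Sum C ?W ?V (\<lambda>i. (case i of (a, b, c) \<Rightarrow> \<omega> a b c) \<bullet> (Assoc C X Y Z \<cdot> ?p i))
      (carrier \<Gamma> \<times> carrier \<Gamma> \<times> carrier \<Gamma>)"
    by (simp add: twist_def case_prod_unfold)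
  ultimately show ?thesis by simp
qed

text \<open>Morphisms preserve degrees and the weight depends on degrees only, so on each
  homogeneous component this is naturality of the original associator times one scalar.\<close>

lemma assoc\<omega>_natural:
  assumes "f \<in> Hom C X X'" "g \<in> Hom C Y Y'" "h \<in> Hom C Z Z'"
  shows "assoc\<omega> X' Y' Z' \<cdot> ((f \<otimes>\<^sub>a g) \<otimes>\<^sub>a h) = (f \<otimes>\<^sub>a (g \<otimes>\<^sub>a h)) \<cdot> assoc\<omega> X Y Z"
proof -
  have obj: "X \<in> Obj C" "X' \<in> Obj C" "Y \<in> Obj C" "Y' \<in> Obj C" "Z \<in> Obj C" "Z' \<in> Obj C"
    using assms Hom_Obj by auto
  note h1 = assoc\<omega>_hom[OF obj(1,3,5)] and h2 = assoc\<omega>_hom[OF obj(2,4,6)]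
  show ?thesis
  proof (rule tens3_eqI[OF obj(1,3,5)])
    fix a b c assume abc: "a \<in> carrier \<Gamma>" "b \<in> carrier \<Gamma>" "c \<in> carrier \<Gamma>"
    let ?p = "(proj a X \<otimes>\<^sub>a proj b Y) \<otimes>\<^sub>a proj c Z" and ?p' = "(proj a X' \<otimes>\<^sub>a proj b Y') \<otimes>\<^sub>a proj c Z'"
    have nat: "proj a X' \<cdot> f = f \<cdot> proj a X" "proj b Y' \<cdot> g = g \<cdot> proj b Y" "proj c Z' \<cdot> h = h \<cdot> proj c Z"
      using proj_natural assms abc by auto
    have swap: "((f \<otimes>\<^sub>a g) \<otimes>\<^sub>a h) \<cdot> ?p = ?p' \<cdot> ((f \<otimes>\<^sub>a g) \<otimes>\<^sub>a h)"
      using assms obj abc nat by (simp add: Hom_iff)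
    have l: "assoc\<omega> X' Y' Z' \<cdot> ?p' = \<omega> a b c \<bullet> (Assoc C X' Y' Z' \<cdot> ?p')"
      and r: "assoc\<omega> X Y Z \<cdot> ?p = \<omega> a b c \<bullet> (Assoc C X Y Z \<cdot> ?p)"
      by (rule assoc\<omega>_comp; use obj abc in \<open>auto intro: homogeneous_proj\<close>)+
    have "Assoc C X' Y' Z' \<cdot> (?p' \<cdot> ((f \<otimes>\<^sub>a g) \<otimes>\<^sub>a h)) = (Assoc C X' Y' Z' \<cdot> ((f \<otimes>\<^sub>a g) \<otimes>\<^sub>a h)) \<cdot> ?p"
      unfolding swap[symmetric] using assms obj abc by (simp add: Hom_iff)
    then have eq: "Assoc C X' Y' Z' \<cdot> (?p' \<cdot> ((f \<otimes>\<^sub>a g) \<otimes>\<^sub>a h)) = (f \<otimes>\<^sub>a (g \<otimes>\<^sub>a h)) \<cdot> (Assoc C X Y Z \<cdot> ?p)"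
      unfolding assoc_natural[OF assms] using assms obj abc by (simp add: Hom_iff)
    have "assoc\<omega> X' Y' Z' \<cdot> (((f \<otimes>\<^sub>a g) \<otimes>\<^sub>a h) \<cdot> ?p) = (assoc\<omega> X' Y' Z' \<cdot> ?p') \<cdot> ((f \<otimes>\<^sub>a g) \<otimes>\<^sub>a h)"
      unfolding swap by (rule comp_assoc[symmetric]) (use assms obj abc h2 in \<open>auto simp: Hom_iff\<close>)
    then show "(assoc\<omega> X' Y' Z' \<cdot> ((f \<otimes>\<^sub>a g) \<otimes>\<^sub>a h)) \<cdot> ?p =
      ((f \<otimes>\<^sub>a (g \<otimes>\<^sub>a h)) \<cdot> assoc\<omega> X Y Z) \<cdot> ?p"
      using assms obj abc h1 h2 by (simp add: Hom_iff l r eq del: interchange interchange_left)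
  qed (use assms h1 h2 in \<open>auto intro!: comp_hom[OF _ h2] comp_hom[OF h1] tens_hom\<close>)
qed

lemma assoc\<omega>_scalar_multiple:
  assumes "homogeneous a X e" "homogeneous b Y f" "homogeneous c Z g"
  shows "scalar_multiple ((X \<otimes>\<^sub>o Y) \<otimes>\<^sub>o Z) (X \<otimes>\<^sub>o (Y \<otimes>\<^sub>o Z)) (assoc\<omega> X Y Z) (Assoc C X Y Z) (\<omega> a b c)
    ((e \<otimes>\<^sub>a f) \<otimes>\<^sub>a g) (e \<otimes>\<^sub>a (f \<otimes>\<^sub>a g))"
proof -
  note e = homogeneousD[OF assms(1)] and f = homogeneousD[OF assms(2)] and g = homogeneousD[OF assms(3)]
  show ?thesis
    unfolding scalar_multiple_def
    using e f g assoc\<omega>_hom[OF e(4) f(4) g(4)] assoc\<omega>_natural[OF e(2) f(2) g(2)]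
      assoc_natural[OF e(2) f(2) g(2)] assoc\<omega>_comp[OF assms]
    by (auto simp: Hom_iff)
qed

text \<open>On each component the twisted associator is a unimodular multiple of a unitary.\<close>

lemma assoc\<omega>_unitary:
  assumes "X \<in> Obj C" "Y \<in> Obj C" "Z \<in> Obj C"
  shows "unitary C ((X \<otimes>\<^sub>o Y) \<otimes>\<^sub>o Z) (X \<otimes>\<^sub>o (Y \<otimes>\<^sub>o Z)) (assoc\<omega> X Y Z)"
proof -
  let ?W = "(X \<otimes>\<^sub>o Y) \<otimes>\<^sub>o Z" and ?V = "X \<otimes>\<^sub>o (Y \<otimes>\<^sub>o Z)"
  let ?A = "assoc\<omega> X Y Z" and ?B = "Assoc C X Y Z"
  note h = assoc\<omega>_hom[OF assms]
  have r: "scalar_multiple ?W ?V ?A ?B (\<omega> a b c) ((proj a X \<otimes>\<^sub>a proj b Y) \<otimes>\<^sub>a proj c Z)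
      (proj a X \<otimes>\<^sub>a (proj b Y \<otimes>\<^sub>a proj c Z))" "cnj (\<omega> a b c) * \<omega> a b c = 1"
    if "a \<in> carrier \<Gamma>" "b \<in> carrier \<Gamma>" "c \<in> carrier \<Gamma>" for a b c
    using assoc\<omega>_scalar_multiple homogeneous_proj assms that cmod_cocycle[OF that]
      complex_norm_square[of "\<omega> a b c"] by (auto simp: mult.commute)
  have "?A\<^sup>\<dagger> \<cdot> ?A = Id C ?W"
  proof (rule tens3_eqI[OF assms])
    fix a b c assume abc: "a \<in> carrier \<Gamma>" "b \<in> carrier \<Gamma>" "c \<in> carrier \<Gamma>"
    note s = scalar_multiple_comp[OF scalar_multiple_adj[OF r(1)[OF abc]] r(1)[OF abc]]
    show "(?A\<^sup>\<dagger> \<cdot> ?A) \<cdot> ((proj a X \<otimes>\<^sub>a proj b Y) \<otimes>\<^sub>a proj c Z) =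
      Id C ?W \<cdot> ((proj a X \<otimes>\<^sub>a proj b Y) \<otimes>\<^sub>a proj c Z)"
      using scalar_multipleD(3,7)[OF s] assms r(2)[OF abc] abc by simp
  qed (use h assms adj_hom[OF h] in \<open>auto intro!: comp_hom[OF h] id_hom\<close>)
  moreover have "?A \<cdot> ?A\<^sup>\<dagger> = Id C ?V"
  proof (rule tens3_eqI'[OF assms])
    fix a b c assume abc: "a \<in> carrier \<Gamma>" "b \<in> carrier \<Gamma>" "c \<in> carrier \<Gamma>"
    note s = scalar_multiple_comp[OF r(1)[OF abc] scalar_multiple_adj[OF r(1)[OF abc]]]
    show "(?A \<cdot> ?A\<^sup>\<dagger>) \<cdot> (proj a X \<otimes>\<^sub>a (proj b Y \<otimes>\<^sub>a proj c Z)) =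
      Id C ?V \<cdot> (proj a X \<otimes>\<^sub>a (proj b Y \<otimes>\<^sub>a proj c Z))"
      using scalar_multipleD(3,7)[OF s] assms r(2)[OF abc] abc by (simp add: mult.commute)
  qed (use h assms adj_hom[OF h] in \<open>auto intro!: comp_hom[OF adj_hom[OF h]] id_hom\<close>)
  ultimately show ?thesis
    using h by (simp add: unitary_def)
qed

text \<open>On the component of degrees \<open>(a, b, c, d)\<close> the two sides are multiples of
  the two sides of the original pentagon, and equality of the scalars is the cocycle
  identity.\<close>

lemma assoc\<omega>_pentagon:
  assumes X: "X \<in> Obj C" and Y: "Y \<in> Obj C" and Z: "Z \<in> Obj C" and W: "W \<in> Obj C"
  shows "assoc\<omega> X Y (Z \<otimes>\<^sub>o W) \<cdot> assoc\<omega> (X \<otimes>\<^sub>o Y) Z W =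
      (X \<lhd> assoc\<omega> Y Z W) \<cdot> assoc\<omega> X (Y \<otimes>\<^sub>o Z) W \<cdot> (assoc\<omega> X Y Z \<rhd> W)" (is "?l = ?r")
proof (rule id_resolution_eqI[OF id_resolution_tens[OF resolution3(1)[OF X Y Z] proj_resolution[OF W]]])
  note h = assoc\<omega>_hom
  let ?V = "((X \<otimes>\<^sub>o Y) \<otimes>\<^sub>o Z) \<otimes>\<^sub>o W" and ?V' = "X \<otimes>\<^sub>o (Y \<otimes>\<^sub>o (Z \<otimes>\<^sub>o W))"
  show "?l \<in> Hom C ?V ?V'"
    by (rule comp_hom[OF h h]) (use assms in auto)
  show "?r \<in> Hom C ?V ?V'"
    by (rule comp_hom[OF tens_hom[OF h id_hom] comp_hom[OF h tens_hom[OF id_hom h]]]) (use assms in auto)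
next
  let ?p = "\<lambda>(i, k). (\<lambda>((a, b), c). (proj a X \<otimes>\<^sub>a proj b Y) \<otimes>\<^sub>a proj c Z) i \<otimes>\<^sub>a proj k W"
  fix i assume "i \<in> ((carrier \<Gamma> \<times> carrier \<Gamma>) \<times> carrier \<Gamma>) \<times> carrier \<Gamma>"
  then obtain a b c d where i: "i = (((a, b), c), d)"
    and abc: "a \<in> carrier \<Gamma>" "b \<in> carrier \<Gamma>" "c \<in> carrier \<Gamma>" "d \<in> carrier \<Gamma>"
    by auto
  note p = homogeneous_proj[OF X abc(1)] homogeneous_proj[OF Y abc(2)] homogeneous_proj[OF Z abc(3)]
    homogeneous_proj[OF W abc(4)]
  note hp = homogeneousD(2,3)
  have "?l \<cdot> (((proj a X \<otimes>\<^sub>a proj b Y) \<otimes>\<^sub>a proj c Z) \<otimes>\<^sub>a proj d W) =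
      ?r \<cdot> (((proj a X \<otimes>\<^sub>a proj b Y) \<otimes>\<^sub>a proj c Z) \<otimes>\<^sub>a proj d W)"
    \<comment> \<open>The nesting follows the two composites factor by factor.
      \<open>homogeneous_tens\<close> supplies the degree of a product such as
      \<open>Z \<otimes> W\<close>, which is how products of degrees enter the arguments of
      \<open>\<omega>\<close>.\<close>
    by (rule scalar_multiple_eqI[OF
          scalar_multiple_comp[OF assoc\<omega>_scalar_multiple[OF p(1,2) homogeneous_tens[OF p(3,4)]]
            assoc\<omega>_scalar_multiple[OF homogeneous_tens[OF p(1,2)] p(3,4)]]
          scalar_multiple_comp[OF scalar_multiple_comp[OF
            scalar_multiple_tens[OF scalar_multiple_Id[OF hp[OF p(1)]] assoc\<omega>_scalar_multiple[OF p(2-4)]]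
            assoc\<omega>_scalar_multiple[OF p(1) homogeneous_tens[OF p(2,3)] p(4)]]
            scalar_multiple_tens[OF assoc\<omega>_scalar_multiple[OF p(1-3)] scalar_multiple_Id[OF hp[OF p(4)]]]]
          pentagon_eq[OF assms]])
      (use cocycle[OF abc] in simp)
  then show "?l \<cdot> ?p i = ?r \<cdot> ?p i"
    by (simp add: i)
qed

lemma assoc\<omega>_triangle:
  assumes X: "X \<in> Obj C" and Y: "Y \<in> Obj C"
  shows "assoc\<omega> X (Unit C) Y = Id C (X \<otimes>\<^sub>o Y)"
proof (rule tens2_eqI[OF X Y])
  fix a c assume ac: "a \<in> carrier \<Gamma>" "c \<in> carrier \<Gamma>"
  have "assoc\<omega> X (Unit C) Y \<cdot> ((proj a X \<rhd> Unit C) \<otimes>\<^sub>a proj c Y) =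
      \<omega> a \<one>\<^bsub>\<Gamma>\<^esub> c \<bullet> (Assoc C X (Unit C) Y \<cdot> ((proj a X \<rhd> Unit C) \<otimes>\<^sub>a proj c Y))"
    by (rule assoc\<omega>_comp) (use X Y ac in \<open>auto intro: homogeneous_proj homogeneous_Unit\<close>)
  then show "assoc\<omega> X (Unit C) Y \<cdot> (proj a X \<otimes>\<^sub>a proj c Y) =
      Id C (X \<otimes>\<^sub>o Y) \<cdot> (proj a X \<otimes>\<^sub>a proj c Y)"
    using X Y ac by (simp add: cocycle_normalized triangle_eq)
qed (use X Y assoc\<omega>_hom[OF X obj_unit Y] in \<open>auto simp: id_hom\<close>)

lemma star_tensor_category_twist: "star_tensor_category (twist C \<Gamma> G \<omega>)"
  by unfold_locales
    (simp_all add: dom_cod id_hom comp_hom comp_id id_comp comp_assoc zero_hom plus_hom scale_hom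
      plus_assoc plus_zero plus_minus scale_plus plus_scale scale_scale scale_one comp_plus plus_comp
      comp_scale scale_comp adj_hom adj_adj adj_comp adj_plus adj_scale tens_hom tens_comp tens_plus
      plus_tens tens_scale scale_tens tens_adj unit_tens tens_unit assoc\<omega>_unitary assoc\<omega>_natural
      assoc\<omega>_pentagon assoc\<omega>_triangle plus_comm)

end

section \<open>The ind-category is a monoidal star category\<close>

context cstar_category
begin

lemma ind_Ix_nonempty: "X \<in> ind_objects C \<Longrightarrow> Ix X \<noteq> {}"
  and ind_length: "\<lbrakk>X \<in> ind_objects C; i \<in> Ix X\<rbrakk> \<Longrightarrow> length i = Len X"
  and ind_directed: "\<lbrakk>X \<in> ind_objects C; i \<in> Ix X; j \<in> Ix X\<rbrakk> \<Longrightarrow> \<exists>l. (i, l) \<in> Leq X \<and> (j, l) \<in> Leq X"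
  and ind_Ob: "\<lbrakk>X \<in> ind_objects C; i \<in> Ix X\<rbrakk> \<Longrightarrow> Ob X i \<in> Obj C"
  and ind_Con_Id: "\<lbrakk>X \<in> ind_objects C; i \<in> Ix X\<rbrakk> \<Longrightarrow> Con X i i = Id C (Ob X i)"
  and ind_Con_isometry: "\<lbrakk>X \<in> ind_objects C; (i, j) \<in> Leq X\<rbrakk> \<Longrightarrow> isometry C (Ob X i) (Ob X j) (Con X j i)"
  and ind_Con_comp: "\<lbrakk>X \<in> ind_objects C; (i, j) \<in> Leq X; (j, l) \<in> Leq X\<rbrakk> \<Longrightarrow> Con X l j \<cdot> Con X j i = Con X l i"
  and ind_Ob_undefined: "\<lbrakk>X \<in> ind_objects C; i \<notin> Ix X\<rbrakk> \<Longrightarrow> Ob X i = undefined"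
  and ind_Con_undefined: "\<lbrakk>X \<in> ind_objects C; (i, j) \<notin> Leq X\<rbrakk> \<Longrightarrow> Con X j i = undefined"
  by (auto simp: ind_objects_def)

lemma ind_Leq_Ix:
  assumes "X \<in> ind_objects C" "(i, j) \<in> Leq X"
  shows "i \<in> Ix X" "j \<in> Ix X"
  using assms by (auto simp: ind_objects_def preorder_on_def)

lemma ind_refl: "\<lbrakk>X \<in> ind_objects C; i \<in> Ix X\<rbrakk> \<Longrightarrow> (i, i) \<in> Leq X"
  by (auto simp: ind_objects_def preorder_on_def refl_on_def)

lemma ind_trans: "\<lbrakk>X \<in> ind_objects C; (i, j) \<in> Leq X; (j, l) \<in> Leq X\<rbrakk> \<Longrightarrow> (i, l) \<in> Leq X"
  unfolding ind_objects_def preorder_on_def by (blast dest: transD)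

lemma ind_Con_hom: "\<lbrakk>X \<in> ind_objects C; (i, j) \<in> Leq X\<rbrakk> \<Longrightarrow> Con X j i \<in> Hom C (Ob X i) (Ob X j)"
  using ind_Con_isometry by (auto simp: isometry_def)

lemma ind_objectsI:
  assumes "Ix X \<noteq> {}" "\<And>i. i \<in> Ix X \<Longrightarrow> length i = Len X"
    and "\<And>i j. (i, j) \<in> Leq X \<Longrightarrow> i \<in> Ix X \<and> j \<in> Ix X" "\<And>i. i \<in> Ix X \<Longrightarrow> (i, i) \<in> Leq X"
    and "\<And>i j l. \<lbrakk>(i, j) \<in> Leq X; (j, l) \<in> Leq X\<rbrakk> \<Longrightarrow> (i, l) \<in> Leq X"
    and "\<And>i j. \<lbrakk>i \<in> Ix X; j \<in> Ix X\<rbrakk> \<Longrightarrow> \<exists>l. (i, l) \<in> Leq X \<and> (j, l) \<in> Leq X"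
    and "\<And>i. i \<in> Ix X \<Longrightarrow> Ob X i \<in> Obj C" "\<And>i. i \<in> Ix X \<Longrightarrow> Con X i i = Id C (Ob X i)"
    and "\<And>i j. (i, j) \<in> Leq X \<Longrightarrow> isometry C (Ob X i) (Ob X j) (Con X j i)"
    and "\<And>i j l. \<lbrakk>(i, j) \<in> Leq X; (j, l) \<in> Leq X\<rbrakk> \<Longrightarrow> Con X l j \<cdot> Con X j i = Con X l i"
    and "\<And>i. i \<notin> Ix X \<Longrightarrow> Ob X i = undefined" "\<And>i j. (i, j) \<notin> Leq X \<Longrightarrow> Con X j i = undefined"
  shows "X \<in> ind_objects C"
proof -
  have "preorder_on (Ix X) (Leq X)"
    unfolding preorder_on_def
  proof (intro conjI)
    show "Leq X \<subseteq> Ix X \<times> Ix X" using assms(3) by auto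
    show "refl_on (Ix X) (Leq X)" using assms(4) by (simp add: refl_on_def)
    show "trans (Leq X)" using assms(5) by (rule transI)
  qed
  then show ?thesis
    unfolding ind_objects_def using assms by auto
qed

section \<open>Limits of nets indexed by an inductive system\<close>

definition tail :: "('p, 'b, 'i) ind_obj \<Rightarrow> 'i list filter" where
  "tail X = (INF i\<in>Ix X. principal {k. (i, k) \<in> Leq X})"

text \<open>Directedness makes the tails a filter base. Convergence along an index set thereby
  becomes convergence along a filter, and the sandwich and addition rules for real limits
  apply.\<close>

lemma eventually_tail:
  assumes X: "X \<in> ind_objects C"
  shows "eventually P (tail X) \<longleftrightarrow> (\<exists>i\<in>Ix X. \<forall>k. (i, k) \<in> Leq X \<longrightarrow> P k)"
proof -
  have "\<exists>l\<in>Ix X. principal {k. (l, k) \<in> Leq X} \<le> inf (principal {k. (i, k) \<in> Leq X}) (principal {k. (j, k) \<in> Leq X})"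
    if "i \<in> Ix X" "j \<in> Ix X" for i j
  proof -
    obtain l where l: "(i, l) \<in> Leq X" "(j, l) \<in> Leq X"
      using ind_directed[OF X \<open>i \<in> Ix X\<close> \<open>j \<in> Ix X\<close>] by blast
    then show ?thesis
      using ind_trans[OF X l(1)] ind_trans[OF X l(2)] ind_Leq_Ix[OF X l(1)]
      by (intro bexI[of _ l]) auto
  qed
  then show ?thesis
    unfolding tail_def using ind_Ix_nonempty[OF X]
    by (subst eventually_INF_base) (auto simp: eventually_principal)
qed

lemma tail_nontrivial: "X \<in> ind_objects C \<Longrightarrow> tail X \<noteq> bot"
  using eventually_tail[of X "\<lambda>_. False"] ind_refl[of X] by (auto simp: trivial_limit_def)

lemma eventually_tail_Ix: "X \<in> ind_objects C \<Longrightarrow> eventually (\<lambda>k. k \<in> Ix X) (tail X)"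
  unfolding eventually_tail using ind_Ix_nonempty ind_Leq_Ix by blast

lemma eventually_tail_ge: "\<lbrakk>X \<in> ind_objects C; i \<in> Ix X\<rbrakk> \<Longrightarrow> eventually (\<lambda>k. (i, k) \<in> Leq X) (tail X)"
  unfolding eventually_tail by blast

text \<open>Membership in the morphism space is part of the notion, so every limit rule also
  delivers the typing that the norm estimates ask for.\<close>

definition nlim :: "('p, 'b, 'i) ind_obj \<Rightarrow> 'o \<Rightarrow> 'o \<Rightarrow> ('i list \<Rightarrow> 'a) \<Rightarrow> 'a \<Rightarrow> bool" where
  "nlim Y A B s l \<longleftrightarrow> l \<in> Hom C A B \<and> (\<forall>k\<in>Ix Y. s k \<in> Hom C A B) \<and> ((\<lambda>k. cdist (s k) l) \<longlongrightarrow> 0) (tail Y)"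

lemma nlimD:
  assumes "nlim Y A B s l"
  shows "l \<in> Hom C A B" "\<And>k. k \<in> Ix Y \<Longrightarrow> s k \<in> Hom C A B" "((\<lambda>k. cdist (s k) l) \<longlongrightarrow> 0) (tail Y)"
  using assms by (auto simp: nlim_def)

lemma nlim_bounded:
  assumes Y: "Y \<in> ind_objects C" and "l \<in> Hom C A B" "\<And>k. k \<in> Ix Y \<Longrightarrow> s k \<in> Hom C A B"
    and lim: "(g \<longlongrightarrow> 0) (tail Y)" and le: "eventually (\<lambda>k. cdist (s k) l \<le> g k) (tail Y)"
  shows "nlim Y A B s l"
proof -
  have "eventually (\<lambda>k. 0 \<le> cdist (s k) l) (tail Y)"
    using eventually_tail_Ix[OF Y] by eventually_elim (rule cdist_nonneg[OF assms(3,2)])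
  then have "((\<lambda>k. cdist (s k) l) \<longlongrightarrow> 0) (tail Y)"
    using real_tendsto_sandwich[OF _ le tendsto_const lim] by simp
  then show ?thesis
    using assms by (simp add: nlim_def)
qed

lemma nlim_cdist_le:
  assumes Y: "Y \<in> ind_objects C" and l: "nlim Y A B s l" and l': "nlim Y A B s' l'"
    and le: "\<And>k. k \<in> Ix Y \<Longrightarrow> cdist (s k) (s' k) \<le> c"
  shows "cdist l l' \<le> c"
proof -
  note l = nlimD[OF l] and l' = nlimD[OF l']
  have "((\<lambda>k. cdist (s k) l + c + cdist (s' k) l') \<longlongrightarrow> 0 + c + 0) (tail Y)"
    by (intro tendsto_add l(3) l'(3) tendsto_const)
  moreover have "eventually (\<lambda>k. cdist l l' \<le> cdist (s k) l + c + cdist (s' k) l') (tail Y)"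
    using eventually_tail_Ix[OF Y]
  proof eventually_elim
    case (elim k)
    then show ?case
      using cdist_triangle[OF l(1) l(2)[OF elim] l'(1)] cdist_triangle[OF l(2)[OF elim] l'(2)[OF elim] l'(1)]
        cdist_commute[OF l(1) l(2)[OF elim]] le[OF elim] by simp
  qed
  ultimately show ?thesis
    using tendsto_lowerbound[OF _ _ tail_nontrivial[OF Y]] by fastforce
qed

lemma nlim_unique:
  assumes "Y \<in> ind_objects C" "nlim Y A B s l" "nlim Y A B s l'"
  shows "l = l'"
proof -
  have "cdist l l' \<le> 0"
    using nlim_cdist_le[OF assms, of 0] cdist_self nlimD(2)[OF assms(2)] by fastforce
  then show ?thesis
    using cdist_eq_0 cdist_nonneg nlimD(1)[OF assms(2)] nlimD(1)[OF assms(3)] by (meson order_antisym)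
qed

lemma nlim_const:
  assumes "Y \<in> ind_objects C" "\<And>k. k \<in> Ix Y \<Longrightarrow> s k \<in> Hom C A B" "l \<in> Hom C A B"
    and "eventually (\<lambda>k. s k = l) (tail Y)"
  shows "nlim Y A B s l"
proof (rule nlim_bounded[OF assms(1,3,2) tendsto_const])
  show "eventually (\<lambda>k. cdist (s k) l \<le> 0) (tail Y)"
    using assms(4) by eventually_elim (use cdist_self[OF assms(3)] in simp)
qed

lemma nlim_cong:
  assumes "Y \<in> ind_objects C" "nlim Y A B s l" "\<And>k. k \<in> Ix Y \<Longrightarrow> s' k = s k"
  shows "nlim Y A B s' l"
proof -
  note l = nlimD[OF assms(2)]
  have "eventually (\<lambda>k. cdist (s' k) l \<le> cdist (s k) l) (tail Y)"
    using eventually_tail_Ix[OF assms(1)] by eventually_elim (simp add: assms(3))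
  then show ?thesis
    by (intro nlim_bounded[OF assms(1) l(1) _ l(3)]) (use assms(3) l(2) in auto)
qed

text \<open>Composition with a fixed morphism, the adjoint and scaling are Lipschitz maps of
  morphism spaces, so their continuity along nets is one statement.\<close>

lemma nlim_lipschitz:
  assumes Y: "Y \<in> ind_objects C" and l: "nlim Y A B s l"
    and F: "\<And>u. u \<in> Hom C A B \<Longrightarrow> F u \<in> Hom C A' B'"
    and lip: "\<And>u w. \<lbrakk>u \<in> Hom C A B; w \<in> Hom C A B\<rbrakk> \<Longrightarrow> cdist (F u) (F w) \<le> c * cdist u w"
  shows "nlim Y A' B' (\<lambda>k. F (s k)) (F l)"
proof -
  note l = nlimD[OF l]
  have lim: "((\<lambda>k. c * cdist (s k) l) \<longlongrightarrow> 0) (tail Y)"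
    using tendsto_mult_right_zero[OF l(3)] by simp
  show ?thesis
    by (rule nlim_bounded[OF Y _ _ lim])
      (use l F in \<open>auto intro!: eventually_mono[OF eventually_tail_Ix[OF Y]] lip\<close>)
qed

lemma nlim_comp_left:
  assumes "Y \<in> ind_objects C" "nlim Y A B s l" "g \<in> Hom C B B'"
  shows "nlim Y A B' (\<lambda>k. g \<cdot> s k) (g \<cdot> l)"
  by (rule nlim_lipschitz[OF assms(1,2), where c = "Norm C g"])
    (use assms(3) in \<open>auto intro: comp_hom cdist_comp_le\<close>)

lemma nlim_comp_right:
  assumes "Y \<in> ind_objects C" "nlim Y A B s l" "g \<in> Hom C A' A"
  shows "nlim Y A' B (\<lambda>k. s k \<cdot> g) (l \<cdot> g)"
  by (rule nlim_lipschitz[OF assms(1,2), where c = "Norm C g"])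
    (use assms(3) in \<open>auto intro: comp_hom comp_cdist_le simp: mult.commute[of "Norm C g"]\<close>)

lemma nlim_adj:
  assumes "Y \<in> ind_objects C" "nlim Y A B s l"
  shows "nlim Y B A (\<lambda>k. (s k)\<^sup>\<dagger>) (l\<^sup>\<dagger>)"
  by (rule nlim_lipschitz[OF assms, where c = 1])
    (auto intro: adj_hom simp: adj_Diff[symmetric] Norm_Adj[OF Diff_hom])

lemma nlim_scale:
  assumes "Y \<in> ind_objects C" "nlim Y A B s l"
  shows "nlim Y A B (\<lambda>k. z \<bullet> s k) (z \<bullet> l)"
  by (rule nlim_lipschitz[OF assms, where c = "cmod z"])
    (auto intro: scale_hom simp: scale_Diff[symmetric] Norm_Scale[OF Diff_hom])

lemma cdist_plus_le:
  assumes "f \<in> Hom C A B" "f' \<in> Hom C A B" "g \<in> Hom C A B" "g' \<in> Hom C A B"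
  shows "cdist (f \<boxplus> f') (g \<boxplus> g') \<le> cdist f g + cdist f' g'"
proof -
  have "cdist (f \<boxplus> f') (g \<boxplus> g') \<le> cdist (f \<boxplus> f') (f \<boxplus> g') + cdist (f \<boxplus> g') (g \<boxplus> g')"
    using assms by (intro cdist_triangle plus_hom)
  also have "cdist (f \<boxplus> f') (f \<boxplus> g') = cdist f' g'"
    using Diff_plus_left[OF assms(2,4,1)] by simp
  also have "cdist (f \<boxplus> g') (g \<boxplus> g') = cdist f g"
    using Diff_plus_left[OF assms(1,3,4)] plus_comm[OF assms(1,4)] plus_comm[OF assms(3,4)] by simp
  finally show ?thesis by simp
qed

lemma nlim_plus:
  assumes Y: "Y \<in> ind_objects C" and "nlim Y A B s l" "nlim Y A B s' l'"
  shows "nlim Y A B (\<lambda>k. s k \<boxplus> s' k) (l \<boxplus> l')"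
proof -
  note l = nlimD[OF assms(2)] and l' = nlimD[OF assms(3)]
  have lim: "((\<lambda>k. cdist (s k) l + cdist (s' k) l') \<longlongrightarrow> 0) (tail Y)"
    using tendsto_add[OF l(3) l'(3)] by simp
  show ?thesis
    by (rule nlim_bounded[OF Y _ _ lim])
      (use l l' in \<open>auto intro!: plus_hom cdist_plus_le eventually_mono[OF eventually_tail_Ix[OF Y]]\<close>)
qed

lemma nlim_Norm_le:
  assumes Y: "Y \<in> ind_objects C" and "nlim Y A B s l" and le: "\<And>k. k \<in> Ix Y \<Longrightarrow> Norm C (s k) \<le> M"
  shows "Norm C l \<le> M"
proof -
  have obj: "A \<in> Obj C" "B \<in> Obj C"
    using nlimD(1)[OF assms(2)] Hom_Obj by auto
  have z: "nlim Y A B (\<lambda>k. Zero C A B) (Zero C A B)"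
    by (rule nlim_const[OF Y]) (use obj in \<open>auto intro: zero_hom\<close>)
  have "cdist l (Zero C A B) \<le> M"
    by (rule nlim_cdist_le[OF Y assms(2) z]) (use le Diff_zero nlimD(2)[OF assms(2)] in auto)
  then show ?thesis
    using Diff_zero[OF nlimD(1)[OF assms(2)]] by simp
qed

lemma net_limit_eq:
  assumes Y: "Y \<in> ind_objects C" and l: "nlim Y A B s l"
  shows "net_limit C A B (Ix Y) (Leq Y) s = l"
proof -
  have iff: "(l' \<in> Hom C A B \<and> (\<forall>e>0. \<exists>k\<^sub>0\<in>Ix Y. \<forall>k. (k\<^sub>0, k) \<in> Leq Y \<longrightarrow> cdist (s k) l' < e)) \<longleftrightarrow> nlim Y A B s l'" for l'
  proof -
    have "((\<lambda>k. cdist (s k) l') \<longlongrightarrow> 0) (tail Y) \<longleftrightarrow>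
        (\<forall>e>0. \<exists>k\<^sub>0\<in>Ix Y. \<forall>k. (k\<^sub>0, k) \<in> Leq Y \<longrightarrow> cdist (s k) l' < e)" if "l' \<in> Hom C A B"
    proof -
      have abs: "\<bar>cdist (s k) l'\<bar> = cdist (s k) l'" if "(k\<^sub>0, k) \<in> Leq Y" for k\<^sub>0 k
        using cdist_nonneg[OF nlimD(2)[OF l] \<open>l' \<in> Hom C A B\<close>] ind_Leq_Ix[OF Y that] by simp
      show ?thesis
        unfolding tendsto_iff eventually_tail[OF Y] using abs by (auto simp: dist_real_def)
    qed
    then show ?thesis
      unfolding nlim_def using nlimD(2)[OF l] by blast
  qed
  show ?thesis
    unfolding net_limit_def iff using l nlim_unique[OF Y _ l] by (rule the_equality)
qed

text \<open>Completeness is given for sequences only. Indices \<open>\<kappa> n\<close> beyond which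
  the net moves by at most \<open>1 / (n + 1)\<close> yield a Cauchy sequence, and its limit is the
  limit of the whole net.\<close>

lemma Cauchy_net_nlim:
  assumes Y: "Y \<in> ind_objects C" and s: "\<And>k. k \<in> Ix Y \<Longrightarrow> s k \<in> Hom C A B" and obj: "A \<in> Obj C" "B \<in> Obj C"
    and Cauchy: "\<And>e::real. e > 0 \<Longrightarrow> \<exists>k\<^sub>0\<in>Ix Y. \<forall>k. (k\<^sub>0, k) \<in> Leq Y \<longrightarrow> cdist (s k) (s k\<^sub>0) \<le> e"
  shows "\<exists>l. nlim Y A B s l"
proof -
  have "\<forall>n::nat. \<exists>k\<^sub>0\<in>Ix Y. \<forall>k. (k\<^sub>0, k) \<in> Leq Y \<longrightarrow> cdist (s k) (s k\<^sub>0) \<le> 1 / Suc n"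
    using Cauchy by simp
  then obtain \<kappa> where \<kappa>: "\<And>n. \<kappa> n \<in> Ix Y" "\<And>n k. (\<kappa> n, k) \<in> Leq Y \<Longrightarrow> cdist (s k) (s (\<kappa> n)) \<le> 1 / Suc n"
    by metis
  have sk: "s (\<kappa> n) \<in> Hom C A B" for n
    using s \<kappa> by blast
  \<comment> \<open>The chosen indices need not be increasing; two of them are compared through a
    common upper bound.\<close>
  have dist: "cdist (s (\<kappa> m)) (s (\<kappa> n)) \<le> 1 / Suc m + 1 / Suc n" for m n
  proof -
    obtain k where k: "(\<kappa> m, k) \<in> Leq Y" "(\<kappa> n, k) \<in> Leq Y"
      using ind_directed[OF Y \<kappa>(1) \<kappa>(1)] by blast
    have "s k \<in> Hom C A B"
      using s ind_Leq_Ix[OF Y k(1)] by blast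
    then show ?thesis
      using cdist_triangle[OF sk[of m] _ sk[of n], of "s k"] cdist_commute[OF sk[of m], of "s k"]
        \<kappa>(2)[OF k(1)] \<kappa>(2)[OF k(2)] by simp
  qed
  have small: "\<exists>N. \<forall>m\<ge>N. 1 / real (Suc m) < e" if "e > 0" for e
    using order_tendstoD(2)[OF lim_inverse_n' that] LIMSEQ_Suc[OF lim_inverse_n'] that
    by (metis (mono_tags, lifting) LIMSEQ_Suc lim_inverse_n' eventually_sequentially order_tendstoD(2))
  have "\<exists>N. \<forall>m\<ge>N. \<forall>m'\<ge>N. cdist (s (\<kappa> m)) (s (\<kappa> m')) < e" if "e > 0" for e
  proof -
    have "e / 2 > 0"
      using that by simp
    then obtain N where "\<forall>m\<ge>N. 1 / real (Suc m) < e / 2"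
      using small by blast
    then have "cdist (s (\<kappa> m)) (s (\<kappa> m')) < e" if "m \<ge> N" "m' \<ge> N" for m m'
      using dist[of m m'] that by (smt (verit) field_sum_of_halves)
    then show ?thesis by blast
  qed
  then obtain l where l: "l \<in> Hom C A B" and lim: "(\<lambda>m. cdist (s (\<kappa> m)) l) \<longlonglongrightarrow> 0"
    using complete[OF obj, of "\<lambda>m. s (\<kappa> m)"] sk by blast
  have "((\<lambda>k. cdist (s k) l) \<longlongrightarrow> 0) (tail Y)"
    unfolding tendsto_iff
  proof (intro allI impI)
    fix e :: real assume e: "e > 0"
    have "e / 2 > 0"
      using e by simp
    then obtain N where N: "\<forall>m\<ge>N. 1 / real (Suc m) < e / 2"
      using small by blast
    have "eventually (\<lambda>m. cdist (s (\<kappa> m)) l < e / 2) sequentially"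
      using order_tendstoD(2)[OF lim, of "e / 2"] e by simp
    then have "eventually (\<lambda>m. cdist (s (\<kappa> m)) l < e / 2 \<and> m \<ge> N) sequentially"
      using eventually_ge_at_top by (rule eventually_conj)
    then obtain m where m: "cdist (s (\<kappa> m)) l < e / 2" "m \<ge> N"
      by (metis (mono_tags, lifting) eventually_sequentially le_refl)
    have "dist (cdist (s k) l) 0 < e" if k: "(\<kappa> m, k) \<in> Leq Y" for k
    proof -
      have sk': "s k \<in> Hom C A B"
        using s ind_Leq_Ix[OF Y k] by blast
      have "cdist (s k) l \<le> cdist (s k) (s (\<kappa> m)) + cdist (s (\<kappa> m)) l"
        by (rule cdist_triangle[OF sk' sk l])
      also have "\<dots> < e"
        using \<kappa>(2)[OF k] m N by (smt (verit) field_sum_of_halves)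
      finally show ?thesis
        using cdist_nonneg[OF sk' l] by simp
    qed
    then show "eventually (\<lambda>k. dist (cdist (s k) l) 0 < e) (tail Y)"
      unfolding eventually_tail[OF Y] using \<kappa>(1) by blast
  qed
  then show ?thesis
    unfolding nlim_def using l s by blast
qed

end

lemma ind_simps [simp]:
  "Obj (ind C) = ind_objects C" "Arr (ind C) = ind_arrows C" "Dom (ind C) = Src" "Cod (ind C) = Tgt"
  "Comp (ind C) = ind_comp C" "TensO (ind C) = ind_tens_obj C" "TensA (ind C) = ind_tens_arr C"
  "Unit (ind C) = emb_obj C (Unit C)"
  by (simp_all add: ind_def)

lemma ind_obj_eqI:
  fixes X Y :: "('o, 'a, 'i) ind_obj"
  assumes "Len X = Len Y" "Ix X = Ix Y" "Leq X = Leq Y" "Ob X = Ob Y" "Con X = Con Y"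
  shows "X = Y"
  using assms by (cases X, cases Y) simp

lemma mk_ind_arr_simps [simp]:
  "Src (mk_ind_arr X Y t) = X" "Tgt (mk_ind_arr X Y t) = Y"
  "\<lbrakk>k \<in> Ix Y; i \<in> Ix X\<rbrakk> \<Longrightarrow> Cmp (mk_ind_arr X Y t) k i = t k i"
  by (simp_all add: mk_ind_arr_def)

lemma mk_ind_arr_cong:
  "\<lbrakk>X = X'; Y = Y'; \<And>k i. \<lbrakk>k \<in> Ix Y'; i \<in> Ix X'\<rbrakk> \<Longrightarrow> t k i = t' k i\<rbrakk> \<Longrightarrow> mk_ind_arr X Y t = mk_ind_arr X' Y' t'"
  by (auto simp: mk_ind_arr_def fun_eq_iff)

section \<open>Composition in the ind-category\<close>

locale ind_category = rigid_cstar_tensor_category C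
  for C :: "('o, 'a) tensor_cat" (structure)
begin

lemma mk_ind_arr_hom:
  assumes "X \<in> ind_objects C" "Y \<in> ind_objects C"
    and "\<And>k i. \<lbrakk>k \<in> Ix Y; i \<in> Ix X\<rbrakk> \<Longrightarrow> t k i \<in> Hom C (Ob X i) (Ob Y k)"
    and "\<And>k l i. \<lbrakk>(k, l) \<in> Leq Y; i \<in> Ix X\<rbrakk> \<Longrightarrow> (Con Y l k)\<^sup>\<dagger> \<cdot> t l i = t k i"
    and "\<And>k i j. \<lbrakk>k \<in> Ix Y; (i, j) \<in> Leq X\<rbrakk> \<Longrightarrow> t k j \<cdot> Con X j i = t k i"
    and "\<And>k i. \<lbrakk>k \<in> Ix Y; i \<in> Ix X\<rbrakk> \<Longrightarrow> Norm C (t k i) \<le> M"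
  shows "mk_ind_arr X Y t \<in> Hom (ind C) X Y"
proof -
  have "\<forall>k l. \<forall>i\<in>Ix X. (k, l) \<in> Leq Y \<longrightarrow> (Con Y l k)\<^sup>\<dagger> \<cdot> Cmp (mk_ind_arr X Y t) l i = Cmp (mk_ind_arr X Y t) k i"
    using assms(4) ind_Leq_Ix[OF assms(2)] by fastforce
  moreover have "\<forall>k\<in>Ix Y. \<forall>i j. (i, j) \<in> Leq X \<longrightarrow> Cmp (mk_ind_arr X Y t) k j \<cdot> Con X j i = Cmp (mk_ind_arr X Y t) k i"
    using assms(5) ind_Leq_Ix[OF assms(1)] by fastforce
  moreover have "\<forall>k\<in>Ix Y. \<forall>i\<in>Ix X. Norm C (Cmp (mk_ind_arr X Y t) k i) \<le> M"
    using assms(6) by simp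
  moreover have "\<forall>k i. k \<notin> Ix Y \<or> i \<notin> Ix X \<longrightarrow> Cmp (mk_ind_arr X Y t) k i = undefined"
    by (auto simp: mk_ind_arr_def)
  ultimately have "mk_ind_arr X Y t \<in> ind_arrows C"
    using assms(1-3) unfolding ind_arrows_def mem_Collect_eq mk_ind_arr_simps(1,2)
    by (intro conjI) (simp | blast)+
  then show ?thesis
    by (simp add: Hom_def)
qed

lemma ind_homD:
  assumes "T \<in> Hom (ind C) X Y"
  shows "X \<in> ind_objects C" "Y \<in> ind_objects C" "Src T = X" "Tgt T = Y"
    and "\<And>k i. \<lbrakk>k \<in> Ix Y; i \<in> Ix X\<rbrakk> \<Longrightarrow> Cmp T k i \<in> Hom C (Ob X i) (Ob Y k)"
    and "\<And>k l i. \<lbrakk>(k, l) \<in> Leq Y; i \<in> Ix X\<rbrakk> \<Longrightarrow> (Con Y l k)\<^sup>\<dagger> \<cdot> Cmp T l i = Cmp T k i"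
    and "\<And>k i j. \<lbrakk>k \<in> Ix Y; (i, j) \<in> Leq X\<rbrakk> \<Longrightarrow> Cmp T k j \<cdot> Con X j i = Cmp T k i"
    and "\<exists>M\<ge>0. \<forall>k\<in>Ix Y. \<forall>i\<in>Ix X. Norm C (Cmp T k i) \<le> M"
    and "\<And>k i. k \<notin> Ix Y \<or> i \<notin> Ix X \<Longrightarrow> Cmp T k i = undefined"
proof -
  have T: "T \<in> ind_arrows C" and st: "Src T = X" "Tgt T = Y"
    using assms by (auto simp: Hom_def)
  then obtain M where "\<forall>k\<in>Ix Y. \<forall>i\<in>Ix X. Norm C (Cmp T k i) \<le> M"
    by (auto simp: ind_arrows_def)
  then have "\<forall>k\<in>Ix Y. \<forall>i\<in>Ix X. Norm C (Cmp T k i) \<le> max M 0"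
    by fastforce
  then show "\<exists>M\<ge>0. \<forall>k\<in>Ix Y. \<forall>i\<in>Ix X. Norm C (Cmp T k i) \<le> M"
    by (intro exI[of _ "max M 0"]) auto
qed (use assms in \<open>auto simp: Hom_def[of "ind C"] ind_arrows_def\<close>)

lemma ind_arr_eqI:
  assumes "S \<in> Hom (ind C) X Y" "T \<in> Hom (ind C) X Y"
    and "\<And>k i. \<lbrakk>k \<in> Ix Y; i \<in> Ix X\<rbrakk> \<Longrightarrow> Cmp S k i = Cmp T k i"
  shows "S = T"
proof -
  have "Cmp S = Cmp T"
  proof (intro ext)
    fix k i
    show "Cmp S k i = Cmp T k i"
      using assms(3) ind_homD(9)[OF assms(1)] ind_homD(9)[OF assms(2)]
      by (cases "k \<in> Ix Y \<and> i \<in> Ix X") auto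
  qed
  then show ?thesis
    using ind_homD(3,4)[OF assms(1)] ind_homD(3,4)[OF assms(2)] by (cases S, cases T) simp
qed

text \<open>The entries of a column are compressions of one another, so their squared Hilbert norms
  \<open>g k\<close> increase with \<open>k\<close>; the uniform bound on the morphism bounds them.
  Beyond an index where \<open>g\<close> nearly attains its supremum, Pythagoras says that a further
  entry differs little from the image of an earlier one under the connecting map.\<close>

lemma column_converges:
  assumes T: "T \<in> Hom (ind C) X Y" and i: "i \<in> Ix X" and e: "e > 0"
  obtains k\<^sub>0 where "k\<^sub>0 \<in> Ix Y"
    "\<And>k k'. \<lbrakk>(k\<^sub>0, k) \<in> Leq Y; (k, k') \<in> Leq Y\<rbrakk> \<Longrightarrow> cdist (Cmp T k' i) (Con Y k' k \<cdot> Cmp T k i) \<le> e"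
proof -
  note T = ind_homD[OF T]
  note Y = T(2)
  obtain M where M: "\<And>k. k \<in> Ix Y \<Longrightarrow> Norm C (Cmp T k i) \<le> M"
    using T(8) i by blast
  obtain q K where q: "\<And>B t. t \<in> Hom C (Ob X i) B \<Longrightarrow> 0 \<le> q t" "\<And>B t. t \<in> Hom C (Ob X i) B \<Longrightarrow> 0 \<le> K"
    and upper: "\<And>B t. t \<in> Hom C (Ob X i) B \<Longrightarrow> q t \<le> K * (Norm C t)\<^sup>2"
    and lower: "\<And>B t. t \<in> Hom C (Ob X i) B \<Longrightarrow> (Norm C t)\<^sup>2 \<le> K * q t"
    and pyth: "\<And>B B' t v. \<lbrakk>t \<in> Hom C (Ob X i) B'; isometry C B B' v\<rbrakk> \<Longrightarrow>
      q t = q (Diff C t (v \<cdot> (v\<^sup>\<dagger> \<cdot> t))) + q (v\<^sup>\<dagger> \<cdot> t)"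
    using hilbert_norm[OF ind_Ob[OF T(1) i]] by metis
  define g where "g k = q (Cmp T k i)" for k
  have K: "0 \<le> K"
    using q(2) T(5) i ind_Ix_nonempty[OF Y] by blast
  have step: "g k' = q (Diff C (Cmp T k' i) (Con Y k' k \<cdot> Cmp T k i)) + g k" if "(k, k') \<in> Leq Y" for k k'
    using pyth[OF T(5)[OF _ i] ind_Con_isometry[OF Y that]] ind_Leq_Ix[OF Y that] T(6)[OF that i]
    by (simp add: g_def)
  have hom: "Diff C (Cmp T k' i) (Con Y k' k \<cdot> Cmp T k i) \<in> Hom C (Ob X i) (Ob Y k')"
    if "(k, k') \<in> Leq Y" for k k'
    using T(5) i ind_Leq_Ix[OF Y that] ind_Con_hom[OF Y that] by (intro Diff_hom comp_hom) auto
  have mono: "g k \<le> g k'" if "(k, k') \<in> Leq Y" for k k'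
    using step[OF that] q(1)[OF hom[OF that]] by simp
  have bdd: "bdd_above (g ` Ix Y)"
  proof (rule bdd_aboveI2)
    fix k assume k: "k \<in> Ix Y"
    have "g k \<le> K * (Norm C (Cmp T k i))\<^sup>2"
      unfolding g_def by (rule upper[OF T(5)[OF k i]])
    also have "\<dots> \<le> K * M\<^sup>2"
      using M[OF k] Norm_nonneg[OF T(5)[OF k i]] K by (intro mult_left_mono power_mono) auto
    finally show "g k \<le> K * M\<^sup>2" .
  qed
  \<comment> \<open>The \<open>+ 1\<close> avoids dividing by \<open>K = 0\<close>, while
    \<open>K \<delta> \<le> e^2\<close> still holds.\<close>
  define \<delta> where "\<delta> = e\<^sup>2 / (K + 1)"
  have \<delta>: "\<delta> > 0"
    using e K by (simp add: \<delta>_def)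
  have "\<exists>x\<in>g ` Ix Y. (SUP k\<in>Ix Y. g k) - \<delta> < x"
    using bdd ind_Ix_nonempty[OF Y] \<delta> by (subst less_cSup_iff[symmetric]) auto
  then obtain k\<^sub>0 where k0: "k\<^sub>0 \<in> Ix Y" "(SUP k\<in>Ix Y. g k) - \<delta> < g k\<^sub>0"
    by blast
  show thesis
  proof (rule that[OF k0(1)])
    fix k k' assume k: "(k\<^sub>0, k) \<in> Leq Y" "(k, k') \<in> Leq Y"
    let ?d = "Diff C (Cmp T k' i) (Con Y k' k \<cdot> Cmp T k i)"
    have "g k' \<le> (SUP k\<in>Ix Y. g k)"
      using bdd ind_Leq_Ix[OF Y k(2)] by (intro cSUP_upper)
    then have "q ?d \<le> \<delta>"
      using step[OF k(2)] mono[OF k(1)] k0(2) by simp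
    then have "K * q ?d \<le> K * \<delta>"
      using K by (rule mult_left_mono)
    moreover have "K * \<delta> \<le> e\<^sup>2"
      using K by (simp add: \<delta>_def field_simps)
    ultimately have "(Norm C ?d)\<^sup>2 \<le> e\<^sup>2"
      using lower[OF hom[OF k(2)]] by simp
    then show "Norm C ?d \<le> e"
      using e power2_le_imp_le[of "Norm C ?d" e] by simp
  qed
qed

lemma comp_term_hom:
  assumes "S \<in> Hom (ind C) Y Z" "T \<in> Hom (ind C) X Y" "m \<in> Ix Z" "i \<in> Ix X" "k \<in> Ix Y"
  shows "Cmp S m k \<cdot> Cmp T k i \<in> Hom C (Ob X i) (Ob Z m)"
  using ind_homD(5)[OF assms(1)] ind_homD(5)[OF assms(2)] assms(3-5) by (blast intro: comp_hom)

text \<open>The term at \<open>k\<close> is rewritten with the row entry at the larger index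
  \<open>k'\<close>, since \<open>S\<close> at \<open>k\<close> is \<open>S\<close> at
  \<open>k'\<close> composed with the connecting map. The two terms then differ only in the column
  of \<open>T\<close>.\<close>

lemma comp_term_cdist:
  assumes S: "S \<in> Hom (ind C) Y Z" and T: "T \<in> Hom (ind C) X Y" and m: "m \<in> Ix Z" and i: "i \<in> Ix X"
    and k: "(k, k') \<in> Leq Y" and le: "cdist (Cmp T k' i) (Con Y k' k \<cdot> Cmp T k i) \<le> e"
    and M: "Norm C (Cmp S m k') \<le> M"
  shows "cdist (Cmp S m k' \<cdot> Cmp T k' i) (Cmp S m k \<cdot> Cmp T k i) \<le> M * e"
proof -
  note S = ind_homD[OF S] and T = ind_homD[OF T]
  have kI: "k \<in> Ix Y" "k' \<in> Ix Y"
    using ind_Leq_Ix[OF S(1) k] by auto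
  note h = S(5)[OF m kI(1)] S(5)[OF m kI(2)] T(5)[OF kI(1) i] T(5)[OF kI(2) i] ind_Con_hom[OF S(1) k]
  have "Cmp S m k \<cdot> Cmp T k i = Cmp S m k' \<cdot> (Con Y k' k \<cdot> Cmp T k i)"
    using S(7)[OF m k] comp_assoc[OF h(3,5,2)] by simp
  then have "cdist (Cmp S m k' \<cdot> Cmp T k' i) (Cmp S m k \<cdot> Cmp T k i) \<le>
      Norm C (Cmp S m k') * cdist (Cmp T k' i) (Con Y k' k \<cdot> Cmp T k i)"
    using cdist_comp_le[OF h(4) comp_hom[OF h(3,5)] h(2)] by simp
  also have "\<dots> \<le> M * e"
    using M le Norm_nonneg[OF h(2)] cdist_nonneg[OF h(4) comp_hom[OF h(3,5)]] by (intro mult_mono) auto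
  finally show ?thesis .
qed

text \<open>The net of terms is Cauchy because the column of \<open>T\<close> converges and the row
  of \<open>S\<close> is bounded; this shows that the \<open>THE\<close> in the definition of
  composition denotes a limit.\<close>

lemma comp_nlim:
  assumes S: "S \<in> Hom (ind C) Y Z" and T: "T \<in> Hom (ind C) X Y" and m: "m \<in> Ix Z" and i: "i \<in> Ix X"
  shows "nlim Y (Ob X i) (Ob Z m) (\<lambda>k. Cmp S m k \<cdot> Cmp T k i) (Cmp (ind_comp C S T) m i)"
proof -
  note Sd = ind_homD[OF S] and Td = ind_homD[OF T]
  obtain M where M: "M \<ge> 0" "\<And>k. k \<in> Ix Y \<Longrightarrow> Norm C (Cmp S m k) \<le> M"
    using Sd(8) m by blast
  have "\<exists>l. nlim Y (Ob X i) (Ob Z m) (\<lambda>k. Cmp S m k \<cdot> Cmp T k i) l"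
  proof (rule Cauchy_net_nlim)
    fix e :: real assume e: "e > 0"
    \<comment> \<open>The row bound \<open>M\<close> may be 0, hence \<open>M + 1\<close>.\<close>
    then have "e / (M + 1) > 0"
      using M by simp
    then obtain k\<^sub>0 where k0: "k\<^sub>0 \<in> Ix Y"
      "\<And>k k'. \<lbrakk>(k\<^sub>0, k) \<in> Leq Y; (k, k') \<in> Leq Y\<rbrakk> \<Longrightarrow> cdist (Cmp T k' i) (Con Y k' k \<cdot> Cmp T k i) \<le> e / (M + 1)"
      using column_converges[OF T i] by metis
    have "cdist (Cmp S m k \<cdot> Cmp T k i) (Cmp S m k\<^sub>0 \<cdot> Cmp T k\<^sub>0 i) \<le> e" if k: "(k\<^sub>0, k) \<in> Leq Y" for k
    proof -
      have "cdist (Cmp S m k \<cdot> Cmp T k i) (Cmp S m k\<^sub>0 \<cdot> Cmp T k\<^sub>0 i) \<le> M * (e / (M + 1))"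
        using comp_term_cdist[OF S T m i k k0(2)[OF ind_refl[OF Sd(1) k0(1)] k]] M ind_Leq_Ix[OF Sd(1) k]
        by blast
      also have "\<dots> \<le> e"
        using M e by (simp add: field_simps)
      finally show ?thesis .
    qed
    then show "\<exists>k\<^sub>0\<in>Ix Y. \<forall>k. (k\<^sub>0, k) \<in> Leq Y \<longrightarrow>
        cdist (Cmp S m k \<cdot> Cmp T k i) (Cmp S m k\<^sub>0 \<cdot> Cmp T k\<^sub>0 i) \<le> e"
      using k0(1) by blast
  qed (rule Sd(1) ind_Ob[OF Td(1) i] ind_Ob[OF Sd(2) m] | erule comp_term_hom[OF S T m i])+
  then obtain l where l: "nlim Y (Ob X i) (Ob Z m) (\<lambda>k. Cmp S m k \<cdot> Cmp T k i) l"
    by blast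
  have "Cmp (ind_comp C S T) m i = l"
    using net_limit_eq[OF Sd(1) l] Sd Td m i by (simp add: ind_comp_def)
  then show ?thesis using l by simp
qed

lemma comp_Cmp_eqI:
  assumes S: "S \<in> Hom (ind C) Y Z" and T: "T \<in> Hom (ind C) X Y" and m: "m \<in> Ix Z" and i: "i \<in> Ix X"
    and "nlim Y (Ob X i) (Ob Z m) (\<lambda>k. Cmp S m k \<cdot> Cmp T k i) l"
  shows "Cmp (ind_comp C S T) m i = l"
  using nlim_unique[OF ind_homD(1)[OF S] comp_nlim[OF S T m i] assms(5)] .

text \<open>For composites with induced maps the net is constant from some index on, and no estimate
  is required.\<close>

lemma comp_Cmp_eventuallyI:
  assumes S: "S \<in> Hom (ind C) Y Z" and T: "T \<in> Hom (ind C) X Y" and m: "m \<in> Ix Z" and i: "i \<in> Ix X"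
    and "l \<in> Hom C (Ob X i) (Ob Z m)" and k0: "k\<^sub>0 \<in> Ix Y"
    and "\<And>k. (k\<^sub>0, k) \<in> Leq Y \<Longrightarrow> Cmp S m k \<cdot> Cmp T k i = l"
  shows "Cmp (ind_comp C S T) m i = l"
proof (rule comp_Cmp_eqI[OF S T m i])
  have Y: "Y \<in> ind_objects C"
    using ind_homD[OF S] by blast
  show "nlim Y (Ob X i) (Ob Z m) (\<lambda>k. Cmp S m k \<cdot> Cmp T k i) l"
    by (rule nlim_const[OF Y])
      (use assms comp_term_hom[OF S T m i] eventually_mono[OF eventually_tail_ge[OF Y k0]] in auto)
qed

text \<open>Compatibility with the connecting maps holds for every term of the net and passes to the
  limit, and so does the norm bound.\<close>

lemma comp_ind_hom:
  assumes S: "S \<in> Hom (ind C) Y Z" and T: "T \<in> Hom (ind C) X Y"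
  shows "ind_comp C S T \<in> Hom (ind C) X Z"
proof -
  note Sd = ind_homD[OF S] and Td = ind_homD[OF T]
  note Y = Sd(1)
  obtain M where M: "M \<ge> 0" "\<And>m k. \<lbrakk>m \<in> Ix Z; k \<in> Ix Y\<rbrakk> \<Longrightarrow> Norm C (Cmp S m k) \<le> M"
    using Sd(8) by blast
  obtain N where N: "N \<ge> 0" "\<And>k i. \<lbrakk>k \<in> Ix Y; i \<in> Ix X\<rbrakk> \<Longrightarrow> Norm C (Cmp T k i) \<le> N"
    using Td(8) by blast
  note lim = comp_nlim[OF S T]
  let ?t = "Cmp (ind_comp C S T)"
  have "mk_ind_arr X Z ?t \<in> Hom (ind C) X Z"
  proof (rule mk_ind_arr_hom[where M = "M * N"])
    fix m i assume mi: "m \<in> Ix Z" "i \<in> Ix X"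
    then show "?t m i \<in> Hom C (Ob X i) (Ob Z m)"
      using nlimD(1)[OF lim] by blast
    show "Norm C (?t m i) \<le> M * N"
    proof (rule nlim_Norm_le[OF Y lim[OF mi]])
      fix k assume k: "k \<in> Ix Y"
      have "Norm C (Cmp S m k \<cdot> Cmp T k i) \<le> Norm C (Cmp S m k) * Norm C (Cmp T k i)"
        by (rule Norm_Comp[OF Td(5)[OF k mi(2)] Sd(5)[OF mi(1) k]])
      also have "\<dots> \<le> M * N"
        using M N mi k Norm_nonneg Sd(5) Td(5) by (intro mult_mono) blast+
      finally show "Norm C (Cmp S m k \<cdot> Cmp T k i) \<le> M * N" .
    qed
  next
    fix m m' i assume m: "(m, m') \<in> Leq Z" and i: "i \<in> Ix X"
    have mI: "m \<in> Ix Z" "m' \<in> Ix Z"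
      using ind_Leq_Ix[OF Sd(2) m] by auto
    note c = ind_Con_hom[OF Sd(2) m]
    have "nlim Y (Ob X i) (Ob Z m) (\<lambda>k. (Con Z m' m)\<^sup>\<dagger> \<cdot> (Cmp S m' k \<cdot> Cmp T k i)) ((Con Z m' m)\<^sup>\<dagger> \<cdot> ?t m' i)"
      by (rule nlim_comp_left[OF Y lim[OF mI(2) i] adj_hom[OF c]])
    then have "nlim Y (Ob X i) (Ob Z m) (\<lambda>k. Cmp S m k \<cdot> Cmp T k i) ((Con Z m' m)\<^sup>\<dagger> \<cdot> ?t m' i)"
    proof (rule nlim_cong[OF Y])
      fix k assume k: "k \<in> Ix Y"
      show "Cmp S m k \<cdot> Cmp T k i = (Con Z m' m)\<^sup>\<dagger> \<cdot> (Cmp S m' k \<cdot> Cmp T k i)"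
        using comp_assoc[OF Td(5)[OF k i] Sd(5)[OF mI(2) k] adj_hom[OF c]] Sd(6)[OF m k] by simp
    qed
    then show "(Con Z m' m)\<^sup>\<dagger> \<cdot> ?t m' i = ?t m i"
      using nlim_unique[OF Y lim[OF mI(1) i]] by simp
  next
    fix m i j assume m: "m \<in> Ix Z" and ij: "(i, j) \<in> Leq X"
    have iI: "i \<in> Ix X" "j \<in> Ix X"
      using ind_Leq_Ix[OF Td(1) ij] by auto
    note c = ind_Con_hom[OF Td(1) ij]
    have "nlim Y (Ob X i) (Ob Z m) (\<lambda>k. (Cmp S m k \<cdot> Cmp T k j) \<cdot> Con X j i) (?t m j \<cdot> Con X j i)"
      by (rule nlim_comp_right[OF Y lim[OF m iI(2)] c])
    then have "nlim Y (Ob X i) (Ob Z m) (\<lambda>k. Cmp S m k \<cdot> Cmp T k i) (?t m j \<cdot> Con X j i)"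
    proof (rule nlim_cong[OF Y])
      fix k assume k: "k \<in> Ix Y"
      show "Cmp S m k \<cdot> Cmp T k i = (Cmp S m k \<cdot> Cmp T k j) \<cdot> Con X j i"
        using comp_assoc[OF c Td(5)[OF k iI(2)] Sd(5)[OF m k]] Td(7)[OF k ij] by simp
    qed
    then show "?t m j \<cdot> Con X j i = ?t m i"
      using nlim_unique[OF Y lim[OF m iI(1)]] by simp
  qed (use Sd Td in auto)
  moreover have "mk_ind_arr X Z ?t = ind_comp C S T"
    unfolding ind_comp_def by (rule mk_ind_arr_cong) (use Sd Td in auto)
  ultimately show ?thesis by simp
qed

text \<open>Two iterated limits have to be exchanged. The column of \<open>T\<close> can be frozen
  at one index \<open>k\<close> with an error that is uniform over all rows of any bounded left
  factor, so the limit over the other index is taken exactly with \<open>k\<close> fixed.\<close>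

lemma comp_ind_assoc:
  assumes R: "R \<in> Hom (ind C) Z W" and S: "S \<in> Hom (ind C) Y Z" and T: "T \<in> Hom (ind C) X Y"
  shows "ind_comp C (ind_comp C R S) T = ind_comp C R (ind_comp C S T)"
proof (rule ind_arr_eqI[OF comp_ind_hom[OF comp_ind_hom[OF R S] T] comp_ind_hom[OF R comp_ind_hom[OF S T]]])
  fix m i assume m: "m \<in> Ix W" and i: "i \<in> Ix X"
  note RS = comp_ind_hom[OF R S] and ST = comp_ind_hom[OF S T]
  note Rd = ind_homD[OF R] and Sd = ind_homD[OF S] and Td = ind_homD[OF T]
  note RSd = ind_homD[OF RS] and STd = ind_homD[OF ST]
  let ?a = "Cmp (ind_comp C (ind_comp C R S) T) m i" and ?b = "Cmp (ind_comp C R (ind_comp C S T)) m i"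
  have ab: "?a \<in> Hom C (Ob X i) (Ob W m)" "?b \<in> Hom C (Ob X i) (Ob W m)"
    using nlimD(1)[OF comp_nlim[OF RS T m i]] nlimD(1)[OF comp_nlim[OF R ST m i]] by auto
  obtain M where M: "M \<ge> 0" "\<And>k. k \<in> Ix Z \<Longrightarrow> Norm C (Cmp R m k) \<le> M"
    using Rd(8) m by blast
  obtain N where N: "N \<ge> 0" "\<And>l k. \<lbrakk>l \<in> Ix Z; k \<in> Ix Y\<rbrakk> \<Longrightarrow> Norm C (Cmp S l k) \<le> N"
    using Sd(8) by blast
  obtain L where L: "L \<ge> 0" "\<And>k. k \<in> Ix Y \<Longrightarrow> Norm C (Cmp (ind_comp C R S) m k) \<le> L"
    using RSd(8) m by blast
  have small: "cdist ?a ?b \<le> (L + M * N) * e" if e: "e > 0" for e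
  proof -
    obtain k where kI: "k \<in> Ix Y" and
      k: "\<And>k' k''. \<lbrakk>(k, k') \<in> Leq Y; (k', k'') \<in> Leq Y\<rbrakk> \<Longrightarrow> cdist (Cmp T k'' i) (Con Y k'' k' \<cdot> Cmp T k' i) \<le> e"
      using column_converges[OF T i e] by metis
    \<comment> \<open>uniform in the first factor\<close>
    have approx: "cdist (Cmp (ind_comp C Q T) l i) (Cmp Q l k \<cdot> Cmp T k i) \<le> B * e"
      if Q: "Q \<in> Hom (ind C) Y V" and l: "l \<in> Ix V" and B: "\<And>k. k \<in> Ix Y \<Longrightarrow> Norm C (Cmp Q l k) \<le> B"
      for Q V l B
    proof -
      note lim = comp_nlim[OF Q T l i]
      have q: "Cmp Q l k \<cdot> Cmp T k i \<in> Hom C (Ob X i) (Ob V l)"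
        using nlimD(2)[OF lim kI] .
      have "((\<lambda>k'. cdist (Cmp Q l k' \<cdot> Cmp T k' i) (Cmp (ind_comp C Q T) l i) + B * e) \<longlongrightarrow> 0 + B * e) (tail Y)"
        by (intro tendsto_add nlimD(3)[OF lim] tendsto_const)
      moreover have "eventually (\<lambda>k'. cdist (Cmp (ind_comp C Q T) l i) (Cmp Q l k \<cdot> Cmp T k i) \<le>
          cdist (Cmp Q l k' \<cdot> Cmp T k' i) (Cmp (ind_comp C Q T) l i) + B * e) (tail Y)"
        using eventually_tail_ge[OF Sd(1) kI]
      proof eventually_elim
        case (elim k')
        have k'I: "k' \<in> Ix Y"
          using ind_Leq_Ix[OF Sd(1) elim] by blast
        note q' = nlimD(2)[OF lim k'I]
        have "cdist (Cmp Q l k' \<cdot> Cmp T k' i) (Cmp Q l k \<cdot> Cmp T k i) \<le> B * e"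
          by (rule comp_term_cdist[OF Q T l i elim k[OF ind_refl[OF Sd(1) kI] elim] B[OF k'I]])
        then show ?case
          using cdist_triangle[OF nlimD(1)[OF lim] q' q] cdist_commute[OF nlimD(1)[OF lim] q'] by simp
      qed
      ultimately show ?thesis
        using tendsto_lowerbound[OF _ _ tail_nontrivial[OF Sd(1)]] by fastforce
    qed
    \<comment> \<open>The common approximant of both sides. The left side is close to it directly.
      For the right side, each entry of \<open>S T\<close> is close to its term at \<open>k\<close>,
      with an error independent of \<open>l\<close>; letting \<open>l\<close> run recovers the entry
      of \<open>R S\<close>.\<close>
    let ?c = "Cmp (ind_comp C R S) m k \<cdot> Cmp T k i"
    have c: "?c \<in> Hom C (Ob X i) (Ob W m)"
      by (rule comp_term_hom[OF RS T m i kI])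
    have 1: "cdist ?a ?c \<le> L * e"
      by (rule approx[OF RS m L(2)])
    have "nlim Z (Ob X i) (Ob W m) (\<lambda>l. (Cmp R m l \<cdot> Cmp S l k) \<cdot> Cmp T k i) ?c"
      by (rule nlim_comp_right[OF Rd(1) comp_nlim[OF R S m kI] Td(5)[OF kI i]])
    then have "cdist ?b ?c \<le> M * (N * e)"
    proof (rule nlim_cdist_le[OF Rd(1) comp_nlim[OF R ST m i]])
      fix l assume l: "l \<in> Ix Z"
      note h = Td(5)[OF kI i] Sd(5)[OF l kI] Rd(5)[OF m l]
      have "cdist (Cmp R m l \<cdot> Cmp (ind_comp C S T) l i) (Cmp R m l \<cdot> (Cmp S l k \<cdot> Cmp T k i)) \<le>
          Norm C (Cmp R m l) * cdist (Cmp (ind_comp C S T) l i) (Cmp S l k \<cdot> Cmp T k i)"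
        by (rule cdist_comp_le[OF STd(5)[OF l i] comp_hom[OF h(1,2)] h(3)])
      also have "\<dots> \<le> M * (N * e)"
        using M N(1) e Norm_nonneg[OF h(3)] cdist_nonneg[OF STd(5)[OF l i] comp_hom[OF h(1,2)]] l
        by (intro mult_mono approx[OF S l N(2)[OF l]]) auto
      finally show "cdist (Cmp R m l \<cdot> Cmp (ind_comp C S T) l i) ((Cmp R m l \<cdot> Cmp S l k) \<cdot> Cmp T k i) \<le> M * (N * e)"
        using comp_assoc[OF h] by simp
    qed
    then show ?thesis
      using 1 cdist_triangle[OF ab(1) c ab(2)] cdist_commute[OF ab(2) c] by (simp add: algebra_simps)
  qed
  have "cdist ?a ?b \<le> 0"
  proof (rule field_le_epsilon)
    fix e :: real assume "e > 0"
    have pos: "L + M * N + 1 > 0"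
      using L M N by (simp add: add_nonneg_pos)
    have "cdist ?a ?b \<le> (L + M * N) * (e / (L + M * N + 1))"
      using small[of "e / (L + M * N + 1)"] pos \<open>e > 0\<close> by simp
    also have "\<dots> \<le> e"
      using pos \<open>e > 0\<close> by (simp add: field_simps)
    finally show "cdist ?a ?b \<le> 0 + e" by simp
  qed
  then show "?a = ?b"
    using cdist_eq_0[OF ab] cdist_nonneg[OF ab] by simp
qed

end

abbreviation pre :: "('o, 'a, 'i) ind_obj \<Rightarrow> 'i list \<Rightarrow> 'i list" where
  "pre X \<equiv> take (Len X)"

abbreviation suf :: "('o, 'a, 'i) ind_obj \<Rightarrow> 'i list \<Rightarrow> 'i list" where
  "suf X \<equiv> drop (Len X)"

abbreviation ind_tens :: "('o, 'a, 'z) tensor_cat_scheme \<Rightarrow> ('o, 'a, 'i) ind_obj \<Rightarrow>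
    ('o, 'a, 'i) ind_obj \<Rightarrow> ('o, 'a, 'i) ind_obj" (infixr "\<odot>\<index>" 75) where
  "X \<odot>\<^bsub>C\<^esub> Y \<equiv> ind_tens_obj C X Y"

lemma ind_ops:
  "Id (ind C) X = ind_map C X X (\<lambda>i. Id C (Ob X i))"
  "Zero (ind C) X Y = mk_ind_arr X Y (\<lambda>k i. Zero C (Ob X i) (Ob Y k))"
  "Plus (ind C) S T = mk_ind_arr (Src S) (Tgt S) (\<lambda>k i. Plus C (Cmp S k i) (Cmp T k i))"
  "Scale (ind C) z T = mk_ind_arr (Src T) (Tgt T) (\<lambda>k i. Scale C z (Cmp T k i))"
  "Adj (ind C) T = mk_ind_arr (Tgt T) (Src T) (\<lambda>i k. Adj C (Cmp T k i))"
  "Assoc (ind C) X Y Z = ind_map C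
       ((X \<odot>\<^bsub>C\<^esub> Y) \<odot>\<^bsub>C\<^esub> Z) (X \<odot>\<^bsub>C\<^esub> (Y \<odot>\<^bsub>C\<^esub> Z))
       (\<lambda>m. Assoc C (Ob X (pre X m)) (Ob Y (pre Y (suf X m)))
                    (Ob Z (drop (Len X + Len Y) m)))"
  by (simp_all add: ind_def)

lemma ind_tens_obj_simps:
  "Len (X \<odot>\<^bsub>C\<^esub> Y) = Len X + Len Y"
  "Ix (X \<odot>\<^bsub>C\<^esub> Y) = {i @ j | i j. i \<in> Ix X \<and> j \<in> Ix Y}"
  "Leq (X \<odot>\<^bsub>C\<^esub> Y) = {(i @ j, i' @ j') | i j i' j'. (i, i') \<in> Leq X \<and> (j, j') \<in> Leq Y}"
  "m \<in> Ix (X \<odot>\<^bsub>C\<^esub> Y) \<Longrightarrow>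
    Ob (X \<odot>\<^bsub>C\<^esub> Y) m = TensO C (Ob X (pre X m)) (Ob Y (suf X m))"
  "m \<notin> Ix (X \<odot>\<^bsub>C\<^esub> Y) \<Longrightarrow> Ob (X \<odot>\<^bsub>C\<^esub> Y) m = undefined"
  "(m, m') \<in> Leq (X \<odot>\<^bsub>C\<^esub> Y) \<Longrightarrow> Con (X \<odot>\<^bsub>C\<^esub> Y) m' m =
    TensA C (Con X (pre X m') (pre X m)) (Con Y (suf X m') (suf X m))"
  "(m, m') \<notin> Leq (X \<odot>\<^bsub>C\<^esub> Y) \<Longrightarrow> Con (X \<odot>\<^bsub>C\<^esub> Y) m' m = undefined"
  by (auto simp: ind_tens_obj_def Let_def)

lemma emb_obj_simps [simp]:
  "Len (emb_obj C Y) = 0" "Ix (emb_obj C Y) = {[]}" "Leq (emb_obj C Y) = {([], [])}"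
  "Ob (emb_obj C Y) [] = Y" "Con (emb_obj C Y) [] [] = Id C Y"
  by (simp_all add: emb_obj_def)

context ind_category
begin

subsection \<open>Morphisms induced by compatible families\<close>

text \<open>The second half of the condition on \<open>(i, j)\<close> says that the adjoints form a
  compatible family as well. It makes not only the columns but also the rows of the induced morphism
  eventually explicit, which is used for adjoints and for composition from the left.\<close>

definition compatible_family ::
  "('o, 'a, 'i) ind_obj \<Rightarrow> ('o, 'a, 'i) ind_obj \<Rightarrow> ('i list \<Rightarrow> 'a) \<Rightarrow> bool" where
  "compatible_family X Y f \<longleftrightarrow> X \<in> ind_objects C \<and> Y \<in> ind_objects C \<and> Ix Y = Ix X \<and> Leq Y = Leq X \<and>
     (\<forall>i\<in>Ix X. f i \<in> Hom C (Ob X i) (Ob Y i)) \<and>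
     (\<forall>i j. (i, j) \<in> Leq X \<longrightarrow> Con Y j i \<cdot> f i = f j \<cdot> Con X j i \<and> Con X j i \<cdot> (f i)\<^sup>\<dagger> = (f j)\<^sup>\<dagger> \<cdot> Con Y j i) \<and>
     (\<exists>M. \<forall>i\<in>Ix X. Norm C (f i) \<le> M)"

lemma compatible_familyD:
  assumes "compatible_family X Y f"
  shows "X \<in> ind_objects C" "Y \<in> ind_objects C" "Ix Y = Ix X" "Leq Y = Leq X"
    and "\<And>i. i \<in> Ix X \<Longrightarrow> f i \<in> Hom C (Ob X i) (Ob Y i)"
    and "\<And>i j. (i, j) \<in> Leq X \<Longrightarrow> Con Y j i \<cdot> f i = f j \<cdot> Con X j i"
    and "\<And>i j. (i, j) \<in> Leq X \<Longrightarrow> Con X j i \<cdot> (f i)\<^sup>\<dagger> = (f j)\<^sup>\<dagger> \<cdot> Con Y j i"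
    and "\<exists>M. \<forall>i\<in>Ix X. Norm C (f i) \<le> M"
  using assms unfolding compatible_family_def by blast+

lemma compatible_familyI:
  assumes "X \<in> ind_objects C" "Y \<in> ind_objects C" "Ix Y = Ix X" "Leq Y = Leq X"
    and "\<And>i. i \<in> Ix X \<Longrightarrow> f i \<in> Hom C (Ob X i) (Ob Y i)"
    and "\<And>i j. (i, j) \<in> Leq X \<Longrightarrow> Con Y j i \<cdot> f i = f j \<cdot> Con X j i"
    and "\<And>i j. (i, j) \<in> Leq X \<Longrightarrow> Con X j i \<cdot> (f i)\<^sup>\<dagger> = (f j)\<^sup>\<dagger> \<cdot> Con Y j i"
    and "\<And>i. i \<in> Ix X \<Longrightarrow> Norm C (f i) \<le> M"
  shows "compatible_family X Y f"
  using assms unfolding compatible_family_def by blast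

lemma ind_map_Cmp:
  assumes f: "compatible_family X Y f" and l: "(k, l) \<in> Leq X" "(i, l) \<in> Leq X"
  shows "Cmp (ind_map C X Y f) k i = (Con Y l k)\<^sup>\<dagger> \<cdot> (Con Y l i \<cdot> f i)"
proof -
  note d = compatible_familyD[OF f]
  have I: "k \<in> Ix X" "i \<in> Ix X"
    using ind_Leq_Ix[OF d(1)] l by auto
  \<comment> \<open>The upper bound picked by \<open>SOME\<close> in \<open>ind_map\<close> is
    compared with the given one through a third index above both; isometry of the connecting map
    cancels the extra step.\<close>
  have indep: "(Con Y l k)\<^sup>\<dagger> \<cdot> Con Y l i = (Con Y n k)\<^sup>\<dagger> \<cdot> Con Y n i"
    if "(k, l) \<in> Leq Y" "(i, l) \<in> Leq Y" "(l, n) \<in> Leq Y" for l n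
  proof -
    note c = ind_Con_hom[OF d(2) that(1)] ind_Con_hom[OF d(2) that(2)] ind_Con_hom[OF d(2) that(3)]
    have "(Con Y n k)\<^sup>\<dagger> \<cdot> Con Y n i = (Con Y n l \<cdot> Con Y l k)\<^sup>\<dagger> \<cdot> (Con Y n l \<cdot> Con Y l i)"
      using ind_Con_comp[OF d(2) that(1,3)] ind_Con_comp[OF d(2) that(2,3)] by simp
    also have "\<dots> = (Con Y l k)\<^sup>\<dagger> \<cdot> ((Con Y n l)\<^sup>\<dagger> \<cdot> (Con Y n l \<cdot> Con Y l i))"
      using c by (simp add: Hom_iff)
    also have "\<dots> = (Con Y l k)\<^sup>\<dagger> \<cdot> Con Y l i"
      using isometry_cancel[OF ind_Con_isometry[OF d(2) that(3)]] c by (simp add: Hom_iff)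
    finally show ?thesis by simp
  qed
  define l' where "l' = (SOME l. (k, l) \<in> Leq Y \<and> (i, l) \<in> Leq Y)"
  have l': "(k, l') \<in> Leq Y \<and> (i, l') \<in> Leq Y"
    unfolding l'_def by (rule someI[of _ l]) (use l d(4) in auto)
  obtain n where n: "(l, n) \<in> Leq Y" "(l', n) \<in> Leq Y"
    using ind_directed[OF d(2), of l l'] ind_Leq_Ix[OF d(2)] l' l d(4) by metis
  have "(Con Y l' k)\<^sup>\<dagger> \<cdot> Con Y l' i = (Con Y l k)\<^sup>\<dagger> \<cdot> Con Y l i"
    using indep[of l' n] indep[of l n] l l' n d(4) by simp
  then have "Cmp (ind_map C X Y f) k i = ((Con Y l k)\<^sup>\<dagger> \<cdot> Con Y l i) \<cdot> f i"
    unfolding ind_map_def using I d(3) by (simp add: l'_def[symmetric] Let_def)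
  also have "\<dots> = (Con Y l k)\<^sup>\<dagger> \<cdot> (Con Y l i \<cdot> f i)"
    using ind_Con_hom[OF d(2), of k l] ind_Con_hom[OF d(2), of i l] l d(4) d(5)[OF I(2)]
    by (auto simp: Hom_iff)
  finally show ?thesis .
qed

lemma ind_map_Cmp_up:
  assumes f: "compatible_family X Y f" and l: "(i, k) \<in> Leq X"
  shows "Cmp (ind_map C X Y f) k i = Con Y k i \<cdot> f i"
proof -
  note d = compatible_familyD[OF f]
  have I: "k \<in> Ix X" "i \<in> Ix X"
    using ind_Leq_Ix[OF d(1)] l by auto
  then show ?thesis
    using ind_map_Cmp[OF f ind_refl[OF d(1) I(1)] l] ind_Con_Id[OF d(2), of k] d(3,4)
      ind_Con_hom[OF d(2), of i k] d(5)[OF I(2)] l ind_Ob[OF d(2), of k]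
    by (auto simp: Hom_iff)
qed

text \<open>Here compatibility of the adjoint family is essential: it carries the morphism from
  index \<open>i\<close> down to the smaller index \<open>k\<close>.\<close>

lemma ind_map_Cmp_down:
  assumes f: "compatible_family X Y f" and l: "(k, i) \<in> Leq X"
  shows "Cmp (ind_map C X Y f) k i = f k \<cdot> (Con X i k)\<^sup>\<dagger>"
proof -
  note d = compatible_familyD[OF f]
  have I: "k \<in> Ix X" "i \<in> Ix X"
    using ind_Leq_Ix[OF d(1)] l by auto
  note h = ind_Con_hom[OF d(1) l] ind_Con_hom[OF d(2), unfolded d(4), OF l] d(5)[OF I(1)] d(5)[OF I(2)]
  have "Cmp (ind_map C X Y f) k i = (Con Y i k)\<^sup>\<dagger> \<cdot> f i"
    using ind_map_Cmp[OF f l ind_refl[OF d(1) I(2)]] ind_Con_Id[OF d(2), of i] d(3) I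
      id_comp[OF h(4)] by simp
  also have "\<dots> = f k \<cdot> (Con X i k)\<^sup>\<dagger>"
    using arg_cong[OF d(7)[OF l], of "Adj C"] h by (simp add: Hom_iff)
  finally show ?thesis .
qed

lemma ind_map_hom:
  assumes f: "compatible_family X Y f"
  shows "ind_map C X Y f \<in> Hom (ind C) X Y"
proof -
  note d = compatible_familyD[OF f]
  obtain M where M: "\<And>i. i \<in> Ix X \<Longrightarrow> Norm C (f i) \<le> M"
    using d(8) by blast
  let ?t = "Cmp (ind_map C X Y f)"
  have con: "(i, j) \<in> Leq X \<Longrightarrow> Con Y j i \<in> Hom C (Ob Y i) (Ob Y j)" for i j
    using ind_Con_hom[OF d(2)] d(4) by simp
  have "mk_ind_arr X Y ?t \<in> Hom (ind C) X Y"
  proof (rule mk_ind_arr_hom[OF d(1,2), where M = M])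
    fix k i assume ki: "k \<in> Ix Y" "i \<in> Ix X"
    then obtain l where l: "(k, l) \<in> Leq X" "(i, l) \<in> Leq X"
      using ind_directed[OF d(1)] d(3) by metis
    note h = con[OF l(1)] con[OF l(2)] d(5)[OF ki(2)]
    show "?t k i \<in> Hom C (Ob X i) (Ob Y k)"
      unfolding ind_map_Cmp[OF f l] using h comp_hom adj_hom by metis
    have "Norm C (?t k i) \<le> Norm C ((Con Y l k)\<^sup>\<dagger>) * Norm C (Con Y l i \<cdot> f i)"
      unfolding ind_map_Cmp[OF f l] by (rule Norm_Comp[OF comp_hom[OF h(3,2)] adj_hom[OF h(1)]])
    also have "\<dots> \<le> 1 * Norm C (Con Y l i \<cdot> f i)"
      using Norm_isometry_le[OF ind_Con_isometry[OF d(2)], of k l] l d(4) Norm_Adj[OF h(1)]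
        Norm_nonneg[OF comp_hom[OF h(3,2)]] by (intro mult_right_mono) auto
    also have "\<dots> \<le> Norm C (Con Y l i) * Norm C (f i)"
      using Norm_Comp[OF h(3,2)] by simp
    also have "\<dots> \<le> 1 * Norm C (f i)"
      using Norm_isometry_le[OF ind_Con_isometry[OF d(2)], of i l] l d(4) Norm_nonneg[OF h(3)]
      by (intro mult_right_mono) auto
    finally show "Norm C (?t k i) \<le> M"
      using M[OF ki(2)] by simp
  next
    fix k k' i assume k: "(k, k') \<in> Leq Y" and i: "i \<in> Ix X"
    obtain l where l: "(k', l) \<in> Leq X" "(i, l) \<in> Leq X"
      using ind_directed[OF d(1), of k' i] ind_Leq_Ix[OF d(2) k] i d(3) by metis
    have kl: "(k, l) \<in> Leq X"
      using ind_trans[OF d(1) _ l(1)] k d(4) by simp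
    have "Con Y l k = Con Y l k' \<cdot> Con Y k' k"
      using ind_Con_comp[OF d(2) k, of l] l d(4) by simp
    then show "(Con Y k' k)\<^sup>\<dagger> \<cdot> ?t k' i = ?t k i"
      unfolding ind_map_Cmp[OF f l] ind_map_Cmp[OF f kl l(2)]
      using con[OF l(1)] con[OF l(2)] con[of k k'] k d(4) d(5)[OF i] by (simp add: Hom_iff)
  next
    fix k i j assume k: "k \<in> Ix Y" and ij: "(i, j) \<in> Leq X"
    obtain l where l: "(k, l) \<in> Leq X" "(j, l) \<in> Leq X"
      using ind_directed[OF d(1), of k j] ind_Leq_Ix[OF d(1) ij] k d(3) by metis
    have il: "(i, l) \<in> Leq X"
      using ind_trans[OF d(1) ij l(2)] .
    have I: "i \<in> Ix X" "j \<in> Ix X"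
      using ind_Leq_Ix[OF d(1) ij] by auto
    have "?t k j \<cdot> Con X j i = (Con Y l k)\<^sup>\<dagger> \<cdot> (Con Y l j \<cdot> (f j \<cdot> Con X j i))"
      unfolding ind_map_Cmp[OF f l] using con[OF l(1)] con[OF l(2)] ind_Con_hom[OF d(1) ij] d(5)[OF I(2)]
      by (simp add: Hom_iff)
    also have "\<dots> = (Con Y l k)\<^sup>\<dagger> \<cdot> (Con Y l j \<cdot> (Con Y j i \<cdot> f i))"
      using d(6)[OF ij] by simp
    also have "Con Y l j \<cdot> (Con Y j i \<cdot> f i) = Con Y l i \<cdot> f i"
      using comp_assoc[OF d(5)[OF I(1)] con[OF ij] con[OF l(2)]] ind_Con_comp[OF d(2), of i j l] ij l d(4)
      by simp
    finally show "?t k j \<cdot> Con X j i = ?t k i"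
      unfolding ind_map_Cmp[OF f l(1) il] .
  qed
  moreover have "mk_ind_arr X Y ?t = ind_map C X Y f"
    unfolding ind_map_def by (rule mk_ind_arr_cong) auto
  ultimately show ?thesis by simp
qed

text \<open>From the index \<open>i\<close> on, the column of the induced map is \<open>f i\<close>
  followed by a connecting map, which the row of \<open>T\<close> absorbs; the net is
  constant.\<close>

lemma comp_ind_map_Cmp:
  assumes f: "compatible_family X Y f" and T: "T \<in> Hom (ind C) Y Z" and m: "m \<in> Ix Z" and i: "i \<in> Ix X"
  shows "Cmp (ind_comp C T (ind_map C X Y f)) m i = Cmp T m i \<cdot> f i"
proof -
  note d = compatible_familyD[OF f] and T' = ind_homD[OF T]
  have i': "i \<in> Ix Y"
    using i d(3) by simp
  note h = T'(5)[OF m i'] d(5)[OF i]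
  show ?thesis
  proof (rule comp_Cmp_eventuallyI[OF T ind_map_hom[OF f] m i comp_hom[OF h(2,1)] i'])
    fix k assume k: "(i, k) \<in> Leq Y"
    have "Cmp T m k \<cdot> (Con Y k i \<cdot> f i) = (Cmp T m k \<cdot> Con Y k i) \<cdot> f i"
      using comp_assoc[OF h(2) ind_Con_hom[OF d(2) k] T'(5)[OF m ind_Leq_Ix(2)[OF d(2) k]]] by simp
    then show "Cmp T m k \<cdot> Cmp (ind_map C X Y f) k i = Cmp T m i \<cdot> f i"
      using ind_map_Cmp_up[OF f, of i k] k d(4) T'(7)[OF m k] by simp
  qed
qed

text \<open>The mirror image: from the index \<open>m\<close> on, the row of the induced map is
  \<open>f m\<close> after the adjoint of a connecting map, which the column of \<open>T\<close>
  absorbs.\<close>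

lemma ind_map_comp_Cmp:
  assumes f: "compatible_family Y Z f" and T: "T \<in> Hom (ind C) X Y" and m: "m \<in> Ix Z" and i: "i \<in> Ix X"
  shows "Cmp (ind_comp C (ind_map C Y Z f) T) m i = f m \<cdot> Cmp T m i"
proof -
  note d = compatible_familyD[OF f] and T' = ind_homD[OF T]
  have m': "m \<in> Ix Y"
    using m d(3) by simp
  note h = d(5)[OF m'] T'(5)[OF m' i]
  show ?thesis
  proof (rule comp_Cmp_eventuallyI[OF ind_map_hom[OF f] T m i comp_hom[OF h(2,1)] m'])
    fix k assume k: "(m, k) \<in> Leq Y"
    have "(f m \<cdot> (Con Y k m)\<^sup>\<dagger>) \<cdot> Cmp T k i = f m \<cdot> ((Con Y k m)\<^sup>\<dagger> \<cdot> Cmp T k i)"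
      using comp_assoc[OF T'(5)[OF ind_Leq_Ix(2)[OF d(1) k] i] adj_hom[OF ind_Con_hom[OF d(1) k]] h(1)] .
    then show "Cmp (ind_map C Y Z f) m k \<cdot> Cmp T k i = f m \<cdot> Cmp T m i"
      using ind_map_Cmp_down[OF f k] T'(6)[OF k i] by simp
  qed
qed

lemma compatible_family_Id:
  assumes X: "X \<in> ind_objects C"
  shows "compatible_family X X (\<lambda>i. Id C (Ob X i))"
proof -
  have "Con X j i \<cdot> Id C (Ob X i) = Id C (Ob X j) \<cdot> Con X j i \<and>
      Con X j i \<cdot> (Id C (Ob X i))\<^sup>\<dagger> = (Id C (Ob X j))\<^sup>\<dagger> \<cdot> Con X j i" if ij: "(i, j) \<in> Leq X" for i j
    using ind_Con_hom[OF X ij] ind_Ob[OF X] ind_Leq_Ix[OF X ij] by (simp add: Hom_iff)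
  then show ?thesis
    by (intro compatible_familyI[where M = 1]) (use X ind_Ob[OF X] Norm_Id_le id_hom in auto)
qed

lemma compatible_family_comp:
  assumes f: "compatible_family X Y f" and g: "compatible_family Y Z g"
  shows "compatible_family X Z (\<lambda>i. g i \<cdot> f i)"
proof -
  note d = compatible_familyD[OF f] and e = compatible_familyD[OF g]
  obtain M where M: "\<And>i. i \<in> Ix X \<Longrightarrow> Norm C (f i) \<le> M" using d(8) by blast
  obtain N where N: "\<And>i. i \<in> Ix Y \<Longrightarrow> Norm C (g i) \<le> N" using e(8) by blast
  have "Con Z j i \<cdot> (g i \<cdot> f i) = (g j \<cdot> f j) \<cdot> Con X j i \<and>
      Con X j i \<cdot> (g i \<cdot> f i)\<^sup>\<dagger> = (g j \<cdot> f j)\<^sup>\<dagger> \<cdot> Con Z j i" if ij: "(i, j) \<in> Leq X" for i j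
  proof -
    have I: "i \<in> Ix X" "j \<in> Ix X"
      using ind_Leq_Ix[OF d(1) ij] by auto
    have ij': "(i, j) \<in> Leq Y" "(i, j) \<in> Leq Z"
      using ij d(4) e(4) by auto
    have c: "Con X j i \<in> Hom C (Ob X i) (Ob X j)" "Con Y j i \<in> Hom C (Ob Y i) (Ob Y j)"
      "Con Z j i \<in> Hom C (Ob Z i) (Ob Z j)"
      using ind_Con_hom d(1,2) e(2) ij ij' by auto
    have h: "f i \<in> Hom C (Ob X i) (Ob Y i)" "f j \<in> Hom C (Ob X j) (Ob Y j)"
      "g i \<in> Hom C (Ob Y i) (Ob Z i)" "g j \<in> Hom C (Ob Y j) (Ob Z j)"
      using d(3,5) e(5) I by auto
    have "Con Z j i \<cdot> (g i \<cdot> f i) = (Con Z j i \<cdot> g i) \<cdot> f i"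
      using comp_assoc[OF h(1,3) c(3)] by simp
    also have "\<dots> = g j \<cdot> (Con Y j i \<cdot> f i)"
      using e(6)[OF ij'(1)] comp_assoc[OF h(1) c(2) h(4)] by simp
    also have "\<dots> = (g j \<cdot> f j) \<cdot> Con X j i"
      using d(6)[OF ij] comp_assoc[OF c(1) h(2,4)] by simp
    finally have 1: "Con Z j i \<cdot> (g i \<cdot> f i) = (g j \<cdot> f j) \<cdot> Con X j i" .
    have "Con X j i \<cdot> (g i \<cdot> f i)\<^sup>\<dagger> = (Con X j i \<cdot> (f i)\<^sup>\<dagger>) \<cdot> (g i)\<^sup>\<dagger>"
      using h c by (simp add: Hom_iff)
    also have "\<dots> = (f j)\<^sup>\<dagger> \<cdot> (Con Y j i \<cdot> (g i)\<^sup>\<dagger>)"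
      unfolding d(7)[OF ij] using h c by (simp add: Hom_iff)
    also have "\<dots> = (g j \<cdot> f j)\<^sup>\<dagger> \<cdot> Con Z j i"
      unfolding e(7)[OF ij'(1)] using h c by (simp add: Hom_iff)
    finally show ?thesis using 1 by blast
  qed
  moreover have h: "g i \<cdot> f i \<in> Hom C (Ob X i) (Ob Z i)" "Norm C (g i \<cdot> f i) \<le> \<bar>N\<bar> * \<bar>M\<bar>" if i: "i \<in> Ix X" for i
  proof -
    note h = d(5)[OF i] e(5)[unfolded d(3), OF i]
    show "g i \<cdot> f i \<in> Hom C (Ob X i) (Ob Z i)"
      by (rule comp_hom[OF h])
    have "Norm C (g i \<cdot> f i) \<le> Norm C (g i) * Norm C (f i)"
      by (rule Norm_Comp[OF h])
    also have "\<dots> \<le> \<bar>N\<bar> * \<bar>M\<bar>"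
      using M[OF i] N[of i] i d(3) Norm_nonneg[OF h(1)] Norm_nonneg[OF h(2)] by (intro mult_mono) auto
    finally show "Norm C (g i \<cdot> f i) \<le> \<bar>N\<bar> * \<bar>M\<bar>" .
  qed
  ultimately show ?thesis
    by (intro compatible_familyI[where M = "\<bar>N\<bar> * \<bar>M\<bar>"]) (use d(1-4) e(1-4) in auto)
qed

lemma compatible_family_adj:
  assumes f: "compatible_family X Y f"
  shows "compatible_family Y X (\<lambda>i. (f i)\<^sup>\<dagger>)"
proof -
  note d = compatible_familyD[OF f]
  have "((f i)\<^sup>\<dagger>)\<^sup>\<dagger> = f i" "Norm C ((f i)\<^sup>\<dagger>) = Norm C (f i)" "(f i)\<^sup>\<dagger> \<in> Hom C (Ob Y i) (Ob X i)" if "i \<in> Ix X" for i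
    using adj_adj[OF d(5)[OF that]] Norm_Adj[OF d(5)[OF that]] adj_hom[OF d(5)[OF that]] by auto
  then show ?thesis
    unfolding compatible_family_def using d ind_Leq_Ix[OF d(1)] by auto
qed

lemma ind_map_comp:
  assumes f: "compatible_family X Y f" and g: "compatible_family Y Z g"
  shows "ind_comp C (ind_map C Y Z g) (ind_map C X Y f) = ind_map C X Z (\<lambda>i. g i \<cdot> f i)"
proof (rule ind_arr_eqI[OF comp_ind_hom[OF ind_map_hom[OF g] ind_map_hom[OF f]]
      ind_map_hom[OF compatible_family_comp[OF f g]]])
  note d = compatible_familyD[OF f] and e = compatible_familyD[OF g]
  fix k i assume k: "k \<in> Ix Z" and i: "i \<in> Ix X"
  then obtain l where l: "(k, l) \<in> Leq X" "(i, l) \<in> Leq X"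
    using ind_directed[OF d(1), of k i] d(3) e(3) by auto
  have l': "(k, l) \<in> Leq Y" "(i, l) \<in> Leq Y" "(k, l) \<in> Leq Z" "(i, l) \<in> Leq Z" "i \<in> Ix Y"
    using l i d(3,4) e(4) by auto
  note h = d(5)[OF i] e(5)[OF l'(5)] ind_Con_hom[OF e(2) l'(3)] ind_Con_hom[OF e(2) l'(4)]
  show "Cmp (ind_comp C (ind_map C Y Z g) (ind_map C X Y f)) k i = Cmp (ind_map C X Z (\<lambda>i. g i \<cdot> f i)) k i"
    unfolding comp_ind_map_Cmp[OF f ind_map_hom[OF g] k i] ind_map_Cmp[OF g l'(1,2)]
      ind_map_Cmp[OF compatible_family_comp[OF f g] l]
    using h by (simp add: Hom_iff)
qed

lemma ind_map_cong:
  "\<lbrakk>X = X'; Y = Y'; \<And>i. i \<in> Ix X' \<Longrightarrow> f i = g i\<rbrakk> \<Longrightarrow> ind_map C X Y f = ind_map C X' Y' g"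
  unfolding ind_map_def by (rule mk_ind_arr_cong) (auto simp: Let_def)

lemma zero_ind_hom:
  assumes "X \<in> ind_objects C" "Y \<in> ind_objects C"
  shows "Zero (ind C) X Y \<in> Hom (ind C) X Y"
  unfolding ind_ops
proof (rule mk_ind_arr_hom[OF assms, where M = 0])
  fix k l i assume k: "(k, l) \<in> Leq Y" and i: "i \<in> Ix X"
  show "(Con Y l k)\<^sup>\<dagger> \<cdot> Zero C (Ob X i) (Ob Y l) = Zero C (Ob X i) (Ob Y k)"
    using comp_zero[OF adj_hom[OF ind_Con_hom[OF assms(2) k]]] ind_Ob[OF assms(1) i] by simp
next
  fix k i j assume k: "k \<in> Ix Y" and i: "(i, j) \<in> Leq X"
  show "Zero C (Ob X j) (Ob Y k) \<cdot> Con X j i = Zero C (Ob X i) (Ob Y k)"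
    using zero_comp[OF ind_Con_hom[OF assms(1) i]] ind_Ob[OF assms(2) k] by simp
qed (simp_all add: zero_hom ind_Ob[OF assms(1)] ind_Ob[OF assms(2)] Norm_zero)

lemma plus_ind_hom:
  assumes S: "S \<in> Hom (ind C) X Y" and T: "T \<in> Hom (ind C) X Y"
  shows "Plus (ind C) S T \<in> Hom (ind C) X Y"
proof -
  note s = ind_homD[OF S] and t = ind_homD[OF T]
  obtain M where M: "\<forall>k\<in>Ix Y. \<forall>i\<in>Ix X. Norm C (Cmp S k i) \<le> M" using s(8) by blast
  obtain N where N: "\<forall>k\<in>Ix Y. \<forall>i\<in>Ix X. Norm C (Cmp T k i) \<le> N" using t(8) by blast
  show ?thesis
    unfolding ind_ops s(3,4)
  proof (rule mk_ind_arr_hom[OF s(1,2), where M = "M + N"])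
    fix k i assume ki: "k \<in> Ix Y" "i \<in> Ix X"
    show "Cmp S k i \<boxplus> Cmp T k i \<in> Hom C (Ob X i) (Ob Y k)"
      by (rule plus_hom[OF s(5)[OF ki] t(5)[OF ki]])
    show "Norm C (Cmp S k i \<boxplus> Cmp T k i) \<le> M + N"
      using Norm_Plus[OF s(5)[OF ki] t(5)[OF ki]] M N ki by fastforce
  next
    fix k l i assume k: "(k, l) \<in> Leq Y" and i: "i \<in> Ix X"
    have l: "l \<in> Ix Y" using ind_Leq_Ix[OF s(2) k] by blast
    show "(Con Y l k)\<^sup>\<dagger> \<cdot> (Cmp S l i \<boxplus> Cmp T l i) = Cmp S k i \<boxplus> Cmp T k i"
      using comp_plus[OF s(5)[OF l i] t(5)[OF l i] adj_hom[OF ind_Con_hom[OF s(2) k]]] s(6)[OF k i] t(6)[OF k i]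
      by simp
  next
    fix k i j assume k: "k \<in> Ix Y" and i: "(i, j) \<in> Leq X"
    have j: "j \<in> Ix X" using ind_Leq_Ix[OF s(1) i] by blast
    show "(Cmp S k j \<boxplus> Cmp T k j) \<cdot> Con X j i = Cmp S k i \<boxplus> Cmp T k i"
      using plus_comp[OF ind_Con_hom[OF s(1) i] s(5)[OF k j] t(5)[OF k j]] s(7)[OF k i] t(7)[OF k i]
      by simp
  qed
qed

lemma scale_ind_hom:
  assumes T: "T \<in> Hom (ind C) X Y"
  shows "Scale (ind C) z T \<in> Hom (ind C) X Y"
proof -
  note t = ind_homD[OF T]
  obtain M where M: "\<forall>k\<in>Ix Y. \<forall>i\<in>Ix X. Norm C (Cmp T k i) \<le> M" using t(8) by blast
  show ?thesis
    unfolding ind_ops t(3,4)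
  proof (rule mk_ind_arr_hom[OF t(1,2), where M = "cmod z * M"])
    fix k i assume ki: "k \<in> Ix Y" "i \<in> Ix X"
    show "z \<bullet> Cmp T k i \<in> Hom C (Ob X i) (Ob Y k)"
      by (rule scale_hom[OF t(5)[OF ki]])
    show "Norm C (z \<bullet> Cmp T k i) \<le> cmod z * M"
      using Norm_Scale[OF t(5)[OF ki], of z] M ki by (simp add: mult_left_mono)
  next
    fix k l i assume k: "(k, l) \<in> Leq Y" and i: "i \<in> Ix X"
    have l: "l \<in> Ix Y" using ind_Leq_Ix[OF t(2) k] by blast
    show "(Con Y l k)\<^sup>\<dagger> \<cdot> (z \<bullet> Cmp T l i) = z \<bullet> Cmp T k i"
      using comp_scale[OF t(5)[OF l i] adj_hom[OF ind_Con_hom[OF t(2) k]]] t(6)[OF k i] by simp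
  next
    fix k i j assume k: "k \<in> Ix Y" and i: "(i, j) \<in> Leq X"
    have j: "j \<in> Ix X" using ind_Leq_Ix[OF t(1) i] by blast
    show "(z \<bullet> Cmp T k j) \<cdot> Con X j i = z \<bullet> Cmp T k i"
      using scale_comp[OF ind_Con_hom[OF t(1) i] t(5)[OF k j]] t(7)[OF k i] by simp
  qed
qed

lemma adj_ind_hom:
  assumes T: "T \<in> Hom (ind C) X Y"
  shows "Adj (ind C) T \<in> Hom (ind C) Y X"
proof -
  note t = ind_homD[OF T]
  obtain M where M: "\<forall>k\<in>Ix Y. \<forall>i\<in>Ix X. Norm C (Cmp T k i) \<le> M" using t(8) by blast
  show ?thesis
    unfolding ind_ops t(3,4)
  proof (rule mk_ind_arr_hom[OF t(2,1), where M = M])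
    fix k i assume ki: "i \<in> Ix Y" "k \<in> Ix X"
    show "(Cmp T i k)\<^sup>\<dagger> \<in> Hom C (Ob Y i) (Ob X k)"
      by (rule adj_hom[OF t(5)[OF ki]])
    show "Norm C ((Cmp T i k)\<^sup>\<dagger>) \<le> M"
      using Norm_Adj[OF t(5)[OF ki]] M ki by simp
  next
    fix k l i assume k: "(k, l) \<in> Leq X" and i: "i \<in> Ix Y"
    have l: "l \<in> Ix X" using ind_Leq_Ix[OF t(1) k] by blast
    show "(Con X l k)\<^sup>\<dagger> \<cdot> (Cmp T i l)\<^sup>\<dagger> = (Cmp T i k)\<^sup>\<dagger>"
      using adj_comp[OF ind_Con_hom[OF t(1) k] t(5)[OF i l]] t(7)[OF i k] by simp
  next
    fix k i j assume k: "k \<in> Ix X" and i: "(i, j) \<in> Leq Y"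
    have j: "j \<in> Ix Y" using ind_Leq_Ix[OF t(2) i] by blast
    show "(Cmp T j k)\<^sup>\<dagger> \<cdot> Con Y j i = (Cmp T i k)\<^sup>\<dagger>"
      using adj_comp[OF t(5)[OF j k] adj_hom[OF ind_Con_hom[OF t(2) i]]] adj_adj[OF ind_Con_hom[OF t(2) i]]
        t(6)[OF i k] by simp
  qed
qed

lemma ind_op_Cmp:
  assumes T: "T \<in> Hom (ind C) X Y" and k: "k \<in> Ix Y" and i: "i \<in> Ix X"
  shows "Cmp (Plus (ind C) T S) k i = Cmp T k i \<boxplus> Cmp S k i"
    and "Cmp (Scale (ind C) z T) k i = z \<bullet> Cmp T k i"
    and "Cmp (Adj (ind C) T) i k = (Cmp T k i)\<^sup>\<dagger>"
    and "Cmp (Zero (ind C) X Y) k i = Zero C (Ob X i) (Ob Y k)"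
  using ind_homD(3,4)[OF T] k i by (simp_all add: ind_ops)

lemma Id_ind_hom: "X \<in> ind_objects C \<Longrightarrow> Id (ind C) X \<in> Hom (ind C) X X"
  unfolding ind_ops by (rule ind_map_hom[OF compatible_family_Id])

lemma comp_Id_ind:
  assumes T: "T \<in> Hom (ind C) X Y"
  shows "ind_comp C T (Id (ind C) X) = T" "ind_comp C (Id (ind C) Y) T = T"
proof -
  note t = ind_homD[OF T]
  show "ind_comp C T (Id (ind C) X) = T"
  proof (rule ind_arr_eqI[OF comp_ind_hom[OF T Id_ind_hom[OF t(1)]] T])
    fix k i assume k: "k \<in> Ix Y" and i: "i \<in> Ix X"
    show "Cmp (ind_comp C T (Id (ind C) X)) k i = Cmp T k i"
      unfolding ind_ops comp_ind_map_Cmp[OF compatible_family_Id[OF t(1)] T k i]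
      by (rule comp_id[OF t(5)[OF k i]])
  qed
  show "ind_comp C (Id (ind C) Y) T = T"
  proof (rule ind_arr_eqI[OF comp_ind_hom[OF Id_ind_hom[OF t(2)] T] T])
    fix k i assume k: "k \<in> Ix Y" and i: "i \<in> Ix X"
    show "Cmp (ind_comp C (Id (ind C) Y) T) k i = Cmp T k i"
      unfolding ind_ops ind_map_comp_Cmp[OF compatible_family_Id[OF t(2)] T k i]
      by (rule id_comp[OF t(5)[OF k i]])
  qed
qed

lemma comp_ind_eqI:
  assumes S: "S \<in> Hom (ind C) Y Z" and T: "T \<in> Hom (ind C) X Y" and R: "R \<in> Hom (ind C) X Z"
    and "\<And>m i. \<lbrakk>m \<in> Ix Z; i \<in> Ix X\<rbrakk> \<Longrightarrow> nlim Y (Ob X i) (Ob Z m) (t m i) (Cmp R m i)"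
    and "\<And>m k i. \<lbrakk>m \<in> Ix Z; k \<in> Ix Y; i \<in> Ix X\<rbrakk> \<Longrightarrow> Cmp S m k \<cdot> Cmp T k i = t m i k"
  shows "ind_comp C S T = R"
proof (rule ind_arr_eqI[OF comp_ind_hom[OF S T] R])
  fix m i assume m: "m \<in> Ix Z" and i: "i \<in> Ix X"
  show "Cmp (ind_comp C S T) m i = Cmp R m i"
    by (rule comp_Cmp_eqI[OF S T m i nlim_cong[OF ind_homD(1)[OF S] assms(4)[OF m i]]])
      (simp add: assms(5) m i)
qed

text \<open>Each identity holds term by term in the net defining the composite; limits commute with
  sums and scalars.\<close>

lemma comp_ind_bilinear:
  assumes S: "S \<in> Hom (ind C) Y Z" and S': "S' \<in> Hom (ind C) Y Z"
    and T: "T \<in> Hom (ind C) X Y" and T': "T' \<in> Hom (ind C) X Y"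
  shows "ind_comp C S (Plus (ind C) T T') = Plus (ind C) (ind_comp C S T) (ind_comp C S T')" (is ?p1)
    and "ind_comp C (Plus (ind C) S S') T = Plus (ind C) (ind_comp C S T) (ind_comp C S' T)" (is ?p2)
    and "ind_comp C S (Scale (ind C) z T) = Scale (ind C) z (ind_comp C S T)" (is ?p3)
    and "ind_comp C (Scale (ind C) z S) T = Scale (ind C) z (ind_comp C S T)" (is ?p4)
proof -
  note s = ind_homD[OF S] and s' = ind_homD[OF S'] and t = ind_homD[OF T] and t' = ind_homD[OF T']
  note c = comp_ind_hom[OF S T] comp_ind_hom[OF S T'] comp_ind_hom[OF S' T]
  note n = nlim_plus[OF s(1) comp_nlim[OF S T]] nlim_scale[OF s(1) comp_nlim[OF S T]]
  show ?p1
    by (rule comp_ind_eqI[OF S plus_ind_hom[OF T T'] plus_ind_hom[OF c(1,2)],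
          where t = "\<lambda>m i k. Cmp S m k \<cdot> Cmp T k i \<boxplus> Cmp S m k \<cdot> Cmp T' k i"])
      (simp_all add: ind_op_Cmp(1)[OF T] ind_op_Cmp(1)[OF c(1)] comp_plus[OF t(5) t'(5) s(5)] n(1) comp_nlim[OF S T'])
  show ?p2
    by (rule comp_ind_eqI[OF plus_ind_hom[OF S S'] T plus_ind_hom[OF c(1,3)],
          where t = "\<lambda>m i k. Cmp S m k \<cdot> Cmp T k i \<boxplus> Cmp S' m k \<cdot> Cmp T k i"])
      (simp_all add: ind_op_Cmp(1)[OF S] ind_op_Cmp(1)[OF c(1)] plus_comp[OF t(5) s(5) s'(5)] n(1) comp_nlim[OF S' T])
  show ?p3
    by (rule comp_ind_eqI[OF S scale_ind_hom[OF T] scale_ind_hom[OF c(1)],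
          where t = "\<lambda>m i k. z \<bullet> (Cmp S m k \<cdot> Cmp T k i)"])
      (simp_all add: ind_op_Cmp(2)[OF T] ind_op_Cmp(2)[OF c(1)] comp_scale[OF t(5) s(5)] n(2))
  show ?p4
    by (rule comp_ind_eqI[OF scale_ind_hom[OF S] T scale_ind_hom[OF c(1)],
          where t = "\<lambda>m i k. z \<bullet> (Cmp S m k \<cdot> Cmp T k i)"])
      (simp_all add: ind_op_Cmp(2)[OF S] ind_op_Cmp(2)[OF c(1)] scale_comp[OF t(5) s(5)] n(2))
qed

lemma adj_comp_ind:
  assumes S: "S \<in> Hom (ind C) Y Z" and T: "T \<in> Hom (ind C) X Y"
  shows "Adj (ind C) (ind_comp C S T) = ind_comp C (Adj (ind C) T) (Adj (ind C) S)"
proof (rule comp_ind_eqI[symmetric, OF adj_ind_hom[OF T] adj_ind_hom[OF S] adj_ind_hom[OF comp_ind_hom[OF S T]]])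
  note s = ind_homD[OF S] and t = ind_homD[OF T]
  fix i m assume im: "i \<in> Ix X" "m \<in> Ix Z"
  show "nlim Y (Ob Z m) (Ob X i) (\<lambda>k. (Cmp S m k \<cdot> Cmp T k i)\<^sup>\<dagger>) (Cmp (Adj (ind C) (ind_comp C S T)) i m)"
    using nlim_adj[OF s(1) comp_nlim[OF S T]] im by (simp add: ind_op_Cmp(3)[OF comp_ind_hom[OF S T]])
  fix k assume "k \<in> Ix Y"
  then show "Cmp (Adj (ind C) T) i k \<cdot> Cmp (Adj (ind C) S) k m = (Cmp S m k \<cdot> Cmp T k i)\<^sup>\<dagger>"
    using im by (simp add: ind_op_Cmp(3)[OF T] ind_op_Cmp(3)[OF S] adj_comp[OF t(5) s(5)])
qed

lemma star_category_ind: "star_category (ind C :: (('o, 'a, 'i) ind_obj, ('o, 'a, 'i) ind_arr) tensor_cat)"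
proof
  fix f :: "('o, 'a, 'i) ind_arr" assume "f \<in> Arr (ind C)"
  then show "Dom (ind C) f \<in> Obj (ind C) \<and> Cod (ind C) f \<in> Obj (ind C)"
    by (auto simp: ind_arrows_def)
next
  fix f g :: "('o, 'a, 'i) ind_arr" and X Y z assume f: "f \<in> Hom (ind C) X Y" and g: "g \<in> Hom (ind C) X Y"
  note fd = ind_homD[OF f] and gd = ind_homD[OF g]
  note cf = ind_op_Cmp[OF f] and cg = ind_op_Cmp[OF g]
  show "f \<boxplus>\<^bsub>ind C\<^esub> g = g \<boxplus>\<^bsub>ind C\<^esub> f"
    by (rule ind_arr_eqI[OF plus_ind_hom[OF f g] plus_ind_hom[OF g f]])
      (simp add: cf cg plus_comm[OF fd(5) gd(5)])
  show "z \<bullet>\<^bsub>ind C\<^esub> (f \<boxplus>\<^bsub>ind C\<^esub> g) = z \<bullet>\<^bsub>ind C\<^esub> f \<boxplus>\<^bsub>ind C\<^esub> z \<bullet>\<^bsub>ind C\<^esub> g"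
    by (rule ind_arr_eqI[OF scale_ind_hom[OF plus_ind_hom[OF f g]] plus_ind_hom[OF scale_ind_hom[OF f] scale_ind_hom[OF g]]])
      (simp add: cf cg ind_op_Cmp(2)[OF plus_ind_hom[OF f g]] ind_op_Cmp(1)[OF scale_ind_hom[OF f]] scale_plus[OF fd(5) gd(5)])
  show "(f \<boxplus>\<^bsub>ind C\<^esub> g)\<^sup>\<dagger>\<^bsub>ind C\<^esub> = f\<^sup>\<dagger>\<^bsub>ind C\<^esub> \<boxplus>\<^bsub>ind C\<^esub> g\<^sup>\<dagger>\<^bsub>ind C\<^esub>"
    by (rule ind_arr_eqI[OF adj_ind_hom[OF plus_ind_hom[OF f g]] plus_ind_hom[OF adj_ind_hom[OF f] adj_ind_hom[OF g]]])
      (simp add: cf cg ind_op_Cmp(3)[OF plus_ind_hom[OF f g]] ind_op_Cmp(1)[OF adj_ind_hom[OF f]] adj_plus[OF fd(5) gd(5)])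
next
  fix f :: "('o, 'a, 'i) ind_arr" and X Y z w assume f: "f \<in> Hom (ind C) X Y"
  note fd = ind_homD[OF f]
  note cf = ind_op_Cmp[OF f] ind_op_Cmp[OF scale_ind_hom[OF f]]
  note h = scale_ind_hom[OF f] adj_ind_hom[OF f]
  note z = zero_ind_hom[OF fd(1,2)]
  show "f \<boxplus>\<^bsub>ind C\<^esub> Zero (ind C) X Y = f"
    by (rule ind_arr_eqI[OF plus_ind_hom[OF f z] f]) (simp add: cf plus_zero[OF fd(5)])
  show "f \<boxplus>\<^bsub>ind C\<^esub> (- 1) \<bullet>\<^bsub>ind C\<^esub> f = Zero (ind C) X Y"
    by (rule ind_arr_eqI[OF plus_ind_hom[OF f h(1)] z]) (simp add: cf plus_minus[OF fd(5)])
  show "(z + w) \<bullet>\<^bsub>ind C\<^esub> f = z \<bullet>\<^bsub>ind C\<^esub> f \<boxplus>\<^bsub>ind C\<^esub> w \<bullet>\<^bsub>ind C\<^esub> f"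
    by (rule ind_arr_eqI[OF h(1) plus_ind_hom[OF h(1) h(1)]]) (simp add: cf plus_scale[OF fd(5)])
  show "z \<bullet>\<^bsub>ind C\<^esub> w \<bullet>\<^bsub>ind C\<^esub> f = (z * w) \<bullet>\<^bsub>ind C\<^esub> f"
    by (rule ind_arr_eqI[OF scale_ind_hom[OF h(1)] h(1)]) (simp add: cf scale_scale[OF fd(5)])
  show "1 \<bullet>\<^bsub>ind C\<^esub> f = f"
    by (rule ind_arr_eqI[OF h(1) f]) (simp add: cf scale_one[OF fd(5)])
  show "(f\<^sup>\<dagger>\<^bsub>ind C\<^esub>)\<^sup>\<dagger>\<^bsub>ind C\<^esub> = f"
    by (rule ind_arr_eqI[OF adj_ind_hom[OF h(2)] f]) (simp add: cf ind_op_Cmp(3)[OF h(2)] adj_adj[OF fd(5)])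
  show "(z \<bullet>\<^bsub>ind C\<^esub> f)\<^sup>\<dagger>\<^bsub>ind C\<^esub> = cnj z \<bullet>\<^bsub>ind C\<^esub> f\<^sup>\<dagger>\<^bsub>ind C\<^esub>"
    by (rule ind_arr_eqI[OF adj_ind_hom[OF h(1)] scale_ind_hom[OF h(2)]])
      (simp add: cf ind_op_Cmp(2)[OF h(2)] adj_scale[OF fd(5)])
next
  fix f g h :: "('o, 'a, 'i) ind_arr" and X Y
  assume f: "f \<in> Hom (ind C) X Y" and g: "g \<in> Hom (ind C) X Y" and h: "h \<in> Hom (ind C) X Y"
  note fg = plus_ind_hom[OF f g] and gh = plus_ind_hom[OF g h]
  show "f \<boxplus>\<^bsub>ind C\<^esub> g \<boxplus>\<^bsub>ind C\<^esub> h = f \<boxplus>\<^bsub>ind C\<^esub> (g \<boxplus>\<^bsub>ind C\<^esub> h)"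
    by (rule ind_arr_eqI[OF plus_ind_hom[OF fg h] plus_ind_hom[OF f gh]])
      (simp add: ind_op_Cmp(1)[OF f] ind_op_Cmp(1)[OF g] ind_op_Cmp(1)[OF fg]
        plus_assoc[OF ind_homD(5)[OF f] ind_homD(5)[OF g] ind_homD(5)[OF h]])
qed (simp_all add: Id_ind_hom comp_ind_hom comp_Id_ind comp_ind_assoc zero_ind_hom plus_ind_hom scale_ind_hom
    adj_ind_hom comp_ind_bilinear adj_comp_ind)

end

context ind_category
begin

subsection \<open>The tensor structure\<close>

text \<open>All indices of \<open>X\<close> have the same length, so a concatenation can be split in
  only one way and membership is decided by prefix and suffix.\<close>

lemma tens_Ix_iff:
  assumes X: "X \<in> ind_objects C"
  shows "m \<in> Ix (X \<odot> Y) \<longleftrightarrow> pre X m \<in> Ix X \<and> suf X m \<in> Ix Y"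
proof
  assume "m \<in> Ix (X \<odot> Y)"
  then obtain i j where m: "m = i @ j" "i \<in> Ix X" "j \<in> Ix Y"
    by (auto simp: ind_tens_obj_simps)
  then show "pre X m \<in> Ix X \<and> suf X m \<in> Ix Y"
    using ind_length[OF X m(2)] by simp
next
  assume "pre X m \<in> Ix X \<and> suf X m \<in> Ix Y"
  then show "m \<in> Ix (X \<odot> Y)"
    unfolding ind_tens_obj_simps using append_take_drop_id[of "Len X" m] by (metis (mono_tags, lifting) mem_Collect_eq)
qed

lemma tens_Leq_iff:
  assumes X: "X \<in> ind_objects C"
  shows "(m, m') \<in> Leq (X \<odot> Y) \<longleftrightarrow>
    (pre X m, pre X m') \<in> Leq X \<and> (suf X m, suf X m') \<in> Leq Y"
proof
  assume "(m, m') \<in> Leq (X \<odot> Y)"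
  then obtain i j i' j' where m: "m = i @ j" "m' = i' @ j'" "(i, i') \<in> Leq X" "(j, j') \<in> Leq Y"
    by (auto simp: ind_tens_obj_simps)
  then show "(pre X m, pre X m') \<in> Leq X \<and> (suf X m, suf X m') \<in> Leq Y"
    using ind_length[OF X] ind_Leq_Ix[OF X m(3)] by simp
next
  assume "(pre X m, pre X m') \<in> Leq X \<and> (suf X m, suf X m') \<in> Leq Y"
  then show "(m, m') \<in> Leq (X \<odot> Y)"
    unfolding ind_tens_obj_simps using append_take_drop_id[of "Len X" m] append_take_drop_id[of "Len X" m']
    by (metis (mono_tags, lifting) mem_Collect_eq)
qed

lemma tens_Ob_Con:
  assumes X: "X \<in> ind_objects C"
  shows "\<lbrakk>pre X m \<in> Ix X; suf X m \<in> Ix Y\<rbrakk> \<Longrightarrow>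
      Ob (X \<odot> Y) m = Ob X (pre X m) \<otimes>\<^sub>o Ob Y (suf X m)"
    and "\<lbrakk>(pre X m, pre X m') \<in> Leq X; (suf X m, suf X m') \<in> Leq Y\<rbrakk> \<Longrightarrow>
      Con (X \<odot> Y) m' m =
        Con X (pre X m') (pre X m) \<otimes>\<^sub>a Con Y (suf X m') (suf X m)"
  using ind_tens_obj_simps(4,6)[where C = C and X = X and Y = Y] tens_Ix_iff[OF X] tens_Leq_iff[OF X] by auto

lemma isometry_tens:
  assumes "isometry C X Y v" "isometry C X' Y' w"
  shows "isometry C (X \<otimes>\<^sub>o X') (Y \<otimes>\<^sub>o Y') (v \<otimes>\<^sub>a w)"
proof -
  have h: "v \<in> Hom C X Y" "w \<in> Hom C X' Y'" and e: "v\<^sup>\<dagger> \<cdot> v = Id C X" "w\<^sup>\<dagger> \<cdot> w = Id C X'"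
    using assms by (auto simp: isometry_def)
  have obj: "X \<in> Obj C" "X' \<in> Obj C"
    using Hom_Obj h by auto
  show ?thesis
    using tens_hom[OF h] e h obj by (simp add: isometry_def Hom_iff)
qed

lemma tens_ind_obj:
  assumes X: "X \<in> ind_objects C" and Y: "Y \<in> ind_objects C"
  shows "X \<odot> Y \<in> ind_objects C"
proof (rule ind_objectsI)
  note I = tens_Ix_iff[OF X, of _ Y] and L = tens_Leq_iff[OF X, of _ _ Y] and OC = tens_Ob_Con[OF X, where Y = Y]
  let ?t = "pre X" and ?d = "suf X"
  show "Ix (X \<odot> Y) \<noteq> {}"
    using ind_Ix_nonempty[OF X] ind_Ix_nonempty[OF Y] by (auto simp: ind_tens_obj_simps)
  fix i assume i: "i \<in> Ix (X \<odot> Y)"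
  then show "length i = Len (X \<odot> Y)"
    using ind_length[OF X] ind_length[OF Y] by (auto simp: ind_tens_obj_simps)
  show "(i, i) \<in> Leq (X \<odot> Y)"
    using i ind_refl[OF X] ind_refl[OF Y] by (simp add: I L)
  show "Ob (X \<odot> Y) i \<in> Obj C"
    using i ind_Ob[OF X] ind_Ob[OF Y] by (simp add: I OC)
  show "Con (X \<odot> Y) i i = Id C (Ob (X \<odot> Y) i)"
    using i ind_refl[OF X] ind_refl[OF Y] ind_Con_Id[OF X] ind_Con_Id[OF Y] ind_Ob[OF X] ind_Ob[OF Y]
    by (simp add: I OC)
  fix j assume j: "j \<in> Ix (X \<odot> Y)"
  obtain a b where a: "(?t i, a) \<in> Leq X" "(?t j, a) \<in> Leq X" and b: "(?d i, b) \<in> Leq Y" "(?d j, b) \<in> Leq Y"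
    using ind_directed[OF X, of "?t i" "?t j"] ind_directed[OF Y, of "?d i" "?d j"] i j by (auto simp: I)
  have "length a = Len X"
    using ind_length[OF X] ind_Leq_Ix[OF X a(1)] by blast
  then have "(i, a @ b) \<in> Leq (X \<odot> Y)" "(j, a @ b) \<in> Leq (X \<odot> Y)"
    using a b by (simp_all add: L)
  then show "\<exists>l. (i, l) \<in> Leq (X \<odot> Y) \<and> (j, l) \<in> Leq (X \<odot> Y)"
    by blast
next
  note I = tens_Ix_iff[OF X, of _ Y] and L = tens_Leq_iff[OF X, of _ _ Y] and OC = tens_Ob_Con[OF X, where Y = Y]
  fix i j assume ij: "(i, j) \<in> Leq (X \<odot> Y)"
  then have ij': "(pre X i, pre X j) \<in> Leq X" "(suf X i, suf X j) \<in> Leq Y"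
    by (simp_all add: L)
  note Ix' = ind_Leq_Ix[OF X ij'(1)] ind_Leq_Ix[OF Y ij'(2)]
  show "i \<in> Ix (X \<odot> Y) \<and> j \<in> Ix (X \<odot> Y)"
    using Ix' by (simp add: I)
  show "isometry C (Ob (X \<odot> Y) i) (Ob (X \<odot> Y) j) (Con (X \<odot> Y) j i)"
    using isometry_tens[OF ind_Con_isometry[OF X ij'(1)] ind_Con_isometry[OF Y ij'(2)]] Ix' ij'
    by (simp add: OC)
  fix l assume jl: "(j, l) \<in> Leq (X \<odot> Y)"
  then have jl': "(pre X j, pre X l) \<in> Leq X" "(suf X j, suf X l) \<in> Leq Y"
    by (simp_all add: L)
  note il' = ind_trans[OF X ij'(1) jl'(1)] ind_trans[OF Y ij'(2) jl'(2)]
  show "(i, l) \<in> Leq (X \<odot> Y)"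
    using il' by (simp add: L)
  show "Con (X \<odot> Y) l j \<cdot> Con (X \<odot> Y) j i = Con (X \<odot> Y) l i"
    using ij' jl' il' ind_Con_comp[OF X ij'(1) jl'(1)] ind_Con_comp[OF Y ij'(2) jl'(2)]
      tens_comp[OF ind_Con_hom[OF X ij'(1)] ind_Con_hom[OF X jl'(1)] ind_Con_hom[OF Y ij'(2)] ind_Con_hom[OF Y jl'(2)]]
    by (simp add: OC)
qed (auto simp: ind_tens_obj_simps(5,7))

lemma tens_ind_hom:
  assumes S: "S \<in> Hom (ind C) X Y" and T: "T \<in> Hom (ind C) X' Y'"
  shows "ind_tens_arr C S T \<in> Hom (ind C) (X \<odot> X') (Y \<odot> Y')"
proof -
  note s = ind_homD[OF S] and t = ind_homD[OF T]
  obtain M where M: "\<forall>k\<in>Ix Y. \<forall>i\<in>Ix X. Norm C (Cmp S k i) \<le> M" "M \<ge> 0" using s(8) by blast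
  obtain N where N: "\<forall>k\<in>Ix Y'. \<forall>i\<in>Ix X'. Norm C (Cmp T k i) \<le> N" "N \<ge> 0" using t(8) by blast
  note iffs = tens_Ix_iff[OF s(1)] tens_Ix_iff[OF s(2)] tens_Leq_iff[OF s(1)] tens_Leq_iff[OF s(2)]
    tens_Ob_Con[OF s(1)] tens_Ob_Con[OF s(2)]
  show ?thesis
    unfolding ind_tens_arr_def s(3,4) t(3,4)
  proof (rule mk_ind_arr_hom[OF tens_ind_obj[OF s(1) t(1)] tens_ind_obj[OF s(2) t(2)], where M = "M * N"])
    fix k i assume "k \<in> Ix (Y \<odot> Y')" "i \<in> Ix (X \<odot> X')"
    then have ki: "pre Y k \<in> Ix Y" "suf Y k \<in> Ix Y'" "pre X i \<in> Ix X" "suf X i \<in> Ix X'"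
      by (simp_all add: iffs)
    note h = s(5)[OF ki(1,3)] t(5)[OF ki(2,4)]
    show "Cmp S (pre Y k) (pre X i) \<otimes>\<^sub>a Cmp T (suf Y k) (suf X i)
        \<in> Hom C (Ob (X \<odot> X') i) (Ob (Y \<odot> Y') k)"
      using tens_hom[OF h] ki by (simp add: iffs)
    have "Norm C (Cmp S (pre Y k) (pre X i)) * Norm C (Cmp T (suf Y k) (suf X i)) \<le> M * N"
      using M N ki Norm_nonneg[OF h(2)] by (intro mult_mono) auto
    then show "Norm C (Cmp S (pre Y k) (pre X i) \<otimes>\<^sub>a Cmp T (suf Y k) (suf X i)) \<le> M * N"
      using Norm_tens_le[OF h] by simp
  next
    fix k l i assume "(k, l) \<in> Leq (Y \<odot> Y')" "i \<in> Ix (X \<odot> X')"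
    then have kl: "(pre Y k, pre Y l) \<in> Leq Y" "(suf Y k, suf Y l) \<in> Leq Y'"
      and i: "pre X i \<in> Ix X" "suf X i \<in> Ix X'"
      by (simp_all add: iffs)
    note l = ind_Leq_Ix(2)[OF s(2) kl(1)] ind_Leq_Ix(2)[OF t(2) kl(2)]
    note h = s(5)[OF l(1) i(1)] t(5)[OF l(2) i(2)] ind_Con_hom[OF s(2) kl(1)] ind_Con_hom[OF t(2) kl(2)]
    show "(Con (Y \<odot> Y') l k)\<^sup>\<dagger> \<cdot> (Cmp S (pre Y l) (pre X i) \<otimes>\<^sub>a Cmp T (suf Y l) (suf X i))
      = Cmp S (pre Y k) (pre X i) \<otimes>\<^sub>a Cmp T (suf Y k) (suf X i)"
      using kl tens_comp[OF h(1) adj_hom[OF h(3)] h(2) adj_hom[OF h(4)]] tens_adj[OF h(3,4)]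
        s(6)[OF kl(1) i(1)] t(6)[OF kl(2) i(2)] by (simp add: iffs)
  next
    fix k i j assume "k \<in> Ix (Y \<odot> Y')" "(i, j) \<in> Leq (X \<odot> X')"
    then have ij: "(pre X i, pre X j) \<in> Leq X" "(suf X i, suf X j) \<in> Leq X'"
      and k: "pre Y k \<in> Ix Y" "suf Y k \<in> Ix Y'"
      by (simp_all add: iffs)
    note j = ind_Leq_Ix(2)[OF s(1) ij(1)] ind_Leq_Ix(2)[OF t(1) ij(2)]
    note h = s(5)[OF k(1) j(1)] t(5)[OF k(2) j(2)] ind_Con_hom[OF s(1) ij(1)] ind_Con_hom[OF t(1) ij(2)]
    show "(Cmp S (pre Y k) (pre X j) \<otimes>\<^sub>a Cmp T (suf Y k) (suf X j)) \<cdot> Con (X \<odot> X') j i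
      = Cmp S (pre Y k) (pre X i) \<otimes>\<^sub>a Cmp T (suf Y k) (suf X i)"
      using ij tens_comp[OF h(3,1) h(4,2)] s(7)[OF k(1) ij(1)] t(7)[OF k(2) ij(2)] by (simp add: iffs)
  qed
qed

lemma tens_ind_Cmp:
  assumes S: "S \<in> Hom (ind C) X Y" and T: "T \<in> Hom (ind C) X' Y'"
    and "pre Y k \<in> Ix Y" "suf Y k \<in> Ix Y'" "pre X i \<in> Ix X" "suf X i \<in> Ix X'"
  shows "Cmp (ind_tens_arr C S T) k i =
    Cmp S (pre Y k) (pre X i) \<otimes>\<^sub>a Cmp T (suf Y k) (suf X i)"
proof -
  note s = ind_homD[OF S] and t = ind_homD[OF T]
  show ?thesis
    unfolding ind_tens_arr_def s(3,4) t(3,4)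
    using assms(3-6) by (simp add: tens_Ix_iff[OF s(1)] tens_Ix_iff[OF s(2)])
qed

lemma tens_ind_eqI:
  assumes "T \<in> Hom (ind C) (X \<odot> X') (Y \<odot> Y')"
    and "T' \<in> Hom (ind C) (X \<odot> X') (Y \<odot> Y')" and X: "X \<in> ind_objects C" and Y: "Y \<in> ind_objects C"
    and "\<And>k i. \<lbrakk>pre Y k \<in> Ix Y; suf Y k \<in> Ix Y'; pre X i \<in> Ix X; suf X i \<in> Ix X'\<rbrakk> \<Longrightarrow>
      Cmp T k i = Cmp T' k i"
  shows "T = T'"
  by (rule ind_arr_eqI[OF assms(1,2)]) (use assms(5) in \<open>auto simp: tens_Ix_iff[OF X] tens_Ix_iff[OF Y]\<close>)

text \<open>A product of nets over the product of the index sets. As for products of numbers, the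
  error splits into two parts, one of which needs a uniform bound on one of the nets.\<close>

lemma nlim_tens:
  assumes Y: "Y \<in> ind_objects C" and Y': "Y' \<in> ind_objects C"
    and s: "nlim Y A B s l" and t: "nlim Y' A' B' t l'" and M: "\<And>k. k \<in> Ix Y \<Longrightarrow> Norm C (s k) \<le> M"
  shows "nlim (Y \<odot> Y') (A \<otimes>\<^sub>o A') (B \<otimes>\<^sub>o B')
    (\<lambda>k. s (pre Y k) \<otimes>\<^sub>a t (suf Y k)) (l \<otimes>\<^sub>a l')"
proof -
  note s' = nlimD[OF s] and t' = nlimD[OF t]
  note YY = tens_ind_obj[OF Y Y']
  \<comment> \<open>Along the product index set each coordinate runs through its own tail; the
    starting point in the other coordinate is arbitrary.\<close>
  have f1: "filterlim (pre Y) (tail Y) (tail (Y \<odot> Y'))"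
    unfolding filterlim_iff
  proof (intro allI impI)
    fix P assume "eventually P (tail Y)"
    then obtain i where i: "i \<in> Ix Y" "\<And>k. (i, k) \<in> Leq Y \<Longrightarrow> P k"
      by (auto simp: eventually_tail[OF Y])
    obtain j where j: "j \<in> Ix Y'"
      using ind_Ix_nonempty[OF Y'] by blast
    have "i @ j \<in> Ix (Y \<odot> Y')"
      using i j by (auto simp: ind_tens_obj_simps)
    moreover have "P (pre Y k)" if "(i @ j, k) \<in> Leq (Y \<odot> Y')" for k
      using that i(2) ind_length[OF Y i(1)] by (simp add: tens_Leq_iff[OF Y])
    ultimately show "eventually (\<lambda>k. P (pre Y k)) (tail (Y \<odot> Y'))"
      unfolding eventually_tail[OF YY] by blast
  qed
  have f2: "filterlim (suf Y) (tail Y') (tail (Y \<odot> Y'))"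
    unfolding filterlim_iff
  proof (intro allI impI)
    fix P assume "eventually P (tail Y')"
    then obtain j where j: "j \<in> Ix Y'" "\<And>k. (j, k) \<in> Leq Y' \<Longrightarrow> P k"
      by (auto simp: eventually_tail[OF Y'])
    obtain i where i: "i \<in> Ix Y"
      using ind_Ix_nonempty[OF Y] by blast
    have "i @ j \<in> Ix (Y \<odot> Y')"
      using i j by (auto simp: ind_tens_obj_simps)
    moreover have "P (suf Y k)" if "(i @ j, k) \<in> Leq (Y \<odot> Y')" for k
      using that j(2) ind_length[OF Y i] by (simp add: tens_Leq_iff[OF Y])
    ultimately show "eventually (\<lambda>k. P (suf Y k)) (tail (Y \<odot> Y'))"
      unfolding eventually_tail[OF YY] by blast
  qed
  have "((\<lambda>k. M * cdist (t (suf Y k)) l' + cdist (s (pre Y k)) l * Norm C l') \<longlongrightarrow> M * 0 + 0 * Norm C l')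
      (tail (Y \<odot> Y'))"
    by (intro tendsto_add tendsto_mult tendsto_const filterlim_compose[OF s'(3) f1] filterlim_compose[OF t'(3) f2])
  then have lim: "((\<lambda>k. M * cdist (t (suf Y k)) l' + cdist (s (pre Y k)) l * Norm C l') \<longlongrightarrow> 0)
      (tail (Y \<odot> Y'))"
    by simp
  show ?thesis
  proof (rule nlim_bounded[OF YY tens_hom[OF s'(1) t'(1)] _ lim])
    fix k assume "k \<in> Ix (Y \<odot> Y')"
    then show "s (pre Y k) \<otimes>\<^sub>a t (suf Y k) \<in> Hom C (A \<otimes>\<^sub>o A') (B \<otimes>\<^sub>o B')"
      using s'(2) t'(2) tens_hom by (simp add: tens_Ix_iff[OF Y])
  next
    show "eventually (\<lambda>k. cdist (s (pre Y k) \<otimes>\<^sub>a t (suf Y k)) (l \<otimes>\<^sub>a l')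
        \<le> M * cdist (t (suf Y k)) l' + cdist (s (pre Y k)) l * Norm C l') (tail (Y \<odot> Y'))"
      using eventually_tail_Ix[OF YY]
    proof eventually_elim
      case (elim k)
      then have k: "pre Y k \<in> Ix Y" "suf Y k \<in> Ix Y'"
        by (simp_all add: tens_Ix_iff[OF Y])
      let ?s = "s (pre Y k)" and ?t = "t (suf Y k)"
      note hs = s'(2)[OF k(1)] and ht = t'(2)[OF k(2)]
      note d = Diff_hom[OF ht t'(1)] and d' = Diff_hom[OF hs s'(1)]
      have eq1: "?s \<otimes>\<^sub>a Diff C ?t l' = Diff C (?s \<otimes>\<^sub>a ?t) (?s \<otimes>\<^sub>a l')"
        unfolding Diff_def using tens_plus[OF hs ht scale_hom[OF t'(1)]] tens_scale[OF hs t'(1)] by simp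
      have eq2: "Diff C ?s l \<otimes>\<^sub>a l' = Diff C (?s \<otimes>\<^sub>a l') (l \<otimes>\<^sub>a l')"
        unfolding Diff_def using plus_tens[OF hs scale_hom[OF s'(1)] t'(1)] scale_tens[OF s'(1) t'(1)] by simp
      have "cdist (?s \<otimes>\<^sub>a ?t) (l \<otimes>\<^sub>a l') \<le> cdist (?s \<otimes>\<^sub>a ?t) (?s \<otimes>\<^sub>a l') + cdist (?s \<otimes>\<^sub>a l') (l \<otimes>\<^sub>a l')"
        by (rule cdist_triangle[OF tens_hom[OF hs ht] tens_hom[OF hs t'(1)] tens_hom[OF s'(1) t'(1)]])
      also have "\<dots> \<le> Norm C ?s * cdist ?t l' + cdist ?s l * Norm C l'"
        using Norm_tens_le[OF hs d] Norm_tens_le[OF d' t'(1)] eq1 eq2 by simp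
      also have "\<dots> \<le> M * cdist ?t l' + cdist ?s l * Norm C l'"
        using M[OF k(1)] Norm_nonneg[OF d] by (simp add: mult_right_mono)
      finally show ?case .
    qed
  qed
qed

text \<open>The terms of the composite on the right are tensor products of terms of the two
  composites on the left, by the interchange law in \<open>C\<close>; \<open>nlim_tens\<close>
  identifies the limits.\<close>

lemma tens_comp_ind:
  assumes S: "S \<in> Hom (ind C) Y Z" and T: "T \<in> Hom (ind C) X Y"
    and S': "S' \<in> Hom (ind C) Y' Z'" and T': "T' \<in> Hom (ind C) X' Y'"
  shows "ind_tens_arr C (ind_comp C S T) (ind_comp C S' T') =
    ind_comp C (ind_tens_arr C S S') (ind_tens_arr C T T')"
proof -
  note s = ind_homD[OF S] and s' = ind_homD[OF S'] and t = ind_homD[OF T] and t' = ind_homD[OF T']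
  note c = comp_ind_hom[OF S T] and c' = comp_ind_hom[OF S' T']
  note ss = tens_ind_hom[OF S S'] and tt = tens_ind_hom[OF T T']
  show ?thesis
  proof (rule tens_ind_eqI[OF tens_ind_hom[OF c c'] comp_ind_hom[OF ss tt] t(1) s(2)])
    fix m i assume mi: "pre Z m \<in> Ix Z" "suf Z m \<in> Ix Z'" "pre X i \<in> Ix X" "suf X i \<in> Ix X'"
    let ?m = "pre Z m" and ?m' = "suf Z m" and ?i = "pre X i" and ?i' = "suf X i"
    have m: "m \<in> Ix (Z \<odot> Z')" "i \<in> Ix (X \<odot> X')"
      using mi by (simp_all add: tens_Ix_iff[OF s(2)] tens_Ix_iff[OF t(1)])
    obtain M where M: "M \<ge> 0" "\<And>k. k \<in> Ix Y \<Longrightarrow> Norm C (Cmp S ?m k) \<le> M"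
      using s(8) mi(1) by blast
    obtain N where N: "N \<ge> 0" "\<And>k. k \<in> Ix Y \<Longrightarrow> Norm C (Cmp T k ?i) \<le> N"
      using t(8) mi(3) by blast
    have "Norm C (Cmp S ?m k \<cdot> Cmp T k ?i) \<le> M * N" if k: "k \<in> Ix Y" for k
    proof -
      have "Norm C (Cmp S ?m k \<cdot> Cmp T k ?i) \<le> Norm C (Cmp S ?m k) * Norm C (Cmp T k ?i)"
        by (rule Norm_Comp[OF t(5)[OF k mi(3)] s(5)[OF mi(1) k]])
      also have "\<dots> \<le> M * N"
        using M N k Norm_nonneg[OF t(5)[OF k mi(3)]] by (intro mult_mono) auto
      finally show ?thesis .
    qed
    note lim = nlim_tens[OF s(1) s'(1) comp_nlim[OF S T mi(1,3)] comp_nlim[OF S' T' mi(2,4)] this]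
    have "nlim (Y \<odot> Y') (Ob (X \<odot> X') i) (Ob (Z \<odot> Z') m)
      (\<lambda>k. Cmp (ind_tens_arr C S S') m k \<cdot> Cmp (ind_tens_arr C T T') k i)
      (Cmp (ind_comp C S T) ?m ?i \<otimes>\<^sub>a Cmp (ind_comp C S' T') ?m' ?i')"
    proof (rule nlim_cong[OF tens_ind_obj[OF s(1) s'(1)]])
      show "nlim (Y \<odot> Y') (Ob (X \<odot> X') i) (Ob (Z \<odot> Z') m)
        (\<lambda>k. (Cmp S ?m (pre Y k) \<cdot> Cmp T (pre Y k) ?i) \<otimes>\<^sub>a
             (Cmp S' ?m' (suf Y k) \<cdot> Cmp T' (suf Y k) ?i'))
        (Cmp (ind_comp C S T) ?m ?i \<otimes>\<^sub>a Cmp (ind_comp C S' T') ?m' ?i')"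
        using lim mi by (simp add: tens_Ob_Con[OF t(1)] tens_Ob_Con[OF s(2)])
      fix k assume "k \<in> Ix (Y \<odot> Y')"
      then have k: "pre Y k \<in> Ix Y" "suf Y k \<in> Ix Y'"
        by (simp_all add: tens_Ix_iff[OF s(1)])
      show "Cmp (ind_tens_arr C S S') m k \<cdot> Cmp (ind_tens_arr C T T') k i =
        (Cmp S ?m (pre Y k) \<cdot> Cmp T (pre Y k) ?i) \<otimes>\<^sub>a
             (Cmp S' ?m' (suf Y k) \<cdot> Cmp T' (suf Y k) ?i')"
        unfolding tens_ind_Cmp[OF S S' mi(1,2) k] tens_ind_Cmp[OF T T' k mi(3,4)]
        by (rule tens_comp[symmetric, OF t(5)[OF k(1) mi(3)] s(5)[OF mi(1) k(1)] t'(5)[OF k(2) mi(4)] s'(5)[OF mi(2) k(2)]])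
    qed
    then show "Cmp (ind_tens_arr C (ind_comp C S T) (ind_comp C S' T')) m i =
        Cmp (ind_comp C (ind_tens_arr C S S') (ind_tens_arr C T T')) m i"
      using comp_Cmp_eqI[OF ss tt m] tens_ind_Cmp[OF c c' mi] by simp
  qed
qed

text \<open>Equal lengths ensure that the combined indices are split at the same place in source and
  target.\<close>

lemma compatible_family_tens:
  assumes f: "compatible_family X Y f" and g: "compatible_family X' Y' g" and L: "Len Y = Len X"
  shows "compatible_family (X \<odot> X') (Y \<odot> Y')
    (\<lambda>m. f (pre X m) \<otimes>\<^sub>a g (suf X m))"
proof -
  note d = compatible_familyD[OF f] and e = compatible_familyD[OF g]
  note iffs = tens_Ix_iff[OF d(1)] tens_Ix_iff[OF d(2)] tens_Leq_iff[OF d(1)] tens_Leq_iff[OF d(2)]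
    tens_Ob_Con[OF d(1)] tens_Ob_Con[OF d(2)]
  obtain M where M: "\<And>i. i \<in> Ix X \<Longrightarrow> Norm C (f i) \<le> M" using d(8) by blast
  obtain N where N: "\<And>i. i \<in> Ix X' \<Longrightarrow> Norm C (g i) \<le> N" using e(8) by blast
  show ?thesis
  proof (rule compatible_familyI[OF tens_ind_obj[OF d(1) e(1)] tens_ind_obj[OF d(2) e(2)], where M = "\<bar>M\<bar> * \<bar>N\<bar>"])
    show "Ix (Y \<odot> Y') = Ix (X \<odot> X')" "Leq (Y \<odot> Y') = Leq (X \<odot> X')"
      using d(3,4) e(3,4) by (simp_all add: ind_tens_obj_simps)
    fix i assume "i \<in> Ix (X \<odot> X')"
    then have i: "pre X i \<in> Ix X" "suf X i \<in> Ix X'"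
      by (simp_all add: iffs)
    note h = d(5)[OF i(1)] e(5)[OF i(2)]
    show "f (pre X i) \<otimes>\<^sub>a g (suf X i) \<in> Hom C (Ob (X \<odot> X') i) (Ob (Y \<odot> Y') i)"
      using tens_hom[OF h] i d(3) e(3) L tens_Ob_Con(1)[OF d(2), of i Y'] by (simp add: iffs(5))
    have "Norm C (f (pre X i)) * Norm C (g (suf X i)) \<le> \<bar>M\<bar> * \<bar>N\<bar>"
      using M[OF i(1)] N[OF i(2)] Norm_nonneg[OF h(1)] Norm_nonneg[OF h(2)] by (intro mult_mono) auto
    then show "Norm C (f (pre X i) \<otimes>\<^sub>a g (suf X i)) \<le> \<bar>M\<bar> * \<bar>N\<bar>"
      using Norm_tens_le[OF h] by simp
  next
    fix i j assume "(i, j) \<in> Leq (X \<odot> X')"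
    then have ij: "(pre X i, pre X j) \<in> Leq X" "(suf X i, suf X j) \<in> Leq X'"
      by (simp_all add: iffs)
    note I = ind_Leq_Ix[OF d(1) ij(1)] ind_Leq_Ix[OF e(1) ij(2)]
    have ij': "(pre X i, pre X j) \<in> Leq Y" "(suf X i, suf X j) \<in> Leq Y'"
      using ij d(4) e(4) by auto
    note h = d(5)[OF I(1)] d(5)[OF I(2)] e(5)[OF I(3)] e(5)[OF I(4)]
      ind_Con_hom[OF d(1) ij(1)] ind_Con_hom[OF e(1) ij(2)] ind_Con_hom[OF d(2) ij'(1)] ind_Con_hom[OF e(2) ij'(2)]
    have con: "Con (Y \<odot> Y') j i = Con Y (pre X j) (pre X i) \<otimes>\<^sub>a Con Y' (suf X j) (suf X i)"
      using tens_Ob_Con(2)[OF d(2), of i j Y'] ij' L by simp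
    show "Con (Y \<odot> Y') j i \<cdot> (f (pre X i) \<otimes>\<^sub>a g (suf X i)) =
        (f (pre X j) \<otimes>\<^sub>a g (suf X j)) \<cdot> Con (X \<odot> X') j i"
      unfolding con tens_Ob_Con(2)[OF d(1) ij]
      using tens_comp[OF h(1,7,3,8)] tens_comp[OF h(5,2,6,4)] d(6)[OF ij(1)] e(6)[OF ij(2)] by simp
    show "Con (X \<odot> X') j i \<cdot> (f (pre X i) \<otimes>\<^sub>a g (suf X i))\<^sup>\<dagger> =
        (f (pre X j) \<otimes>\<^sub>a g (suf X j))\<^sup>\<dagger> \<cdot> Con (Y \<odot> Y') j i"
      unfolding con tens_Ob_Con(2)[OF d(1) ij] tens_adj[OF h(1,3)] tens_adj[OF h(2,4)]
      using tens_comp[OF adj_hom[OF h(1)] h(5) adj_hom[OF h(3)] h(6)]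
        tens_comp[OF h(7) adj_hom[OF h(2)] h(8) adj_hom[OF h(4)]] d(7)[OF ij(1)] e(7)[OF ij(2)] by simp
  qed
qed

lemma ind_map_tens:
  assumes f: "compatible_family X Y f" and g: "compatible_family X' Y' g" and L: "Len Y = Len X"
  shows "ind_tens_arr C (ind_map C X Y f) (ind_map C X' Y' g) =
    ind_map C (X \<odot> X') (Y \<odot> Y') (\<lambda>m. f (pre X m) \<otimes>\<^sub>a g (suf X m))"
proof -
  note d = compatible_familyD[OF f] and e = compatible_familyD[OF g]
  note F = ind_map_hom[OF f] and G = ind_map_hom[OF g]
  note fg = compatible_family_tens[OF assms]
  show ?thesis
  proof (rule tens_ind_eqI[OF tens_ind_hom[OF F G] ind_map_hom[OF fg] d(1,2)])
    fix k i assume ki: "pre Y k \<in> Ix Y" "suf Y k \<in> Ix Y'" "pre X i \<in> Ix X" "suf X i \<in> Ix X'"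
    then obtain a b where a: "(pre X k, a) \<in> Leq X" "(pre X i, a) \<in> Leq X"
      and b: "(suf X k, b) \<in> Leq X'" "(suf X i, b) \<in> Leq X'"
      using ind_directed[OF d(1), of "pre X k" "pre X i"]
        ind_directed[OF e(1), of "suf X k" "suf X i"] L d(3) e(3) by auto
    have len: "length a = Len X"
      using ind_length[OF d(1)] ind_Leq_Ix[OF d(1) a(1)] by blast
    have ab: "(k, a @ b) \<in> Leq (X \<odot> X')" "(i, a @ b) \<in> Leq (X \<odot> X')"
      using a b len by (simp_all add: tens_Leq_iff[OF d(1)])
    have a': "(pre X k, a) \<in> Leq Y" "(pre X i, a) \<in> Leq Y"
      and b': "(suf X k, b) \<in> Leq Y'" "(suf X i, b) \<in> Leq Y'"
      using a b d(4) e(4) by auto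
    have con: "Con (Y \<odot> Y') (a @ b) k = Con Y a (pre X k) \<otimes>\<^sub>a Con Y' b (suf X k)"
      "Con (Y \<odot> Y') (a @ b) i = Con Y a (pre X i) \<otimes>\<^sub>a Con Y' b (suf X i)"
      using tens_Ob_Con(2)[OF d(2), of _ "a @ b" Y'] a' b' L len by simp_all
    note h = ind_Con_hom[OF d(2) a'(1)] ind_Con_hom[OF d(2) a'(2)] ind_Con_hom[OF e(2) b'(1)] ind_Con_hom[OF e(2) b'(2)]
      d(5)[OF ki(3)] e(5)[OF ki(4)]
    show "Cmp (ind_tens_arr C (ind_map C X Y f) (ind_map C X' Y' g)) k i =
        Cmp (ind_map C (X \<odot> X') (Y \<odot> Y') (\<lambda>m. f (pre X m) \<otimes>\<^sub>a g (suf X m))) k i"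
      unfolding tens_ind_Cmp[OF F G ki] ind_map_Cmp[OF fg ab] con L ind_map_Cmp[OF f a] ind_map_Cmp[OF g b]
      using h by (simp add: Hom_iff)
  qed
qed

text \<open>Both sides are evaluated at a common upper bound \<open>l\<close>: compatibility of
  \<open>f\<close> moves it from \<open>i\<close> up to \<open>l\<close>, and compatibility of the
  adjoints moves it from \<open>l\<close> to \<open>k\<close>.\<close>

lemma ind_map_adj:
  assumes f: "compatible_family X Y f"
  shows "Adj (ind C) (ind_map C X Y f) = ind_map C Y X (\<lambda>i. (f i)\<^sup>\<dagger>)"
proof (rule ind_arr_eqI[OF adj_ind_hom[OF ind_map_hom[OF f]] ind_map_hom[OF compatible_family_adj[OF f]]])
  note d = compatible_familyD[OF f]
  fix i k assume i: "i \<in> Ix X" and k: "k \<in> Ix Y"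
  then obtain l where l: "(k, l) \<in> Leq X" "(i, l) \<in> Leq X"
    using ind_directed[OF d(1), of k i] d(3) by auto
  have l': "(k, l) \<in> Leq Y" "(i, l) \<in> Leq Y"
    using l d(4) by auto
  have kX: "k \<in> Ix X" and lX: "l \<in> Ix X"
    using ind_Leq_Ix[OF d(1)] l by auto
  note h = ind_Con_hom[OF d(2) l'(1)] ind_Con_hom[OF d(2) l'(2)] ind_Con_hom[OF d(1) l(1)] ind_Con_hom[OF d(1) l(2)]
    d(5)[OF i] d(5)[OF kX] d(5)[OF lX]
  have "Cmp (Adj (ind C) (ind_map C X Y f)) i k = ((Con Y l k)\<^sup>\<dagger> \<cdot> (f l \<cdot> Con X l i))\<^sup>\<dagger>"
    unfolding ind_op_Cmp(3)[OF ind_map_hom[OF f] k i] ind_map_Cmp[OF f l] d(6)[OF l(2)] ..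
  also have "\<dots> = (Con X l i)\<^sup>\<dagger> \<cdot> ((f l)\<^sup>\<dagger> \<cdot> Con Y l k)"
    using h by (simp add: Hom_iff)
  also have "\<dots> = Cmp (ind_map C Y X (\<lambda>i. (f i)\<^sup>\<dagger>)) i k"
    unfolding d(7)[OF l(1), symmetric] ind_map_Cmp[OF compatible_family_adj[OF f] l'(2,1)] ..
  finally show "Cmp (Adj (ind C) (ind_map C X Y f)) i k = Cmp (ind_map C Y X (\<lambda>i. (f i)\<^sup>\<dagger>)) i k" .
qed

lemma emb_ind_obj: "Y \<in> Obj C \<Longrightarrow> emb_obj C Y \<in> ind_objects C"
  by (rule ind_objectsI) (auto simp: emb_obj_def isometry_def id_hom)

text \<open>The unit is indexed by the empty list, so concatenation does not change indices, and the
  unit of \<open>C\<close> is strict. The convention that systems are \<open>undefined\<close> off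
  their domain turns this into equality of records.\<close>

lemma emb_tens_obj:
  assumes X: "X \<in> ind_objects C"
  shows "emb_obj C (Unit C) \<odot> X = X" "X \<odot> emb_obj C (Unit C) = X"
proof -
  have U: "emb_obj C (Unit C) \<in> ind_objects C"
    by (rule emb_ind_obj[OF obj_unit])
  show "emb_obj C (Unit C) \<odot> X = X"
  proof (rule ind_obj_eqI)
    show "Leq (emb_obj C (Unit C) \<odot> X) = Leq X" "Ix (emb_obj C (Unit C) \<odot> X) = Ix X"
      by (auto simp: ind_tens_obj_simps)
    show "Ob (emb_obj C (Unit C) \<odot> X) = Ob X"
    proof
      fix m show "Ob (emb_obj C (Unit C) \<odot> X) m = Ob X m"
        using tens_Ob_Con(1)[OF U, of m X] ind_tens_obj_simps(5)[of m C "emb_obj C (Unit C)" X]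
          tens_Ix_iff[OF U, of m X] ind_Ob[OF X] ind_Ob_undefined[OF X]
        by (cases "m \<in> Ix X") auto
    qed
    show "Con (emb_obj C (Unit C) \<odot> X) = Con X"
    proof (intro ext)
      fix m' m show "Con (emb_obj C (Unit C) \<odot> X) m' m = Con X m' m"
        using tens_Ob_Con(2)[OF U, of m m' X] ind_tens_obj_simps(7)[of m m' C "emb_obj C (Unit C)" X]
          tens_Leq_iff[OF U, of m m' X] unit_tens[OF ind_Con_hom[OF X]] ind_Con_undefined[OF X]
        by (cases "(m, m') \<in> Leq X") auto
    qed
  qed (simp add: ind_tens_obj_simps)
  show "X \<odot> emb_obj C (Unit C) = X"
  proof (rule ind_obj_eqI)
    show "Leq (X \<odot> emb_obj C (Unit C)) = Leq X" "Ix (X \<odot> emb_obj C (Unit C)) = Ix X"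
      by (auto simp: ind_tens_obj_simps)
    show "Ob (X \<odot> emb_obj C (Unit C)) = Ob X"
    proof
      fix m show "Ob (X \<odot> emb_obj C (Unit C)) m = Ob X m"
        using tens_Ob_Con(1)[OF X, of m "emb_obj C (Unit C)"] ind_tens_obj_simps(5)[of m C X "emb_obj C (Unit C)"]
          ind_length[OF X, of m] ind_Ob[OF X] ind_Ob_undefined[OF X]
        by (cases "m \<in> Ix X") (auto simp: ind_tens_obj_simps(2))
    qed
    show "Con (X \<odot> emb_obj C (Unit C)) = Con X"
    proof (intro ext)
      fix m' m show "Con (X \<odot> emb_obj C (Unit C)) m' m = Con X m' m"
        using tens_Ob_Con(2)[OF X, of m m' "emb_obj C (Unit C)"] ind_tens_obj_simps(7)[of m m' C X "emb_obj C (Unit C)"]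
          ind_length[OF X] ind_Leq_Ix[OF X, of m m']
          tens_unit[OF ind_Con_hom[OF X]] ind_Con_undefined[OF X]
        by (cases "(m, m') \<in> Leq X") (auto simp: ind_tens_obj_simps(3))
    qed
  qed (simp add: ind_tens_obj_simps)
qed

lemma emb_arr_Cmp [simp]: "Cmp (emb_arr C f) [] [] = f" "Src (emb_arr C f) = emb_obj C (Dom C f)"
  "Tgt (emb_arr C f) = emb_obj C (Cod C f)"
  by (simp_all add: emb_arr_def)

lemma emb_arr_hom:
  assumes "f \<in> Hom C X Y"
  shows "emb_arr C f \<in> Hom (ind C) (emb_obj C X) (emb_obj C Y)"
proof -
  have d: "Dom C f = X" "Cod C f = Y" and obj: "X \<in> Obj C" "Y \<in> Obj C"
    using assms Hom_Obj by (auto simp: Hom_iff)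
  show ?thesis
    unfolding emb_arr_def d
    by (rule mk_ind_arr_hom[where M = "Norm C f"]) (use assms obj in \<open>auto simp: emb_ind_obj Hom_iff\<close>)
qed

lemma Id_emb: "Y \<in> Obj C \<Longrightarrow> Id (ind C) (emb_obj C Y) = emb_arr C (Id C Y)"
proof -
  assume Y: "Y \<in> Obj C"
  note f = compatible_family_Id[OF emb_ind_obj[OF Y]]
  show ?thesis
    by (rule ind_arr_eqI[OF Id_ind_hom[OF emb_ind_obj[OF Y]] emb_arr_hom[OF id_hom[OF Y]]])
      (use Y ind_map_Cmp_up[OF f, of "[]" "[]"] in \<open>simp add: ind_ops\<close>)
qed

lemma unit_tens_ind:
  assumes T: "T \<in> Hom (ind C) X Y"
  shows "ind_tens_arr C (Id (ind C) (emb_obj C (Unit C))) T = T"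
    and "ind_tens_arr C T (Id (ind C) (emb_obj C (Unit C))) = T"
proof -
  note t = ind_homD[OF T]
  note i = emb_arr_hom[OF id_hom[OF obj_unit]]
  note u = emb_tens_obj[OF t(1)] emb_tens_obj[OF t(2)]
  have h: "ind_tens_arr C (emb_arr C (Id C (Unit C))) T \<in> Hom (ind C) X Y"
    "ind_tens_arr C T (emb_arr C (Id C (Unit C))) \<in> Hom (ind C) X Y"
    using tens_ind_hom[OF i T] tens_ind_hom[OF T i] u by simp_all
  show "ind_tens_arr C (Id (ind C) (emb_obj C (Unit C))) T = T"
    unfolding Id_emb[OF obj_unit]
    by (rule ind_arr_eqI[OF h(1) T])
      (use tens_ind_Cmp[OF i T] unit_tens[OF t(5)] in simp)
  show "ind_tens_arr C T (Id (ind C) (emb_obj C (Unit C))) = T"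
    unfolding Id_emb[OF obj_unit]
    by (rule ind_arr_eqI[OF h(2) T])
      (use tens_ind_Cmp[OF T i] tens_unit[OF t(5)] ind_length[OF t(1)] ind_length[OF t(2)] in simp)
qed

lemma tens_ind_bilinear:
  assumes S: "S \<in> Hom (ind C) X Y" and S': "S' \<in> Hom (ind C) X Y"
    and T: "T \<in> Hom (ind C) X' Y'" and T': "T' \<in> Hom (ind C) X' Y'"
  shows "ind_tens_arr C S (Plus (ind C) T T') = Plus (ind C) (ind_tens_arr C S T) (ind_tens_arr C S T')" (is ?p1)
    and "ind_tens_arr C (Plus (ind C) S S') T = Plus (ind C) (ind_tens_arr C S T) (ind_tens_arr C S' T)" (is ?p2)
    and "ind_tens_arr C S (Scale (ind C) z T) = Scale (ind C) z (ind_tens_arr C S T)" (is ?p3)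
    and "ind_tens_arr C (Scale (ind C) z S) T = Scale (ind C) z (ind_tens_arr C S T)" (is ?p4)
    and "Adj (ind C) (ind_tens_arr C S T) = ind_tens_arr C (Adj (ind C) S) (Adj (ind C) T)" (is ?p5)
proof -
  note s = ind_homD[OF S] and s' = ind_homD[OF S'] and t = ind_homD[OF T] and t' = ind_homD[OF T']
  note st = tens_ind_hom[OF S T] and st' = tens_ind_hom[OF S T'] and s't = tens_ind_hom[OF S' T]
  have I: "k \<in> Ix (Y \<odot> Y')" if "pre Y k \<in> Ix Y" "suf Y k \<in> Ix Y'" for k
    using that by (simp add: tens_Ix_iff[OF s(2)])
  have J: "i \<in> Ix (X \<odot> X')" if "pre X i \<in> Ix X" "suf X i \<in> Ix X'" for i
    using that by (simp add: tens_Ix_iff[OF s(1)])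
  show ?p1
    by (rule tens_ind_eqI[OF tens_ind_hom[OF S plus_ind_hom[OF T T']] plus_ind_hom[OF st st'] s(1,2)])
      (simp add: tens_ind_Cmp[OF S plus_ind_hom[OF T T']] ind_op_Cmp(1)[OF st I J] ind_op_Cmp(1)[OF T]
        tens_ind_Cmp[OF S T] tens_ind_Cmp[OF S T'] tens_plus[OF s(5) t(5) t'(5)])
  show ?p2
    by (rule tens_ind_eqI[OF tens_ind_hom[OF plus_ind_hom[OF S S'] T] plus_ind_hom[OF st s't] s(1,2)])
      (simp add: tens_ind_Cmp[OF plus_ind_hom[OF S S'] T] ind_op_Cmp(1)[OF st I J] ind_op_Cmp(1)[OF S]
        tens_ind_Cmp[OF S T] tens_ind_Cmp[OF S' T] plus_tens[OF s(5) s'(5) t(5)])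
  show ?p3
    by (rule tens_ind_eqI[OF tens_ind_hom[OF S scale_ind_hom[OF T]] scale_ind_hom[OF st] s(1,2)])
      (simp add: tens_ind_Cmp[OF S scale_ind_hom[OF T]] ind_op_Cmp(2)[OF st I J] ind_op_Cmp(2)[OF T]
        tens_ind_Cmp[OF S T] tens_scale[OF s(5) t(5)])
  show ?p4
    by (rule tens_ind_eqI[OF tens_ind_hom[OF scale_ind_hom[OF S] T] scale_ind_hom[OF st] s(1,2)])
      (simp add: tens_ind_Cmp[OF scale_ind_hom[OF S] T] ind_op_Cmp(2)[OF st I J] ind_op_Cmp(2)[OF S]
        tens_ind_Cmp[OF S T] scale_tens[OF s(5) t(5)])
  show ?p5
    by (rule tens_ind_eqI[OF adj_ind_hom[OF st] tens_ind_hom[OF adj_ind_hom[OF S] adj_ind_hom[OF T]] s(2,1)])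
      (simp add: tens_ind_Cmp[OF adj_ind_hom[OF S] adj_ind_hom[OF T]] ind_op_Cmp(3)[OF st I J] ind_op_Cmp(3)[OF S]
        ind_op_Cmp(3)[OF T] tens_ind_Cmp[OF S T] tens_adj[OF s(5) t(5)])
qed

definition assoc_family ::
  "('o, 'a, 'i) ind_obj \<Rightarrow> ('o, 'a, 'i) ind_obj \<Rightarrow> ('o, 'a, 'i) ind_obj \<Rightarrow> 'i list \<Rightarrow> 'a" where
  "assoc_family X Y Z m = Assoc C (Ob X (pre X m)) (Ob Y (pre Y (suf X m)))
     (Ob Z (drop (Len X + Len Y) m))"

lemma Assoc_ind: "Assoc (ind C) X Y Z = ind_map C
    ((X \<odot> Y) \<odot> Z) (X \<odot> (Y \<odot> Z)) (assoc_family X Y Z)"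
  unfolding ind_ops assoc_family_def[abs_def] ..

text \<open>Associativity of concatenation: the two bracketings of a triple product have literally
  the same index set and order. Hence the associator can be given by a family over one index
  set.\<close>

lemma tens3_simps:
  assumes X: "X \<in> ind_objects C" and Y: "Y \<in> ind_objects C" and Z: "Z \<in> ind_objects C"
  shows "m \<in> Ix ((X \<odot> Y) \<odot> Z) \<longleftrightarrow>
      pre X m \<in> Ix X \<and> pre Y (suf X m) \<in> Ix Y \<and> drop (Len X + Len Y) m \<in> Ix Z"
    and "m \<in> Ix (X \<odot> (Y \<odot> Z)) \<longleftrightarrow>
      pre X m \<in> Ix X \<and> pre Y (suf X m) \<in> Ix Y \<and> drop (Len X + Len Y) m \<in> Ix Z"
    and "(m, m') \<in> Leq ((X \<odot> Y) \<odot> Z) \<longleftrightarrow>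
      (pre X m, pre X m') \<in> Leq X \<and>
      (pre Y (suf X m), pre Y (suf X m')) \<in> Leq Y \<and>
      (drop (Len X + Len Y) m, drop (Len X + Len Y) m') \<in> Leq Z"
    and "(m, m') \<in> Leq (X \<odot> (Y \<odot> Z)) \<longleftrightarrow>
      (pre X m, pre X m') \<in> Leq X \<and>
      (pre Y (suf X m), pre Y (suf X m')) \<in> Leq Y \<and>
      (drop (Len X + Len Y) m, drop (Len X + Len Y) m') \<in> Leq Z"
  using X Y Z tens_ind_obj[OF X Y]
  by (auto simp: tens_Ix_iff tens_Leq_iff ind_tens_obj_simps(1) min_def drop_take add.commute)

lemma tens3_Ob_Con:
  assumes X: "X \<in> ind_objects C" and Y: "Y \<in> ind_objects C" and Z: "Z \<in> ind_objects C"
  shows "\<lbrakk>pre X m \<in> Ix X; pre Y (suf X m) \<in> Ix Y; drop (Len X + Len Y) m \<in> Ix Z\<rbrakk> \<Longrightarrow>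
      Ob ((X \<odot> Y) \<odot> Z) m =
      (Ob X (pre X m) \<otimes>\<^sub>o Ob Y (pre Y (suf X m))) \<otimes>\<^sub>o Ob Z (drop (Len X + Len Y) m)"
    and "\<lbrakk>pre X m \<in> Ix X; pre Y (suf X m) \<in> Ix Y; drop (Len X + Len Y) m \<in> Ix Z\<rbrakk> \<Longrightarrow>
      Ob (X \<odot> (Y \<odot> Z)) m =
      Ob X (pre X m) \<otimes>\<^sub>o (Ob Y (pre Y (suf X m)) \<otimes>\<^sub>o Ob Z (drop (Len X + Len Y) m))"
    and "\<lbrakk>(pre X m, pre X m') \<in> Leq X;
      (pre Y (suf X m), pre Y (suf X m')) \<in> Leq Y;
      (drop (Len X + Len Y) m, drop (Len X + Len Y) m') \<in> Leq Z\<rbrakk> \<Longrightarrow>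
      Con ((X \<odot> Y) \<odot> Z) m' m =
      (Con X (pre X m') (pre X m) \<otimes>\<^sub>a Con Y (pre Y (suf X m')) (pre Y (suf X m)))
        \<otimes>\<^sub>a Con Z (drop (Len X + Len Y) m') (drop (Len X + Len Y) m)"
    and "\<lbrakk>(pre X m, pre X m') \<in> Leq X;
      (pre Y (suf X m), pre Y (suf X m')) \<in> Leq Y;
      (drop (Len X + Len Y) m, drop (Len X + Len Y) m') \<in> Leq Z\<rbrakk> \<Longrightarrow>
      Con (X \<odot> (Y \<odot> Z)) m' m =
      Con X (pre X m') (pre X m) \<otimes>\<^sub>a (Con Y (pre Y (suf X m')) (pre Y (suf X m))
        \<otimes>\<^sub>a Con Z (drop (Len X + Len Y) m') (drop (Len X + Len Y) m))"
  using X Y Z tens_ind_obj[OF X Y]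
  by (simp_all add: tens_Ix_iff tens_Leq_iff tens_Ob_Con ind_tens_obj_simps(1) min_def drop_take add.commute)

text \<open>Kept abstract in the unitary natural family \<open>A\<close>, since it is applied both
  to the associator of \<open>C\<close> and to the twisted one. Naturality at the adjoints of the
  connecting maps gives compatibility of the adjoint family.\<close>

lemma compatible_family_natural:
  assumes X: "X \<in> ind_objects C" and Y: "Y \<in> ind_objects C" and Z: "Z \<in> ind_objects C"
    and U: "\<And>x y z. \<lbrakk>x \<in> Obj C; y \<in> Obj C; z \<in> Obj C\<rbrakk> \<Longrightarrow>
      unitary C ((x \<otimes>\<^sub>o y) \<otimes>\<^sub>o z) (x \<otimes>\<^sub>o (y \<otimes>\<^sub>o z)) (A x y z)"
    and N: "\<And>x x' y y' z z' f g h. \<lbrakk>f \<in> Hom C x x'; g \<in> Hom C y y'; h \<in> Hom C z z'\<rbrakk> \<Longrightarrow>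
      A x' y' z' \<cdot> ((f \<otimes>\<^sub>a g) \<otimes>\<^sub>a h) = (f \<otimes>\<^sub>a (g \<otimes>\<^sub>a h)) \<cdot> A x y z"
  shows "compatible_family ((X \<odot> Y) \<odot> Z) (X \<odot> (Y \<odot> Z))
    (\<lambda>m. A (Ob X (pre X m)) (Ob Y (pre Y (suf X m))) (Ob Z (drop (Len X + Len Y) m)))"
    (is "compatible_family ?V ?W ?A")
proof (rule compatible_familyI[where M = 1])
  note s = tens3_simps[OF X Y Z] and oc = tens3_Ob_Con[OF X Y Z]
  show "?V \<in> ind_objects C" "?W \<in> ind_objects C"
    using X Y Z tens_ind_obj by auto
  show "Ix ?W = Ix ?V"
    by (rule Set.set_eqI) (simp add: s)
  show "Leq ?W = Leq ?V"
    by (rule Set.set_eqI) (simp add: s split_paired_all)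
  fix m assume "m \<in> Ix ?V"
  then have m: "pre X m \<in> Ix X" "pre Y (suf X m) \<in> Ix Y" "drop (Len X + Len Y) m \<in> Ix Z"
    by (simp_all add: s)
  have u: "unitary C (Ob ?V m) (Ob ?W m) (?A m)"
    using U[OF ind_Ob[OF X m(1)] ind_Ob[OF Y m(2)] ind_Ob[OF Z m(3)]] m by (simp add: oc)
  then show "?A m \<in> Hom C (Ob ?V m) (Ob ?W m)"
    by (simp add: unitary_def)
  show "Norm C (?A m) \<le> 1"
    by (rule Norm_isometry_le) (use u in \<open>auto simp: unitary_def isometry_def\<close>)
next
  note s = tens3_simps[OF X Y Z] and oc = tens3_Ob_Con[OF X Y Z]
  fix i j assume "(i, j) \<in> Leq ?V"
  then have ij: "(pre X i, pre X j) \<in> Leq X"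
      "(pre Y (suf X i), pre Y (suf X j)) \<in> Leq Y"
      "(drop (Len X + Len Y) i, drop (Len X + Len Y) j) \<in> Leq Z"
    by (simp_all add: s)
  note h = ind_Con_hom[OF X ij(1)] ind_Con_hom[OF Y ij(2)] ind_Con_hom[OF Z ij(3)]
  have A: "?A k \<in> Arr C" "Dom C (?A k) = (Ob X (pre X k) \<otimes>\<^sub>o Ob Y (pre Y (suf X k))) \<otimes>\<^sub>o Ob Z (drop (Len X + Len Y) k)"
    "Cod C (?A k) = Ob X (pre X k) \<otimes>\<^sub>o (Ob Y (pre Y (suf X k)) \<otimes>\<^sub>o Ob Z (drop (Len X + Len Y) k))"
    if "k = i \<or> k = j" for k
    using U[of "Ob X (pre X k)" "Ob Y (pre Y (suf X k))" "Ob Z (drop (Len X + Len Y) k)"]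
      Hom_Obj[OF h(1)] Hom_Obj[OF h(2)] Hom_Obj[OF h(3)] that by (auto simp: unitary_def Hom_iff)
  show "Con ?W j i \<cdot> ?A i = ?A j \<cdot> Con ?V j i"
    using N[OF h] ij by (simp add: oc)
  have "(?A i \<cdot> (((Con X (pre X j) (pre X i))\<^sup>\<dagger> \<otimes>\<^sub>a
        (Con Y (pre Y (suf X j)) (pre Y (suf X i)))\<^sup>\<dagger>) \<otimes>\<^sub>a
        (Con Z (drop (Len X + Len Y) j) (drop (Len X + Len Y) i))\<^sup>\<dagger>))\<^sup>\<dagger> =
      (((Con X (pre X j) (pre X i))\<^sup>\<dagger> \<otimes>\<^sub>a
        ((Con Y (pre Y (suf X j)) (pre Y (suf X i)))\<^sup>\<dagger> \<otimes>\<^sub>a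
        (Con Z (drop (Len X + Len Y) j) (drop (Len X + Len Y) i))\<^sup>\<dagger>)) \<cdot> ?A j)\<^sup>\<dagger>"
    using N[OF adj_hom[OF h(1)] adj_hom[OF h(2)] adj_hom[OF h(3)]] by simp
  then show "Con ?V j i \<cdot> (?A i)\<^sup>\<dagger> = (?A j)\<^sup>\<dagger> \<cdot> Con ?W j i"
    using h ij A by (simp add: oc Hom_iff)
qed

lemma compatible_family_assoc:
  assumes "X \<in> ind_objects C" "Y \<in> ind_objects C" "Z \<in> ind_objects C"
  shows "compatible_family ((X \<odot> Y) \<odot> Z) (X \<odot> (Y \<odot> Z))
    (assoc_family X Y Z)"
  unfolding assoc_family_def[abs_def]
  by (rule compatible_family_natural[OF assms assoc_unitary assoc_natural])

lemma assoc_ind_unitary: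
  assumes X: "X \<in> ind_objects C" and Y: "Y \<in> ind_objects C" and Z: "Z \<in> ind_objects C"
  shows "unitary (ind C) ((X \<odot> Y) \<odot> Z) (X \<odot> (Y \<odot> Z))
    (Assoc (ind C) X Y Z)"
proof -
  let ?V = "(X \<odot> Y) \<odot> Z" and ?W = "X \<odot> (Y \<odot> Z)"
  note f = compatible_family_assoc[OF assms]
  note g = compatible_family_adj[OF f]
  note d = compatible_familyD[OF f]
  note s = tens3_simps[OF assms] and oc = tens3_Ob_Con[OF assms]
  have cancel: "(assoc_family X Y Z m)\<^sup>\<dagger> \<cdot> assoc_family X Y Z m = Id C (Ob ?V m)"
    "assoc_family X Y Z m \<cdot> (assoc_family X Y Z m)\<^sup>\<dagger> = Id C (Ob ?W m)" if "m \<in> Ix ?V" for m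
    using that ind_Ob[OF X] ind_Ob[OF Y] ind_Ob[OF Z] by (simp_all add: s oc assoc_family_def)
  have "Adj (ind C) (Assoc (ind C) X Y Z) \<cdot>\<^bsub>ind C\<^esub> Assoc (ind C) X Y Z = Id (ind C) ?V"
    unfolding Assoc_ind ind_map_adj[OF f] ind_simps(5) ind_map_comp[OF f g] ind_ops(1)
    by (rule ind_map_cong) (use cancel in auto)
  moreover have "Assoc (ind C) X Y Z \<cdot>\<^bsub>ind C\<^esub> Adj (ind C) (Assoc (ind C) X Y Z) = Id (ind C) ?W"
    unfolding Assoc_ind ind_map_adj[OF f] ind_simps(5) ind_map_comp[OF g f] ind_ops(1)
    by (rule ind_map_cong) (use cancel d(3) in auto)
  ultimately show ?thesis
    using ind_map_hom[OF f] by (simp add: unitary_def Assoc_ind)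
qed

lemma assoc_ind_natural:
  assumes f: "f \<in> Hom (ind C) X X'" and g: "g \<in> Hom (ind C) Y Y'" and h: "h \<in> Hom (ind C) Z Z'"
  shows "ind_comp C (Assoc (ind C) X' Y' Z') (ind_tens_arr C (ind_tens_arr C f g) h) =
    ind_comp C (ind_tens_arr C f (ind_tens_arr C g h)) (Assoc (ind C) X Y Z)"
proof -
  note f' = ind_homD[OF f] and g' = ind_homD[OF g] and h' = ind_homD[OF h]
  note a = compatible_family_assoc[OF f'(1) g'(1) h'(1)] and a' = compatible_family_assoc[OF f'(2) g'(2) h'(2)]
  note fgh = tens_ind_hom[OF tens_ind_hom[OF f g] h] and fgh' = tens_ind_hom[OF f tens_ind_hom[OF g h]]
  note s = tens3_simps[OF f'(1) g'(1) h'(1)] tens3_simps[OF f'(2) g'(2) h'(2)]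
  show ?thesis
    unfolding Assoc_ind
  proof (rule ind_arr_eqI[OF comp_ind_hom[OF ind_map_hom[OF a'] fgh] comp_ind_hom[OF fgh' ind_map_hom[OF a]]])
    fix m i assume m: "m \<in> Ix (X' \<odot> (Y' \<odot> Z'))"
      and i: "i \<in> Ix ((X \<odot> Y) \<odot> Z)"
    note mi = m[unfolded s] i[unfolded s]
    have l: "Cmp (ind_tens_arr C (ind_tens_arr C f g) h) m i =
      (Cmp f (pre X' m) (pre X i) \<otimes>\<^sub>a
       Cmp g (pre Y' (suf X' m)) (pre Y (suf X i))) \<otimes>\<^sub>a
       Cmp h (drop (Len X' + Len Y') m) (drop (Len X + Len Y) i)"
      using mi tens_ind_Cmp[OF tens_ind_hom[OF f g] h, of m i] tens_ind_Cmp[OF f g]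
      by (simp add: tens_Ix_iff[OF f'(1)] tens_Ix_iff[OF f'(2)] ind_tens_obj_simps(1) min_def drop_take)
    have r: "Cmp (ind_tens_arr C f (ind_tens_arr C g h)) m i =
      Cmp f (pre X' m) (pre X i) \<otimes>\<^sub>a
       (Cmp g (pre Y' (suf X' m)) (pre Y (suf X i)) \<otimes>\<^sub>a
       Cmp h (drop (Len X' + Len Y') m) (drop (Len X + Len Y) i))"
      using mi tens_ind_Cmp[OF f tens_ind_hom[OF g h], of m i] tens_ind_Cmp[OF g h]
      by (simp add: tens_Ix_iff[OF g'(1)] tens_Ix_iff[OF g'(2)] ind_tens_obj_simps(1) add.commute)
    show "Cmp (ind_comp C (ind_map C ((X' \<odot> Y') \<odot> Z') (X' \<odot> (Y' \<odot> Z'))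
          (assoc_family X' Y' Z')) (ind_tens_arr C (ind_tens_arr C f g) h)) m i =
        Cmp (ind_comp C (ind_tens_arr C f (ind_tens_arr C g h)) (ind_map C ((X \<odot> Y) \<odot> Z)
          (X \<odot> (Y \<odot> Z)) (assoc_family X Y Z))) m i"
      unfolding ind_map_comp_Cmp[OF a' fgh m i] comp_ind_map_Cmp[OF a fgh' m i] l r assoc_family_def
      by (rule assoc_natural) (use f'(5) g'(5) h'(5) mi in auto)
  qed
qed

text \<open>Every arrow of the diagram is induced by a compatible family, and such arrows compose
  and tensor termwise; what is left is the pentagon of \<open>C\<close> at each index.\<close>

lemma assoc_ind_pentagon:
  assumes X: "X \<in> ind_objects C" and Y: "Y \<in> ind_objects C" and Z: "Z \<in> ind_objects C" and W: "W \<in> ind_objects C"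
  shows "ind_comp C (Assoc (ind C) X Y (Z \<odot> W)) (Assoc (ind C) (X \<odot> Y) Z W) =
    ind_comp C (ind_comp C (ind_tens_arr C (Id (ind C) X) (Assoc (ind C) Y Z W)) (Assoc (ind C) X (Y \<odot> Z) W))
      (ind_tens_arr C (Assoc (ind C) X Y Z) (Id (ind C) W))"
proof -
  note XY = tens_ind_obj[OF X Y] and YZ = tens_ind_obj[OF Y Z] and ZW = tens_ind_obj[OF Z W]
  note a1 = compatible_family_assoc[OF X Y ZW] and a2 = compatible_family_assoc[OF XY Z W]
    and a3 = compatible_family_assoc[OF Y Z W] and a4 = compatible_family_assoc[OF X YZ W]
    and a5 = compatible_family_assoc[OF X Y Z]
  note iX = compatible_family_Id[OF X] and iW = compatible_family_Id[OF W]
  note t3 = compatible_family_tens[OF iX a3 refl]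
  have len: "Len (X \<odot> (Y \<odot> Z)) = Len ((X \<odot> Y) \<odot> Z)"
    by (simp add: ind_tens_obj_simps(1))
  note t5 = compatible_family_tens[OF a5 iW len]
  show ?thesis
    unfolding Assoc_ind ind_ops(1) ind_map_tens[OF iX a3 refl] ind_map_tens[OF a5 iW len]
      ind_map_comp[OF a2 a1] ind_map_comp[OF a4 t3] ind_map_comp[OF t5 compatible_family_comp[OF a4 t3]]
  proof (rule ind_map_cong)
    fix m assume "m \<in> Ix (((X \<odot> Y) \<odot> Z) \<odot> W)"
    then have m: "pre X m \<in> Ix X" "pre Y (suf X m) \<in> Ix Y"
      "pre Z (drop (Len X + Len Y) m) \<in> Ix Z" "drop (Len X + Len Y + Len Z) m \<in> Ix W"
      using tens3_simps(1)[OF XY Z W, of m] tens_Ix_iff[OF X]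
      by (simp_all add: ind_tens_obj_simps(1) min_def drop_take)
    let ?x = "Ob X (pre X m)" and ?y = "Ob Y (pre Y (suf X m))"
      and ?z = "Ob Z (pre Z (drop (Len X + Len Y) m))" and ?w = "Ob W (drop (Len X + Len Y + Len Z) m)"
    have o1: "Ob (Z \<odot> W) (drop (Len X + Len Y) m) = ?z \<otimes>\<^sub>o ?w"
      using tens_Ob_Con(1)[OF Z, of "drop (Len X + Len Y) m" W] m by (simp add: ac_simps)
    have o2: "Ob (X \<odot> Y) (take (Len X + Len Y) m) = ?x \<otimes>\<^sub>o ?y"
      using tens_Ob_Con(1)[OF X, of "take (Len X + Len Y) m" Y] m by (simp add: min_def drop_take)
    have o3: "Ob (Y \<odot> Z) (take (Len Y + Len Z) (suf X m)) = ?y \<otimes>\<^sub>o ?z"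
      using tens_Ob_Con(1)[OF Y, of "take (Len Y + Len Z) (suf X m)" Z] m
      by (simp add: min_def drop_take add.commute)
    have "assoc_family X Y (Z \<odot> W) m = Assoc C ?x ?y (?z \<otimes>\<^sub>o ?w)"
      "assoc_family (X \<odot> Y) Z W m = Assoc C (?x \<otimes>\<^sub>o ?y) ?z ?w"
      "assoc_family Y Z W (suf X m) = Assoc C ?y ?z ?w"
      "assoc_family X (Y \<odot> Z) W m = Assoc C ?x (?y \<otimes>\<^sub>o ?z) ?w"
      "assoc_family X Y Z (take (Len X + Len Y + Len Z) m) = Assoc C ?x ?y ?z"
      using o1 o2 o3 by (simp_all add: assoc_family_def ind_tens_obj_simps(1) min_def drop_take ac_simps)
    then show "assoc_family X Y (Z \<odot> W) m \<cdot> assoc_family (X \<odot> Y) Z W m =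
      ((Ob X (pre X m)) \<lhd> assoc_family Y Z W (suf X m)) \<cdot> assoc_family X (Y \<odot> Z) W m \<cdot>
      (assoc_family X Y Z (pre ((X \<odot> Y) \<odot> Z) m) \<otimes>\<^sub>a
        Id C (Ob W (suf ((X \<odot> Y) \<odot> Z) m)))"
      using pentagon_eq[OF ind_Ob[OF X m(1)] ind_Ob[OF Y m(2)] ind_Ob[OF Z m(3)] ind_Ob[OF W m(4)]]
      by (simp add: ind_tens_obj_simps(1))
  qed simp_all
qed

lemma star_tensor_category_ind:
  "star_tensor_category (ind C :: (('o, 'a, 'i) ind_obj, ('o, 'a, 'i) ind_arr) tensor_cat)"
proof -
  interpret D: star_category "ind C :: (('o, 'a, 'i) ind_obj, ('o, 'a, 'i) ind_arr) tensor_cat"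
    by (rule star_category_ind)
  show ?thesis
  proof
    fix X Y :: "('o, 'a, 'i) ind_obj" assume X: "X \<in> Obj (ind C)" and Y: "Y \<in> Obj (ind C)"
    show "X \<otimes>\<^sub>o\<^bsub>ind C\<^esub> Y \<in> Obj (ind C)"
      using X Y tens_ind_obj by simp
    show "Id (ind C) X \<otimes>\<^sub>a\<^bsub>ind C\<^esub> Id (ind C) Y = Id (ind C) (X \<otimes>\<^sub>o\<^bsub>ind C\<^esub> Y)"
    proof -
      have X': "X \<in> ind_objects C" and Y': "Y \<in> ind_objects C"
        using X Y by simp_all
      show ?thesis
        unfolding ind_ops(1) ind_simps ind_map_tens[OF compatible_family_Id[OF X'] compatible_family_Id[OF Y'] refl]
        by (rule ind_map_cong) (auto simp: tens_Ix_iff[OF X'] tens_Ob_Con[OF X'] ind_Ob[OF X'] ind_Ob[OF Y'])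
    qed
    show "Assoc (ind C) X (Unit (ind C)) Y = Id (ind C) (X \<otimes>\<^sub>o\<^bsub>ind C\<^esub> Y)"
    proof -
      have X': "X \<in> ind_objects C" and Y': "Y \<in> ind_objects C"
        using X Y by simp_all
      show ?thesis
        unfolding Assoc_ind ind_ops(1) ind_simps
      proof (rule ind_map_cong)
        show "(X \<odot> emb_obj C (Unit C)) \<odot> Y = X \<odot> Y"
          "X \<odot> (emb_obj C (Unit C) \<odot> Y) = X \<odot> Y"
          by (simp_all add: emb_tens_obj X' Y')
        fix m assume "m \<in> Ix (X \<odot> Y)"
        then show "assoc_family X (emb_obj C (Unit C)) Y m = Id C (Ob (X \<odot> Y) m)"
          using ind_Ob[OF X'] ind_Ob[OF Y']
          by (simp add: assoc_family_def tens_Ix_iff[OF X'] tens_Ob_Con[OF X'] triangle_eq)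
      qed
    qed
  qed (simp_all add: tens_ind_hom tens_comp_ind tens_ind_bilinear emb_ind_obj emb_tens_obj unit_tens_ind
      assoc_ind_unitary assoc_ind_pentagon assoc_ind_natural)
qed

end

subsection \<open>Gradings of the ind-category\<close>

text \<open>Converts the given grading, where products are homogeneous up to isomorphism, into the
  form with projections. The degree of the unit is not among the axioms of a grading and has to be
  derived.\<close>

lemma (in cstar_tensor_category) graded_star_tensor_categoryI:
  assumes "graded C \<Gamma> G"
  shows "graded_star_tensor_category C \<Gamma> G"
proof -
  interpret graded_star_category C \<Gamma> G
  proof (intro graded_star_category.intro graded_star_category_axioms.intro)
    show "star_category C" ..
    show "group \<Gamma>" "finite (carrier \<Gamma>)"
      using assms by (auto simp: graded_def)
    show "Hom C X Y \<subseteq> {Zero C X Y}"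
      if "\<gamma> \<in> carrier \<Gamma>" "\<eta> \<in> carrier \<Gamma>" "\<gamma> \<noteq> \<eta>" "X \<in> G \<gamma>" "Y \<in> G \<eta>" for \<gamma> \<eta> X Y
      using assms that unfolding graded_def by blast
    show "\<exists>Y v. homogeneous_decomposition C \<Gamma> G X Y v" if "X \<in> Obj C" for X
      using assms that unfolding graded_def by blast
  qed
  interpret \<Gamma>: group \<Gamma>
    by (rule grading_group)
  have tens: "proj (\<gamma> \<otimes>\<^bsub>\<Gamma>\<^esub> \<eta>) (X \<otimes>\<^sub>o Y) \<cdot> (proj \<gamma> X \<otimes>\<^sub>a proj \<eta> Y) = proj \<gamma> X \<otimes>\<^sub>a proj \<eta> Y"
    if X: "X \<in> Obj C" and Y: "Y \<in> Obj C" and \<gamma>: "\<gamma> \<in> carrier \<Gamma>" and \<eta>: "\<eta> \<in> carrier \<Gamma>" for X Y \<gamma> \<eta>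
  proof -
    obtain V v where d: "homogeneous_decomposition C \<Gamma> G X V v"
      using ex_decomposition X by blast
    obtain W w where e: "homogeneous_decomposition C \<Gamma> G Y W w"
      using ex_decomposition Y by blast
    note v = decompositionD[OF d \<gamma>] and w = decompositionD[OF e \<eta>]
    have obj: "V \<gamma> \<in> Obj C" "W \<eta> \<in> Obj C"
      using v w Hom_Obj by auto
    have \<gamma>\<eta>: "\<gamma> \<otimes>\<^bsub>\<Gamma>\<^esub> \<eta> \<in> carrier \<Gamma>"
      using \<gamma> \<eta> by simp
    obtain Z f g where Z: "Z \<in> G (\<gamma> \<otimes>\<^bsub>\<Gamma>\<^esub> \<eta>)" "f \<in> Hom C (V \<gamma> \<otimes>\<^sub>o W \<eta>) Z" "g \<in> Hom C Z (V \<gamma> \<otimes>\<^sub>o W \<eta>)"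
      "g \<cdot> f = Id C (V \<gamma> \<otimes>\<^sub>o W \<eta>)"
      using assms v(1) w(1) \<gamma> \<eta> unfolding graded_def isomorphic_def by meson
    have ZO: "Z \<in> Obj C"
      using Z Hom_Obj by blast
    let ?p = "proj (\<gamma> \<otimes>\<^bsub>\<Gamma>\<^esub> \<eta>)"
    \<comment> \<open>By naturality the projection of total degree can be computed through the
      isomorphism with the homogeneous object \<open>Z\<close>, where it is the identity.\<close>
    have "?p (V \<gamma> \<otimes>\<^sub>o W \<eta>) = (g \<cdot> f) \<cdot> ?p (V \<gamma> \<otimes>\<^sub>o W \<eta>)"
      unfolding Z(4) using obj \<gamma>\<eta> by simp
    also have "\<dots> = g \<cdot> (?p Z \<cdot> f)"
      unfolding proj_natural[OF Z(2) \<gamma>\<eta>] using Z(2,3) obj \<gamma>\<eta> by (simp add: Hom_iff)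
    also have "\<dots> = Id C (V \<gamma> \<otimes>\<^sub>o W \<eta>)"
      using proj_homogeneous[OF ZO Z(1) \<gamma>\<eta> \<gamma>\<eta>] id_comp[OF Z(2)] Z(4) by simp
    finally have one: "?p (V \<gamma> \<otimes>\<^sub>o W \<eta>) = Id C (V \<gamma> \<otimes>\<^sub>o W \<eta>)" .
    note vw = tens_hom[OF v(3) w(3)] and vw' = tens_hom[OF adj_hom[OF v(3)] adj_hom[OF w(3)]]
    have "proj \<gamma> X \<otimes>\<^sub>a proj \<eta> Y = (v \<gamma> \<otimes>\<^sub>a w \<eta>) \<cdot> ((v \<gamma>)\<^sup>\<dagger> \<otimes>\<^sub>a (w \<eta>)\<^sup>\<dagger>)"
      unfolding proj_eq[OF d X \<gamma>] proj_eq[OF e Y \<eta>]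
      by (rule tens_comp[OF adj_hom[OF v(3)] v(3) adj_hom[OF w(3)] w(3)])
    moreover have "?p (X \<otimes>\<^sub>o Y) \<cdot> ((v \<gamma> \<otimes>\<^sub>a w \<eta>) \<cdot> ((v \<gamma>)\<^sup>\<dagger> \<otimes>\<^sub>a (w \<eta>)\<^sup>\<dagger>)) =
        (v \<gamma> \<otimes>\<^sub>a w \<eta>) \<cdot> ((v \<gamma>)\<^sup>\<dagger> \<otimes>\<^sub>a (w \<eta>)\<^sup>\<dagger>)"
      using comp_assoc[OF vw' vw proj_hom[OF tens_obj[OF X Y] \<gamma>\<eta>]] proj_natural[OF vw \<gamma>\<eta>] one comp_id[OF vw]
      by simp
    ultimately show ?thesis by simp
  qed
  have unit: "proj \<one>\<^bsub>\<Gamma>\<^esub> (Unit C) = Id C (Unit C)"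
  proof -
    \<comment> \<open>Endomorphisms of the unit are scalars, so each of its degree projections is a
      scalar with \<open>z z = z\<close>.\<close>
    have scalar: "proj \<gamma> (Unit C) = Zero C (Unit C) (Unit C) \<or> proj \<gamma> (Unit C) = Id C (Unit C)"
      if \<gamma>: "\<gamma> \<in> carrier \<Gamma>" for \<gamma>
    proof -
      obtain z where z: "proj \<gamma> (Unit C) = z \<bullet> Id C (Unit C)"
        using Unit_simple[OF proj_hom[OF obj_unit \<gamma>]] by blast
      note i = id_hom[OF obj_unit]
      have "(z * z) \<bullet> Id C (Unit C) = z \<bullet> Id C (Unit C)"
        using proj_proj[OF obj_unit \<gamma> \<gamma>] z by simp
      then have "(z * z + - z) \<bullet> Id C (Unit C) = (z + - z) \<bullet> Id C (Unit C)"
        unfolding plus_scale[OF i] by simp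
      then have "cmod (z * z + - z) = cmod (z + - z)"
        using Norm_Scale[OF i] Norm_Unit by (metis mult_1_right)
      then have "z = 0 \<or> z = 1"
        by simp
      then show ?thesis
        using z scale_zero_num[OF i] scale_one[OF i] by auto
    qed
    have "\<exists>\<gamma>\<in>carrier \<Gamma>. proj \<gamma> (Unit C) \<noteq> Zero C (Unit C) (Unit C)"
    proof (rule ccontr)
      assume "\<not> ?thesis"
      then have "Sum C (Unit C) (Unit C) (\<lambda>\<gamma>. proj \<gamma> (Unit C)) (carrier \<Gamma>) = Zero C (Unit C) (Unit C)"
        by (intro Sum_zero) auto
      then show False
        using proj_resolution[OF obj_unit] Unit_nonzero by (simp add: id_resolution_def)
    qed
    then obtain \<gamma> where \<gamma>: "\<gamma> \<in> carrier \<Gamma>" "proj \<gamma> (Unit C) = Id C (Unit C)"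
      using scalar by blast
    \<comment> \<open>As the unit is strictly its own tensor square, its degree
      \<open>\<gamma>\<close> satisfies \<open>\<gamma> \<gamma> = \<gamma>\<close>, which in a
      group forces \<open>\<gamma> = \<one>\<close>.\<close>
    have "proj (\<gamma> \<otimes>\<^bsub>\<Gamma>\<^esub> \<gamma>) (Unit C) = Id C (Unit C)"
      using tens[OF obj_unit obj_unit \<gamma>(1) \<gamma>(1)] \<gamma> by simp
    then have "\<gamma> \<otimes>\<^bsub>\<Gamma>\<^esub> \<gamma> = \<gamma>"
      using proj_proj[OF obj_unit _ \<gamma>(1), of "\<gamma> \<otimes>\<^bsub>\<Gamma>\<^esub> \<gamma>"] \<gamma> Unit_nonzero by (auto split: if_splits)
    then have "\<gamma> = \<one>\<^bsub>\<Gamma>\<^esub>"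
      using \<gamma>(1) by (metis \<Gamma>.l_cancel_one)
    then show ?thesis using \<gamma> by simp
  qed
  show ?thesis
    by unfold_locales (fact tens, fact unit)
qed

section \<open>Comparison of the ind-category of the twist with the twist of the
  ind-category\<close>

lemma ind_twist_simps [simp]:
  "isometry (twist C \<Gamma> G \<omega>) = isometry C" "Diff (twist C \<Gamma> G \<omega>) = Diff C"
  "ind_objects (twist C \<Gamma> G \<omega>) = ind_objects C" "ind_arrows (twist C \<Gamma> G \<omega>) = ind_arrows C"
  "ind_map (twist C \<Gamma> G \<omega>) = ind_map C" "ind_comp (twist C \<Gamma> G \<omega>) = ind_comp C"
  "ind_tens_obj (twist C \<Gamma> G \<omega>) = ind_tens_obj C" "ind_tens_arr (twist C \<Gamma> G \<omega>) = ind_tens_arr C"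
  "emb_obj (twist C \<Gamma> G \<omega>) = emb_obj C" "emb_arr (twist C \<Gamma> G \<omega>) = emb_arr C"
proof -
  show iso: "isometry (twist C \<Gamma> G \<omega>) = isometry C"
    by (simp add: isometry_def fun_eq_iff)
  show diff: "Diff (twist C \<Gamma> G \<omega>) = Diff C"
    by (simp add: Diff_def fun_eq_iff)
  show obj: "ind_objects (twist C \<Gamma> G \<omega>) = ind_objects C"
    by (simp add: ind_objects_def iso)
  show "ind_arrows (twist C \<Gamma> G \<omega>) = ind_arrows C"
    by (simp add: ind_arrows_def obj)
  show "ind_map (twist C \<Gamma> G \<omega>) = ind_map C"
    by (simp add: ind_map_def fun_eq_iff)
  show "ind_comp (twist C \<Gamma> G \<omega>) = ind_comp C"
    by (simp add: ind_comp_def net_limit_def fun_eq_iff diff)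
  show t: "ind_tens_obj (twist C \<Gamma> G \<omega>) = ind_tens_obj C"
    by (intro ext) (simp only: ind_tens_obj_def twist_simps)
  show "ind_tens_arr (twist C \<Gamma> G \<omega>) = ind_tens_arr C"
    by (simp add: ind_tens_arr_def fun_eq_iff t)
  show e: "emb_obj (twist C \<Gamma> G \<omega>) = emb_obj C"
    by (simp add: emb_obj_def fun_eq_iff)
  show "emb_arr (twist C \<Gamma> G \<omega>) = emb_arr C"
    by (simp add: emb_arr_def fun_eq_iff e)
qed

lemma ind_twist_fields [simp]:
  "Id (ind (twist C \<Gamma> G \<omega>)) = Id (ind C)" "Zero (ind (twist C \<Gamma> G \<omega>)) = Zero (ind C)"
  "Plus (ind (twist C \<Gamma> G \<omega>)) = Plus (ind C)" "Scale (ind (twist C \<Gamma> G \<omega>)) = Scale (ind C)"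
  "Adj (ind (twist C \<Gamma> G \<omega>)) = Adj (ind C)" "Norm (ind (twist C \<Gamma> G \<omega>)) = Norm (ind C)"
  by (simp_all add: ind_def)

lemma Hom_ind_twist [simp]: "Hom (ind (twist C \<Gamma> G \<omega>)) = Hom (ind C)"
  by (simp add: Hom_def fun_eq_iff)

lemma unitary_ind_twist [simp]: "unitary (ind (twist C \<Gamma> G \<omega>)) = unitary (ind C)"
  by (simp add: unitary_def fun_eq_iff)

text \<open>The two associators to be compared are known to agree only at objects; elsewhere their
  values are not controlled, so the records need not be equal and the axioms have to be carried
  over.\<close>

lemma star_tensor_category_cong:
  fixes A B :: "('o, 'a) tensor_cat"
  assumes A: "star_tensor_category A" and B: "B = A\<lparr>Assoc := \<alpha>\<rparr>"
    and \<alpha>: "\<And>X Y Z. \<lbrakk>X \<in> Obj A; Y \<in> Obj A; Z \<in> Obj A\<rbrakk> \<Longrightarrow> \<alpha> X Y Z = Assoc A X Y Z"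
  shows "star_tensor_category B"
proof -
  interpret star_tensor_category A by (rule A)
  have [simp]: "Hom (A\<lparr>Assoc := \<alpha>\<rparr>) = Hom A"
    by (simp add: Hom_def fun_eq_iff)
  have [simp]: "unitary (A\<lparr>Assoc := \<alpha>\<rparr>) = unitary A"
    by (simp add: unitary_def fun_eq_iff)
  have nat: "\<alpha> X' Y' Z' \<cdot>\<^bsub>A\<^esub> ((f \<otimes>\<^sub>a\<^bsub>A\<^esub> g) \<otimes>\<^sub>a\<^bsub>A\<^esub> h) = (f \<otimes>\<^sub>a\<^bsub>A\<^esub> (g \<otimes>\<^sub>a\<^bsub>A\<^esub> h)) \<cdot>\<^bsub>A\<^esub> \<alpha> X Y Z"
    if "f \<in> Hom A X X'" "g \<in> Hom A Y Y'" "h \<in> Hom A Z Z'" for f g h X X' Y Y' Z Z'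
    using assoc_natural[OF that] Hom_Obj[OF that(1)] Hom_Obj[OF that(2)] Hom_Obj[OF that(3)] \<alpha> by simp
  show ?thesis
    unfolding B
    by unfold_locales
      (simp_all add: dom_cod id_hom comp_hom comp_id id_comp comp_assoc zero_hom plus_hom scale_hom
        plus_assoc plus_zero plus_minus scale_plus plus_scale scale_scale scale_one comp_plus plus_comp
        comp_scale scale_comp adj_hom adj_adj adj_comp adj_plus adj_scale tens_hom tens_comp tens_plus
        plus_tens tens_scale scale_tens tens_adj unit_tens tens_unit \<alpha> assoc_unitary nat
        pentagon_eq triangle_eq plus_comm)
qed

locale twisted_ind_category = ind_category C + twisted_star_tensor_category C \<Gamma> G \<omega>
  for C :: "('o, 'a) tensor_cat" (structure) and \<Gamma> :: "'g monoid" and G :: "'g \<Rightarrow> 'o set"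
    and \<omega> :: "'g \<Rightarrow> 'g \<Rightarrow> 'g \<Rightarrow> complex"
begin

lemma Norm_proj_le: "\<lbrakk>X \<in> Obj C; \<gamma> \<in> carrier \<Gamma>\<rbrakk> \<Longrightarrow> Norm C (proj \<gamma> X) \<le> 1"
proof -
  assume X: "X \<in> Obj C" and \<gamma>: "\<gamma> \<in> carrier \<Gamma>"
  note p = proj_hom[OF X \<gamma>]
  have "(Norm C (proj \<gamma> X))\<^sup>2 = Norm C (proj \<gamma> X)"
    using Norm_Adj_Comp[OF p] X \<gamma> by (simp add: proj_proj)
  then show ?thesis
    by (metis mult_cancel_left1 power2_eq_square order_refl zero_le_one)
qed

lemma compatible_family_proj:
  assumes X: "X \<in> ind_objects C" and \<gamma>: "\<gamma> \<in> carrier \<Gamma>"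
  shows "compatible_family X X (\<lambda>i. proj \<gamma> (Ob X i))"
proof (rule compatible_familyI[where M = 1])
  fix i assume i: "i \<in> Ix X"
  show "proj \<gamma> (Ob X i) \<in> Hom C (Ob X i) (Ob X i)" "Norm C (proj \<gamma> (Ob X i)) \<le> 1"
    using proj_hom[OF ind_Ob[OF X i] \<gamma>] Norm_proj_le[OF ind_Ob[OF X i] \<gamma>] by auto
next
  fix i j assume ij: "(i, j) \<in> Leq X"
  show "Con X j i \<cdot> proj \<gamma> (Ob X i) = proj \<gamma> (Ob X j) \<cdot> Con X j i"
    "Con X j i \<cdot> (proj \<gamma> (Ob X i))\<^sup>\<dagger> = (proj \<gamma> (Ob X j))\<^sup>\<dagger> \<cdot> Con X j i"
    using proj_natural[OF ind_Con_hom[OF X ij] \<gamma>] ind_Ob[OF X] ind_Leq_Ix[OF X ij] \<gamma> by auto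
qed (use X in auto)

text \<open>Every term \<open>X i\<close> is decomposed separately, with no coherence between the
  choices. As degree projections commute with the connecting maps, the homogeneous parts still form
  an inductive system.\<close>

lemma ex_ind_decomposition:
  assumes X: "X \<in> ind_objects C"
  obtains Y v where "\<And>\<gamma>. \<gamma> \<in> carrier \<Gamma> \<Longrightarrow> Y \<gamma> \<in> ind_grading C G \<gamma>"
    "\<And>\<gamma>. \<gamma> \<in> carrier \<Gamma> \<Longrightarrow> compatible_family (Y \<gamma>) X (v \<gamma>)"
    "\<And>\<gamma> i. \<lbrakk>\<gamma> \<in> carrier \<Gamma>; i \<in> Ix X\<rbrakk> \<Longrightarrow> (v \<gamma> i)\<^sup>\<dagger> \<cdot> v \<gamma> i = Id C (Ob (Y \<gamma>) i)"
    "\<And>\<gamma> i. \<lbrakk>\<gamma> \<in> carrier \<Gamma>; i \<in> Ix X\<rbrakk> \<Longrightarrow> v \<gamma> i \<cdot> (v \<gamma> i)\<^sup>\<dagger> = proj \<gamma> (Ob X i)"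
proof -
  have "\<forall>i\<in>Ix X. \<exists>V w. homogeneous_decomposition C \<Gamma> G (Ob X i) V w"
    using ex_decomposition ind_Ob[OF X] by blast
  then obtain V w where dec: "\<And>i. i \<in> Ix X \<Longrightarrow> homogeneous_decomposition C \<Gamma> G (Ob X i) (V i) (w i)"
    by metis
  \<comment> \<open>The connecting maps of the degree \<open>\<gamma>\<close> part are the
    compressions of those of \<open>X\<close>. They remain isometric because the connecting maps of
    \<open>X\<close> send the summand of degree \<open>\<gamma>\<close> into the corresponding
    summand.\<close>
  define Y where "Y \<gamma> = \<lparr>Len = Len X, Ix = Ix X, Leq = Leq X,
      Ob = (\<lambda>i. if i \<in> Ix X then V i \<gamma> else undefined),
      Con = (\<lambda>j i. if (i, j) \<in> Leq X then (w j \<gamma>)\<^sup>\<dagger> \<cdot> (Con X j i \<cdot> w i \<gamma>) else undefined)\<rparr>" for \<gamma>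
  have Y_simps: "Len (Y \<gamma>) = Len X" "Ix (Y \<gamma>) = Ix X" "Leq (Y \<gamma>) = Leq X"
    "i \<in> Ix X \<Longrightarrow> Ob (Y \<gamma>) i = V i \<gamma>" "i \<notin> Ix X \<Longrightarrow> Ob (Y \<gamma>) i = undefined"
    "(i, j) \<in> Leq X \<Longrightarrow> Con (Y \<gamma>) j i = (w j \<gamma>)\<^sup>\<dagger> \<cdot> (Con X j i \<cdot> w i \<gamma>)"
    "(i, j) \<notin> Leq X \<Longrightarrow> Con (Y \<gamma>) j i = undefined" for \<gamma> i j
    by (simp_all add: Y_def)
  have w: "V i \<gamma> \<in> G \<gamma>" "isometry C (V i \<gamma>) (Ob X i) (w i \<gamma>)" "w i \<gamma> \<in> Hom C (V i \<gamma>) (Ob X i)"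
    "(w i \<gamma>)\<^sup>\<dagger> \<cdot> w i \<gamma> = Id C (V i \<gamma>)" "w i \<gamma> \<cdot> (w i \<gamma>)\<^sup>\<dagger> = proj \<gamma> (Ob X i)" "V i \<gamma> \<in> Obj C"
    if "i \<in> Ix X" "\<gamma> \<in> carrier \<Gamma>" for i \<gamma>
    using decompositionD[OF dec[OF that(1)] that(2)] proj_eq[OF dec[OF that(1)] ind_Ob[OF X that(1)] that(2)]
      Hom_Obj by auto
  have nat: "w j \<gamma> \<cdot> Con (Y \<gamma>) j i = Con X j i \<cdot> w i \<gamma>" "Con (Y \<gamma>) j i \<cdot> (w i \<gamma>)\<^sup>\<dagger> = (w j \<gamma>)\<^sup>\<dagger> \<cdot> Con X j i"
    "Con (Y \<gamma>) j i \<in> Hom C (V i \<gamma>) (V j \<gamma>)"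
    if ij: "(i, j) \<in> Leq X" and \<gamma>: "\<gamma> \<in> carrier \<Gamma>" for i j \<gamma>
  proof -
    note I = ind_Leq_Ix[OF X ij]
    note wi = w[OF I(1) \<gamma>] and wj = w[OF I(2) \<gamma>]
    note c = ind_Con_hom[OF X ij]
    note cw = comp_hom[OF wi(3) c]
    have "w j \<gamma> \<cdot> Con (Y \<gamma>) j i = (w j \<gamma> \<cdot> (w j \<gamma>)\<^sup>\<dagger>) \<cdot> (Con X j i \<cdot> w i \<gamma>)"
      unfolding Y_simps(6)[OF ij] by (rule comp_assoc[symmetric, OF cw adj_hom[OF wj(3)] wj(3)])
    also have "\<dots> = (Con X j i \<cdot> proj \<gamma> (Ob X i)) \<cdot> w i \<gamma>"
      unfolding wj(5) using proj_natural[OF c \<gamma>] comp_assoc[OF wi(3) c proj_hom[OF ind_Ob[OF X I(2)] \<gamma>]] by simp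
    also have "\<dots> = Con X j i \<cdot> (w i \<gamma> \<cdot> ((w i \<gamma>)\<^sup>\<dagger> \<cdot> w i \<gamma>))"
      unfolding wi(5)[symmetric] using c wi(3) by (simp add: Hom_iff)
    finally show "w j \<gamma> \<cdot> Con (Y \<gamma>) j i = Con X j i \<cdot> w i \<gamma>"
      using wi(4) comp_id[OF wi(3)] by simp
    have "Con (Y \<gamma>) j i \<cdot> (w i \<gamma>)\<^sup>\<dagger> = (w j \<gamma>)\<^sup>\<dagger> \<cdot> (Con X j i \<cdot> (w i \<gamma> \<cdot> (w i \<gamma>)\<^sup>\<dagger>))"
      unfolding Y_simps(6)[OF ij] using c wi(3) wj(3) by (simp add: Hom_iff)
    also have "\<dots> = ((w j \<gamma>)\<^sup>\<dagger> \<cdot> (w j \<gamma> \<cdot> (w j \<gamma>)\<^sup>\<dagger>)) \<cdot> Con X j i"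
      unfolding wi(5) wj(5) proj_natural[OF c \<gamma>, symmetric]
      by (rule comp_assoc[symmetric, OF c proj_hom[OF ind_Ob[OF X I(2)] \<gamma>] adj_hom[OF wj(3)]])
    also have "(w j \<gamma>)\<^sup>\<dagger> \<cdot> (w j \<gamma> \<cdot> (w j \<gamma>)\<^sup>\<dagger>) = (w j \<gamma>)\<^sup>\<dagger>"
      using isometry_cancel[OF wj(2), of "(w j \<gamma>)\<^sup>\<dagger>"] wj(3) by (simp add: Hom_iff)
    finally show "Con (Y \<gamma>) j i \<cdot> (w i \<gamma>)\<^sup>\<dagger> = (w j \<gamma>)\<^sup>\<dagger> \<cdot> Con X j i" .
    show "Con (Y \<gamma>) j i \<in> Hom C (V i \<gamma>) (V j \<gamma>)"
      unfolding Y_simps(6)[OF ij] by (rule comp_hom[OF cw adj_hom[OF wj(3)]])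
  qed
  have Y_obj: "Y \<gamma> \<in> ind_objects C" if \<gamma>: "\<gamma> \<in> carrier \<Gamma>" for \<gamma>
  proof (rule ind_objectsI, unfold Y_simps(1-3))
    fix i assume i: "i \<in> Ix X"
    note wi = w[OF i \<gamma>]
    show "Con (Y \<gamma>) i i = Id C (Ob (Y \<gamma>) i)"
      using ind_refl[OF X i] i ind_Con_Id[OF X i] wi(4) id_comp[OF wi(3)] by (simp add: Y_simps)
    show "Ob (Y \<gamma>) i \<in> Obj C"
      using i wi(6) by (simp add: Y_simps)
  next
    fix i j assume ij: "(i, j) \<in> Leq X"
    note I = ind_Leq_Ix[OF X ij]
    note wi = w[OF I(1) \<gamma>] and wj = w[OF I(2) \<gamma>]
    note c = ind_Con_hom[OF X ij] and n = nat[OF ij \<gamma>]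
    have "(Con (Y \<gamma>) j i)\<^sup>\<dagger> \<cdot> Con (Y \<gamma>) j i = (Con (Y \<gamma>) j i)\<^sup>\<dagger> \<cdot> ((w j \<gamma>)\<^sup>\<dagger> \<cdot> (w j \<gamma> \<cdot> Con (Y \<gamma>) j i))"
      using isometry_cancel[OF wj(2), of "Con (Y \<gamma>) j i"] n(3) by (simp add: Hom_iff)
    also have "\<dots> = (w j \<gamma> \<cdot> Con (Y \<gamma>) j i)\<^sup>\<dagger> \<cdot> (w j \<gamma> \<cdot> Con (Y \<gamma>) j i)"
      using n(3) wj(3) by (simp add: Hom_iff)
    also have "\<dots> = (w i \<gamma>)\<^sup>\<dagger> \<cdot> ((Con X j i)\<^sup>\<dagger> \<cdot> (Con X j i \<cdot> w i \<gamma>))"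
      unfolding n(1) using c wi(3) by (simp add: Hom_iff)
    also have "\<dots> = Id C (V i \<gamma>)"
      using isometry_cancel[OF ind_Con_isometry[OF X ij], of "w i \<gamma>"] wi(3,4) by (simp add: Hom_iff)
    finally show "isometry C (Ob (Y \<gamma>) i) (Ob (Y \<gamma>) j) (Con (Y \<gamma>) j i)"
      using n(3) I by (simp add: isometry_def Y_simps(4))
    fix l assume jl: "(j, l) \<in> Leq X"
    note il = ind_trans[OF X ij jl]
    note L = ind_Leq_Ix(2)[OF X jl]
    note wl = w[OF L \<gamma>] and m = nat[OF jl \<gamma>] and c' = ind_Con_hom[OF X jl]
    have "Con (Y \<gamma>) l j \<cdot> Con (Y \<gamma>) j i = (w l \<gamma>)\<^sup>\<dagger> \<cdot> ((w l \<gamma> \<cdot> Con (Y \<gamma>) l j) \<cdot> Con (Y \<gamma>) j i)"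
      using isometry_cancel[OF wl(2), of "Con (Y \<gamma>) l j \<cdot> Con (Y \<gamma>) j i"] n(3) m(3) wl(3) by (simp add: Hom_iff)
    also have "\<dots> = (w l \<gamma>)\<^sup>\<dagger> \<cdot> (Con X l j \<cdot> (w j \<gamma> \<cdot> Con (Y \<gamma>) j i))"
      unfolding m(1) using n(3) c' wj(3) by (simp add: Hom_iff)
    also have "\<dots> = (w l \<gamma>)\<^sup>\<dagger> \<cdot> ((Con X l j \<cdot> Con X j i) \<cdot> w i \<gamma>)"
      unfolding n(1) using c c' wi(3) by (simp add: Hom_iff)
    also have "\<dots> = Con (Y \<gamma>) l i"
      unfolding ind_Con_comp[OF X ij jl] Y_simps(6)[OF il] ..
    finally show "Con (Y \<gamma>) l j \<cdot> Con (Y \<gamma>) j i = Con (Y \<gamma>) l i" .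
  next
    show "(i, l) \<in> Leq X" if "(i, j) \<in> Leq X" "(j, l) \<in> Leq X" for i j l
      using ind_trans[OF X that] .
    show "\<exists>l. (i, l) \<in> Leq X \<and> (j, l) \<in> Leq X" if "i \<in> Ix X" "j \<in> Ix X" for i j
      using ind_directed[OF X that] .
    show "i \<in> Ix X \<and> j \<in> Ix X" if "(i, j) \<in> Leq X" for i j
      using ind_Leq_Ix[OF X that] by blast
  qed (simp_all add: Y_simps(5,7) ind_Ix_nonempty[OF X] ind_length[OF X] ind_refl[OF X])
  show thesis
  proof (rule that[of Y "\<lambda>\<gamma> i. w i \<gamma>"])
    fix \<gamma> assume \<gamma>: "\<gamma> \<in> carrier \<Gamma>"
    show "Y \<gamma> \<in> ind_grading C G \<gamma>"
      using Y_obj[OF \<gamma>] w(1)[OF _ \<gamma>] by (simp add: ind_grading_def Y_simps)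
    show "compatible_family (Y \<gamma>) X (\<lambda>i. w i \<gamma>)"
    proof (rule compatible_familyI[where M = 1], unfold Y_simps(2,3))
      fix i assume i: "i \<in> Ix X"
      show "w i \<gamma> \<in> Hom C (Ob (Y \<gamma>) i) (Ob X i)" "Norm C (w i \<gamma>) \<le> 1"
        using w(3)[OF i \<gamma>] Norm_isometry_le[OF w(2)[OF i \<gamma>]] i by (simp_all add: Y_simps)
    next
      fix i j assume ij: "(i, j) \<in> Leq X"
      show "Con X j i \<cdot> w i \<gamma> = w j \<gamma> \<cdot> Con (Y \<gamma>) j i"
        "Con (Y \<gamma>) j i \<cdot> (w i \<gamma>)\<^sup>\<dagger> = (w j \<gamma>)\<^sup>\<dagger> \<cdot> Con X j i"
        using nat[OF ij \<gamma>] by auto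
    qed (use Y_obj[OF \<gamma>] X in auto)
    fix i assume i: "i \<in> Ix X"
    show "(w i \<gamma>)\<^sup>\<dagger> \<cdot> w i \<gamma> = Id C (Ob (Y \<gamma>) i)" "w i \<gamma> \<cdot> (w i \<gamma>)\<^sup>\<dagger> = proj \<gamma> (Ob X i)"
      using w(4,5)[OF i \<gamma>] i by (simp_all add: Y_simps)
  qed
qed

lemma Sum_ind_map:
  assumes "finite A" and X: "X \<in> ind_objects C" and Y: "Y \<in> ind_objects C"
    and "\<And>a. a \<in> A \<Longrightarrow> T a \<in> Hom (ind C) X Y" and k: "k \<in> Ix Y" and i: "i \<in> Ix X"
  shows "Cmp (Sum (ind C) X Y T A) k i = Sum C (Ob X i) (Ob Y k) (\<lambda>a. Cmp (T a) k i) A"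
  using assms(1,4)
proof (induction A)
  interpret D: star_category "ind C"
    by (rule star_category_ind)
  case empty
  show ?case
    using X Y k i ind_Ob[OF X i] ind_Ob[OF Y k] ind_op_Cmp(4)[OF zero_ind_hom[OF X Y] k i]
    by (simp add: Sum_empty D.Sum_empty)
next
  interpret D: star_category "ind C"
    by (rule star_category_ind)
  case (insert a A)
  have "Cmp (Sum (ind C) X Y T (insert a A)) k i = Cmp (T a \<boxplus>\<^bsub>ind C\<^esub> Sum (ind C) X Y T A) k i"
    using insert X Y by (subst D.Sum_insert) auto
  also have "\<dots> = Cmp (T a) k i \<boxplus> Sum C (Ob X i) (Ob Y k) (\<lambda>a. Cmp (T a) k i) A"
    using insert ind_op_Cmp(1)[OF _ k i] by simp
  also have "\<dots> = Sum C (Ob X i) (Ob Y k) (\<lambda>a. Cmp (T a) k i) (insert a A)"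
    using insert ind_Ob[OF X i] ind_Ob[OF Y k] ind_homD(5)[OF _ k i] by (subst Sum_insert) auto
  finally show ?case .
qed

lemma ex_ind_homogeneous_decomposition:
  assumes X: "X \<in> ind_objects C"
  obtains Y v where "homogeneous_decomposition (ind C) \<Gamma> (ind_grading C G) X Y v"
    "\<And>\<gamma>. \<gamma> \<in> carrier \<Gamma> \<Longrightarrow> v \<gamma> \<cdot>\<^bsub>ind C\<^esub> Adj (ind C) (v \<gamma>) = ind_map C X X (\<lambda>i. proj \<gamma> (Ob X i))"
proof -
  obtain Y v where Y: "\<And>\<gamma>. \<gamma> \<in> carrier \<Gamma> \<Longrightarrow> Y \<gamma> \<in> ind_grading C G \<gamma>"
    and v: "\<And>\<gamma>. \<gamma> \<in> carrier \<Gamma> \<Longrightarrow> compatible_family (Y \<gamma>) X (v \<gamma>)"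
    and vv: "\<And>\<gamma> i. \<lbrakk>\<gamma> \<in> carrier \<Gamma>; i \<in> Ix X\<rbrakk> \<Longrightarrow> (v \<gamma> i)\<^sup>\<dagger> \<cdot> v \<gamma> i = Id C (Ob (Y \<gamma>) i)"
      "\<And>\<gamma> i. \<lbrakk>\<gamma> \<in> carrier \<Gamma>; i \<in> Ix X\<rbrakk> \<Longrightarrow> v \<gamma> i \<cdot> (v \<gamma> i)\<^sup>\<dagger> = proj \<gamma> (Ob X i)"
    using ex_ind_decomposition[OF X] by metis
  interpret D: star_category "ind C"
    by (rule star_category_ind)
  define V where "V \<gamma> = ind_map C (Y \<gamma>) X (v \<gamma>)" for \<gamma>
  have VV: "V \<gamma> \<cdot>\<^bsub>ind C\<^esub> Adj (ind C) (V \<gamma>) = ind_map C X X (\<lambda>i. proj \<gamma> (Ob X i))"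
    "Adj (ind C) (V \<gamma>) \<cdot>\<^bsub>ind C\<^esub> V \<gamma> = Id (ind C) (Y \<gamma>)" if \<gamma>: "\<gamma> \<in> carrier \<Gamma>" for \<gamma>
  proof -
    note c = v[OF \<gamma>] and c' = compatible_family_adj[OF v[OF \<gamma>]]
    show "V \<gamma> \<cdot>\<^bsub>ind C\<^esub> Adj (ind C) (V \<gamma>) = ind_map C X X (\<lambda>i. proj \<gamma> (Ob X i))"
      unfolding V_def ind_map_adj[OF c] ind_simps(5) ind_map_comp[OF c' c]
      by (rule ind_map_cong) (use vv(2)[OF \<gamma>] in auto)
    show "Adj (ind C) (V \<gamma>) \<cdot>\<^bsub>ind C\<^esub> V \<gamma> = Id (ind C) (Y \<gamma>)"
      unfolding V_def ind_map_adj[OF c] ind_simps(5) ind_map_comp[OF c c'] ind_ops(1)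
      by (rule ind_map_cong) (use vv(1)[OF \<gamma>] compatible_familyD(3)[OF c] in auto)
  qed
  have P: "ind_map C X X (\<lambda>i. proj \<gamma> (Ob X i)) \<in> Hom (ind C) X X" if "\<gamma> \<in> carrier \<Gamma>" for \<gamma>
    by (rule ind_map_hom[OF compatible_family_proj[OF X that]])
  have "Sum (ind C) X X (\<lambda>\<gamma>. V \<gamma> \<cdot>\<^bsub>ind C\<^esub> Adj (ind C) (V \<gamma>)) (carrier \<Gamma>) =
      Sum (ind C) X X (\<lambda>\<gamma>. ind_map C X X (\<lambda>i. proj \<gamma> (Ob X i))) (carrier \<Gamma>)"
    by (rule D.Sum_cong) (use X VV P in auto)
  also have "\<dots> = Id (ind C) X"
  proof (rule ind_arr_eqI[OF _ Id_ind_hom[OF X]])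
    show "Sum (ind C) X X (\<lambda>\<gamma>. ind_map C X X (\<lambda>i. proj \<gamma> (Ob X i))) (carrier \<Gamma>) \<in> Hom (ind C) X X"
      by (rule D.Sum_hom) (use X P in auto)
    fix k i assume k: "k \<in> Ix X" and i: "i \<in> Ix X"
    obtain l where l: "(k, l) \<in> Leq X" "(i, l) \<in> Leq X"
      using ind_directed[OF X k i] by blast
    note c = ind_Con_hom[OF X l(1)] ind_Con_hom[OF X l(2)]
    note cc = comp_hom[OF c(2) adj_hom[OF c(1)]]
    note O = ind_Ob[OF X i] ind_Ob[OF X k]
    have "Cmp (Sum (ind C) X X (\<lambda>\<gamma>. ind_map C X X (\<lambda>i. proj \<gamma> (Ob X i))) (carrier \<Gamma>)) k i =
        Sum C (Ob X i) (Ob X k) (\<lambda>\<gamma>. Cmp (ind_map C X X (\<lambda>i. proj \<gamma> (Ob X i))) k i) (carrier \<Gamma>)"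
      by (rule Sum_ind_map) (use X P k i in auto)
    also have "\<dots> = Sum C (Ob X i) (Ob X k) (\<lambda>\<gamma>. ((Con X l k)\<^sup>\<dagger> \<cdot> Con X l i) \<cdot> proj \<gamma> (Ob X i)) (carrier \<Gamma>)"
    proof (rule Sum_cong[OF O])
      fix \<gamma> assume \<gamma>: "\<gamma> \<in> carrier \<Gamma>"
      show "((Con X l k)\<^sup>\<dagger> \<cdot> Con X l i) \<cdot> proj \<gamma> (Ob X i) \<in> Hom C (Ob X i) (Ob X k)"
        by (rule comp_hom[OF proj_hom[OF O(1) \<gamma>] cc])
      show "Cmp (ind_map C X X (\<lambda>i. proj \<gamma> (Ob X i))) k i = ((Con X l k)\<^sup>\<dagger> \<cdot> Con X l i) \<cdot> proj \<gamma> (Ob X i)"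
        unfolding ind_map_Cmp[OF compatible_family_proj[OF X \<gamma>] l]
        by (rule comp_assoc[symmetric, OF proj_hom[OF O(1) \<gamma>] c(2) adj_hom[OF c(1)]])
    qed
    also have "\<dots> = ((Con X l k)\<^sup>\<dagger> \<cdot> Con X l i) \<cdot> Sum C (Ob X i) (Ob X i) (\<lambda>\<gamma>. proj \<gamma> (Ob X i)) (carrier \<Gamma>)"
      by (rule comp_Sum[symmetric, OF finite_grading O(1) _ cc]) (use proj_hom[OF O(1)] in auto)
    also have "\<dots> = ((Con X l k)\<^sup>\<dagger> \<cdot> Con X l i) \<cdot> Id C (Ob X i)"
      using proj_resolution[OF O(1)] by (simp add: id_resolution_def)
    also have "\<dots> = Cmp (Id (ind C) X) k i"
      unfolding ind_ops(1) ind_map_Cmp[OF compatible_family_Id[OF X] l]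
      by (rule comp_assoc[OF id_hom[OF O(1)] c(2) adj_hom[OF c(1)]])
    finally show "Cmp (Sum (ind C) X X (\<lambda>\<gamma>. ind_map C X X (\<lambda>i. proj \<gamma> (Ob X i))) (carrier \<Gamma>)) k i = Cmp (Id (ind C) X) k i" .
  qed
  finally have "homogeneous_decomposition (ind C) \<Gamma> (ind_grading C G) X Y V"
    unfolding homogeneous_decomposition_def isometry_def
    using Y VV(2) ind_map_hom[OF v] by (auto simp: V_def)
  then show thesis
    using that VV(1) by blast
qed

text \<open>Every entry of a morphism between systems of different degrees is a morphism between
  different degrees in \<open>C\<close>, hence zero.\<close>

lemma graded_star_category_ind:
  "graded_star_category (ind C :: (('o, 'a, 'i) ind_obj, ('o, 'a, 'i) ind_arr) tensor_cat) \<Gamma> (ind_grading C G)"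
proof -
  interpret D: star_category "ind C :: (('o, 'a, 'i) ind_obj, ('o, 'a, 'i) ind_arr) tensor_cat"
    by (rule star_category_ind)
  show ?thesis
  proof
    fix \<gamma> \<eta> and X Y :: "('o, 'a, 'i) ind_obj"
    assume g: "\<gamma> \<in> carrier \<Gamma>" "\<eta> \<in> carrier \<Gamma>" "\<gamma> \<noteq> \<eta>"
      and XY: "X \<in> ind_grading C G \<gamma>" "Y \<in> ind_grading C G \<eta>"
    show "Hom (ind C) X Y \<subseteq> {Zero (ind C) X Y}"
    proof
      fix T assume T: "T \<in> Hom (ind C) X Y"
      note t = ind_homD[OF T]
      have "T = Zero (ind C) X Y"
      proof (rule ind_arr_eqI[OF T zero_ind_hom[OF t(1,2)]])
        fix k i assume k: "k \<in> Ix Y" and i: "i \<in> Ix X"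
        have "Ob X i \<in> G \<gamma>" "Ob Y k \<in> G \<eta>"
          using XY k i by (auto simp: ind_grading_def)
        then have "Cmp T k i = Zero C (Ob X i) (Ob Y k)"
          using homogeneous_orthogonal[OF g] t(5)[OF k i] by blast
        then show "Cmp T k i = Cmp (Zero (ind C) X Y) k i"
          using ind_op_Cmp(4)[OF T k i] by simp
      qed
      then show "T \<in> {Zero (ind C) X Y}" by simp
    qed
  next
    fix X :: "('o, 'a, 'i) ind_obj" assume "X \<in> Obj (ind C)"
    then have "X \<in> ind_objects C" by simp
    then show "\<exists>Y v. homogeneous_decomposition (ind C) \<Gamma> (ind_grading C G) X Y v"
      by (metis ex_ind_homogeneous_decomposition)
  qed (simp_all add: grading_group)
qed

lemma grade_proj_ind:
  assumes X: "X \<in> ind_objects C" and \<gamma>: "\<gamma> \<in> carrier \<Gamma>"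
  shows "grade_proj (ind C) \<Gamma> (ind_grading C G) \<gamma> X = ind_map C X X (\<lambda>i. proj \<gamma> (Ob X i))"
proof -
  interpret D: graded_star_category "ind C" \<Gamma> "ind_grading C G"
    by (rule graded_star_category_ind)
  obtain Y v where d: "homogeneous_decomposition (ind C) \<Gamma> (ind_grading C G) X Y v"
    "\<And>\<gamma>. \<gamma> \<in> carrier \<Gamma> \<Longrightarrow> v \<gamma> \<cdot>\<^bsub>ind C\<^esub> Adj (ind C) (v \<gamma>) = ind_map C X X (\<lambda>i. proj \<gamma> (Ob X i))"
    using ex_ind_homogeneous_decomposition[OF X] by metis
  show ?thesis
    using D.proj_eq[OF d(1)] d(2)[OF \<gamma>] X \<gamma> by simp
qed

lemma grade_proj_emb:
  assumes Y: "Y \<in> Obj C" and \<gamma>: "\<gamma> \<in> carrier \<Gamma>"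
  shows "grade_proj (ind C) \<Gamma> (ind_grading C G) \<gamma> (emb_obj C Y) = emb_arr C (proj \<gamma> Y)"
proof -
  note J = emb_ind_obj[OF Y]
  note f = compatible_family_proj[OF J \<gamma>]
  have hom: "ind_map C (emb_obj C Y) (emb_obj C Y) (\<lambda>i. proj \<gamma> (Ob (emb_obj C Y) i)) \<in> Hom (ind C) (emb_obj C Y) (emb_obj C Y)"
    by (rule ind_map_hom[OF f])
  show ?thesis
    unfolding grade_proj_ind[OF J \<gamma>]
    by (rule ind_arr_eqI[OF hom emb_arr_hom[OF proj_hom[OF Y \<gamma>]]])
      (use ind_map_Cmp_up[OF f, of "[]" "[]"] Y \<gamma> in simp)
qed

lemma twisted_star_tensor_category_ind:
  "twisted_star_tensor_category (ind C :: (('o, 'a, 'i) ind_obj, ('o, 'a, 'i) ind_arr) tensor_cat) \<Gamma> (ind_grading C G) \<omega>"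
proof -
  interpret D: star_tensor_category "ind C :: (('o, 'a, 'i) ind_obj, ('o, 'a, 'i) ind_arr) tensor_cat"
    by (rule star_tensor_category_ind)
  interpret D: graded_star_category "ind C :: (('o, 'a, 'i) ind_obj, ('o, 'a, 'i) ind_arr) tensor_cat" \<Gamma> "ind_grading C G"
    by (rule graded_star_category_ind)
  show ?thesis
  proof
    fix X Y :: "('o, 'a, 'i) ind_obj" and \<gamma> \<eta>
    assume "X \<in> Obj (ind C)" "Y \<in> Obj (ind C)" and \<gamma>: "\<gamma> \<in> carrier \<Gamma>" and \<eta>: "\<eta> \<in> carrier \<Gamma>"
    then have X: "X \<in> ind_objects C" and Y: "Y \<in> ind_objects C"
      by simp_all
    have \<gamma>\<eta>: "\<gamma> \<otimes>\<^bsub>\<Gamma>\<^esub> \<eta> \<in> carrier \<Gamma>"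
      using \<gamma> \<eta> by simp
    note fX = compatible_family_proj[OF X \<gamma>] and fY = compatible_family_proj[OF Y \<eta>]
    note fXY = compatible_family_tens[OF fX fY refl]
    note g = compatible_family_proj[OF tens_ind_obj[OF X Y] \<gamma>\<eta>]
    show "grade_proj (ind C) \<Gamma> (ind_grading C G) (\<gamma> \<otimes>\<^bsub>\<Gamma>\<^esub> \<eta>) (X \<otimes>\<^sub>o\<^bsub>ind C\<^esub> Y) \<cdot>\<^bsub>ind C\<^esub>
        (grade_proj (ind C) \<Gamma> (ind_grading C G) \<gamma> X \<otimes>\<^sub>a\<^bsub>ind C\<^esub> grade_proj (ind C) \<Gamma> (ind_grading C G) \<eta> Y) =
        grade_proj (ind C) \<Gamma> (ind_grading C G) \<gamma> X \<otimes>\<^sub>a\<^bsub>ind C\<^esub> grade_proj (ind C) \<Gamma> (ind_grading C G) \<eta> Y"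
      unfolding ind_simps grade_proj_ind[OF X \<gamma>] grade_proj_ind[OF Y \<eta>] grade_proj_ind[OF tens_ind_obj[OF X Y] \<gamma>\<eta>]
        ind_map_tens[OF fX fY refl] ind_map_comp[OF fXY g]
      by (rule ind_map_cong)
        (use ind_Ob[OF X] ind_Ob[OF Y] \<gamma> \<eta> in \<open>auto simp: tens_Ix_iff[OF X] tens_Ob_Con[OF X] proj_tens\<close>)
  next
    show "grade_proj (ind C) \<Gamma> (ind_grading C G) \<one>\<^bsub>\<Gamma>\<^esub> (Unit (ind C)) = Id (ind C) (Unit (ind C))"
      by (simp add: grade_proj_emb Id_emb proj_Unit)
  qed (fact cmod_cocycle cocycle cocycle_normalized)+
qed

text \<open>Both sides are tested on triples of degree projections, which act termwise. There each
  is \<open>\<omega> a b c\<close> times the untwisted associator, on one side index by index and on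
  the other as a whole.\<close>

lemma Assoc_ind_twist:
  fixes X Y Z :: "('o, 'a, 'i) ind_obj"
  assumes X: "X \<in> ind_objects C" and Y: "Y \<in> ind_objects C" and Z: "Z \<in> ind_objects C"
  shows "Assoc (ind (twist C \<Gamma> G \<omega>)) X Y Z = Assoc (twist (ind C) \<Gamma> (ind_grading C G) \<omega>) X Y Z"
proof -
  interpret D: twisted_star_tensor_category "ind C :: (('o, 'a, 'i) ind_obj, ('o, 'a, 'i) ind_arr) tensor_cat"
      \<Gamma> "ind_grading C G" \<omega>
    by (rule twisted_star_tensor_category_ind)
  let ?V = "(X \<odot> Y) \<odot> Z" and ?W = "X \<odot> (Y \<odot> Z)"
  let ?f = "\<lambda>m. assoc\<omega> (Ob X (pre X m)) (Ob Y (pre Y (suf X m))) (Ob Z (drop (Len X + Len Y) m))"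
  have f: "compatible_family ?V ?W ?f"
    by (rule compatible_family_natural[OF assms assoc\<omega>_unitary assoc\<omega>_natural])
  have eq: "Assoc (ind (twist C \<Gamma> G \<omega>)) X Y Z = ind_map C ?V ?W ?f"
    unfolding ind_ops by simp
  have obj: "X \<in> Obj (ind C)" "Y \<in> Obj (ind C)" "Z \<in> Obj (ind C)"
    using assms by auto
  show ?thesis
    unfolding eq
  proof (rule D.tens3_eqI[OF obj])
    show "ind_map C ?V ?W ?f \<in> Hom (ind C) ((X \<otimes>\<^sub>o\<^bsub>ind C\<^esub> Y) \<otimes>\<^sub>o\<^bsub>ind C\<^esub> Z) ?W"
      using ind_map_hom[OF f] by simp
    show "Assoc (twist (ind C) \<Gamma> (ind_grading C G) \<omega>) X Y Z \<in> Hom (ind C) ((X \<otimes>\<^sub>o\<^bsub>ind C\<^esub> Y) \<otimes>\<^sub>o\<^bsub>ind C\<^esub> Z) ?W"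
      using D.assoc\<omega>_hom[OF obj] by simp
    fix a b c assume abc: "a \<in> carrier \<Gamma>" "b \<in> carrier \<Gamma>" "c \<in> carrier \<Gamma>"
    let ?P = "(D.proj a X \<otimes>\<^sub>a\<^bsub>ind C\<^esub> D.proj b Y) \<otimes>\<^sub>a\<^bsub>ind C\<^esub> D.proj c Z"
    let ?p = "\<lambda>m. (proj a (Ob X (pre X (pre (X \<odot> Y) m))) \<otimes>\<^sub>a
        proj b (Ob Y (suf X (pre (X \<odot> Y) m)))) \<otimes>\<^sub>a
        proj c (Ob Z (suf (X \<odot> Y) m))"
    note fX = compatible_family_proj[OF X abc(1)] and fY = compatible_family_proj[OF Y abc(2)]
      and fZ = compatible_family_proj[OF Z abc(3)]
    note fXY = compatible_family_tens[OF fX fY refl]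
    note fXYZ = compatible_family_tens[OF fXY fZ refl]
    have P: "?P = ind_map C ?V ?V ?p"
      unfolding ind_simps grade_proj_ind[OF X abc(1)] grade_proj_ind[OF Y abc(2)] grade_proj_ind[OF Z abc(3)]
        ind_map_tens[OF fX fY refl] ind_map_tens[OF fXY fZ refl] ..
    note g = compatible_family_assoc[OF assms]
    have "ind_map C ?V ?W ?f \<cdot>\<^bsub>ind C\<^esub> ?P = ind_map C ?V ?W (\<lambda>m. ?f m \<cdot> ?p m)"
      unfolding P ind_simps(5) by (rule ind_map_comp[OF fXYZ f])
    also have "\<dots> = \<omega> a b c \<bullet>\<^bsub>ind C\<^esub> ind_map C ?V ?W (\<lambda>m. assoc_family X Y Z m \<cdot> ?p m)"
    proof (rule ind_arr_eqI[OF ind_map_hom[OF compatible_family_comp[OF fXYZ f]]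
          scale_ind_hom[OF ind_map_hom[OF compatible_family_comp[OF fXYZ g]]]])
      fix k i assume k: "k \<in> Ix ?W" and i: "i \<in> Ix ?V"
      note d = compatible_familyD[OF g]
      obtain l where l: "(k, l) \<in> Leq ?V" "(i, l) \<in> Leq ?V"
        using ind_directed[OF d(1), of k i] k i d(3) by auto
      have l': "(k, l) \<in> Leq ?W" "(i, l) \<in> Leq ?W"
        using l d(4) by auto
      have m: "pre X i \<in> Ix X" "pre Y (suf X i) \<in> Ix Y" "drop (Len X + Len Y) i \<in> Ix Z"
        using i by (simp_all add: tens3_simps[OF assms])
      have "?f i \<cdot> ?p i = \<omega> a b c \<bullet> (assoc_family X Y Z i \<cdot> ?p i)"
        using assoc\<omega>_comp[OF homogeneous_proj[OF ind_Ob[OF X m(1)] abc(1)] homogeneous_proj[OF ind_Ob[OF Y m(2)] abc(2)]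
            homogeneous_proj[OF ind_Ob[OF Z m(3)] abc(3)]]
        by (simp add: assoc_family_def ind_tens_obj_simps(1) min_def drop_take)
      moreover have "assoc_family X Y Z i \<cdot> ?p i \<in> Hom C (Ob ?V i) (Ob ?W i)"
        using compatible_familyD(5)[OF compatible_family_comp[OF fXYZ g] i] .
      ultimately show "Cmp (ind_map C ?V ?W (\<lambda>m. ?f m \<cdot> ?p m)) k i =
          Cmp (\<omega> a b c \<bullet>\<^bsub>ind C\<^esub> ind_map C ?V ?W (\<lambda>m. assoc_family X Y Z m \<cdot> ?p m)) k i"
        unfolding ind_op_Cmp(2)[OF ind_map_hom[OF compatible_family_comp[OF fXYZ g]] k i]
          ind_map_Cmp[OF compatible_family_comp[OF fXYZ g] l] ind_map_Cmp[OF compatible_family_comp[OF fXYZ f] l]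
        using ind_Con_hom[OF d(2) l'(1)] ind_Con_hom[OF d(2) l'(2)] by (simp add: Hom_iff)
    qed
    also have "ind_map C ?V ?W (\<lambda>m. assoc_family X Y Z m \<cdot> ?p m) = Assoc (ind C) X Y Z \<cdot>\<^bsub>ind C\<^esub> ?P"
      unfolding P ind_simps(5) Assoc_ind by (rule ind_map_comp[symmetric, OF fXYZ g])
    also have "\<omega> a b c \<bullet>\<^bsub>ind C\<^esub> (Assoc (ind C) X Y Z \<cdot>\<^bsub>ind C\<^esub> ?P) =
        Assoc (twist (ind C) \<Gamma> (ind_grading C G) \<omega>) X Y Z \<cdot>\<^bsub>ind C\<^esub> ?P"
      by (rule D.assoc\<omega>_comp[symmetric]) (use D.homogeneous_proj obj abc in auto)
    finally show "ind_map C ?V ?W ?f \<cdot>\<^bsub>ind C\<^esub> ?P =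
        Assoc (twist (ind C) \<Gamma> (ind_grading C G) \<omega>) X Y Z \<cdot>\<^bsub>ind C\<^esub> ?P" .
  qed
qed

text \<open>Obtained from the twist of \<open>ind C\<close>. Going through rigidity of the twisted
  category instead would require new solutions of the conjugate equations.\<close>

lemma star_tensor_category_ind_twist:
  "star_tensor_category (ind (twist C \<Gamma> G \<omega>) :: (('o, 'a, 'i) ind_obj, ('o, 'a, 'i) ind_arr) tensor_cat)"
proof -
  interpret D: twisted_star_tensor_category "ind C :: (('o, 'a, 'i) ind_obj, ('o, 'a, 'i) ind_arr) tensor_cat"
      \<Gamma> "ind_grading C G" \<omega>
    by (rule twisted_star_tensor_category_ind)
  show ?thesis
  proof (rule star_tensor_category_cong[OF D.star_tensor_category_twist])
    show "ind (twist C \<Gamma> G \<omega>) = (twist (ind C) \<Gamma> (ind_grading C G) \<omega>)\<lparr>Assoc := Assoc (ind (twist C \<Gamma> G \<omega>))\<rparr>"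
      by (rule tensor_cat.equality) simp_all
  qed (use Assoc_ind_twist in simp)
qed

end

section \<open>Half-braidings\<close>

text \<open>Everything is expressed by the morphisms \<open>P \<otimes> (X \<otimes> W) \<rightarrow> X \<otimes> (P \<otimes> W)\<close> between right-normed
  products that a morphism \<open>c : P \<otimes> X \<rightarrow> X \<otimes> P\<close> induces; associators then enter only through the
  pentagon.\<close>

definition whisker :: "('o, 'a, 'z) tensor_cat_scheme \<Rightarrow> 'o \<Rightarrow> 'o \<Rightarrow> 'o \<Rightarrow> 'a \<Rightarrow> 'a" where
  "whisker D P X W c =
     Assoc D X P W \<cdot>\<^bsub>D\<^esub> ((c \<otimes>\<^sub>a\<^bsub>D\<^esub> Id D W) \<cdot>\<^bsub>D\<^esub> (Assoc D P X W)\<^sup>\<dagger>\<^bsub>D\<^esub>)"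

text \<open>The left side of the half-braiding axiom and, next, the formula for the product, as
  functions of single morphisms and of the ambient category. The same expressions can then be formed
  with the original and with the twisted associator.\<close>

definition hexagon :: "('o, 'a, 'z) tensor_cat_scheme \<Rightarrow> 'o \<Rightarrow> 'o \<Rightarrow> 'o \<Rightarrow> 'a \<Rightarrow> 'a \<Rightarrow> 'a" where
  "hexagon D P Q X c e = Assoc D X P Q \<cdot>\<^bsub>D\<^esub> (c \<otimes>\<^sub>a\<^bsub>D\<^esub> Id D Q) \<cdot>\<^bsub>D\<^esub> (Assoc D P X Q)\<^sup>\<dagger>\<^bsub>D\<^esub>
     \<cdot>\<^bsub>D\<^esub> (Id D P \<otimes>\<^sub>a\<^bsub>D\<^esub> e) \<cdot>\<^bsub>D\<^esub> Assoc D P Q X"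

definition braid_tens :: "('o, 'a, 'z) tensor_cat_scheme \<Rightarrow> 'o \<Rightarrow> 'o \<Rightarrow> 'o \<Rightarrow> 'a \<Rightarrow> 'a \<Rightarrow> 'a" where
  "braid_tens D P X X' c c' = (Assoc D X X' P)\<^sup>\<dagger>\<^bsub>D\<^esub> \<cdot>\<^bsub>D\<^esub> (Id D X \<otimes>\<^sub>a\<^bsub>D\<^esub> c') \<cdot>\<^bsub>D\<^esub> Assoc D X P X'
     \<cdot>\<^bsub>D\<^esub> (c \<otimes>\<^sub>a\<^bsub>D\<^esub> Id D X') \<cdot>\<^bsub>D\<^esub> (Assoc D P X X')\<^sup>\<dagger>\<^bsub>D\<^esub>"

abbreviation Braid :: "('o, 'a, 'z) tensor_cat_scheme \<Rightarrow> 'o \<Rightarrow> 'o \<Rightarrow> 'a set" where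
  "Braid D P X \<equiv> Hom D (P \<otimes>\<^sub>o\<^bsub>D\<^esub> X) (X \<otimes>\<^sub>o\<^bsub>D\<^esub> P)"

context star_tensor_category
begin

text \<open>Composites are nested to the right, so an equation for \<open>f \<cdot> g\<close> does
  not match inside \<open>f \<cdot> (g \<cdot> h)\<close>; this turns it into a rewriting rule that
  does.\<close>

lemma comp_eq_left:
  "\<lbrakk>f \<cdot> g = k; f \<in> Arr C; g \<in> Arr C; h \<in> Arr C; Cod C g = Dom C f; Cod C h = Dom C g\<rbrakk> \<Longrightarrow>
   f \<cdot> (g \<cdot> h) = k \<cdot> h"
  using comp_assoc_arr[of h g f] by simp

lemma comp_eq_left2:
  "\<lbrakk>f \<cdot> (g \<cdot> h) = k; f \<in> Arr C; g \<in> Arr C; h \<in> Arr C; x \<in> Arr C; Cod C g = Dom C f; Cod C h = Dom C g;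
    Cod C x = Dom C h\<rbrakk> \<Longrightarrow> f \<cdot> (g \<cdot> (h \<cdot> x)) = k \<cdot> x"
  using comp_eq_left[of f "g \<cdot> h" k x] by simp

lemma unitary_tens:
  assumes "unitary C X Y u" "unitary C X' Y' w"
  shows "unitary C (X \<otimes>\<^sub>o X') (Y \<otimes>\<^sub>o Y') (u \<otimes>\<^sub>a w)"
proof -
  have h: "u \<in> Hom C X Y" "w \<in> Hom C X' Y'" and e: "u\<^sup>\<dagger> \<cdot> u = Id C X" "u \<cdot> u\<^sup>\<dagger> = Id C Y"
    "w\<^sup>\<dagger> \<cdot> w = Id C X'" "w \<cdot> w\<^sup>\<dagger> = Id C Y'"
    using assms by (auto simp: unitary_def)
  have obj: "X \<in> Obj C" "Y \<in> Obj C" "X' \<in> Obj C" "Y' \<in> Obj C"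
    using Hom_Obj h by auto
  show ?thesis
    using tens_hom[OF h] e h obj by (simp add: unitary_def Hom_iff)
qed

text \<open>The pentagon with two units says that this associator equals its own square; being
  invertible, it is the identity.\<close>

lemma assoc_unit:
  assumes X: "X \<in> Obj C" and Y: "Y \<in> Obj C"
  shows "Assoc C X Y (Unit C) = Id C (X \<otimes>\<^sub>o Y)"
proof -
  have "Assoc C X Y (Unit C) = Assoc C X Y (Unit C) \<cdot> Assoc C X Y (Unit C)"
    using pentagon_eq[OF X Y obj_unit obj_unit] X Y by (simp add: triangle_eq)
  then have "(Assoc C X Y (Unit C))\<^sup>\<dagger> \<cdot> Assoc C X Y (Unit C) =
      (Assoc C X Y (Unit C))\<^sup>\<dagger> \<cdot> (Assoc C X Y (Unit C) \<cdot> Assoc C X Y (Unit C))"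
    by simp
  then show ?thesis
    using X Y assoc_cancel_left(1)[OF X Y obj_unit] assoc_cancel(1)[OF X Y obj_unit] by simp
qed

lemma unit_assoc:
  assumes Y: "Y \<in> Obj C" and Z: "Z \<in> Obj C"
  shows "Assoc C (Unit C) Y Z = Id C (Y \<otimes>\<^sub>o Z)"
proof -
  have "Assoc C (Unit C) Y Z = Assoc C (Unit C) Y Z \<cdot> Assoc C (Unit C) Y Z"
    using pentagon_eq[OF obj_unit obj_unit Y Z] Y Z by (simp add: triangle_eq)
  then have "(Assoc C (Unit C) Y Z)\<^sup>\<dagger> \<cdot> Assoc C (Unit C) Y Z =
      (Assoc C (Unit C) Y Z)\<^sup>\<dagger> \<cdot> (Assoc C (Unit C) Y Z \<cdot> Assoc C (Unit C) Y Z)"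
    by simp
  then show ?thesis
    using Y Z assoc_cancel_left(1)[OF obj_unit Y Z] assoc_cancel(1)[OF obj_unit Y Z] by simp
qed

text \<open>Solved forms of the pentagon, one for each way in which associators meet in the diagrams
  below. They permit rewriting toward right-normed products.\<close>

lemma pentagon_variants:
  assumes A: "A \<in> Obj C" and B: "B \<in> Obj C" and E: "E \<in> Obj C" and W: "W \<in> Obj C"
  shows "((Assoc C A B E)\<^sup>\<dagger> \<rhd> W) \<cdot> (Assoc C A (B \<otimes>\<^sub>o E) W)\<^sup>\<dagger> =
      (Assoc C (A \<otimes>\<^sub>o B) E W)\<^sup>\<dagger> \<cdot> ((Assoc C A B (E \<otimes>\<^sub>o W))\<^sup>\<dagger> \<cdot> (A \<lhd> Assoc C B E W))" (is ?p1)
    and "(Assoc C A B E \<rhd> W) \<cdot> (Assoc C (A \<otimes>\<^sub>o B) E W)\<^sup>\<dagger> =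
      (Assoc C A (B \<otimes>\<^sub>o E) W)\<^sup>\<dagger> \<cdot> ((A \<lhd> (Assoc C B E W)\<^sup>\<dagger>) \<cdot> Assoc C A B (E \<otimes>\<^sub>o W))" (is ?p2)
    and "Assoc C (A \<otimes>\<^sub>o B) E W \<cdot> ((Assoc C A B E)\<^sup>\<dagger> \<rhd> W) =
      (Assoc C A B (E \<otimes>\<^sub>o W))\<^sup>\<dagger> \<cdot> ((A \<lhd> Assoc C B E W) \<cdot> Assoc C A (B \<otimes>\<^sub>o E) W)" (is ?p3)
    and "(A \<lhd> Assoc C B E W) \<cdot> (Assoc C A (B \<otimes>\<^sub>o E) W \<cdot> (Assoc C A B E \<rhd> W)) =
      Assoc C A B (E \<otimes>\<^sub>o W) \<cdot> Assoc C (A \<otimes>\<^sub>o B) E W" (is ?p4)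
    and "Assoc C A (B \<otimes>\<^sub>o E) W \<cdot> ((Assoc C A B E \<rhd> W) \<cdot> (Assoc C (A \<otimes>\<^sub>o B) E W)\<^sup>\<dagger>) =
      (A \<lhd> (Assoc C B E W)\<^sup>\<dagger>) \<cdot> Assoc C A B (E \<otimes>\<^sub>o W)" (is ?p5)
proof -
  note o = A B E W
  show p4: ?p4
    using pentagon_eq[OF o] o by simp
  have adj: "((Assoc C A B E)\<^sup>\<dagger> \<rhd> W) \<cdot> ((Assoc C A (B \<otimes>\<^sub>o E) W)\<^sup>\<dagger> \<cdot> (A \<lhd> (Assoc C B E W)\<^sup>\<dagger>)) =
      (Assoc C (A \<otimes>\<^sub>o B) E W)\<^sup>\<dagger> \<cdot> (Assoc C A B (E \<otimes>\<^sub>o W))\<^sup>\<dagger>"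
    using arg_cong[OF p4, of "Adj C"] o by simp
  have "(((Assoc C A B E)\<^sup>\<dagger> \<rhd> W) \<cdot> ((Assoc C A (B \<otimes>\<^sub>o E) W)\<^sup>\<dagger> \<cdot> (A \<lhd> (Assoc C B E W)\<^sup>\<dagger>))) \<cdot>
      (A \<lhd> Assoc C B E W) = ((Assoc C A B E)\<^sup>\<dagger> \<rhd> W) \<cdot> (Assoc C A (B \<otimes>\<^sub>o E) W)\<^sup>\<dagger>"
    using o by simp
  then show p1: ?p1
    unfolding adj using o by simp
  have p6: "Assoc C (A \<otimes>\<^sub>o B) E W \<cdot> (((Assoc C A B E)\<^sup>\<dagger> \<rhd> W) \<cdot> (Assoc C A (B \<otimes>\<^sub>o E) W)\<^sup>\<dagger>) =
      (Assoc C A B (E \<otimes>\<^sub>o W))\<^sup>\<dagger> \<cdot> (A \<lhd> Assoc C B E W)"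
    unfolding p1 using o by simp
  have "(Assoc C (A \<otimes>\<^sub>o B) E W \<cdot> (((Assoc C A B E)\<^sup>\<dagger> \<rhd> W) \<cdot> (Assoc C A (B \<otimes>\<^sub>o E) W)\<^sup>\<dagger>)) \<cdot> Assoc C A (B \<otimes>\<^sub>o E) W
      = Assoc C (A \<otimes>\<^sub>o B) E W \<cdot> ((Assoc C A B E)\<^sup>\<dagger> \<rhd> W)"
    using o by simp
  then show ?p3
    unfolding p6 using o by simp
  have "((Assoc C A B E \<rhd> W) \<cdot> (((Assoc C A B E)\<^sup>\<dagger> \<rhd> W) \<cdot> (Assoc C A (B \<otimes>\<^sub>o E) W)\<^sup>\<dagger>)) \<cdot>
      ((A \<lhd> (Assoc C B E W)\<^sup>\<dagger>) \<cdot> Assoc C A B (E \<otimes>\<^sub>o W)) =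
      (Assoc C A (B \<otimes>\<^sub>o E) W)\<^sup>\<dagger> \<cdot> ((A \<lhd> (Assoc C B E W)\<^sup>\<dagger>) \<cdot> Assoc C A B (E \<otimes>\<^sub>o W))"
    using o by simp
  then show p2: ?p2
    unfolding p1 using o by simp
  show ?p5
    unfolding p2 using o by simp
qed

section \<open>Crossings in right-normed form\<close>

lemma whisker_hom:
  assumes "c \<in> Braid C P X" "P \<in> Obj C" "X \<in> Obj C" "W \<in> Obj C"
  shows "whisker C P X W c \<in> Hom C (P \<otimes>\<^sub>o (X \<otimes>\<^sub>o W)) (X \<otimes>\<^sub>o (P \<otimes>\<^sub>o W))"
  using assms by (simp add: whisker_def Hom_iff)

lemma hexagon_eq:
  assumes "c \<in> Braid C P X" "e \<in> Braid C Q X"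
    and "P \<in> Obj C" "Q \<in> Obj C" "X \<in> Obj C"
  shows "hexagon C P Q X c e = whisker C P X Q c \<cdot> ((P \<lhd> e) \<cdot> Assoc C P Q X)"
  using assms by (simp add: hexagon_def whisker_def Hom_iff)

lemma hexagon_hom:
  assumes "c \<in> Braid C P X" "e \<in> Braid C Q X"
    and "P \<in> Obj C" "Q \<in> Obj C" "X \<in> Obj C"
  shows "hexagon C P Q X c e \<in> Braid C (P \<otimes>\<^sub>o Q) X"
  using assms by (simp add: hexagon_def Hom_iff)

lemma braid_tens_eq:
  assumes "c \<in> Braid C P X" "c' \<in> Braid C P X'"
    and "P \<in> Obj C" "X \<in> Obj C" "X' \<in> Obj C"
  shows "braid_tens C P X X' c c' = (Assoc C X X' P)\<^sup>\<dagger> \<cdot> ((X \<lhd> c') \<cdot> whisker C P X X' c)"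
  using assms by (simp add: braid_tens_def whisker_def Hom_iff)

lemma braid_tens_hom:
  assumes "c \<in> Braid C P X" "c' \<in> Braid C P X'"
    and "P \<in> Obj C" "X \<in> Obj C" "X' \<in> Obj C"
  shows "braid_tens C P X X' c c' \<in> Braid C P (X \<otimes>\<^sub>o X')"
  using assms by (simp add: braid_tens_def Hom_iff)

lemma braid_tens_unitary:
  assumes c: "unitary C (P \<otimes>\<^sub>o X) (X \<otimes>\<^sub>o P) c" and c': "unitary C (P \<otimes>\<^sub>o X') (X' \<otimes>\<^sub>o P) c'"
    and o: "P \<in> Obj C" "X \<in> Obj C" "X' \<in> Obj C"
  shows "unitary C (P \<otimes>\<^sub>o (X \<otimes>\<^sub>o X')) ((X \<otimes>\<^sub>o X') \<otimes>\<^sub>o P) (braid_tens C P X X' c c')"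
  unfolding braid_tens_def
  by (rule unitary_comp[OF _ unitary_comp[OF _ unitary_comp[OF _ unitary_comp]]])
    (rule unitary_adj[OF assoc_unitary] unitary_tens[OF c unitary_Id] unitary_tens[OF unitary_Id c']
      assoc_unitary o)+

lemma whisker_natural:
  assumes c: "c \<in> Braid C P X" and e: "e \<in> Braid C Q Y"
    and f: "f \<in> Hom C P Q" and x: "x \<in> Hom C X Y" and g: "g \<in> Hom C W V"
    and eq: "e \<cdot> (f \<otimes>\<^sub>a x) = (x \<otimes>\<^sub>a f) \<cdot> c"
  shows "whisker C Q Y V e \<cdot> (f \<otimes>\<^sub>a (x \<otimes>\<^sub>a g)) = (x \<otimes>\<^sub>a (f \<otimes>\<^sub>a g)) \<cdot> whisker C P X W c"
proof -
  have o: "P \<in> Obj C" "Q \<in> Obj C" "X \<in> Obj C" "Y \<in> Obj C" "W \<in> Obj C" "V \<in> Obj C"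
    using f x g Hom_Obj by auto
  note h = c e f x g
  have n: "(Assoc C Q Y V)\<^sup>\<dagger> \<cdot> (f \<otimes>\<^sub>a (x \<otimes>\<^sub>a g)) = ((f \<otimes>\<^sub>a x) \<otimes>\<^sub>a g) \<cdot> (Assoc C P X W)\<^sup>\<dagger>"
    using assoc_adj_nat[of f x g] h by (simp add: Hom_iff)
  show ?thesis
    unfolding whisker_def using h o by (simp add: Hom_iff n eq comp_eq_left[OF assoc_natural[OF x f g, symmetric]])
qed

lemma braid_tens_natural:
  assumes c: "c \<in> Braid C P X" and e: "e \<in> Braid C Q Y"
    and c': "c' \<in> Braid C P X'" and e': "e' \<in> Braid C Q Y'"
    and f: "f \<in> Hom C P Q" and x: "x \<in> Hom C X Y" and x': "x' \<in> Hom C X' Y'"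
    and eq: "e \<cdot> (f \<otimes>\<^sub>a x) = (x \<otimes>\<^sub>a f) \<cdot> c" and eq': "e' \<cdot> (f \<otimes>\<^sub>a x') = (x' \<otimes>\<^sub>a f) \<cdot> c'"
  shows "braid_tens C Q Y Y' e e' \<cdot> (f \<otimes>\<^sub>a (x \<otimes>\<^sub>a x')) = ((x \<otimes>\<^sub>a x') \<otimes>\<^sub>a f) \<cdot> braid_tens C P X X' c c'"
proof -
  have o: "P \<in> Obj C" "Q \<in> Obj C" "X \<in> Obj C" "Y \<in> Obj C" "X' \<in> Obj C" "Y' \<in> Obj C"
    using f x x' Hom_Obj by auto
  note h = c e c' e' f x x'
  note w = whisker_hom[OF c o(1,3,5)] whisker_hom[OF e o(2,4,6)]
  have n: "((x \<otimes>\<^sub>a x') \<otimes>\<^sub>a f) \<cdot> (Assoc C X X' P)\<^sup>\<dagger> = (Assoc C Y Y' Q)\<^sup>\<dagger> \<cdot> (x \<otimes>\<^sub>a (x' \<otimes>\<^sub>a f))"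
    using assoc_adj_nat[of x x' f] h by (simp add: Hom_iff)
  show ?thesis
    unfolding braid_tens_eq[OF e e' o(2,4,6)] braid_tens_eq[OF c c' o(1,3,5)] using h o w
    by (simp add: Hom_iff eq' comp_eq_left[OF n] whisker_natural[OF c e f x x' eq])
qed

text \<open>In right-normed form the hexagon expression is a plain composite: to move
  \<open>P \<otimes> Q\<close> past \<open>X\<close>, move \<open>Q\<close> past it and then
  \<open>P\<close>.\<close>

lemma whisker_hexagon:
  assumes c: "c \<in> Braid C P X" and e: "e \<in> Braid C Q X"
    and P: "P \<in> Obj C" and Q: "Q \<in> Obj C" and X: "X \<in> Obj C" and W: "W \<in> Obj C"
  shows "(X \<lhd> Assoc C P Q W) \<cdot> whisker C (P \<otimes>\<^sub>o Q) X W (hexagon C P Q X c e) =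
    whisker C P X (Q \<otimes>\<^sub>o W) c \<cdot> ((P \<lhd> whisker C Q X W e) \<cdot> Assoc C P Q (X \<otimes>\<^sub>o W))"
proof -
  note o = P Q X W
  have ce: "c \<in> Arr C" "Dom C c = P \<otimes>\<^sub>o X" "Cod C c = X \<otimes>\<^sub>o P" "e \<in> Arr C" "Dom C e = Q \<otimes>\<^sub>o X" "Cod C e = X \<otimes>\<^sub>o Q"
    using c e by (auto simp: Hom_iff)
  have split: "hexagon C P Q X c e \<rhd> W =
      (Assoc C X P Q \<rhd> W) \<cdot> (((c \<rhd> Q) \<rhd> W) \<cdot> (((Assoc C P X Q)\<^sup>\<dagger> \<rhd> W) \<cdot>
        (((P \<lhd> e) \<rhd> W) \<cdot> (Assoc C P Q X \<rhd> W))))"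
    using o ce by (simp add: hexagon_def)
  have split': "P \<lhd> (Assoc C X Q W \<cdot> ((e \<rhd> W) \<cdot> (Assoc C Q X W)\<^sup>\<dagger>)) =
      (P \<lhd> Assoc C X Q W) \<cdot> ((P \<lhd> (e \<rhd> W)) \<cdot> (P \<lhd> (Assoc C Q X W)\<^sup>\<dagger>))"
    using o ce by simp
  have n: "Assoc C (X \<otimes>\<^sub>o P) Q W \<cdot> ((c \<rhd> Q) \<rhd> W) = (c \<rhd> (Q \<otimes>\<^sub>o W)) \<cdot> Assoc C (P \<otimes>\<^sub>o X) Q W"
    using assoc_natural[OF c id_hom[OF Q] id_hom[OF W]] o by simp
  show ?thesis
    unfolding whisker_def split split' using o ce
    by (simp del: interchange interchange_left add: comp_eq_left[OF n] pentagon_variants(5)[OF P Q X W]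
        comp_eq_left2[OF pentagon_variants(4)[OF X P Q W]] comp_eq_left[OF pentagon_variants(3)[OF P X Q W]]
        comp_eq_left[OF assoc_natural[OF id_hom[OF P] e id_hom[OF W]]])
qed

text \<open>The companion of \<open>whisker_hexagon\<close>: moving \<open>P\<close> past
  \<open>X \<otimes> X'\<close> is moving it past \<open>X\<close> and then past
  \<open>X'\<close>.\<close>

lemma whisker_braid_tens:
  assumes c: "c \<in> Braid C P X" and c': "c' \<in> Braid C P X'"
    and P: "P \<in> Obj C" and X: "X \<in> Obj C" and X': "X' \<in> Obj C" and W: "W \<in> Obj C"
  shows "whisker C P (X \<otimes>\<^sub>o X') W (braid_tens C P X X' c c') =
    (Assoc C X X' (P \<otimes>\<^sub>o W))\<^sup>\<dagger> \<cdot> ((X \<lhd> whisker C P X' W c') \<cdot>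
      (whisker C P X (X' \<otimes>\<^sub>o W) c \<cdot> (P \<lhd> Assoc C X X' W)))"
proof -
  note o = P X X' W
  have ce: "c \<in> Arr C" "Dom C c = P \<otimes>\<^sub>o X" "Cod C c = X \<otimes>\<^sub>o P" "c' \<in> Arr C" "Dom C c' = P \<otimes>\<^sub>o X'" "Cod C c' = X' \<otimes>\<^sub>o P"
    using c c' by (auto simp: Hom_iff)
  have split: "braid_tens C P X X' c c' \<rhd> W =
      ((Assoc C X X' P)\<^sup>\<dagger> \<rhd> W) \<cdot> (((X \<lhd> c') \<rhd> W) \<cdot> ((Assoc C X P X' \<rhd> W) \<cdot>
        (((c \<rhd> X') \<rhd> W) \<cdot> ((Assoc C P X X')\<^sup>\<dagger> \<rhd> W))))"
    using o ce by (simp add: braid_tens_def)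
  have n1: "((c \<rhd> X') \<rhd> W) \<cdot> (Assoc C (P \<otimes>\<^sub>o X) X' W)\<^sup>\<dagger> =
      (Assoc C (X \<otimes>\<^sub>o P) X' W)\<^sup>\<dagger> \<cdot> (c \<rhd> (X' \<otimes>\<^sub>o W))"
    using assoc_adj_nat[of c "Id C X'" "Id C W"] o ce by simp
  have n2: "((X \<lhd> c') \<rhd> W) \<cdot> (Assoc C X (P \<otimes>\<^sub>o X') W)\<^sup>\<dagger> =
      (Assoc C X (X' \<otimes>\<^sub>o P) W)\<^sup>\<dagger> \<cdot> (X \<lhd> (c' \<rhd> W))"
    using assoc_adj_nat[of "Id C X" c' "Id C W"] o ce by simp
  have split': "X \<lhd> (Assoc C X' P W \<cdot> ((c' \<rhd> W) \<cdot> (Assoc C P X' W)\<^sup>\<dagger>)) =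
      (X \<lhd> Assoc C X' P W) \<cdot> ((X \<lhd> (c' \<rhd> W)) \<cdot> (X \<lhd> (Assoc C P X' W)\<^sup>\<dagger>))"
    using o ce by simp
  show ?thesis
    unfolding whisker_def split split' using o ce
    by (simp del: interchange interchange_left add: comp_eq_left[OF n1] comp_eq_left[OF n2]
        pentagon_variants(1)[OF P X X' W] comp_eq_left[OF pentagon_variants(1)[OF X X' P W]]
        comp_eq_left[OF pentagon_variants(2)[OF X P X' W]])
qed

text \<open>Both sides consist of the four crossings of \<open>P\<close> and \<open>Q\<close> with
  \<open>X\<close> and \<open>X'\<close>. They differ in the order of two crossings that involve
  disjoint factors, which commute.\<close>

lemma hexagon_braid_tens:
  assumes cP: "cP \<in> Braid C P X" and cQ: "cQ \<in> Braid C Q X"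
    and eP: "eP \<in> Braid C P X'" and eQ: "eQ \<in> Braid C Q X'"
    and P: "P \<in> Obj C" and Q: "Q \<in> Obj C" and X: "X \<in> Obj C" and X': "X' \<in> Obj C"
  shows "hexagon C P Q (X \<otimes>\<^sub>o X') (braid_tens C P X X' cP eP) (braid_tens C Q X X' cQ eQ) =
    braid_tens C (P \<otimes>\<^sub>o Q) X X' (hexagon C P Q X cP cQ) (hexagon C P Q X' eP eQ)"
proof -
  note o = P Q X X'
  have PQ: "P \<otimes>\<^sub>o Q \<in> Obj C" "X \<otimes>\<^sub>o X' \<in> Obj C" "Q \<otimes>\<^sub>o X' \<in> Obj C" "X' \<otimes>\<^sub>o Q \<in> Obj C"
    using o by auto
  note w = whisker_hom[OF eP P X' Q] whisker_hom[OF cP P X PQ(4)] whisker_hom[OF cP P X PQ(3)] whisker_hom[OF cQ Q X X']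
  note hx = hexagon_hom[OF cP cQ P Q X] hexagon_hom[OF eP eQ P Q X']
  note wh = whisker_hom[OF hx(1) PQ(1) X X']
  have a: "(X \<lhd> Assoc C P Q X') \<in> Arr C" using o by simp
  \<comment> \<open>The commuting pair: \<open>P\<close> past \<open>X\<close>, and \<open>Q\<close>
    past \<open>X'\<close> to the right of it.\<close>
  have n: "whisker C P X (X' \<otimes>\<^sub>o Q) cP \<cdot> (P \<lhd> (X \<lhd> eQ)) = (X \<lhd> (P \<lhd> eQ)) \<cdot> whisker C P X (Q \<otimes>\<^sub>o X') cP"
    by (rule whisker_natural[OF cP cP id_hom[OF P] id_hom[OF X] eQ]) (use o cP in \<open>simp add: Hom_iff\<close>)
  have split: "P \<lhd> ((Assoc C X X' Q)\<^sup>\<dagger> \<cdot> ((X \<lhd> eQ) \<cdot> whisker C Q X X' cQ)) =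
      (P \<lhd> (Assoc C X X' Q)\<^sup>\<dagger>) \<cdot> ((P \<lhd> (X \<lhd> eQ)) \<cdot> (P \<lhd> whisker C Q X X' cQ))"
    using o eQ w by (simp add: Hom_iff)
  have split': "X \<lhd> hexagon C P Q X' eP eQ =
      (X \<lhd> whisker C P X' Q eP) \<cdot> ((X \<lhd> (P \<lhd> eQ)) \<cdot> (X \<lhd> Assoc C P Q X'))"
    unfolding hexagon_eq[OF eP eQ P Q X'] using o eQ w by (simp add: Hom_iff)
  have c: "(P \<lhd> Assoc C X X' Q) \<cdot> ((P \<lhd> (Assoc C X X' Q)\<^sup>\<dagger>) \<cdot> h) = h"
    if "h \<in> Arr C" "Cod C h = P \<otimes>\<^sub>o (X \<otimes>\<^sub>o (X' \<otimes>\<^sub>o Q))" for h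
    using o that by simp
  show ?thesis
    unfolding hexagon_eq[OF braid_tens_hom[OF cP eP P X X'] braid_tens_hom[OF cQ eQ Q X X'] P Q PQ(2)]
      whisker_braid_tens[OF cP eP P X X' Q] braid_tens_eq[OF hx PQ(1) X X'] split'
    unfolding braid_tens_eq[OF cQ eQ Q X X'] split using o eQ w wh
    by (simp del: interchange interchange_left add: Hom_iff c comp_eq_left[OF n] whisker_hexagon[OF cP cQ P Q X X'])
qed

text \<open>In right-normed form both bracketings move \<open>P\<close> past \<open>X\<close>,
  \<open>X'\<close> and \<open>X''\<close> in turn.\<close>

lemma braid_tens_assoc:
  assumes c: "c \<in> Braid C P X" and c': "c' \<in> Braid C P X'"
    and c'': "c'' \<in> Braid C P X''"
    and P: "P \<in> Obj C" and X: "X \<in> Obj C" and X': "X' \<in> Obj C" and X'': "X'' \<in> Obj C"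
  shows "(Assoc C X X' X'' \<rhd> P) \<cdot> braid_tens C P (X \<otimes>\<^sub>o X') X'' (braid_tens C P X X' c c') c'' =
    braid_tens C P X (X' \<otimes>\<^sub>o X'') c (braid_tens C P X' X'' c' c'') \<cdot> (P \<lhd> Assoc C X X' X'')"
proof -
  note o = P X X' X''
  have t: "X \<otimes>\<^sub>o X' \<in> Obj C" "X' \<otimes>\<^sub>o X'' \<in> Obj C" "P \<otimes>\<^sub>o X'' \<in> Obj C"
    using o by auto
  note w = whisker_hom[OF c' P X' X''] whisker_hom[OF c P X t(2)]
  note b = braid_tens_hom[OF c c' P X X'] braid_tens_hom[OF c' c'' P X' X'']
  let ?R = "(X \<lhd> whisker C P X' X'' c') \<cdot> (whisker C P X (X' \<otimes>\<^sub>o X'') c \<cdot> (P \<lhd> Assoc C X X' X''))"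
  have R: "?R \<in> Arr C" "Dom C ?R = P \<otimes>\<^sub>o ((X \<otimes>\<^sub>o X') \<otimes>\<^sub>o X'')" "Cod C ?R = X \<otimes>\<^sub>o (X' \<otimes>\<^sub>o (P \<otimes>\<^sub>o X''))"
    using o w by (simp_all add: Hom_iff)
  have c2: "c'' \<in> Arr C" "Dom C c'' = P \<otimes>\<^sub>o X''" "Cod C c'' = X'' \<otimes>\<^sub>o P"
    using c'' by auto
  have n: "((X \<otimes>\<^sub>o X') \<lhd> c'') \<cdot> (Assoc C X X' (P \<otimes>\<^sub>o X''))\<^sup>\<dagger> =
      (Assoc C X X' (X'' \<otimes>\<^sub>o P))\<^sup>\<dagger> \<cdot> (X \<lhd> (X' \<lhd> c''))"
    using assoc_adj_nat[of "Id C X" "Id C X'" c''] o c2 by simp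
  have split: "X \<lhd> braid_tens C P X' X'' c' c'' =
      (X \<lhd> (Assoc C X' X'' P)\<^sup>\<dagger>) \<cdot> ((X \<lhd> (X' \<lhd> c'')) \<cdot> (X \<lhd> whisker C P X' X'' c'))"
    unfolding braid_tens_eq[OF c' c'' P X' X''] using o w c2 by (simp add: Hom_iff)
  show ?thesis
    unfolding braid_tens_eq[OF b(1) c'' P t(1) X''] braid_tens_eq[OF c b(2) P X t(2)] split
      whisker_braid_tens[OF c c' P X X' X''] using o w c2
    by (simp del: interchange interchange_left add: Hom_iff comp_eq_left[OF n]
        comp_eq_left[OF pentagon_variants(2)[OF X X' X'' P]])
qed

lemma hexagon_natural:
  assumes c: "c \<in> Braid C P X" and e: "e \<in> Braid C Q X"
    and c': "c' \<in> Braid C P Y" and e': "e' \<in> Braid C Q Y"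
    and P: "P \<in> Obj C" and Q: "Q \<in> Obj C" and x: "x \<in> Hom C X Y"
    and eq: "c' \<cdot> (P \<lhd> x) = (x \<rhd> P) \<cdot> c" and eq': "e' \<cdot> (Q \<lhd> x) = (x \<rhd> Q) \<cdot> e"
  shows "hexagon C P Q Y c' e' \<cdot> ((P \<otimes>\<^sub>o Q) \<lhd> x) = (x \<rhd> (P \<otimes>\<^sub>o Q)) \<cdot> hexagon C P Q X c e"
proof -
  have o: "P \<in> Obj C" "Q \<in> Obj C" "X \<in> Obj C" "Y \<in> Obj C"
    using P Q x Hom_Obj by auto
  note h = c e c' e' x
  note w = whisker_hom[OF c P o(3) Q] whisker_hom[OF c' P o(4) Q]
  have n: "Assoc C P Q Y \<cdot> ((P \<otimes>\<^sub>o Q) \<lhd> x) = (P \<lhd> (Q \<lhd> x)) \<cdot> Assoc C P Q X"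
    using assoc_natural[OF id_hom[OF P] id_hom[OF Q] x] P Q by simp
  have n': "(x \<rhd> (P \<otimes>\<^sub>o Q)) \<cdot> whisker C P X Q c = whisker C P Y Q c' \<cdot> (P \<lhd> (x \<rhd> Q))"
    using whisker_natural[OF c c' id_hom[OF P] x id_hom[OF Q] eq] P Q by simp
  show ?thesis
    unfolding hexagon_eq[OF c e P Q o(3)] hexagon_eq[OF c' e' P Q o(4)] using o h w
    by (simp add: Hom_iff n eq' comp_eq_left[OF n'])
qed

text \<open>The compression of \<open>c\<close> to the summand embedded by \<open>v\<close>. When
  \<open>c\<close> commutes with the projection onto that summand it is again unitary, and
  \<open>v\<close> intertwines it with \<open>c\<close>; this produces the homogeneous parts of an
  object of the center.\<close>

definition restrict_braid :: "'o \<Rightarrow> 'a \<Rightarrow> 'a \<Rightarrow> 'a" where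
  "restrict_braid P v c = (v\<^sup>\<dagger> \<rhd> P) \<cdot> (c \<cdot> (P \<lhd> v))"

lemma restrict_braid_hom:
  assumes "c \<in> Braid C P X" "isometry C V X v" "P \<in> Obj C"
  shows "restrict_braid P v c \<in> Braid C P V"
  using assms by (auto simp: restrict_braid_def isometry_def Hom_iff)

lemma restrict_braid_intertwines:
  assumes c: "c \<in> Braid C P X" and v: "isometry C V X v" and P: "P \<in> Obj C"
    and comm: "c \<cdot> (P \<lhd> (v \<cdot> v\<^sup>\<dagger>)) = ((v \<cdot> v\<^sup>\<dagger>) \<rhd> P) \<cdot> c"
  shows "c \<cdot> (P \<lhd> v) = (v \<rhd> P) \<cdot> restrict_braid P v c"
    and "restrict_braid P v c \<cdot> (P \<lhd> v\<^sup>\<dagger>) = (v\<^sup>\<dagger> \<rhd> P) \<cdot> c"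
proof -
  have v': "v \<in> Hom C V X" "v\<^sup>\<dagger> \<cdot> v = Id C V"
    using v by (auto simp: isometry_def)
  have o: "V \<in> Obj C" "X \<in> Obj C"
    using v' Hom_Obj by auto
  have vv: "v \<cdot> (v\<^sup>\<dagger> \<cdot> v) = v" "v\<^sup>\<dagger> \<cdot> (v \<cdot> v\<^sup>\<dagger>) = v\<^sup>\<dagger>"
    using v' o isometry_cancel[OF v, of "v\<^sup>\<dagger>"] by (auto simp: Hom_iff)
  have "c \<cdot> (P \<lhd> v) = (c \<cdot> (P \<lhd> (v \<cdot> v\<^sup>\<dagger>))) \<cdot> (P \<lhd> v)"
    using c v'(1) P o vv by (simp add: Hom_iff)
  also have "\<dots> = (v \<rhd> P) \<cdot> restrict_braid P v c"
    unfolding comm restrict_braid_def using c v'(1) P o by (simp add: Hom_iff)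
  finally show "c \<cdot> (P \<lhd> v) = (v \<rhd> P) \<cdot> restrict_braid P v c" .
  have "restrict_braid P v c \<cdot> (P \<lhd> v\<^sup>\<dagger>) = (v\<^sup>\<dagger> \<rhd> P) \<cdot> (c \<cdot> (P \<lhd> (v \<cdot> v\<^sup>\<dagger>)))"
    unfolding restrict_braid_def using c v'(1) P o by (simp add: Hom_iff)
  also have "\<dots> = (v\<^sup>\<dagger> \<rhd> P) \<cdot> c"
    unfolding comm using c v'(1) P o vv by (simp add: Hom_iff)
  finally show "restrict_braid P v c \<cdot> (P \<lhd> v\<^sup>\<dagger>) = (v\<^sup>\<dagger> \<rhd> P) \<cdot> c" .
qed

lemma restrict_braid_unitary:
  assumes c: "unitary C (P \<otimes>\<^sub>o X) (X \<otimes>\<^sub>o P) c" and v: "isometry C V X v" and P: "P \<in> Obj C"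
    and comm: "c \<cdot> (P \<lhd> (v \<cdot> v\<^sup>\<dagger>)) = ((v \<cdot> v\<^sup>\<dagger>) \<rhd> P) \<cdot> c"
  shows "unitary C (P \<otimes>\<^sub>o V) (V \<otimes>\<^sub>o P) (restrict_braid P v c)"
proof -
  have c': "c \<in> Braid C P X" "c\<^sup>\<dagger> \<cdot> c = Id C (P \<otimes>\<^sub>o X)" "c \<cdot> c\<^sup>\<dagger> = Id C (X \<otimes>\<^sub>o P)"
    using c by (auto simp: unitary_def)
  have v': "v \<in> Hom C V X" "v\<^sup>\<dagger> \<cdot> v = Id C V"
    using v by (auto simp: isometry_def)
  have o: "V \<in> Obj C" "X \<in> Obj C"
    using v' Hom_Obj by auto
  note r = restrict_braid_hom[OF c'(1) v P]
  note i = restrict_braid_intertwines[OF c'(1) v P comm]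
  have "(restrict_braid P v c)\<^sup>\<dagger> \<cdot> restrict_braid P v c =
      (P \<lhd> v\<^sup>\<dagger>) \<cdot> (c\<^sup>\<dagger> \<cdot> ((v \<rhd> P) \<cdot> restrict_braid P v c))"
    using c'(1) v'(1) r P o by (simp add: Hom_iff restrict_braid_def)
  also have "\<dots> = (P \<lhd> v\<^sup>\<dagger>) \<cdot> (c\<^sup>\<dagger> \<cdot> (c \<cdot> (P \<lhd> v)))"
    unfolding i(1) ..
  also have "\<dots> = Id C (P \<otimes>\<^sub>o V)"
    using c'(1) v' P o unitary_cancel(1)[OF c, of "P \<lhd> v"] by (simp add: Hom_iff)
  finally have 1: "(restrict_braid P v c)\<^sup>\<dagger> \<cdot> restrict_braid P v c = Id C (P \<otimes>\<^sub>o V)" .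
  have "restrict_braid P v c \<cdot> (restrict_braid P v c)\<^sup>\<dagger> =
      (restrict_braid P v c \<cdot> (P \<lhd> v\<^sup>\<dagger>)) \<cdot> (c\<^sup>\<dagger> \<cdot> (v \<rhd> P))"
    using c'(1) v'(1) r P o by (simp add: Hom_iff restrict_braid_def)
  also have "\<dots> = (v\<^sup>\<dagger> \<rhd> P) \<cdot> (c \<cdot> (c\<^sup>\<dagger> \<cdot> (v \<rhd> P)))"
    unfolding i(2) using c'(1) v'(1) P o by (simp add: Hom_iff)
  also have "\<dots> = Id C (V \<otimes>\<^sub>o P)"
    using c'(1) v' P o unitary_cancel(2)[OF c, of "v \<rhd> P"] by (simp add: Hom_iff)
  finally show ?thesis
    using 1 r by (simp add: unitary_def)
qed

text \<open>The isometry \<open>v\<close> intertwines the compressed crossings with the given ones,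
  so the hexagon expressions are intertwined by naturality, and \<open>v\<close> cancels.\<close>

lemma restrict_braid_hexagon:
  assumes c: "c \<in> Braid C P X" and e: "e \<in> Braid C Q X"
    and v: "isometry C V X v" and P: "P \<in> Obj C" and Q: "Q \<in> Obj C"
    and comm: "c \<cdot> (P \<lhd> (v \<cdot> v\<^sup>\<dagger>)) = ((v \<cdot> v\<^sup>\<dagger>) \<rhd> P) \<cdot> c"
      "e \<cdot> (Q \<lhd> (v \<cdot> v\<^sup>\<dagger>)) = ((v \<cdot> v\<^sup>\<dagger>) \<rhd> Q) \<cdot> e"
  shows "hexagon C P Q V (restrict_braid P v c) (restrict_braid Q v e) =
    restrict_braid (P \<otimes>\<^sub>o Q) v (hexagon C P Q X c e)"
proof -
  have v': "v \<in> Hom C V X" "v\<^sup>\<dagger> \<cdot> v = Id C V"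
    using v by (auto simp: isometry_def)
  have o: "V \<in> Obj C" "X \<in> Obj C" "P \<otimes>\<^sub>o Q \<in> Obj C"
    using v' Hom_Obj P Q by auto
  note rc = restrict_braid_hom[OF c v P] and re = restrict_braid_hom[OF e v Q]
  note h = hexagon_hom[OF rc re P Q o(1)]
  have "hexagon C P Q V (restrict_braid P v c) (restrict_braid Q v e) =
      (v\<^sup>\<dagger> \<rhd> (P \<otimes>\<^sub>o Q)) \<cdot> ((v \<rhd> (P \<otimes>\<^sub>o Q)) \<cdot> hexagon C P Q V (restrict_braid P v c) (restrict_braid Q v e))"
    using h v' o by (simp add: Hom_iff)
  also have "(v \<rhd> (P \<otimes>\<^sub>o Q)) \<cdot> hexagon C P Q V (restrict_braid P v c) (restrict_braid Q v e) =
      hexagon C P Q X c e \<cdot> ((P \<otimes>\<^sub>o Q) \<lhd> v)"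
    by (rule hexagon_natural[symmetric, OF rc re c e P Q v'(1)])
      (rule restrict_braid_intertwines(1)[OF c v P comm(1)] restrict_braid_intertwines(1)[OF e v Q comm(2)])+
  finally show ?thesis
    by (simp add: restrict_braid_def)
qed

end

section \<open>Twisting half-braidings\<close>

text \<open>Commutativity is what makes half-braidings respect degrees: \<open>P \<otimes> X\<close>
  and \<open>X \<otimes> P\<close> then have the same total degree componentwise.\<close>

locale abelian_twisted_star_tensor_category = twisted_star_tensor_category C \<Gamma> G \<omega>
  for C :: "('o, 'a) tensor_cat" (structure) and \<Gamma> :: "'g monoid" and G :: "'g \<Rightarrow> 'o set"
    and \<omega> :: "'g \<Rightarrow> 'g \<Rightarrow> 'g \<Rightarrow> complex" +
  assumes grading_comm: "\<lbrakk>\<gamma> \<in> carrier \<Gamma>; \<eta> \<in> carrier \<Gamma>\<rbrakk> \<Longrightarrow> \<gamma> \<otimes>\<^bsub>\<Gamma>\<^esub> \<eta> = \<eta> \<otimes>\<^bsub>\<Gamma>\<^esub> \<gamma>"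
begin

definition graded_braid :: "'o \<Rightarrow> 'o \<Rightarrow> 'a \<Rightarrow> bool" where
  "graded_braid P X c \<longleftrightarrow> P \<in> Obj C \<and> X \<in> Obj C \<and> c \<in> Braid C P X \<and>
     (\<forall>s\<in>carrier \<Gamma>. \<forall>a\<in>carrier \<Gamma>. c \<cdot> (proj s P \<otimes>\<^sub>a proj a X) = (proj a X \<otimes>\<^sub>a proj s P) \<cdot> c)"

lemma graded_braidD:
  assumes "graded_braid P X c"
  shows "P \<in> Obj C" "X \<in> Obj C" "c \<in> Braid C P X"
    "\<And>s a. \<lbrakk>s \<in> carrier \<Gamma>; a \<in> carrier \<Gamma>\<rbrakk> \<Longrightarrow> c \<cdot> (proj s P \<otimes>\<^sub>a proj a X) = (proj a X \<otimes>\<^sub>a proj s P) \<cdot> c"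
  using assms by (auto simp: graded_braid_def)

text \<open>Naturality of \<open>c\<close> in \<open>P\<close> fixes the degree of \<open>P\<close>; as the total degree is preserved, that of \<open>X\<close>
  is preserved too.\<close>

lemma braid_proj:
  assumes c: "c \<in> Braid C P X" and P: "P \<in> Obj C" and X: "X \<in> Obj C"
    and nat: "\<And>s. s \<in> carrier \<Gamma> \<Longrightarrow> c \<cdot> (proj s P \<rhd> X) = (X \<lhd> proj s P) \<cdot> c"
    and a: "a \<in> carrier \<Gamma>"
  shows "c \<cdot> (P \<lhd> proj a X) = (proj a X \<rhd> P) \<cdot> c"
proof (rule tens2_eqI[OF P X])
  show "c \<cdot> (P \<lhd> proj a X) \<in> Braid C P X" "(proj a X \<rhd> P) \<cdot> c \<in> Braid C P X"
    using c P X a by (auto simp: Hom_iff)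
  fix s b assume sb: "s \<in> carrier \<Gamma>" "b \<in> carrier \<Gamma>"
  have c': "c \<in> Arr C" "Dom C c = P \<otimes>\<^sub>o X" "Cod C c = X \<otimes>\<^sub>o P"
    using c by auto
  define m where "m = c \<cdot> (proj s P \<otimes>\<^sub>a proj b X)"
  have m: "m \<in> Braid C P X" and m': "m \<in> Arr C" "Dom C m = P \<otimes>\<^sub>o X" "Cod C m = X \<otimes>\<^sub>o P"
    unfolding m_def using c' P X sb by (auto simp: Hom_iff)
  have m_s: "(X \<lhd> proj s P) \<cdot> m = m"
  proof -
    have "(X \<lhd> proj s P) \<cdot> m = ((X \<lhd> proj s P) \<cdot> c) \<cdot> (proj s P \<otimes>\<^sub>a proj b X)"
      unfolding m_def using c' P X sb by simp
    also have "\<dots> = m"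
      unfolding nat[OF sb(1), symmetric] m_def using c' P X sb by (simp add: proj_proj)
    finally show ?thesis .
  qed
  have m_sb: "proj (s \<otimes>\<^bsub>\<Gamma>\<^esub> b) (X \<otimes>\<^sub>o P) \<cdot> m = m"
  proof -
    have sb': "s \<otimes>\<^bsub>\<Gamma>\<^esub> b \<in> carrier \<Gamma>"
      using sb by simp
    have "proj (s \<otimes>\<^bsub>\<Gamma>\<^esub> b) (X \<otimes>\<^sub>o P) \<cdot> m = (proj (s \<otimes>\<^bsub>\<Gamma>\<^esub> b) (X \<otimes>\<^sub>o P) \<cdot> c) \<cdot> (proj s P \<otimes>\<^sub>a proj b X)"
      unfolding m_def using c' P X sb by simp
    also have "\<dots> = c \<cdot> (proj (s \<otimes>\<^bsub>\<Gamma>\<^esub> b) (P \<otimes>\<^sub>o X) \<cdot> (proj s P \<otimes>\<^sub>a proj b X))"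
      unfolding proj_natural[OF c sb'] using c' P X sb sb' by simp
    finally show ?thesis
      unfolding proj_tens[OF P X sb] m_def .
  qed
  \<comment> \<open>A component with \<open>X\<close> in degree \<open>b'\<close> would have total
    degree \<open>b' s\<close>, but \<open>m\<close> has total degree \<open>s b = b s\<close>;
    these differ unless \<open>b' = b\<close>.\<close>
  have zero: "(proj b' X \<rhd> P) \<cdot> m = Zero C (P \<otimes>\<^sub>o X) (X \<otimes>\<^sub>o P)" if b': "b' \<in> carrier \<Gamma>" "b' \<noteq> b" for b'
  proof -
    have "b' \<otimes>\<^bsub>\<Gamma>\<^esub> s \<noteq> b \<otimes>\<^bsub>\<Gamma>\<^esub> s"
      using b' sb by simp
    then have ne: "b' \<otimes>\<^bsub>\<Gamma>\<^esub> s \<noteq> s \<otimes>\<^bsub>\<Gamma>\<^esub> b"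
      using grading_comm sb by simp
    have car: "b' \<otimes>\<^bsub>\<Gamma>\<^esub> s \<in> carrier \<Gamma>" "s \<otimes>\<^bsub>\<Gamma>\<^esub> b \<in> carrier \<Gamma>"
      using b' sb by simp_all
    note XP = tens_obj[OF X P]
    have h: "proj b' X \<otimes>\<^sub>a proj s P \<in> Hom C (X \<otimes>\<^sub>o P) (X \<otimes>\<^sub>o P)"
      using X P b' sb by (simp add: Hom_iff)
    have "(proj b' X \<rhd> P) \<cdot> m = (proj b' X \<rhd> P) \<cdot> ((X \<lhd> proj s P) \<cdot> m)"
      using m_s by simp
    also have "\<dots> = (proj b' X \<otimes>\<^sub>a proj s P) \<cdot> m"
      using m' X P b' sb by simp
    also have "\<dots> = ((proj b' X \<otimes>\<^sub>a proj s P) \<cdot> proj (b' \<otimes>\<^bsub>\<Gamma>\<^esub> s) (X \<otimes>\<^sub>o P)) \<cdot> (proj (s \<otimes>\<^bsub>\<Gamma>\<^esub> b) (X \<otimes>\<^sub>o P) \<cdot> m)"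
      using proj_tens[OF X P b'(1) sb(1)] proj_natural[OF h car(1)] m_sb by simp
    also have "\<dots> = (proj b' X \<otimes>\<^sub>a proj s P) \<cdot> ((proj (b' \<otimes>\<^bsub>\<Gamma>\<^esub> s) (X \<otimes>\<^sub>o P) \<cdot> proj (s \<otimes>\<^bsub>\<Gamma>\<^esub> b) (X \<otimes>\<^sub>o P)) \<cdot> m)"
      using m' X P b' sb car by simp
    also have "\<dots> = Zero C (P \<otimes>\<^sub>o X) (X \<otimes>\<^sub>o P)"
      using proj_proj[OF XP car] ne zero_comp[OF m XP] comp_zero[OF h, of "P \<otimes>\<^sub>o X"] X P by simp
    finally show ?thesis .
  qed
  have "m = (Sum C X X (\<lambda>b'. proj b' X) (carrier \<Gamma>) \<rhd> P) \<cdot> m"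
    using proj_resolution[OF X] m' X P by (simp add: id_resolution_def)
  also have "Sum C X X (\<lambda>b'. proj b' X) (carrier \<Gamma>) \<rhd> P = Sum C (X \<otimes>\<^sub>o P) (X \<otimes>\<^sub>o P) (\<lambda>b'. proj b' X \<rhd> P) (carrier \<Gamma>)"
    by (rule Sum_tens) (use X P in \<open>auto intro: proj_hom id_hom\<close>)
  also have "\<dots> \<cdot> m = Sum C (P \<otimes>\<^sub>o X) (X \<otimes>\<^sub>o P) (\<lambda>b'. (proj b' X \<rhd> P) \<cdot> m) (carrier \<Gamma>)"
    by (rule Sum_comp[OF _ _ _ m]) (use X P in \<open>auto intro: tens_hom proj_hom id_hom\<close>)
  also have "\<dots> = (proj b X \<rhd> P) \<cdot> m"
    by (rule Sum_single) (use X P sb m' zero in \<open>auto simp: Hom_iff\<close>)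
  finally have one: "(proj b X \<rhd> P) \<cdot> m = m" by simp
  have "(c \<cdot> (P \<lhd> proj a X)) \<cdot> (proj s P \<otimes>\<^sub>a proj b X) = c \<cdot> (proj s P \<otimes>\<^sub>a (proj a X \<cdot> proj b X))"
    using c' P X sb a by simp
  also have "\<dots> = (if a = b then m else Zero C (P \<otimes>\<^sub>o X) (X \<otimes>\<^sub>o P))"
    using proj_proj[OF X a sb(2)] tens_zero(1)[OF proj_hom[OF P sb(1)] X X] comp_zero[OF c] P X by (simp add: m_def)
  also have "\<dots> = (proj a X \<rhd> P) \<cdot> m"
    using one zero a by auto
  also have "\<dots> = ((proj a X \<rhd> P) \<cdot> c) \<cdot> (proj s P \<otimes>\<^sub>a proj b X)"
    unfolding m_def using c' P X sb a by simp
  finally show "(c \<cdot> (P \<lhd> proj a X)) \<cdot> (proj s P \<otimes>\<^sub>a proj b X) =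
      ((proj a X \<rhd> P) \<cdot> c) \<cdot> (proj s P \<otimes>\<^sub>a proj b X)" .
qed

lemma graded_braidI:
  assumes c: "c \<in> Braid C P X" and P: "P \<in> Obj C" and X: "X \<in> Obj C"
    and nat: "\<And>s. s \<in> carrier \<Gamma> \<Longrightarrow> c \<cdot> (proj s P \<rhd> X) = (X \<lhd> proj s P) \<cdot> c"
  shows "graded_braid P X c"
proof -
  have "c \<cdot> (proj s P \<otimes>\<^sub>a proj a X) = (proj a X \<otimes>\<^sub>a proj s P) \<cdot> c" if sa: "s \<in> carrier \<Gamma>" "a \<in> carrier \<Gamma>" for s a
  proof -
    have bp: "c \<cdot> (P \<lhd> proj a X) = (proj a X \<rhd> P) \<cdot> c"
      by (rule braid_proj[OF c P X _ sa(2)]) (rule nat)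
    have "c \<cdot> (proj s P \<otimes>\<^sub>a proj a X) = (c \<cdot> (proj s P \<rhd> X)) \<cdot> (P \<lhd> proj a X)"
      using c P X sa by (simp add: Hom_iff)
    also have "\<dots> = (X \<lhd> proj s P) \<cdot> (c \<cdot> (P \<lhd> proj a X))"
      unfolding nat[OF sa(1)] using c P X sa by (simp add: Hom_iff)
    also have "\<dots> = (proj a X \<otimes>\<^sub>a proj s P) \<cdot> c"
      unfolding bp using c P X sa by (simp add: Hom_iff)
    finally show ?thesis .
  qed
  then show ?thesis
    using c P X by (simp add: graded_braid_def)
qed

text \<open>The weight takes the degree of \<open>X\<close> first, although \<open>P\<close> is the
  left factor of the source, in keeping with the weights \<open>f(a, s)\<close>.\<close>

definition twist_braid :: "('g \<Rightarrow> 'g \<Rightarrow> complex) \<Rightarrow> 'o \<Rightarrow> 'o \<Rightarrow> 'a \<Rightarrow> 'a" where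
  "twist_braid g P X c = Sum C (P \<otimes>\<^sub>o X) (X \<otimes>\<^sub>o P)
     (\<lambda>(s, a). g a s \<bullet> (c \<cdot> (proj s P \<otimes>\<^sub>a proj a X))) (carrier \<Gamma> \<times> carrier \<Gamma>)"

lemma twist_braid_hom:
  assumes "c \<in> Braid C P X" "P \<in> Obj C" "X \<in> Obj C"
  shows "twist_braid g P X c \<in> Braid C P X"
  unfolding twist_braid_def by (rule Sum_hom) (use assms in \<open>auto simp: Hom_iff\<close>)

lemma twist_braid_comp:
  assumes c: "c \<in> Braid C P X" and e: "homogeneous s P e" and x: "homogeneous a X x"
  shows "twist_braid g P X c \<cdot> (e \<otimes>\<^sub>a x) = g a s \<bullet> (c \<cdot> (e \<otimes>\<^sub>a x))"
proof -
  note eD = homogeneousD[OF e] and xD = homogeneousD[OF x]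
  let ?W = "P \<otimes>\<^sub>o X" and ?V = "X \<otimes>\<^sub>o P"
  let ?p = "\<lambda>(s, a). proj s P \<otimes>\<^sub>a proj a X"
  have "Sum C ?W ?V (\<lambda>i. (case i of (s, a) \<Rightarrow> g a s) \<bullet> (c \<cdot> ?p i)) (carrier \<Gamma> \<times> carrier \<Gamma>) \<cdot> (e \<otimes>\<^sub>a x) =
      (case (s, a) of (s, a) \<Rightarrow> g a s) \<bullet> (c \<cdot> (e \<otimes>\<^sub>a x))"
  proof (rule weighted_Sum_comp[where W = ?W and U = ?W])
    fix i assume "i \<in> carrier \<Gamma> \<times> carrier \<Gamma>"
    then obtain s' a' where i: "i = (s', a')" "s' \<in> carrier \<Gamma>" "a' \<in> carrier \<Gamma>"
      by blast
    have "?p i \<cdot> (e \<otimes>\<^sub>a x) = (proj s' P \<cdot> e) \<otimes>\<^sub>a (proj a' X \<cdot> x)"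
      using eD xD i by (simp add: Hom_iff)
    then show "?p i \<cdot> (e \<otimes>\<^sub>a x) = (if i = (s, a) then e \<otimes>\<^sub>a x else Zero C ?W ?W)"
      using proj_comp_homogeneous[OF e i(2)] proj_comp_homogeneous[OF x i(3)] eD xD
        tens_zero[OF eD(2)] tens_zero[OF xD(2)] tens_zero[OF zero_hom[OF eD(4) eD(4)]]
      by (auto simp: i(1))
  qed (use c eD xD in \<open>auto simp: Hom_iff\<close>)
  moreover have "twist_braid g P X c = Sum C ?W ?V (\<lambda>i. (case i of (s, a) \<Rightarrow> g a s) \<bullet> (c \<cdot> ?p i)) (carrier \<Gamma> \<times> carrier \<Gamma>)"
    by (simp add: twist_braid_def case_prod_unfold)
  ultimately show ?thesis by simp
qed

text \<open>Naturality survives because \<open>f\<close> and \<open>x\<close> preserve degrees, so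
  the same weight appears on both sides.\<close>

lemma twist_braid_natural:
  assumes c: "c \<in> Braid C P X" and e: "e \<in> Braid C Q Y"
    and f: "f \<in> Hom C P Q" and x: "x \<in> Hom C X Y" and eq: "e \<cdot> (f \<otimes>\<^sub>a x) = (x \<otimes>\<^sub>a f) \<cdot> c"
  shows "twist_braid g Q Y e \<cdot> (f \<otimes>\<^sub>a x) = (x \<otimes>\<^sub>a f) \<cdot> twist_braid g P X c"
proof (rule tens2_eqI)
  show o: "P \<in> Obj C" "X \<in> Obj C"
    using f x Hom_Obj by auto
  have o': "Q \<in> Obj C" "Y \<in> Obj C"
    using f x Hom_Obj by auto
  note tc = twist_braid_hom[OF c o, of g] and te = twist_braid_hom[OF e o', of g]
  show "twist_braid g Q Y e \<cdot> (f \<otimes>\<^sub>a x) \<in> Hom C (P \<otimes>\<^sub>o X) (Y \<otimes>\<^sub>o Q)" "(x \<otimes>\<^sub>a f) \<cdot> twist_braid g P X c \<in> Hom C (P \<otimes>\<^sub>o X) (Y \<otimes>\<^sub>o Q)"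
    using tc te f x by (auto simp: Hom_iff)
  fix s a assume sa: "s \<in> carrier \<Gamma>" "a \<in> carrier \<Gamma>"
  have n: "proj s Q \<cdot> f = f \<cdot> proj s P" "proj a Y \<cdot> x = x \<cdot> proj a X"
    using proj_natural f x sa by auto
  have "(twist_braid g Q Y e \<cdot> (f \<otimes>\<^sub>a x)) \<cdot> (proj s P \<otimes>\<^sub>a proj a X) =
      (twist_braid g Q Y e \<cdot> (proj s Q \<otimes>\<^sub>a proj a Y)) \<cdot> (f \<otimes>\<^sub>a x)"
    using te f x o o' sa n by (simp add: Hom_iff)
  also have "\<dots> = g a s \<bullet> (e \<cdot> ((proj s Q \<otimes>\<^sub>a proj a Y) \<cdot> (f \<otimes>\<^sub>a x)))"
    unfolding twist_braid_comp[OF e homogeneous_proj[OF o'(1) sa(1)] homogeneous_proj[OF o'(2) sa(2)]]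
    using e f x o' sa by (simp add: Hom_iff)
  also have "\<dots> = g a s \<bullet> ((e \<cdot> (f \<otimes>\<^sub>a x)) \<cdot> (proj s P \<otimes>\<^sub>a proj a X))"
    using e f x o o' sa n by (simp add: Hom_iff)
  also have "\<dots> = (x \<otimes>\<^sub>a f) \<cdot> (g a s \<bullet> (c \<cdot> (proj s P \<otimes>\<^sub>a proj a X)))"
    unfolding eq using c f x o sa by (simp add: Hom_iff)
  also have "\<dots> = ((x \<otimes>\<^sub>a f) \<cdot> twist_braid g P X c) \<cdot> (proj s P \<otimes>\<^sub>a proj a X)"
    unfolding twist_braid_comp[OF c homogeneous_proj[OF o(1) sa(1)] homogeneous_proj[OF o(2) sa(2)], symmetric]
    using tc f x o sa by (simp add: Hom_iff)
  finally show "(twist_braid g Q Y e \<cdot> (f \<otimes>\<^sub>a x)) \<cdot> (proj s P \<otimes>\<^sub>a proj a X) =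
      ((x \<otimes>\<^sub>a f) \<cdot> twist_braid g P X c) \<cdot> (proj s P \<otimes>\<^sub>a proj a X)" .
qed

lemma twist_braid_graded:
  assumes "graded_braid P X c"
  shows "graded_braid P X (twist_braid g P X c)"
proof -
  note c = graded_braidD[OF assms]
  show ?thesis
    using c twist_braid_hom[OF c(3,1,2)]
      twist_braid_natural[OF c(3,3) proj_hom[OF c(1)] proj_hom[OF c(2)] c(4)]
    by (simp add: graded_braid_def)
qed

lemma twist_braid_scalar_multiple:
  assumes c: "graded_braid P X c" and sa: "s \<in> carrier \<Gamma>" "a \<in> carrier \<Gamma>"
  shows "scalar_multiple (P \<otimes>\<^sub>o X) (X \<otimes>\<^sub>o P) (twist_braid g P X c) c (g a s)
    (proj s P \<otimes>\<^sub>a proj a X) (proj a X \<otimes>\<^sub>a proj s P)"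
proof -
  note d = graded_braidD[OF c] and e = graded_braidD[OF twist_braid_graded[OF c, of g]]
  show ?thesis
    unfolding scalar_multiple_def
    using d(1-3) e(3) d(4)[OF sa] e(4)[OF sa] sa
      twist_braid_comp[OF d(3) homogeneous_proj[OF d(1) sa(1)] homogeneous_proj[OF d(2) sa(2)], of g]
    by (auto simp: Hom_iff)
qed

lemma twist_braid_unitary:
  assumes c: "graded_braid P X c" and u: "unitary C (P \<otimes>\<^sub>o X) (X \<otimes>\<^sub>o P) c"
    and g: "\<And>a s. \<lbrakk>a \<in> carrier \<Gamma>; s \<in> carrier \<Gamma>\<rbrakk> \<Longrightarrow> cmod (g a s) = 1"
  shows "unitary C (P \<otimes>\<^sub>o X) (X \<otimes>\<^sub>o P) (twist_braid g P X c)"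
proof -
  note d = graded_braidD[OF c] and e = graded_braidD[OF twist_braid_graded[OF c, of g]]
  let ?t = "twist_braid g P X c"
  have u': "c\<^sup>\<dagger> \<cdot> c = Id C (P \<otimes>\<^sub>o X)" "c \<cdot> c\<^sup>\<dagger> = Id C (X \<otimes>\<^sub>o P)"
    using u by (auto simp: unitary_def)
  have gg: "cnj (g a s) * g a s = 1" if "a \<in> carrier \<Gamma>" "s \<in> carrier \<Gamma>" for a s
    using g[OF that] complex_norm_square[of "g a s"] by (simp add: mult.commute)
  have "?t\<^sup>\<dagger> \<cdot> ?t = Id C (P \<otimes>\<^sub>o X)"
  proof (rule tens2_eqI[OF d(1,2) comp_hom[OF e(3) adj_hom[OF e(3)]] id_hom[OF tens_obj[OF d(1,2)]]])
    fix s a assume sa: "s \<in> carrier \<Gamma>" "a \<in> carrier \<Gamma>"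
    note r = twist_braid_scalar_multiple[OF c sa, of g]
    note q = scalar_multiple_comp[OF scalar_multiple_adj[OF r] r]
    show "(?t\<^sup>\<dagger> \<cdot> ?t) \<cdot> (proj s P \<otimes>\<^sub>a proj a X) = Id C (P \<otimes>\<^sub>o X) \<cdot> (proj s P \<otimes>\<^sub>a proj a X)"
      using scalar_multipleD(7)[OF q] u' gg[OF sa(2,1)] d sa by simp
  qed
  moreover have "?t \<cdot> ?t\<^sup>\<dagger> = Id C (X \<otimes>\<^sub>o P)"
  proof (rule tens2_eqI[OF d(2,1) comp_hom[OF adj_hom[OF e(3)] e(3)] id_hom[OF tens_obj[OF d(2,1)]]])
    fix a s assume sa: "a \<in> carrier \<Gamma>" "s \<in> carrier \<Gamma>"
    note r = twist_braid_scalar_multiple[OF c sa(2,1), of g]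
    note q = scalar_multiple_comp[OF r scalar_multiple_adj[OF r]]
    show "(?t \<cdot> ?t\<^sup>\<dagger>) \<cdot> (proj a X \<otimes>\<^sub>a proj s P) = Id C (X \<otimes>\<^sub>o P) \<cdot> (proj a X \<otimes>\<^sub>a proj s P)"
      using scalar_multipleD(7)[OF q] u' gg[OF sa] d sa by (simp add: mult.commute)
  qed
  ultimately show ?thesis
    using e by (simp add: unitary_def)
qed

lemma twist_braid_twist_braid:
  assumes c: "c \<in> Braid C P X" and P: "P \<in> Obj C" and X: "X \<in> Obj C"
    and fg: "\<And>a s. \<lbrakk>a \<in> carrier \<Gamma>; s \<in> carrier \<Gamma>\<rbrakk> \<Longrightarrow> f a s * g a s = 1"
  shows "twist_braid f P X (twist_braid g P X c) = c"
proof (rule tens2_eqI[OF P X _ c])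
  note h = twist_braid_hom[OF c P X, of g]
  show "twist_braid f P X (twist_braid g P X c) \<in> Braid C P X"
    by (rule twist_braid_hom[OF h P X])
  fix s a assume sa: "s \<in> carrier \<Gamma>" "a \<in> carrier \<Gamma>"
  note p = homogeneous_proj[OF P sa(1)] homogeneous_proj[OF X sa(2)]
  show "twist_braid f P X (twist_braid g P X c) \<cdot> (proj s P \<otimes>\<^sub>a proj a X) = c \<cdot> (proj s P \<otimes>\<^sub>a proj a X)"
    unfolding twist_braid_comp[OF h p] twist_braid_comp[OF c p]
    using c P X sa fg[OF sa(2,1)] by (simp add: Hom_iff)
qed

lemma twist_braid_Unit:
  assumes P: "P \<in> Obj C" and g: "\<And>s. s \<in> carrier \<Gamma> \<Longrightarrow> g \<one>\<^bsub>\<Gamma>\<^esub> s = 1"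
  shows "twist_braid g P (Unit C) (Id C P) = Id C P"
proof (rule id_resolution_eqI[OF proj_resolution[OF P]])
  have i: "Id C P \<in> Hom C (P \<otimes>\<^sub>o Unit C) (Unit C \<otimes>\<^sub>o P)"
    using P by (simp add: Hom_iff)
  show "twist_braid g P (Unit C) (Id C P) \<in> Hom C P P" "Id C P \<in> Hom C P P"
    using twist_braid_hom[OF i P obj_unit] P by (simp_all add: id_hom)
  fix s assume s: "s \<in> carrier \<Gamma>"
  show "twist_braid g P (Unit C) (Id C P) \<cdot> proj s P = Id C P \<cdot> proj s P"
    using twist_braid_comp[OF i homogeneous_proj[OF P s] homogeneous_Unit, of g] g[OF s] P s by simp
qed

text \<open>The scalar lists the contributions of the five factors from left to right; the factors
  \<open>1\<close> belong to the identities with which the half-braidings are whiskered.\<close>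

lemma hexagon_scalar_multiple:
  assumes c: "graded_braid P X c" and e: "graded_braid Q X e"
    and s: "s \<in> carrier \<Gamma>" and t: "t \<in> carrier \<Gamma>" and a: "a \<in> carrier \<Gamma>"
  shows "scalar_multiple ((P \<otimes>\<^sub>o Q) \<otimes>\<^sub>o X) (X \<otimes>\<^sub>o (P \<otimes>\<^sub>o Q))
    (hexagon (twist C \<Gamma> G \<omega>) P Q X (twist_braid g P X c) (twist_braid g Q X e)) (hexagon C P Q X c e)
    (\<omega> a s t * (g a s * 1) * cnj (\<omega> s a t) * (1 * g a t) * \<omega> s t a)
    ((proj s P \<otimes>\<^sub>a proj t Q) \<otimes>\<^sub>a proj a X) (proj a X \<otimes>\<^sub>a (proj s P \<otimes>\<^sub>a proj t Q))"
proof -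
  note cD = graded_braidD[OF c] and eD = graded_braidD[OF e]
  note p = homogeneous_proj[OF cD(1) s] homogeneous_proj[OF eD(1) t] homogeneous_proj[OF cD(2) a]
  note h = homogeneousD(2,3)
  show ?thesis
    unfolding hexagon_def twist_simps
    by (rule scalar_multiple_comp[OF scalar_multiple_comp[OF scalar_multiple_comp[OF scalar_multiple_comp[OF
          assoc\<omega>_scalar_multiple[OF p(3,1,2)]
          scalar_multiple_tens[OF twist_braid_scalar_multiple[OF c s a] scalar_multiple_Id[OF h[OF p(2)]]]]
          scalar_multiple_adj[OF assoc\<omega>_scalar_multiple[OF p(1,3,2)]]]
          scalar_multiple_tens[OF scalar_multiple_Id[OF h[OF p(1)]] twist_braid_scalar_multiple[OF e t a]]]
          assoc\<omega>_scalar_multiple[OF p(1,2,3)]])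
qed

lemma braid_tens_scalar_multiple:
  assumes c: "graded_braid P X c" and e: "graded_braid P Y e"
    and s: "s \<in> carrier \<Gamma>" and a: "a \<in> carrier \<Gamma>" and b: "b \<in> carrier \<Gamma>"
  shows "scalar_multiple (P \<otimes>\<^sub>o (X \<otimes>\<^sub>o Y)) ((X \<otimes>\<^sub>o Y) \<otimes>\<^sub>o P)
    (braid_tens (twist C \<Gamma> G \<omega>) P X Y (twist_braid g P X c) (twist_braid g P Y e)) (braid_tens C P X Y c e)
    (cnj (\<omega> a b s) * (1 * g b s) * \<omega> a s b * (g a s * 1) * cnj (\<omega> s a b))
    (proj s P \<otimes>\<^sub>a (proj a X \<otimes>\<^sub>a proj b Y)) ((proj a X \<otimes>\<^sub>a proj b Y) \<otimes>\<^sub>a proj s P)"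
proof -
  note cD = graded_braidD[OF c] and eD = graded_braidD[OF e]
  note p = homogeneous_proj[OF cD(1) s] homogeneous_proj[OF cD(2) a] homogeneous_proj[OF eD(2) b]
  note h = homogeneousD(2,3)
  show ?thesis
    unfolding braid_tens_def twist_simps
    by (rule scalar_multiple_comp[OF scalar_multiple_comp[OF scalar_multiple_comp[OF scalar_multiple_comp[OF
          scalar_multiple_adj[OF assoc\<omega>_scalar_multiple[OF p(2,3,1)]]
          scalar_multiple_tens[OF scalar_multiple_Id[OF h[OF p(2)]] twist_braid_scalar_multiple[OF e s b]]]
          assoc\<omega>_scalar_multiple[OF p(2,1,3)]]
          scalar_multiple_tens[OF twist_braid_scalar_multiple[OF c s a] scalar_multiple_Id[OF h[OF p(3)]]]]
          scalar_multiple_adj[OF assoc\<omega>_scalar_multiple[OF p(1,2,3)]]])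
qed

text \<open>The assumption on \<open>g\<close> says that the scalar collected by the twisted hexagon
  is the weight of the half-braiding at the product degree. On every component both sides are thus
  the same invertible multiple of the untwisted sides. The equivalence, rather than one implication,
  is needed to pass between the two centers in both directions.\<close>

lemma hexagon_twist_iff:
  assumes c: "graded_braid P X c" and e: "graded_braid Q X e" and d: "graded_braid (P \<otimes>\<^sub>o Q) X d"
    and g1: "\<And>a s. \<lbrakk>a \<in> carrier \<Gamma>; s \<in> carrier \<Gamma>\<rbrakk> \<Longrightarrow> cmod (g a s) = 1"
    and g: "\<And>a s t. \<lbrakk>a \<in> carrier \<Gamma>; s \<in> carrier \<Gamma>; t \<in> carrier \<Gamma>\<rbrakk> \<Longrightarrow>
      g a (s \<otimes>\<^bsub>\<Gamma>\<^esub> t) = \<omega> a s t * g a s * cnj (\<omega> s a t) * g a t * \<omega> s t a"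
  shows "hexagon (twist C \<Gamma> G \<omega>) P Q X (twist_braid g P X c) (twist_braid g Q X e) = twist_braid g (P \<otimes>\<^sub>o Q) X d \<longleftrightarrow>
    hexagon C P Q X c e = d"
proof -
  note cD = graded_braidD[OF c] and eD = graded_braidD[OF e] and dD = graded_braidD[OF d]
  note P = cD(1) and Q = eD(1) and X = cD(2)
  let ?H' = "hexagon (twist C \<Gamma> G \<omega>) P Q X (twist_braid g P X c) (twist_braid g Q X e)"
    and ?H = "hexagon C P Q X c e" and ?d' = "twist_braid g (P \<otimes>\<^sub>o Q) X d"
  let ?p = "\<lambda>s t a. (proj s P \<otimes>\<^sub>a proj t Q) \<otimes>\<^sub>a proj a X"
  have H: "?H \<in> Braid C (P \<otimes>\<^sub>o Q) X"
    by (rule hexagon_hom[OF cD(3) eD(3) P Q X])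
  have H': "?H' \<in> Braid C (P \<otimes>\<^sub>o Q) X"
    using scalar_multipleD(1)[OF hexagon_scalar_multiple[OF c e \<Gamma>.one_closed \<Gamma>.one_closed \<Gamma>.one_closed]] .
  have d': "?d' \<in> Braid C (P \<otimes>\<^sub>o Q) X"
    by (rule twist_braid_hom[OF dD(3,1,2)])
  have eq: "?H' \<cdot> ?p s t a = g a (s \<otimes>\<^bsub>\<Gamma>\<^esub> t) \<bullet> (?H \<cdot> ?p s t a)" "?d' \<cdot> ?p s t a = g a (s \<otimes>\<^bsub>\<Gamma>\<^esub> t) \<bullet> (d \<cdot> ?p s t a)"
    "cnj (g a (s \<otimes>\<^bsub>\<Gamma>\<^esub> t)) * g a (s \<otimes>\<^bsub>\<Gamma>\<^esub> t) = 1"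
    if s: "s \<in> carrier \<Gamma>" and t: "t \<in> carrier \<Gamma>" and a: "a \<in> carrier \<Gamma>" for s t a
  proof -
    show "?H' \<cdot> ?p s t a = g a (s \<otimes>\<^bsub>\<Gamma>\<^esub> t) \<bullet> (?H \<cdot> ?p s t a)"
      using scalar_multipleD(7)[OF hexagon_scalar_multiple[OF c e s t a]] g[OF a s t] by simp
    show "?d' \<cdot> ?p s t a = g a (s \<otimes>\<^bsub>\<Gamma>\<^esub> t) \<bullet> (d \<cdot> ?p s t a)"
      by (rule twist_braid_comp[OF dD(3) homogeneous_tens[OF homogeneous_proj[OF P s] homogeneous_proj[OF Q t]]
            homogeneous_proj[OF X a]])
    show "cnj (g a (s \<otimes>\<^bsub>\<Gamma>\<^esub> t)) * g a (s \<otimes>\<^bsub>\<Gamma>\<^esub> t) = 1"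
      using g1[OF a, of "s \<otimes>\<^bsub>\<Gamma>\<^esub> t"] s t complex_norm_square[of "g a (s \<otimes>\<^bsub>\<Gamma>\<^esub> t)"] by (simp add: mult.commute)
  qed
  have iff: "?H' \<cdot> ?p s t a = ?d' \<cdot> ?p s t a \<longleftrightarrow> ?H \<cdot> ?p s t a = d \<cdot> ?p s t a"
    if s: "s \<in> carrier \<Gamma>" and t: "t \<in> carrier \<Gamma>" and a: "a \<in> carrier \<Gamma>" for s t a
  proof
    \<comment> \<open>The common weight is unimodular, so multiplication by its conjugate removes
      it.\<close>
    have "cnj (g a (s \<otimes>\<^bsub>\<Gamma>\<^esub> t)) \<bullet> g a (s \<otimes>\<^bsub>\<Gamma>\<^esub> t) \<bullet> (x \<cdot> ?p s t a) = x \<cdot> ?p s t a"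
      if "x \<in> Braid C (P \<otimes>\<^sub>o Q) X" for x
      using that eq(3)[OF s t a] P Q X s t a by (simp add: Hom_iff)
    then show "?H \<cdot> ?p s t a = d \<cdot> ?p s t a" if "?H' \<cdot> ?p s t a = ?d' \<cdot> ?p s t a"
      using that H dD(3) unfolding eq(1,2)[OF s t a] by metis
  qed (simp add: eq(1,2)[OF s t a])
  show ?thesis
    using tens3_eqI[OF P Q X H dD(3)] tens3_eqI[OF P Q X H' d'] iff by auto
qed

text \<open>Twist both half-braidings by \<open>g\<close>, multiply them with the twisted
  associators, and twist back by \<open>f\<close> at the degree \<open>a b\<close> of
  \<open>X \<otimes> Y\<close>: the net effect on the original product is the weight
  \<open>\<tau> a b s\<close>.\<close>

lemma weighted_braid_tens_eq:
  assumes c: "graded_braid P X c" and e: "graded_braid P Y e"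
    and \<tau>: "\<And>a b s. \<lbrakk>a \<in> carrier \<Gamma>; b \<in> carrier \<Gamma>; s \<in> carrier \<Gamma>\<rbrakk> \<Longrightarrow>
      \<tau> a b s = f (a \<otimes>\<^bsub>\<Gamma>\<^esub> b) s * (cnj (\<omega> a b s) * g b s * \<omega> a s b * g a s * cnj (\<omega> s a b))"
  shows "Sum C (P \<otimes>\<^sub>o (X \<otimes>\<^sub>o Y)) ((X \<otimes>\<^sub>o Y) \<otimes>\<^sub>o P)
      (\<lambda>(a, b, s). \<tau> a b s \<bullet> (braid_tens C P X Y c e \<cdot> (proj s P \<otimes>\<^sub>a (proj a X \<otimes>\<^sub>a proj b Y))))
      (carrier \<Gamma> \<times> carrier \<Gamma> \<times> carrier \<Gamma>) =
    twist_braid f P (X \<otimes>\<^sub>o Y) (braid_tens (twist C \<Gamma> G \<omega>) P X Y (twist_braid g P X c) (twist_braid g P Y e))"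
    (is "?S = ?R")
proof -
  note cD = graded_braidD[OF c] and eD = graded_braidD[OF e]
  note P = cD(1) and X = cD(2) and Y = eD(2)
  let ?B = "braid_tens C P X Y c e" and ?B' = "braid_tens (twist C \<Gamma> G \<omega>) P X Y (twist_braid g P X c) (twist_braid g P Y e)"
  let ?W = "P \<otimes>\<^sub>o (X \<otimes>\<^sub>o Y)" and ?V = "(X \<otimes>\<^sub>o Y) \<otimes>\<^sub>o P"
  let ?p = "\<lambda>(a, b, s). proj s P \<otimes>\<^sub>a (proj a X \<otimes>\<^sub>a proj b Y)"
  have B: "?B \<in> Hom C ?W ?V"
    by (rule braid_tens_hom[OF cD(3) eD(3) P X Y])
  have B': "?B' \<in> Hom C ?W ?V"
    using scalar_multipleD(1)[OF braid_tens_scalar_multiple[OF c e \<Gamma>.one_closed \<Gamma>.one_closed \<Gamma>.one_closed]] .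
  have S: "?S = Sum C ?W ?V (\<lambda>i. (case i of (a, b, s) \<Rightarrow> \<tau> a b s) \<bullet> (?B \<cdot> ?p i)) (carrier \<Gamma> \<times> carrier \<Gamma> \<times> carrier \<Gamma>)"
    by (simp add: case_prod_unfold)
  show ?thesis
  proof (rule tens3_eqI'[OF P X Y])
    show "?S \<in> Hom C ?W ?V"
      by (rule Sum_hom) (use P X Y B in \<open>auto simp: Hom_iff\<close>)
    show "?R \<in> Hom C ?W ?V"
      by (rule twist_braid_hom[OF B']) (use P X Y in auto)
    fix s a b assume sab: "s \<in> carrier \<Gamma>" "a \<in> carrier \<Gamma>" "b \<in> carrier \<Gamma>"
    note p = homogeneous_proj[OF P sab(1)] homogeneous_proj[OF X sab(2)] homogeneous_proj[OF Y sab(3)]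
    let ?x = "proj s P \<otimes>\<^sub>a (proj a X \<otimes>\<^sub>a proj b Y)"
    have x: "?x \<in> Hom C ?W ?W"
      using P X Y sab by (simp add: Hom_iff)
    have "?S \<cdot> ?x = (case (a, b, s) of (a, b, s) \<Rightarrow> \<tau> a b s) \<bullet> (?B \<cdot> ?x)"
      unfolding S
    proof (rule weighted_Sum_comp[OF _ B _ x])
      fix j assume "j \<in> carrier \<Gamma> \<times> carrier \<Gamma> \<times> carrier \<Gamma>"
      then obtain a' b' s' where j: "j = (a', b', s')" "a' \<in> carrier \<Gamma>" "b' \<in> carrier \<Gamma>" "s' \<in> carrier \<Gamma>"
        by blast
      show "?p j \<cdot> ?x = (if j = (a, b, s) then ?x else Zero C ?W ?W)"
        using proj_tens3_comp(2)[OF p j(4,2,3)] by (auto simp: j(1))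
    qed (use P X Y sab in \<open>auto simp: Hom_iff\<close>)
    also have "\<dots> = f (a \<otimes>\<^bsub>\<Gamma>\<^esub> b) s \<bullet> (?B' \<cdot> ?x)"
      using scalar_multipleD(7)[OF braid_tens_scalar_multiple[OF c e sab, of g]] \<tau>[OF sab(2,3,1)] comp_hom[OF x B]
      by (simp add: scale_scale[OF comp_hom[OF x B]])
    also have "\<dots> = ?R \<cdot> ?x"
      by (rule twist_braid_comp[symmetric, OF B' p(1) homogeneous_tens[OF p(2,3)]])
    finally show "?S \<cdot> ?x = ?R \<cdot> ?x" .
  qed
qed

end

lemma (in ind_category) emb_obj_tens:
  assumes Y: "Y \<in> Obj C" and Z: "Z \<in> Obj C"
  shows "(emb_obj C (Y \<otimes>\<^sub>o Z) :: ('o, 'a, 'i) ind_obj) = emb_obj C Y \<odot> emb_obj C Z"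
proof (rule ind_obj.equality)
  show "Con (emb_obj C (Y \<otimes>\<^sub>o Z) :: ('o, 'a, 'i) ind_obj) = Con (emb_obj C Y \<odot> emb_obj C Z)"
    by (intro ext) (use Y Z in \<open>auto simp: emb_obj_def ind_tens_obj_def Let_def\<close>)
qed (auto simp: emb_obj_def ind_tens_obj_def Let_def)

subsection \<open>The center\<close>

text \<open>Centers are developed from the monoidal star structure of the ind-category and the
  embedding alone, so the results apply both to \<open>C\<close> and to its twist, for which nothing
  more is established.\<close>

locale half_braided_category = star_tensor_category D
  for D :: "(('o, 'a, 'i) ind_obj, ('o, 'a, 'i) ind_arr) tensor_cat" (structure) +
  fixes E :: "('o, 'a) tensor_cat"
  assumes ind_eq: "ind E = D"
    and emb_Obj [simp]: "Y \<in> Obj E \<Longrightarrow> emb_obj E Y \<in> Obj D"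
    and emb_hom: "f \<in> Hom E Y Z \<Longrightarrow> emb_arr E f \<in> Hom D (emb_obj E Y) (emb_obj E Z)"
    and Obj_tens [simp]: "\<lbrakk>Y \<in> Obj E; Z \<in> Obj E\<rbrakk> \<Longrightarrow> Y \<otimes>\<^sub>o\<^bsub>E\<^esub> Z \<in> Obj E"
    and emb_tens: "\<lbrakk>Y \<in> Obj E; Z \<in> Obj E\<rbrakk> \<Longrightarrow> emb_obj E (Y \<otimes>\<^sub>o\<^bsub>E\<^esub> Z) = emb_obj E Y \<otimes>\<^sub>o emb_obj E Z"
begin

abbreviation J :: "'o \<Rightarrow> ('o, 'a, 'i) ind_obj" where
  "J \<equiv> emb_obj E"

lemma ind_objects_eq: "ind_objects E = Obj D"
  by (simp flip: ind_eq)

lemma half_braiding_iff: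
  "half_braiding E X c \<longleftrightarrow> c \<in> extensional (Obj E) \<and>
     (\<forall>Y\<in>Obj E. unitary D (J Y \<otimes>\<^sub>o X) (X \<otimes>\<^sub>o J Y) (c Y)) \<and>
     (\<forall>Y\<in>Obj E. \<forall>Z\<in>Obj E. \<forall>f\<in>Hom E Y Z.
        c Z \<cdot> (emb_arr E f \<rhd> X) = (X \<lhd> emb_arr E f) \<cdot> c Y) \<and>
     (\<forall>Y\<in>Obj E. \<forall>Z\<in>Obj E. hexagon D (J Y) (J Z) X (c Y) (c Z) = c (Y \<otimes>\<^sub>o\<^bsub>E\<^esub> Z))"
  unfolding half_braiding_def ind_eq Let_def hexagon_def ..

lemma center_objects_iff: "A \<in> center_objects E \<longleftrightarrow> fst A \<in> Obj D \<and> half_braiding E (fst A) (snd A)"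
  by (cases A) (simp add: center_objects_def ind_objects_eq)

lemma center_objectsD:
  assumes "A \<in> center_objects E"
  shows "fst A \<in> Obj D" "snd A \<in> extensional (Obj E)"
    "\<And>Y. Y \<in> Obj E \<Longrightarrow> unitary D (J Y \<otimes>\<^sub>o fst A) (fst A \<otimes>\<^sub>o J Y) (snd A Y)"
    "\<And>Y. Y \<in> Obj E \<Longrightarrow> snd A Y \<in> Braid D (J Y) (fst A)"
    "\<And>Y Z f. \<lbrakk>Y \<in> Obj E; Z \<in> Obj E; f \<in> Hom E Y Z\<rbrakk> \<Longrightarrow>
      snd A Z \<cdot> (emb_arr E f \<rhd> fst A) = (fst A \<lhd> emb_arr E f) \<cdot> snd A Y"
    "\<And>Y Z. \<lbrakk>Y \<in> Obj E; Z \<in> Obj E\<rbrakk> \<Longrightarrow>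
      hexagon D (J Y) (J Z) (fst A) (snd A Y) (snd A Z) = snd A (Y \<otimes>\<^sub>o\<^bsub>E\<^esub> Z)"
  using assms by (auto simp: center_objects_iff half_braiding_iff unitary_def)

text \<open>Arrows of the center are records that carry their end points; this predicate isolates
  the condition on the underlying morphism, and the same morphism can be considered between
  different objects of the center.\<close>

definition intertwiner where
  "intertwiner A B u \<longleftrightarrow> A \<in> center_objects E \<and> B \<in> center_objects E \<and> u \<in> Hom D (fst A) (fst B) \<and>
     (\<forall>Y\<in>Obj E. (u \<rhd> J Y) \<cdot> snd A Y = snd B Y \<cdot> (J Y \<lhd> u))"

lemma intertwinerD:
  assumes "intertwiner A B u"
  shows "A \<in> center_objects E" "B \<in> center_objects E" "u \<in> Hom D (fst A) (fst B)"
    "\<And>Y. Y \<in> Obj E \<Longrightarrow> (u \<rhd> J Y) \<cdot> snd A Y = snd B Y \<cdot> (J Y \<lhd> u)"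
  using assms by (auto simp: intertwiner_def)

lemma center_fields [simp]:
  "Obj (center_with E \<beta>) = center_objects E"
  "Arr (center_with E \<beta>) = {x. intertwiner (CSrc x) (CTgt x) (Und x)}"
  "Dom (center_with E \<beta>) = CSrc" "Cod (center_with E \<beta>) = CTgt"
  "Id (center_with E \<beta>) A = \<lparr>CSrc = A, CTgt = A, Und = Id D (fst A)\<rparr>"
  "Comp (center_with E \<beta>) y x = \<lparr>CSrc = CSrc x, CTgt = CTgt y, Und = Und y \<cdot> Und x\<rparr>"
  "Zero (center_with E \<beta>) A B = \<lparr>CSrc = A, CTgt = B, Und = Zero D (fst A) (fst B)\<rparr>"
  "Plus (center_with E \<beta>) x y = \<lparr>CSrc = CSrc x, CTgt = CTgt x, Und = Und x \<boxplus> Und y\<rparr>"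
  "Scale (center_with E \<beta>) z x = \<lparr>CSrc = CSrc x, CTgt = CTgt x, Und = z \<bullet> Und x\<rparr>"
  "Adj (center_with E \<beta>) x = \<lparr>CSrc = CTgt x, CTgt = CSrc x, Und = (Und x)\<^sup>\<dagger>\<rparr>"
  "TensO (center_with E \<beta>) A B = (fst A \<otimes>\<^sub>o fst B, \<beta> A B)"
  "TensA (center_with E \<beta>) x y = \<lparr>CSrc = (fst (CSrc x) \<otimes>\<^sub>o fst (CSrc y), \<beta> (CSrc x) (CSrc y)),
     CTgt = (fst (CTgt x) \<otimes>\<^sub>o fst (CTgt y), \<beta> (CTgt x) (CTgt y)), Und = Und x \<otimes>\<^sub>a Und y\<rparr>"
  "Unit (center_with E \<beta>) = (Unit D, \<lambda>Y\<in>Obj E. Id D (J Y))"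
  "Assoc (center_with E \<beta>) A B F = \<lparr>CSrc = ((fst A \<otimes>\<^sub>o fst B) \<otimes>\<^sub>o fst F, \<beta> (fst A \<otimes>\<^sub>o fst B, \<beta> A B) F),
     CTgt = (fst A \<otimes>\<^sub>o (fst B \<otimes>\<^sub>o fst F), \<beta> A (fst B \<otimes>\<^sub>o fst F, \<beta> B F)), Und = Assoc D (fst A) (fst B) (fst F)\<rparr>"
  by (simp_all add: center_with_def Let_def ind_eq center_arrows_def intertwiner_def)

lemma center_Hom:
  "x \<in> Hom (center_with E \<beta>) A B \<longleftrightarrow> CSrc x = A \<and> CTgt x = B \<and> intertwiner A B (Und x)"
  by (auto simp: Hom_def)

lemma intertwiner_Id: "A \<in> center_objects E \<Longrightarrow> intertwiner A A (Id D (fst A))"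
  using center_objectsD(1,4)[of A] by (auto simp: intertwiner_def Hom_iff)

lemma intertwiner_zero:
  assumes A: "A \<in> center_objects E" and B: "B \<in> center_objects E"
  shows "intertwiner A B (Zero D (fst A) (fst B))"
proof -
  note o = center_objectsD(1)[OF A] center_objectsD(1)[OF B]
  have "(Zero D (fst A) (fst B) \<rhd> J Y) \<cdot> snd A Y = snd B Y \<cdot> (J Y \<lhd> Zero D (fst A) (fst B))"
    if Y: "Y \<in> Obj E" for Y
    using tens_zero[OF id_hom[OF emb_Obj[OF Y]] o] zero_comp[OF center_objectsD(4)[OF A Y]]
      comp_zero[OF center_objectsD(4)[OF B Y]] o Y by simp
  then show ?thesis
    using A B o zero_hom by (auto simp: intertwiner_def)
qed

lemma intertwiner_comp:
  assumes u: "intertwiner A B u" and v: "intertwiner B F v"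
  shows "intertwiner A F (v \<cdot> u)"
proof -
  note uD = intertwinerD[OF u] and vD = intertwinerD[OF v]
  have "((v \<cdot> u) \<rhd> J Y) \<cdot> snd A Y = snd F Y \<cdot> (J Y \<lhd> (v \<cdot> u))" if Y: "Y \<in> Obj E" for Y
  proof -
    note c = center_objectsD(4)[OF uD(1) Y] center_objectsD(4)[OF uD(2) Y] center_objectsD(4)[OF vD(2) Y]
    have "((v \<cdot> u) \<rhd> J Y) \<cdot> snd A Y = (v \<rhd> J Y) \<cdot> ((u \<rhd> J Y) \<cdot> snd A Y)"
      using uD(3) vD(3) c Y by (simp add: Hom_iff)
    also have "\<dots> = ((v \<rhd> J Y) \<cdot> snd B Y) \<cdot> (J Y \<lhd> u)"
      unfolding uD(4)[OF Y] using uD(3) vD(3) c Y by (simp add: Hom_iff)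
    also have "\<dots> = snd F Y \<cdot> (J Y \<lhd> (v \<cdot> u))"
      unfolding vD(4)[OF Y] using uD(3) vD(3) c Y by (simp add: Hom_iff)
    finally show ?thesis .
  qed
  then show ?thesis
    using uD vD by (auto simp: intertwiner_def Hom_iff)
qed

lemma intertwiner_plus:
  assumes u: "intertwiner A B u" and v: "intertwiner A B v"
  shows "intertwiner A B (u \<boxplus> v)"
proof -
  note uD = intertwinerD[OF u] and vD = intertwinerD[OF v]
  have "((u \<boxplus> v) \<rhd> J Y) \<cdot> snd A Y = snd B Y \<cdot> (J Y \<lhd> (u \<boxplus> v))" if Y: "Y \<in> Obj E" for Y
  proof -
    note c = center_objectsD(4)[OF uD(1) Y] center_objectsD(4)[OF uD(2) Y]
    have J: "Id D (J Y) \<in> Hom D (J Y) (J Y)"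
      using Y id_hom by simp
    show ?thesis
      unfolding plus_tens[OF uD(3) vD(3) J] tens_plus[OF J uD(3) vD(3)]
        plus_comp[OF c(1) tens_hom[OF uD(3) J] tens_hom[OF vD(3) J]]
        comp_plus[OF tens_hom[OF J uD(3)] tens_hom[OF J vD(3)] c(2)] uD(4)[OF Y] vD(4)[OF Y] ..
  qed
  then show ?thesis
    using uD vD plus_hom by (auto simp: intertwiner_def)
qed

lemma intertwiner_scale:
  assumes u: "intertwiner A B u"
  shows "intertwiner A B (z \<bullet> u)"
proof -
  note uD = intertwinerD[OF u]
  have "((z \<bullet> u) \<rhd> J Y) \<cdot> snd A Y = snd B Y \<cdot> (J Y \<lhd> (z \<bullet> u))" if Y: "Y \<in> Obj E" for Y
  proof -
    note c = center_objectsD(4)[OF uD(1) Y] center_objectsD(4)[OF uD(2) Y]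
    have J: "Id D (J Y) \<in> Hom D (J Y) (J Y)"
      using Y id_hom by simp
    show ?thesis
      unfolding scale_tens[OF uD(3) J] tens_scale[OF J uD(3)]
        scale_comp[OF c(1) tens_hom[OF uD(3) J]] comp_scale[OF tens_hom[OF J uD(3)] c(2)] uD(4)[OF Y] ..
  qed
  then show ?thesis
    using uD scale_hom by (auto simp: intertwiner_def)
qed

text \<open>The adjoint of the intertwining relation is a relation between the inverse
  half-braidings; unitarity turns it into one between the half-braidings themselves.\<close>

lemma intertwiner_adj:
  assumes u: "intertwiner A B u"
  shows "intertwiner B A (u\<^sup>\<dagger>)"
proof -
  note uD = intertwinerD[OF u]
  have "(u\<^sup>\<dagger> \<rhd> J Y) \<cdot> snd B Y = snd A Y \<cdot> (J Y \<lhd> u\<^sup>\<dagger>)" if Y: "Y \<in> Obj E" for Y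
  proof -
    note c = center_objectsD(4)[OF uD(1) Y] center_objectsD(4)[OF uD(2) Y]
    note un = center_objectsD(3)[OF uD(1) Y] center_objectsD(3)[OF uD(2) Y]
    have *: "(snd A Y)\<^sup>\<dagger> \<cdot> (u\<^sup>\<dagger> \<rhd> J Y) = (J Y \<lhd> u\<^sup>\<dagger>) \<cdot> (snd B Y)\<^sup>\<dagger>"
      using arg_cong[OF uD(4)[OF Y], of "Adj D"] uD(3) c Y by (simp add: Hom_iff)
    have "(u\<^sup>\<dagger> \<rhd> J Y) \<cdot> snd B Y = (snd A Y \<cdot> (snd A Y)\<^sup>\<dagger>) \<cdot> ((u\<^sup>\<dagger> \<rhd> J Y) \<cdot> snd B Y)"
      using un(1) uD(3) c Y by (simp add: unitary_def Hom_iff del: comp_assoc_arr)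
    also have "\<dots> = snd A Y \<cdot> (((snd A Y)\<^sup>\<dagger> \<cdot> (u\<^sup>\<dagger> \<rhd> J Y)) \<cdot> snd B Y)"
      using uD(3) c Y by (simp add: Hom_iff)
    also have "\<dots> = snd A Y \<cdot> ((J Y \<lhd> u\<^sup>\<dagger>) \<cdot> ((snd B Y)\<^sup>\<dagger> \<cdot> snd B Y))"
      unfolding * using uD(3) c Y by (simp add: Hom_iff)
    also have "\<dots> = snd A Y \<cdot> (J Y \<lhd> u\<^sup>\<dagger>)"
      using un(2) uD(3) c Y by (simp add: unitary_def Hom_iff)
    finally show ?thesis .
  qed
  then show ?thesis
    using uD adj_hom by (auto simp: intertwiner_def)
qed

lemmas intertwiner_intros = intertwiner_Id intertwiner_zero intertwiner_comp intertwiner_plus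
  intertwiner_scale intertwiner_adj

text \<open>Holds for every product rule \<open>\<beta>\<close>, so the center with the weighted
  product may be used as a star category before that product is known to stay in the center.\<close>

lemma star_category_center:
  "star_category (center_with E \<beta> :: (('o, 'a, 'i) center_obj, ('o, 'a, 'i) center_arr) tensor_cat)"
proof
  fix f :: "('o, 'a, 'i) center_arr"
  assume "f \<in> Arr (center_with E \<beta>)"
  then show "Dom (center_with E \<beta>) f \<in> Obj (center_with E \<beta>) \<and> Cod (center_with E \<beta>) f \<in> Obj (center_with E \<beta>)"
    using intertwinerD(1,2)[of "CSrc f" "CTgt f" "Und f"] by simp
qed (auto simp: center_Hom intertwiner_intros intro!: center_arr.equality
    dest!: intertwinerD(3) intro: comp_id id_comp comp_assoc plus_assoc plus_comm plus_zero plus_minus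
      scale_plus plus_scale scale_scale scale_one comp_plus plus_comp comp_scale scale_comp adj_adj adj_comp
      adj_plus adj_scale)

lemma center_Sum:
  assumes "finite I" and A: "A \<in> center_objects E" and B: "B \<in> center_objects E"
    and t: "\<And>i. i \<in> I \<Longrightarrow> t i \<in> Hom (center_with E \<beta>) A B"
  shows "Sum (center_with E \<beta>) A B t I = \<lparr>CSrc = A, CTgt = B, Und = Sum D (fst A) (fst B) (\<lambda>i. Und (t i)) I\<rparr>"
  using assms(1) t
proof (induction I rule: finite_induct)
  case empty
  interpret Z: star_category "center_with E \<beta>"
    by (rule star_category_center)
  show ?case
    using A B center_objectsD(1) by (simp add: Z.Sum_empty Sum_empty)
next
  case (insert i I)
  interpret Z: star_category "center_with E \<beta>"
    by (rule star_category_center)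
  have "Sum (center_with E \<beta>) A B t (insert i I) = t i \<boxplus>\<^bsub>center_with E \<beta>\<^esub> Sum (center_with E \<beta>) A B t I"
    using insert A B by (intro Z.Sum_insert) auto
  moreover have "Sum D (fst A) (fst B) (\<lambda>i. Und (t i)) (insert i I) =
      Und (t i) \<boxplus> Sum D (fst A) (fst B) (\<lambda>i. Und (t i)) I"
    using insert A B center_objectsD(1) by (intro Sum_insert) (auto simp: center_Hom intertwiner_def)
  ultimately show ?case
    using insert by (simp add: center_Hom)
qed

lemma hb_tensor_eq:
  "hb_tensor E A B = (\<lambda>Y\<in>Obj E. braid_tens D (J Y) (fst A) (fst B) (snd A Y) (snd B Y))"
  by (cases A; cases B) (simp add: hb_tensor_def ind_eq Let_def braid_tens_def)

lemma hb_tensor_center: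
  assumes A: "A \<in> center_objects E" and B: "B \<in> center_objects E"
  shows "(fst A \<otimes>\<^sub>o fst B, hb_tensor E A B) \<in> center_objects E"
proof -
  note a = center_objectsD[OF A] and b = center_objectsD[OF B]
  let ?h = "\<lambda>Y. braid_tens D (J Y) (fst A) (fst B) (snd A Y) (snd B Y)"
  have "?h Z \<cdot> (emb_arr E f \<rhd> (fst A \<otimes>\<^sub>o fst B)) = ((fst A \<otimes>\<^sub>o fst B) \<lhd> emb_arr E f) \<cdot> ?h Y"
    if YZ: "Y \<in> Obj E" "Z \<in> Obj E" "f \<in> Hom E Y Z" for Y Z f
    using braid_tens_natural[OF a(4)[OF YZ(1)] a(4)[OF YZ(2)] b(4)[OF YZ(1)] b(4)[OF YZ(2)] emb_hom[OF YZ(3)]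
        id_hom[OF a(1)] id_hom[OF b(1)] a(5)[OF YZ] b(5)[OF YZ]] a(1) b(1)
    by (simp add: tens_id)
  moreover have "hexagon D (J Y) (J Z) (fst A \<otimes>\<^sub>o fst B) (?h Y) (?h Z) = ?h (Y \<otimes>\<^sub>o\<^bsub>E\<^esub> Z)"
    if YZ: "Y \<in> Obj E" "Z \<in> Obj E" for Y Z
    using hexagon_braid_tens[OF a(4)[OF YZ(1)] a(4)[OF YZ(2)] b(4)[OF YZ(1)] b(4)[OF YZ(2)]] a(1) b(1) YZ
    by (simp add: a(6) b(6) emb_tens)
  ultimately show ?thesis
    using a(1,3) b(1,3) braid_tens_unitary[OF a(3) b(3)]
    by (simp add: center_objects_iff half_braiding_iff hb_tensor_eq tens_obj)
qed

lemma intertwiner_tens: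
  assumes u: "intertwiner A B u" and v: "intertwiner A' B' v"
  shows "intertwiner (fst A \<otimes>\<^sub>o fst A', hb_tensor E A A') (fst B \<otimes>\<^sub>o fst B', hb_tensor E B B') (u \<otimes>\<^sub>a v)"
proof -
  note uD = intertwinerD[OF u] and vD = intertwinerD[OF v]
  have "((u \<otimes>\<^sub>a v) \<rhd> J Y) \<cdot> hb_tensor E A A' Y = hb_tensor E B B' Y \<cdot> (J Y \<lhd> (u \<otimes>\<^sub>a v))"
    if Y: "Y \<in> Obj E" for Y
    using braid_tens_natural[OF center_objectsD(4)[OF uD(1) Y] center_objectsD(4)[OF uD(2) Y]
        center_objectsD(4)[OF vD(1) Y] center_objectsD(4)[OF vD(2) Y] id_hom[OF emb_Obj[OF Y]] uD(3) vD(3)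
        uD(4)[OF Y, symmetric] vD(4)[OF Y, symmetric]] Y
    by (simp add: hb_tensor_eq)
  then show ?thesis
    using uD vD hb_tensor_center tens_hom by (auto simp: intertwiner_def)
qed

lemma intertwiner_Assoc:
  assumes A: "A \<in> center_objects E" and B: "B \<in> center_objects E" and F: "F \<in> center_objects E"
  shows "intertwiner ((fst A \<otimes>\<^sub>o fst B) \<otimes>\<^sub>o fst F, hb_tensor E (fst A \<otimes>\<^sub>o fst B, hb_tensor E A B) F)
    (fst A \<otimes>\<^sub>o (fst B \<otimes>\<^sub>o fst F), hb_tensor E A (fst B \<otimes>\<^sub>o fst F, hb_tensor E B F))
    (Assoc D (fst A) (fst B) (fst F))"
proof -
  note o = center_objectsD(1)[OF A] center_objectsD(1)[OF B] center_objectsD(1)[OF F]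
  show ?thesis
    unfolding intertwiner_def
    using hb_tensor_center[OF hb_tensor_center[OF A B] F] hb_tensor_center[OF A hb_tensor_center[OF B F]]
      assoc_unitary[OF o] braid_tens_assoc[OF center_objectsD(4)[OF A] center_objectsD(4)[OF B] center_objectsD(4)[OF F]
        emb_Obj o]
    by (auto simp: hb_tensor_eq unitary_def)
qed

lemma Unit_center: "(Unit D, \<lambda>Y\<in>Obj E. Id D (J Y)) \<in> center_objects E"
proof -
  have "hexagon D (J Y) (J Z) (Unit D) (Id D (J Y)) (Id D (J Z)) = Id D (J Y \<otimes>\<^sub>o J Z)"
    if "Y \<in> Obj E" "Z \<in> Obj E" for Y Z
    unfolding hexagon_def using that by (simp add: unit_assoc assoc_unit triangle_eq tens_id)
  moreover have "Id D (J Z) \<cdot> (emb_arr E f \<rhd> Unit D) = (Unit D \<lhd> emb_arr E f) \<cdot> Id D (J Y)"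
    if "f \<in> Hom E Y Z" for f Y Z
    using emb_hom[OF that] tens_unit[OF emb_hom[OF that]] unit_tens[OF emb_hom[OF that]] by (simp add: Hom_iff)
  moreover have "unitary D (J Y \<otimes>\<^sub>o Unit D) (Unit D \<otimes>\<^sub>o J Y) (Id D (J Y))" if "Y \<in> Obj E" for Y
    using unitary_Id[OF emb_Obj[OF that]] that by simp
  ultimately show ?thesis
    by (simp add: center_objects_iff half_braiding_iff emb_tens)
qed

text \<open>All associators involved have a unit argument and are identities. Equality of the
  half-braidings as functions also uses that they are extensional.\<close>

lemma hb_tensor_Unit:
  assumes A: "A \<in> center_objects E"
  shows "hb_tensor E (Unit D, \<lambda>Y\<in>Obj E. Id D (J Y)) A = snd A"
    and "hb_tensor E A (Unit D, \<lambda>Y\<in>Obj E. Id D (J Y)) = snd A"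
proof -
  note a = center_objectsD[OF A]
  have c: "snd A Y \<in> Arr D" "Dom D (snd A Y) = J Y \<otimes>\<^sub>o fst A" "Cod D (snd A Y) = fst A \<otimes>\<^sub>o J Y"
    "snd A Y \<rhd> Unit D = snd A Y" "Unit D \<lhd> snd A Y = snd A Y" if "Y \<in> Obj E" for Y
    using a(4)[OF that] tens_unit[OF a(4)[OF that]] unit_tens[OF a(4)[OF that]] by auto
  have "braid_tens D (J Y) (Unit D) (fst A) (Id D (J Y)) (snd A Y) = snd A Y"
    "braid_tens D (J Y) (fst A) (Unit D) (snd A Y) (Id D (J Y)) = snd A Y" if "Y \<in> Obj E" for Y
    unfolding braid_tens_def using that a(1) by (simp_all add: c unit_assoc assoc_unit triangle_eq tens_id)
  then show "hb_tensor E (Unit D, \<lambda>Y\<in>Obj E. Id D (J Y)) A = snd A"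
    "hb_tensor E A (Unit D, \<lambda>Y\<in>Obj E. Id D (J Y)) = snd A"
    by (auto simp: hb_tensor_eq intro!: extensionalityI[OF restrict_extensional a(2)])
qed

end

subsection \<open>The center of the twist\<close>

text \<open>The weights enter only through identities: \<open>f_mult\<close> is the hexagon
  condition for the conjugate of \<open>f\<close>, and \<open>\<tau>_eq\<close> prescribes the
  weight of the transported product. Explicit roots of unity appear only when the locale is
  instantiated.\<close>

locale twisted_center = abelian_twisted_star_tensor_category D \<Gamma> "ind_grading C G" \<omega> + half_braided_category D C
  for D :: "(('o, 'a, 'i) ind_obj, ('o, 'a, 'i) ind_arr) tensor_cat" (structure) and \<Gamma> :: "'g monoid"
    and C :: "('o, 'a) tensor_cat" and G :: "'g \<Rightarrow> 'o set" and \<omega> :: "'g \<Rightarrow> 'g \<Rightarrow> 'g \<Rightarrow> complex" +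
  fixes f :: "'g \<Rightarrow> 'g \<Rightarrow> complex" and \<tau> :: "'g \<Rightarrow> 'g \<Rightarrow> 'g \<Rightarrow> complex"
  assumes proj_emb: "\<lbrakk>Y \<in> Obj C; s \<in> carrier \<Gamma>\<rbrakk> \<Longrightarrow>
      \<exists>p\<in>Hom C Y Y. grade_proj D \<Gamma> (ind_grading C G) s (emb_obj C Y) = emb_arr C p"
    and half_braided_twist: "half_braided_category
      (ind (twist C \<Gamma> G \<omega>) :: (('o, 'a, 'i) ind_obj, ('o, 'a, 'i) ind_arr) tensor_cat) (twist C \<Gamma> G \<omega>)"
    and Assoc_twist: "\<lbrakk>U \<in> Obj D; V \<in> Obj D; W \<in> Obj D\<rbrakk> \<Longrightarrow>
      Assoc (ind (twist C \<Gamma> G \<omega>)) U V W = Assoc (twist D \<Gamma> (ind_grading C G) \<omega>) U V W"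
    and cmod_f: "\<lbrakk>a \<in> carrier \<Gamma>; s \<in> carrier \<Gamma>\<rbrakk> \<Longrightarrow> cmod (f a s) = 1"
    and f_one: "s \<in> carrier \<Gamma> \<Longrightarrow> f \<one>\<^bsub>\<Gamma>\<^esub> s = 1"
    and f_mult: "\<lbrakk>a \<in> carrier \<Gamma>; s \<in> carrier \<Gamma>; t \<in> carrier \<Gamma>\<rbrakk> \<Longrightarrow> cnj (f a (s \<otimes>\<^bsub>\<Gamma>\<^esub> t)) =
      \<omega> a s t * cnj (f a s) * cnj (\<omega> s a t) * cnj (f a t) * \<omega> s t a"
    and \<tau>_eq: "\<lbrakk>a \<in> carrier \<Gamma>; b \<in> carrier \<Gamma>; s \<in> carrier \<Gamma>\<rbrakk> \<Longrightarrow> \<tau> a b s =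
      f (a \<otimes>\<^bsub>\<Gamma>\<^esub> b) s * (cnj (\<omega> a b s) * cnj (f b s) * \<omega> a s b * cnj (f a s) * cnj (\<omega> s a b))"
begin

declare ind_simps [simp del] and ind_eq [simp]

abbreviation D' :: "(('o, 'a, 'i) ind_obj, ('o, 'a, 'i) ind_arr) tensor_cat" where
  "D' \<equiv> ind (twist C \<Gamma> G \<omega>)"

abbreviation C' :: "('o, 'a) tensor_cat" where
  "C' \<equiv> twist C \<Gamma> G \<omega>"

text \<open>The direction of the isomorphism: \<open>g\<close> carries half-braidings for
  \<open>C\<close> to half-braidings for the twist, and \<open>f\<close> carries them back.\<close>

abbreviation g :: "'g \<Rightarrow> 'g \<Rightarrow> complex" where
  "g \<equiv> \<lambda>a s. cnj (f a s)"

lemma ind_twist_eq [simp]: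
  "Obj D' = Obj D" "Arr D' = Arr D" "Dom D' = Dom D" "Cod D' = Cod D" "Id D' = Id D"
  "Comp D' = Comp D" "Zero D' = Zero D" "Plus D' = Plus D" "Scale D' = Scale D" "Adj D' = Adj D"
  "Norm D' = Norm D" "TensO D' = TensO D" "TensA D' = TensA D" "Unit D' = Unit D"
  "Hom D' = Hom D" "unitary D' = unitary D"
  unfolding ind_eq[symmetric] by (simp_all add: ind_simps del: ind_eq)

interpretation N: half_braided_category D' C'
  by (rule half_braided_twist)

lemma fg: "\<lbrakk>a \<in> carrier \<Gamma>; s \<in> carrier \<Gamma>\<rbrakk> \<Longrightarrow> f a s * g a s = 1"
  using cmod_f by (simp add: complex_norm_square[symmetric])

lemma hexagon_ind_twist:
  "\<lbrakk>P \<in> Obj D; Q \<in> Obj D; X \<in> Obj D\<rbrakk> \<Longrightarrow>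
   hexagon D' P Q X c e = hexagon (twist D \<Gamma> (ind_grading C G) \<omega>) P Q X c e"
  by (simp add: hexagon_def Assoc_twist)

lemma braid_tens_ind_twist:
  "\<lbrakk>P \<in> Obj D; X \<in> Obj D; X' \<in> Obj D\<rbrakk> \<Longrightarrow>
   braid_tens D' P X X' c e = braid_tens (twist D \<Gamma> (ind_grading C G) \<omega>) P X X' c e"
  by (simp add: braid_tens_def Assoc_twist)

text \<open>A half-braiding without its hexagon, that is, without the one condition that sees the
  associator. Twisting by any unimodular weight preserves these families, so only the hexagon has to
  be compared between the two categories.\<close>

definition braid_family :: "('o, 'a, 'i) center_obj \<Rightarrow> bool" where
  "braid_family A \<longleftrightarrow> fst A \<in> Obj D \<and> snd A \<in> extensional (Obj C) \<and>
     (\<forall>Y\<in>Obj C. unitary D (J Y \<otimes>\<^sub>o fst A) (fst A \<otimes>\<^sub>o J Y) (snd A Y)) \<and>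
     (\<forall>Y\<in>Obj C. \<forall>Z\<in>Obj C. \<forall>h\<in>Hom C Y Z.
        snd A Z \<cdot> (emb_arr C h \<rhd> fst A) = (fst A \<lhd> emb_arr C h) \<cdot> snd A Y)"

lemma braid_familyD:
  assumes "braid_family A"
  shows "fst A \<in> Obj D" "snd A \<in> extensional (Obj C)"
    "\<And>Y. Y \<in> Obj C \<Longrightarrow> unitary D (J Y \<otimes>\<^sub>o fst A) (fst A \<otimes>\<^sub>o J Y) (snd A Y)"
    "\<And>Y. Y \<in> Obj C \<Longrightarrow> snd A Y \<in> Braid D (J Y) (fst A)"
    "\<And>Y Z h. \<lbrakk>Y \<in> Obj C; Z \<in> Obj C; h \<in> Hom C Y Z\<rbrakk> \<Longrightarrow>
      snd A Z \<cdot> (emb_arr C h \<rhd> fst A) = (fst A \<lhd> emb_arr C h) \<cdot> snd A Y"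
  using assms by (auto simp: braid_family_def unitary_def)

lemma center_objects_family:
  "A \<in> center_objects C \<longleftrightarrow> braid_family A \<and>
     (\<forall>Y\<in>Obj C. \<forall>Z\<in>Obj C. hexagon D (J Y) (J Z) (fst A) (snd A Y) (snd A Z) = snd A (Y \<otimes>\<^sub>o\<^bsub>C\<^esub> Z))"
  by (auto simp: center_objects_iff half_braiding_iff braid_family_def)

lemma center_objects_twist_family:
  "A \<in> center_objects C' \<longleftrightarrow> braid_family A \<and> (\<forall>Y\<in>Obj C. \<forall>Z\<in>Obj C.
     hexagon (twist D \<Gamma> (ind_grading C G) \<omega>) (J Y) (J Z) (fst A) (snd A Y) (snd A Z) = snd A (Y \<otimes>\<^sub>o\<^bsub>C\<^esub> Z))"
  by (auto simp: N.center_objects_iff N.half_braiding_iff braid_family_def hexagon_ind_twist)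

text \<open>The degree projections of an embedded object come from morphisms of \<open>C\<close>, so
  naturality of the family applies to them.\<close>

lemma graded_braid_family:
  assumes A: "braid_family A" and Y: "Y \<in> Obj C"
  shows "graded_braid (J Y) (fst A) (snd A Y)"
proof (rule graded_braidI[OF braid_familyD(4)[OF A Y] emb_Obj[OF Y] braid_familyD(1)[OF A]])
  fix s assume "s \<in> carrier \<Gamma>"
  then obtain p where p: "p \<in> Hom C Y Y" "proj s (J Y) = emb_arr C p"
    using proj_emb Y by blast
  show "snd A Y \<cdot> (proj s (J Y) \<rhd> fst A) = (fst A \<lhd> proj s (J Y)) \<cdot> snd A Y"
    unfolding p(2) by (rule braid_familyD(5)[OF A Y Y p(1)])
qed

definition transport :: "('g \<Rightarrow> 'g \<Rightarrow> complex) \<Rightarrow> ('o, 'a, 'i) center_obj \<Rightarrow> ('o, 'a, 'i) center_obj" where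
  "transport h A = (fst A, \<lambda>Y\<in>Obj C. twist_braid h (J Y) (fst A) (snd A Y))"

lemma transport_simps [simp]: "fst (transport h A) = fst A"
  "Y \<in> Obj C \<Longrightarrow> snd (transport h A) Y = twist_braid h (J Y) (fst A) (snd A Y)"
  by (simp_all add: transport_def)

lemma braid_family_transport:
  assumes A: "braid_family A" and h: "\<And>a s. \<lbrakk>a \<in> carrier \<Gamma>; s \<in> carrier \<Gamma>\<rbrakk> \<Longrightarrow> cmod (h a s) = 1"
  shows "braid_family (transport h A)"
proof -
  note a = braid_familyD[OF A]
  have "unitary D (J Y \<otimes>\<^sub>o fst A) (fst A \<otimes>\<^sub>o J Y) (twist_braid h (J Y) (fst A) (snd A Y))" if "Y \<in> Obj C" for Y
    by (rule twist_braid_unitary[OF graded_braid_family[OF A that] a(3)[OF that]]) (rule h)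
  moreover have "twist_braid h (J Z) (fst A) (snd A Z) \<cdot> (emb_arr C x \<rhd> fst A) =
      (fst A \<lhd> emb_arr C x) \<cdot> twist_braid h (J Y) (fst A) (snd A Y)"
    if "Y \<in> Obj C" "Z \<in> Obj C" "x \<in> Hom C Y Z" for Y Z x
    by (rule twist_braid_natural[OF a(4)[OF that(1)] a(4)[OF that(2)] emb_hom[OF that(3)] id_hom[OF a(1)] a(5)[OF that]])
  ultimately show ?thesis
    using a(1) by (simp add: braid_family_def transport_def)
qed

lemma transport_transport:
  assumes A: "braid_family A" and h: "\<And>a s. \<lbrakk>a \<in> carrier \<Gamma>; s \<in> carrier \<Gamma>\<rbrakk> \<Longrightarrow> h a s * h' a s = 1"
  shows "transport h (transport h' A) = A"
proof (rule prod_eqI)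
  note a = braid_familyD[OF A]
  have "twist_braid h (J Y) (fst A) (twist_braid h' (J Y) (fst A) (snd A Y)) = snd A Y" if "Y \<in> Obj C" for Y
    by (rule twist_braid_twist_braid[OF a(4)[OF that] emb_Obj[OF that] a(1)]) (rule h)
  then show "snd (transport h (transport h' A)) = snd A"
    using a(2) by (intro extensionalityI[of _ "Obj C"]) (auto simp: transport_def)
qed simp

text \<open>The two hexagon conditions are compared pair by pair through
  \<open>hexagon_twist_iff\<close>; the product degree appears because the embedding is strictly
  monoidal.\<close>

lemma transport_center_iff:
  assumes A: "braid_family A"
  shows "transport g A \<in> center_objects C' \<longleftrightarrow> A \<in> center_objects C"
proof -
  have "hexagon (twist D \<Gamma> (ind_grading C G) \<omega>) (J Y) (J Z) (fst A) (twist_braid g (J Y) (fst A) (snd A Y))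
      (twist_braid g (J Z) (fst A) (snd A Z)) =
      twist_braid g (J (Y \<otimes>\<^sub>o\<^bsub>C\<^esub> Z)) (fst A) (snd A (Y \<otimes>\<^sub>o\<^bsub>C\<^esub> Z)) \<longleftrightarrow>
      hexagon D (J Y) (J Z) (fst A) (snd A Y) (snd A Z) = snd A (Y \<otimes>\<^sub>o\<^bsub>C\<^esub> Z)"
    if YZ: "Y \<in> Obj C" "Z \<in> Obj C" for Y Z
    unfolding emb_tens[OF YZ]
  proof (rule hexagon_twist_iff)
    show "graded_braid (J Y \<otimes>\<^sub>o J Z) (fst A) (snd A (Y \<otimes>\<^sub>o\<^bsub>C\<^esub> Z))"
      using graded_braid_family[OF A Obj_tens[OF YZ]] by (simp add: emb_tens YZ)
  qed (use graded_braid_family[OF A] YZ cmod_f f_mult in auto)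
  moreover have "braid_family (transport g A)"
    by (rule braid_family_transport[OF A]) (simp add: cmod_f)
  ultimately show ?thesis
    using A by (simp add: center_objects_twist_family center_objects_family)
qed

lemma transport_g_center: "A \<in> center_objects C \<Longrightarrow> transport g A \<in> center_objects C'"
  and transport_fg: "A \<in> center_objects C \<Longrightarrow> transport f (transport g A) = A"
  using transport_center_iff transport_transport[of A f g] fg by (auto simp: center_objects_family)

lemma transport_f_center: "A \<in> center_objects C' \<Longrightarrow> transport f A \<in> center_objects C"
  and transport_gf: "A \<in> center_objects C' \<Longrightarrow> transport g (transport f A) = A"
proof -
  assume A: "A \<in> center_objects C'"
  then have A': "braid_family A"
    by (simp add: center_objects_twist_family)
  show *: "transport g (transport f A) = A"
    by (rule transport_transport[OF A']) (metis fg mult.commute)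
  have "braid_family (transport f A)"
    by (rule braid_family_transport[OF A' cmod_f])
  from transport_center_iff[OF this] show "transport f A \<in> center_objects C"
    using A by (simp add: *)
qed

lemma intertwiner_twist:
  "N.intertwiner A B u \<longleftrightarrow> A \<in> center_objects C' \<and> B \<in> center_objects C' \<and> u \<in> Hom D (fst A) (fst B) \<and>
     (\<forall>Y\<in>Obj C. (u \<rhd> J Y) \<cdot> snd A Y = snd B Y \<cdot> (J Y \<lhd> u))"
  by (simp add: N.intertwiner_def)

lemma transport_intertwines:
  assumes A: "braid_family A" and B: "braid_family B" and u: "u \<in> Hom D (fst A) (fst B)" and Y: "Y \<in> Obj C"
    and eq: "(u \<rhd> J Y) \<cdot> snd A Y = snd B Y \<cdot> (J Y \<lhd> u)"
  shows "(u \<rhd> J Y) \<cdot> snd (transport h A) Y = snd (transport h B) Y \<cdot> (J Y \<lhd> u)"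
  using twist_braid_natural[OF braid_familyD(4)[OF A Y] braid_familyD(4)[OF B Y] id_hom[OF emb_Obj[OF Y]] u eq[symmetric]]
    Y by simp

lemma intertwiner_transport_f:
  "N.intertwiner A B u \<Longrightarrow> intertwiner (transport f A) (transport f B) u"
  unfolding intertwiner_twist intertwiner_def
  using transport_f_center transport_intertwines center_objects_twist_family by simp

lemma intertwiner_transport_g:
  "intertwiner A B u \<Longrightarrow> N.intertwiner (transport g A) (transport g B) u"
  unfolding intertwiner_twist intertwiner_def
  using transport_g_center transport_intertwines center_objects_family by simp

text \<open>The product of half-braidings with weight \<open>\<tau>\<close>, in the syntactic shape
  of the product for cyclic gradings, so that the latter is an instance by unfolding.\<close>

definition weighted_hb_tensor :: "('o, 'a, 'i) center_obj \<Rightarrow> ('o, 'a, 'i) center_obj \<Rightarrow> ('o, 'a, 'i) half_braiding" where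
  "weighted_hb_tensor A B = (\<lambda>Y\<in>Obj C. Sum D (J Y \<otimes>\<^sub>o (fst A \<otimes>\<^sub>o fst B)) ((fst A \<otimes>\<^sub>o fst B) \<otimes>\<^sub>o J Y)
     (\<lambda>(a, b, s). \<tau> a b s \<bullet> (hb_tensor C A B Y \<cdot> (proj s (J Y) \<otimes>\<^sub>a (proj a (fst A) \<otimes>\<^sub>a proj b (fst B)))))
     (carrier \<Gamma> \<times> carrier \<Gamma> \<times> carrier \<Gamma>))"

abbreviation tens' (infixr "\<otimes>''" 75) where
  "A \<otimes>' B \<equiv> (fst A \<otimes>\<^sub>o fst B, hb_tensor C' A B)"

abbreviation tens\<tau> (infixr "\<otimes>\<^sub>\<tau>" 75) where
  "A \<otimes>\<^sub>\<tau> B \<equiv> (fst A \<otimes>\<^sub>o fst B, weighted_hb_tensor A B)"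

text \<open>The weighted product is the usual product of the twisted center seen through the
  isomorphism. Its functoriality and its associator are therefore obtained by transport.\<close>

lemma tens\<tau>_transport:
  assumes A: "A \<in> center_objects C" and B: "B \<in> center_objects C"
  shows "A \<otimes>\<^sub>\<tau> B = transport f (transport g A \<otimes>' transport g B)"
proof -
  have A': "braid_family A" and B': "braid_family B"
    using A B by (auto simp: center_objects_family)
  note o = braid_familyD(1)[OF A'] braid_familyD(1)[OF B']
  have "weighted_hb_tensor A B Y = twist_braid f (J Y) (fst A \<otimes>\<^sub>o fst B)
      (hb_tensor C' (transport g A) (transport g B) Y)" if Y: "Y \<in> Obj C" for Y
  proof -
    have "weighted_hb_tensor A B Y = Sum D (J Y \<otimes>\<^sub>o (fst A \<otimes>\<^sub>o fst B)) ((fst A \<otimes>\<^sub>o fst B) \<otimes>\<^sub>o J Y)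
      (\<lambda>(a, b, s). \<tau> a b s \<bullet> (braid_tens D (J Y) (fst A) (fst B) (snd A Y) (snd B Y) \<cdot>
        (proj s (J Y) \<otimes>\<^sub>a (proj a (fst A) \<otimes>\<^sub>a proj b (fst B))))) (carrier \<Gamma> \<times> carrier \<Gamma> \<times> carrier \<Gamma>)"
      using Y by (simp add: weighted_hb_tensor_def hb_tensor_eq)
    also have "\<dots> = twist_braid f (J Y) (fst A \<otimes>\<^sub>o fst B) (braid_tens (twist D \<Gamma> (ind_grading C G) \<omega>) (J Y) (fst A) (fst B)
        (twist_braid g (J Y) (fst A) (snd A Y)) (twist_braid g (J Y) (fst B) (snd B Y)))"
      by (rule weighted_braid_tens_eq[OF graded_braid_family[OF A' Y] graded_braid_family[OF B' Y]]) (rule \<tau>_eq)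
    finally show ?thesis
      using Y o by (simp add: N.hb_tensor_eq braid_tens_ind_twist)
  qed
  then show ?thesis
    by (auto simp: transport_def weighted_hb_tensor_def intro!: extensionalityI[of _ "Obj C"])
qed

lemma tens'_center: "\<lbrakk>A \<in> center_objects C'; B \<in> center_objects C'\<rbrakk> \<Longrightarrow> A \<otimes>' B \<in> center_objects C'"
  using N.hb_tensor_center by simp

lemma transport_tens':
  "\<lbrakk>A \<in> center_objects C'; B \<in> center_objects C'\<rbrakk> \<Longrightarrow> transport f (A \<otimes>' B) = transport f A \<otimes>\<^sub>\<tau> transport f B"
  using tens\<tau>_transport[OF transport_f_center transport_f_center] transport_gf by simp

lemma intertwiner_tens\<tau>:
  assumes u: "intertwiner A B u" and v: "intertwiner A' B' v"
  shows "intertwiner (A \<otimes>\<^sub>\<tau> A') (B \<otimes>\<^sub>\<tau> B') (u \<otimes>\<^sub>a v)"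
  unfolding tens\<tau>_transport[OF intertwinerD(1)[OF u] intertwinerD(1)[OF v]]
    tens\<tau>_transport[OF intertwinerD(2)[OF u] intertwinerD(2)[OF v]]
  by (rule intertwiner_transport_f)
    (use N.intertwiner_tens[OF intertwiner_transport_g[OF u] intertwiner_transport_g[OF v]] in simp)

lemma intertwiner_Assoc_twist:
  assumes A: "A \<in> center_objects C'" and B: "B \<in> center_objects C'" and F: "F \<in> center_objects C'"
  shows "N.intertwiner ((A \<otimes>' B) \<otimes>' F) (A \<otimes>' (B \<otimes>' F)) (Assoc (twist D \<Gamma> (ind_grading C G) \<omega>) (fst A) (fst B) (fst F))"
  using N.intertwiner_Assoc[OF A B F] N.center_objectsD(1)[OF A] N.center_objectsD(1)[OF B] N.center_objectsD(1)[OF F]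
  by (simp add: Assoc_twist)

lemma Unit_transport: "transport f (Unit D, \<lambda>Y\<in>Obj C. Id D (J Y)) = (Unit D, \<lambda>Y\<in>Obj C. Id D (J Y))"
  unfolding transport_def using twist_braid_Unit[of _ f, OF _ f_one] by (auto simp: fun_eq_iff)

abbreviation Z\<tau> :: "(('o, 'a, 'i) center_obj, ('o, 'a, 'i) center_arr) tensor_cat" where
  "Z\<tau> \<equiv> center_with C weighted_hb_tensor"

interpretation Z: star_category Z\<tau>
  by (rule star_category_center)

section \<open>The grading of the center\<close>

lemma restrict_center:
  assumes A: "A \<in> center_objects C" and v: "isometry D V (fst A) v"
    and comm: "\<And>Y. Y \<in> Obj C \<Longrightarrow> snd A Y \<cdot> (J Y \<lhd> (v \<cdot> v\<^sup>\<dagger>)) = ((v \<cdot> v\<^sup>\<dagger>) \<rhd> J Y) \<cdot> snd A Y"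
  defines "B \<equiv> (V, \<lambda>Y\<in>Obj C. restrict_braid (J Y) v (snd A Y))"
  shows "B \<in> center_objects C" "intertwiner B A v"
proof -
  note a = center_objectsD[OF A]
  have vh: "v \<in> Hom D V (fst A)"
    using v by (simp add: isometry_def)
  have V: "V \<in> Obj D"
    using Hom_Obj[OF vh] by simp
  note r = restrict_braid_hom[OF a(4) v emb_Obj]
  have "restrict_braid (J Z) v (snd A Z) \<cdot> (emb_arr C h \<rhd> V) =
      (V \<lhd> emb_arr C h) \<cdot> restrict_braid (J Y) v (snd A Y)"
    if YZ: "Y \<in> Obj C" "Z \<in> Obj C" "h \<in> Hom C Y Z" for Y Z h
  proof -
    note e = emb_hom[OF YZ(3)] and c = a(4)[OF YZ(1)] a(4)[OF YZ(2)]
    have "restrict_braid (J Z) v (snd A Z) \<cdot> (emb_arr C h \<rhd> V) =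
        (v\<^sup>\<dagger> \<rhd> J Z) \<cdot> ((snd A Z \<cdot> (emb_arr C h \<rhd> fst A)) \<cdot> (J Y \<lhd> v))"
      unfolding restrict_braid_def using e c vh V a(1) YZ by (simp add: Hom_iff)
    also have "\<dots> = (V \<lhd> emb_arr C h) \<cdot> restrict_braid (J Y) v (snd A Y)"
      unfolding a(5)[OF YZ] restrict_braid_def using e c vh V a(1) YZ by (simp add: Hom_iff)
    finally show ?thesis .
  qed
  moreover have "hexagon D (J Y) (J Z) V (restrict_braid (J Y) v (snd A Y)) (restrict_braid (J Z) v (snd A Z)) =
      restrict_braid (J Y \<otimes>\<^sub>o J Z) v (snd A (Y \<otimes>\<^sub>o\<^bsub>C\<^esub> Z))" if YZ: "Y \<in> Obj C" "Z \<in> Obj C" for Y Z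
    unfolding a(6)[OF YZ, symmetric]
    by (rule restrict_braid_hexagon[OF a(4)[OF YZ(1)] a(4)[OF YZ(2)] v emb_Obj[OF YZ(1)] emb_Obj[OF YZ(2)]
          comm[OF YZ(1)] comm[OF YZ(2)]])
  ultimately show B: "B \<in> center_objects C"
    using V restrict_braid_unitary[OF a(3) v emb_Obj comm]
    by (simp add: center_objects_iff half_braiding_iff B_def emb_tens)
  show "intertwiner B A v"
    using A B vh restrict_braid_intertwines(1)[OF a(4) v emb_Obj comm] by (simp add: intertwiner_def B_def)
qed

lemma braid_center_proj:
  assumes A: "A \<in> center_objects C" and Y: "Y \<in> Obj C" and \<gamma>: "\<gamma> \<in> carrier \<Gamma>"
  shows "snd A Y \<cdot> (J Y \<lhd> proj \<gamma> (fst A)) = (proj \<gamma> (fst A) \<rhd> J Y) \<cdot> snd A Y"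
proof (rule braid_proj[OF center_objectsD(4)[OF A Y] emb_Obj[OF Y] center_objectsD(1)[OF A] _ \<gamma>])
  fix s assume "s \<in> carrier \<Gamma>"
  then obtain p where p: "p \<in> Hom C Y Y" "proj s (J Y) = emb_arr C p"
    using proj_emb Y by blast
  show "snd A Y \<cdot> (proj s (J Y) \<rhd> fst A) = (fst A \<lhd> proj s (J Y)) \<cdot> snd A Y"
    unfolding p(2) by (rule center_objectsD(5)[OF A Y Y p(1)])
qed

text \<open>The underlying ind-object is decomposed first. Half-braidings commute with its degree
  projections, so they compress to each part, and the embeddings of the parts become morphisms of
  the center.\<close>

lemma ex_center_decomposition:
  assumes A: "A \<in> center_objects C"
  obtains B w where "homogeneous_decomposition Z\<tau> \<Gamma> (center_grading C G) A B w"
    "\<And>\<gamma>. \<gamma> \<in> carrier \<Gamma> \<Longrightarrow> w \<gamma> \<cdot>\<^bsub>Z\<tau>\<^esub> Adj Z\<tau> (w \<gamma>) = \<lparr>CSrc = A, CTgt = A, Und = proj \<gamma> (fst A)\<rparr>"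
proof -
  obtain Y v where d: "homogeneous_decomposition D \<Gamma> (ind_grading C G) (fst A) Y v"
    using ex_decomposition center_objectsD(1)[OF A] by blast
  note dD = decompositionD[OF d]
  have p: "v \<gamma> \<cdot> (v \<gamma>)\<^sup>\<dagger> = proj \<gamma> (fst A)" if "\<gamma> \<in> carrier \<Gamma>" for \<gamma>
    using proj_eq[OF d center_objectsD(1)[OF A] that] by simp
  define B where "B \<gamma> = (Y \<gamma>, \<lambda>Z\<in>Obj C. restrict_braid (J Z) (v \<gamma>) (snd A Z))" for \<gamma>
  define w where "w \<gamma> = \<lparr>CSrc = B \<gamma>, CTgt = A, Und = v \<gamma>\<rparr>" for \<gamma>
  have B: "B \<gamma> \<in> center_objects C" "intertwiner (B \<gamma>) A (v \<gamma>)" if \<gamma>: "\<gamma> \<in> carrier \<Gamma>" for \<gamma>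
    unfolding B_def using braid_center_proj[OF A _ \<gamma>] by (intro restrict_center[OF A dD(2)[OF \<gamma>]]; simp add: p \<gamma>)+
  have ww: "w \<gamma> \<cdot>\<^bsub>Z\<tau>\<^esub> Adj Z\<tau> (w \<gamma>) = \<lparr>CSrc = A, CTgt = A, Und = proj \<gamma> (fst A)\<rparr>" if "\<gamma> \<in> carrier \<Gamma>" for \<gamma>
    using p[OF that] by (simp add: w_def)
  have "isometry Z\<tau> (B \<gamma>) A (w \<gamma>)" if \<gamma>: "\<gamma> \<in> carrier \<Gamma>" for \<gamma>
    using B[OF \<gamma>] dD(4)[OF \<gamma>] by (simp add: isometry_def center_Hom w_def B_def)
  moreover have "B \<gamma> \<in> center_grading C G \<gamma>" if \<gamma>: "\<gamma> \<in> carrier \<Gamma>" for \<gamma>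
    using B(1)[OF \<gamma>] dD(1)[OF \<gamma>] by (simp add: center_grading_def B_def)
  moreover have "Sum Z\<tau> A A (\<lambda>\<gamma>. w \<gamma> \<cdot>\<^bsub>Z\<tau>\<^esub> Adj Z\<tau> (w \<gamma>)) (carrier \<Gamma>) = Id Z\<tau> A"
  proof -
    have "w \<gamma> \<cdot>\<^bsub>Z\<tau>\<^esub> Adj Z\<tau> (w \<gamma>) \<in> Hom Z\<tau> A A" if "\<gamma> \<in> carrier \<Gamma>" for \<gamma>
      using intertwiner_comp[OF intertwiner_adj[OF B(2)[OF that]] B(2)[OF that]] by (simp add: w_def center_Hom)
    then have "Sum Z\<tau> A A (\<lambda>\<gamma>. w \<gamma> \<cdot>\<^bsub>Z\<tau>\<^esub> Adj Z\<tau> (w \<gamma>)) (carrier \<Gamma>) =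
        \<lparr>CSrc = A, CTgt = A, Und = Sum D (fst A) (fst A) (\<lambda>\<gamma>. Und (w \<gamma> \<cdot>\<^bsub>Z\<tau>\<^esub> Adj Z\<tau> (w \<gamma>))) (carrier \<Gamma>)\<rparr>"
      by (rule center_Sum[OF finite_grading A A])
    also have "Sum D (fst A) (fst A) (\<lambda>\<gamma>. Und (w \<gamma> \<cdot>\<^bsub>Z\<tau>\<^esub> Adj Z\<tau> (w \<gamma>))) (carrier \<Gamma>) = Id D (fst A)"
      using d by (simp add: homogeneous_decomposition_def w_def)
    finally show ?thesis
      by simp
  qed
  ultimately have "homogeneous_decomposition Z\<tau> \<Gamma> (center_grading C G) A B w"
    by (simp add: homogeneous_decomposition_def)
  then show thesis
    using ww that by blast
qed

lemma graded_star_category_center: "graded_star_category Z\<tau> \<Gamma> (center_grading C G)"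
proof (rule graded_star_category.intro[OF star_category_center graded_star_category_axioms.intro])
  show "group \<Gamma>" "finite (carrier \<Gamma>)"
    by (simp_all add: grading_group)
  show "Hom Z\<tau> A B \<subseteq> {Zero Z\<tau> A B}"
    if "\<gamma> \<in> carrier \<Gamma>" "\<eta> \<in> carrier \<Gamma>" "\<gamma> \<noteq> \<eta>" "A \<in> center_grading C G \<gamma>" "B \<in> center_grading C G \<eta>" for \<gamma> \<eta> A B
  proof
    fix x assume "x \<in> Hom Z\<tau> A B"
    then have x: "CSrc x = A" "CTgt x = B" "Und x \<in> Hom D (fst A) (fst B)"
      using intertwinerD(3)[of A B "Und x"] by (auto simp: center_Hom)
    have "Hom D (fst A) (fst B) \<subseteq> {Zero D (fst A) (fst B)}"
      by (rule homogeneous_orthogonal[OF that(1,2,3)]) (use that(4,5) in \<open>auto simp: center_grading_def\<close>)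
    then show "x \<in> {Zero Z\<tau> A B}"
      using x by (auto intro: center_arr.equality)
  qed
  show "\<exists>B w. homogeneous_decomposition Z\<tau> \<Gamma> (center_grading C G) A B w" if "A \<in> Obj Z\<tau>" for A
    using ex_center_decomposition that by (metis center_fields(1))
qed

lemma grade_proj_center:
  assumes A: "A \<in> center_objects C" and \<gamma>: "\<gamma> \<in> carrier \<Gamma>"
  shows "grade_proj Z\<tau> \<Gamma> (center_grading C G) \<gamma> A = \<lparr>CSrc = A, CTgt = A, Und = proj \<gamma> (fst A)\<rparr>"
proof -
  interpret Z': graded_star_category Z\<tau> \<Gamma> "center_grading C G"
    by (rule graded_star_category_center)
  obtain B w where "homogeneous_decomposition Z\<tau> \<Gamma> (center_grading C G) A B w"
    "\<And>\<gamma>. \<gamma> \<in> carrier \<Gamma> \<Longrightarrow> w \<gamma> \<cdot>\<^bsub>Z\<tau>\<^esub> Adj Z\<tau> (w \<gamma>) = \<lparr>CSrc = A, CTgt = A, Und = proj \<gamma> (fst A)\<rparr>"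
    using ex_center_decomposition[OF A] by blast
  then show ?thesis
    using Z'.proj_eq A \<gamma> by simp
qed

lemma intertwiner_proj:
  assumes A: "A \<in> center_objects C" and \<gamma>: "\<gamma> \<in> carrier \<Gamma>"
  shows "intertwiner A A (proj \<gamma> (fst A))"
  using A braid_center_proj[OF A _ \<gamma>] proj_hom[OF center_objectsD(1)[OF A] \<gamma>] by (simp add: intertwiner_def)

text \<open>The twisted associator of the center is a sum formed in the center, over degree
  projections of the center. It is reduced to the sum defining the twisted associator of the
  ind-category, which requires each summand to be a morphism of the center.\<close>

lemma Assoc_twist_center:
  assumes A: "A \<in> center_objects C" and B: "B \<in> center_objects C" and F: "F \<in> center_objects C"
  shows "Assoc (twist Z\<tau> \<Gamma> (center_grading C G) \<omega>) A B F = \<lparr>CSrc = (A \<otimes>\<^sub>\<tau> B) \<otimes>\<^sub>\<tau> F, CTgt = A \<otimes>\<^sub>\<tau> (B \<otimes>\<^sub>\<tau> F),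
    Und = Assoc (twist D \<Gamma> (ind_grading C G) \<omega>) (fst A) (fst B) (fst F)\<rparr>"
proof -
  let ?\<alpha> = "Assoc (twist D \<Gamma> (ind_grading C G) \<omega>) (fst A) (fst B) (fst F)"
  let ?S = "(A \<otimes>\<^sub>\<tau> B) \<otimes>\<^sub>\<tau> F" and ?T = "A \<otimes>\<^sub>\<tau> (B \<otimes>\<^sub>\<tau> F)"
  let ?t = "\<lambda>(a, b, c). \<omega> a b c \<bullet> (Assoc D (fst A) (fst B) (fst F) \<cdot> ((proj a (fst A) \<otimes>\<^sub>a proj b (fst B)) \<otimes>\<^sub>a proj c (fst F)))"
  note o = center_objectsD(1)[OF A] center_objectsD(1)[OF B] center_objectsD(1)[OF F]
  \<comment> \<open>The full twisted associator is a morphism of the twisted center, and transport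
    carries this over to the weighted product.\<close>
  have "intertwiner (transport f ((transport g A \<otimes>' transport g B) \<otimes>' transport g F))
      (transport f (transport g A \<otimes>' (transport g B \<otimes>' transport g F))) ?\<alpha>"
    using intertwiner_transport_f[OF intertwiner_Assoc_twist[OF transport_g_center[OF A] transport_g_center[OF B]
        transport_g_center[OF F]]] by (simp only: transport_simps)
  moreover note c = transport_g_center[OF A] transport_g_center[OF B] transport_g_center[OF F]
  ultimately have \<alpha>: "intertwiner ?S ?T ?\<alpha>"
    unfolding transport_tens'[OF tens'_center[OF c(1,2)] c(3)] transport_tens'[OF c(1) tens'_center[OF c(2,3)]]
      transport_tens'[OF c(1,2)] transport_tens'[OF c(2,3)] transport_fg[OF A] transport_fg[OF B] transport_fg[OF F]
    by simp
  have "intertwiner ?S ?T (?t i)" if i: "i \<in> carrier \<Gamma> \<times> carrier \<Gamma> \<times> carrier \<Gamma>" for i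
  proof -
    obtain a b c where abc: "i = (a, b, c)" "a \<in> carrier \<Gamma>" "b \<in> carrier \<Gamma>" "c \<in> carrier \<Gamma>"
      using i by auto
    \<comment> \<open>Each summand is the full twisted associator restricted to one component, that
      is, a composite of two morphisms of the center.\<close>
    have "?t i = ?\<alpha> \<cdot> ((proj a (fst A) \<otimes>\<^sub>a proj b (fst B)) \<otimes>\<^sub>a proj c (fst F))"
      using assoc\<omega>_comp[OF homogeneous_proj[OF o(1) abc(2)] homogeneous_proj[OF o(2) abc(3)]
          homogeneous_proj[OF o(3) abc(4)]] by (simp add: abc(1))
    moreover have "intertwiner ?S ?S ((proj a (fst A) \<otimes>\<^sub>a proj b (fst B)) \<otimes>\<^sub>a proj c (fst F))"
      using intertwiner_tens\<tau>[OF intertwiner_tens\<tau>[OF intertwiner_proj[OF A abc(2)] intertwiner_proj[OF B abc(3)]]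
          intertwiner_proj[OF F abc(4)]] by simp
    ultimately show ?thesis
      using intertwiner_comp[OF _ \<alpha>] by simp
  qed
  note t = this
  let ?P = "grade_proj Z\<tau> \<Gamma> (center_grading C G)"
  let ?u = "\<lambda>(a, b, c). \<omega> a b c \<bullet>\<^bsub>Z\<tau>\<^esub> (Assoc Z\<tau> A B F \<cdot>\<^bsub>Z\<tau>\<^esub> ((?P a A \<otimes>\<^sub>a\<^bsub>Z\<tau>\<^esub> ?P b B) \<otimes>\<^sub>a\<^bsub>Z\<tau>\<^esub> ?P c F))"
  have u: "?u i = \<lparr>CSrc = ?S, CTgt = ?T, Und = ?t i\<rparr>" if "i \<in> carrier \<Gamma> \<times> carrier \<Gamma> \<times> carrier \<Gamma>" for i
    using that A B F by (auto simp: grade_proj_center)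
  have "Assoc (twist Z\<tau> \<Gamma> (center_grading C G) \<omega>) A B F = Sum Z\<tau> ?S ?T ?u (carrier \<Gamma> \<times> carrier \<Gamma> \<times> carrier \<Gamma>)"
    by (simp add: twist_def)
  also have "\<dots> = \<lparr>CSrc = ?S, CTgt = ?T,
      Und = Sum D (fst ?S) (fst ?T) (\<lambda>i. Und (?u i)) (carrier \<Gamma> \<times> carrier \<Gamma> \<times> carrier \<Gamma>)\<rparr>"
  proof (rule center_Sum)
    show "?u i \<in> Hom Z\<tau> ?S ?T" if "i \<in> carrier \<Gamma> \<times> carrier \<Gamma> \<times> carrier \<Gamma>" for i
      unfolding u[OF that] center_Hom using t[OF that] by simp
  qed (use intertwinerD(1,2)[OF \<alpha>] in auto)
  also have "Sum D (fst ?S) (fst ?T) (\<lambda>i. Und (?u i)) (carrier \<Gamma> \<times> carrier \<Gamma> \<times> carrier \<Gamma>) =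
      Sum D (fst ?S) (fst ?T) ?t (carrier \<Gamma> \<times> carrier \<Gamma> \<times> carrier \<Gamma>)"
  proof (rule Sum_cong)
    show "Und (?u i) = ?t i" if "i \<in> carrier \<Gamma> \<times> carrier \<Gamma> \<times> carrier \<Gamma>" for i
      unfolding u[OF that] by simp
    show "?t i \<in> Hom D (fst ?S) (fst ?T)" if "i \<in> carrier \<Gamma> \<times> carrier \<Gamma> \<times> carrier \<Gamma>" for i
      by (rule intertwinerD(3)[OF t[OF that]])
  qed (use o in auto)
  also have "\<dots> = ?\<alpha>"
    by (simp add: twist_def)
  finally show ?thesis .
qed

theorem center_equivalence:
  "unitarily_monoidally_equivalent (center C' :: (('o, 'a, 'i) center_obj, ('o, 'a, 'i) center_arr) tensor_cat)
     (twist Z\<tau> \<Gamma> (center_grading C G) \<omega>)"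
proof -
  let ?A = "center C' :: (('o, 'a, 'i) center_obj, ('o, 'a, 'i) center_arr) tensor_cat"
  let ?B = "twist Z\<tau> \<Gamma> (center_grading C G) \<omega>"
  let ?F = "\<lambda>x. \<lparr>CSrc = transport f (CSrc x), CTgt = transport f (CTgt x), Und = Und x\<rparr>"
  let ?G = "\<lambda>x. \<lparr>CSrc = transport g (CSrc x), CTgt = transport g (CTgt x), Und = Und x\<rparr>"
  have [simp]: "?A = center_with C' (hb_tensor C')"
    by (simp add: center_def)
  note [simp] = N.center_Hom center_Hom transport_f_center transport_g_center transport_fg transport_gf
    intertwiner_transport_f intertwiner_transport_g tens'_center
  have F: "star_functor ?A ?B (transport f) ?F"
    by (auto simp: star_functor_def)
  have G: "star_functor ?B ?A (transport g) ?G"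
    by (auto simp: star_functor_def)
  have Id_unitary: "unitary ?B X X (Id ?B X)" if "X \<in> center_objects C" for X
    using Z.unitary_Id that by simp
  have Id_unitary': "unitary ?A X X (Id ?A X)" if "X \<in> center_objects C'" for X
    using star_category.unitary_Id[OF N.star_category_center] that by simp
  have eq: "star_equivalence ?A ?B (transport f) ?F"
    unfolding star_equivalence_def
  proof (intro conjI exI)
    \<comment> \<open>The two transports are inverse to each other on the nose, so identities serve
      as unit and counit.\<close>
    show "unitary_natural_iso ?A ?A (\<lambda>X. X) (\<lambda>f. f) (\<lambda>X. transport g (transport f X)) (\<lambda>x. ?G (?F x)) (Id ?A)"
      using Id_unitary' by (auto simp: unitary_natural_iso_def id_comp comp_id dest!: N.intertwinerD(3))
    show "unitary_natural_iso ?B ?B (\<lambda>X. transport f (transport g X)) (\<lambda>x. ?F (?G x)) (\<lambda>X. X) (\<lambda>f. f) (Id ?B)"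
      using Id_unitary by (auto simp: unitary_natural_iso_def id_comp comp_id dest!: intertwinerD(3))
  qed (rule F G)+
  \<comment> \<open>Both structure morphisms are identities, since transport preserves units and
    products as equalities of objects. The content of the associativity axiom is that the two
    twisted associators have the same underlying morphism.\<close>
  have "cstar_tensor_functor ?A ?B (transport f) ?F (Id ?B (Unit ?B)) (\<lambda>X Y. Id ?B (transport f (TensO ?A X Y)))"
    unfolding cstar_tensor_functor_def
  proof (intro conjI ballI)
    show "star_functor ?A ?B (transport f) ?F"
      by (rule F)
    show "unitary ?B (Unit ?B) (transport f (Unit ?A)) (Id ?B (Unit ?B))"
      using Id_unitary[OF Unit_center] by (simp add: Unit_transport)
  next
    fix X Y assume "X \<in> Obj ?A" "Y \<in> Obj ?A"
    then have XY: "X \<in> center_objects C'" "Y \<in> center_objects C'"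
      by simp_all
    note t = transport_tens'[OF XY]
    show "unitary ?B (TensO ?B (transport f X) (transport f Y)) (transport f (TensO ?A X Y))
        (Id ?B (transport f (TensO ?A X Y)))"
      using Id_unitary[OF transport_f_center[OF tens'_center[OF XY]]] t by simp
  next
    fix X X' Y Y' x y
    assume "X \<in> Obj ?A" "X' \<in> Obj ?A" "Y \<in> Obj ?A" "Y' \<in> Obj ?A" and x: "x \<in> Hom ?A X X'" and y: "y \<in> Hom ?A Y Y'"
    then have o: "X \<in> center_objects C'" "X' \<in> center_objects C'" "Y \<in> center_objects C'" "Y' \<in> center_objects C'"
      by simp_all
    have "Und x \<in> Hom D (fst X) (fst X')" "Und y \<in> Hom D (fst Y) (fst Y')"
      using x y N.intertwinerD(3) by auto
    then have "Und x \<otimes>\<^sub>a Und y \<in> Hom D (fst X \<otimes>\<^sub>o fst Y) (fst X' \<otimes>\<^sub>o fst Y')"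
      by (rule tens_hom)
    then show "Id ?B (transport f (TensO ?A X' Y')) \<cdot>\<^bsub>?B\<^esub> (?F x \<otimes>\<^sub>a\<^bsub>?B\<^esub> ?F y) =
        ?F (x \<otimes>\<^sub>a\<^bsub>?A\<^esub> y) \<cdot>\<^bsub>?B\<^esub> Id ?B (transport f (TensO ?A X Y))"
      using x y transport_tens'[OF o(1,3)] transport_tens'[OF o(2,4)] by (simp add: id_comp comp_id)
  next
    fix X Y W assume "X \<in> Obj ?A" "Y \<in> Obj ?A" "W \<in> Obj ?A"
    then have o: "X \<in> center_objects C'" "Y \<in> center_objects C'" "W \<in> center_objects C'"
      by simp_all
    note d = N.center_objectsD(1)[OF o(1)] N.center_objectsD(1)[OF o(2)] N.center_objectsD(1)[OF o(3)]
    note \<alpha> = assoc\<omega>_hom[OF d[unfolded ind_twist_eq]]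
    show "Id ?B (transport f (TensO ?A X (TensO ?A Y W))) \<cdot>\<^bsub>?B\<^esub>
        (Id ?B (transport f X) \<otimes>\<^sub>a\<^bsub>?B\<^esub> Id ?B (transport f (TensO ?A Y W))) \<cdot>\<^bsub>?B\<^esub>
        Assoc ?B (transport f X) (transport f Y) (transport f W) =
      ?F (Assoc ?A X Y W) \<cdot>\<^bsub>?B\<^esub> Id ?B (transport f (TensO ?A (TensO ?A X Y) W)) \<cdot>\<^bsub>?B\<^esub>
        (Id ?B (transport f (TensO ?A X Y)) \<otimes>\<^sub>a\<^bsub>?B\<^esub> Id ?B (transport f W))"
      using d \<alpha> o Assoc_twist_center[OF o[THEN transport_f_center]] transport_tens'[OF o(1,2)] transport_tens'[OF o(2,3)]
        transport_tens'[OF tens'_center[OF o(1,2)] o(3)] transport_tens'[OF o(1) tens'_center[OF o(2,3)]]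
      by (simp add: Assoc_twist id_comp comp_id)
  next
    fix X assume "X \<in> Obj ?A"
    then have X: "X \<in> center_objects C'"
      by simp
    have U: "(Unit D, \<lambda>Y\<in>Obj C. Id D (J Y)) \<in> center_objects C'"
      using N.Unit_center by simp
    have d: "fst X \<in> Obj D"
      using N.center_objectsD(1)[OF X] by simp
    have t: "fst X = Unit D \<otimes>\<^sub>o fst X" "fst X = fst X \<otimes>\<^sub>o Unit D"
      using d by (simp_all add: unit_tens_obj tens_unit_obj)
    note h = N.hb_tensor_Unit[OF X]
    note tt = transport_tens'[OF U X] transport_tens'[OF X U]
    show "Id ?B (transport f (TensO ?A (Unit ?A) X)) \<cdot>\<^bsub>?B\<^esub> (Id ?B (Unit ?B) \<otimes>\<^sub>a\<^bsub>?B\<^esub> Id ?B (transport f X)) = Id ?B (transport f X)"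
      using d h tt by (simp add: Unit_transport unit_tens_obj unit_obj)
    show "Id ?B (transport f (TensO ?A X (Unit ?A))) \<cdot>\<^bsub>?B\<^esub> (Id ?B (transport f X) \<otimes>\<^sub>a\<^bsub>?B\<^esub> Id ?B (Unit ?B)) = Id ?B (transport f X)"
      using d h tt by (simp add: Unit_transport tens_unit_obj unit_obj)
  qed
  then show ?thesis
    using eq unfolding unitarily_monoidally_equivalent_def by blast
qed

end

section \<open>The cocycles on $\mathbb{Z}/n\mathbb{Z}$\<close>

locale cyclic_cocycle =
  fixes n k :: nat
  assumes n_pos: "n \<ge> 1"
begin

abbreviation \<Gamma> :: "int monoid" where
  "\<Gamma> \<equiv> integer_mod_group n"

definition carry :: "int \<Rightarrow> int \<Rightarrow> int" where
  "carry a b = (a + b) div int n"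

text \<open>The weight \<open>f\<close>, a function of representatives below \<open>n\<close>: it is
  not periodic modulo \<open>n\<close>, and its failure to be so produces the cocycle.\<close>

definition phase :: "int \<Rightarrow> int \<Rightarrow> complex" where
  "phase a s = cis (2 * pi * (real k * of_int a * of_int s / (real n)\<^sup>2))"

lemma carrier_eq: "carrier \<Gamma> = {0..<int n}"
  using n_pos by (simp add: carrier_integer_mod_group)

lemma carry_commute: "carry a b = carry b a"
  by (simp add: carry_def add.commute)

lemma mult_eq: "(a + b) mod int n = a + b - int n * carry a b"
  by (simp add: carry_def minus_mult_div_eq_mod)

text \<open>Both sides, times \<open>n\<close>, are \<open>a + b + c\<close> minus its
  residue.\<close>

lemma carry_cocycle: "carry a b + carry ((a + b) mod int n) c = carry b c + carry a ((b + c) mod int n)"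
proof -
  have "int n * (carry a b + carry ((a + b) mod int n) c) = a + b + c - ((a + b) mod int n + c) mod int n"
    using mult_eq[of a b] mult_eq[of "(a + b) mod int n" c] by (simp add: algebra_simps)
  also have "\<dots> = a + b + c - (a + (b + c) mod int n) mod int n"
    by (simp add: mod_add_left_eq mod_add_right_eq add.assoc)
  also have "\<dots> = int n * (carry b c + carry a ((b + c) mod int n))"
    using mult_eq[of b c] mult_eq[of a "(b + c) mod int n"] by (simp add: algebra_simps)
  finally show ?thesis
    using n_pos by simp
qed

text \<open>For representatives below \<open>n\<close> the floors of \<open>a / n\<close> and
  \<open>b / n\<close> vanish and the remaining one is the carry. The factor \<open>m\<close> is
  left free so that the statement covers both \<open>k\<close> and \<open>2k\<close>.\<close>

lemma omega_eq:
  assumes "a \<in> carrier \<Gamma>" "b \<in> carrier \<Gamma>"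
  shows "omega n m a b c = cis (2 * pi * (real m * of_int (carry a b) * of_int c / real n))"
proof -
  have fl: "\<lfloor>of_int x / real n\<rfloor> = x div int n" for x :: int
    using floor_divide_of_int_eq[of x "int n"] by simp
  have z: "a div int n = 0" "b div int n = 0"
    using assms by (simp_all add: carrier_eq)
  have "exp (2 * of_real pi * \<i> * of_nat m * of_int (carry a b) * (of_int c / of_nat n)) =
      cis (2 * pi * (real m * of_int (carry a b) * of_int c / real n))"
    unfolding cis_conv_exp by (rule arg_cong[where f = exp]) (simp add: mult_ac)
  then show ?thesis
    using z unfolding omega_def fl by (simp add: carry_def)
qed

lemma cis_2pi_eq:
  assumes "x = y + of_int z"
  shows "cis (2 * pi * x) = cis (2 * pi * y)"
proof -
  have "cis (2 * pi * x) = cis (2 * pi * y) * cis (2 * pi * of_int z)"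
    unfolding assms cis_mult by (simp add: distrib_left)
  then show ?thesis
    using cis_multiple_2pi[of "of_int z"] by simp
qed

lemma cocycle:
  assumes abcd: "a \<in> carrier \<Gamma>" "b \<in> carrier \<Gamma>" "c \<in> carrier \<Gamma>" "d \<in> carrier \<Gamma>"
  shows "omega n k a b ((c + d) mod int n) * omega n k ((a + b) mod int n) c d =
    omega n k b c d * omega n k a ((b + c) mod int n) d * omega n k a b c"
proof -
  have m: "(x + y) mod int n \<in> carrier \<Gamma>" for x y
    using n_pos by (simp add: carrier_eq)
  have nz: "real n \<noteq> 0"
    using n_pos by simp
  have c: "real_of_int (carry a b) + of_int (carry ((a + b) mod int n) c) =
      of_int (carry b c) + of_int (carry a ((b + c) mod int n))"
    using carry_cocycle[of a b c] by (metis of_int_add)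
  let ?l = "real k * of_int (carry a b) * of_int ((c + d) mod int n) / real n
      + real k * of_int (carry ((a + b) mod int n) c) * of_int d / real n"
  let ?r = "real k * of_int (carry b c) * of_int d / real n
      + real k * of_int (carry a ((b + c) mod int n)) * of_int d / real n + real k * of_int (carry a b) * of_int c / real n"
  \<comment> \<open>Replacing the residue of \<open>c + d\<close> by \<open>c + d\<close> minus
    \<open>n\<close> times the carry produces, besides the cocycle identity for carries, the integer
    \<open>- k carry(a, b) carry(c, d)\<close>, which the exponential does not see.\<close>
  have "?l = real k * of_int (carry a b) * of_int c / real n - real k * of_int (carry a b) * of_int (carry c d)
      + real k * of_int d / real n * (real_of_int (carry a b) + of_int (carry ((a + b) mod int n) c))"
    unfolding mult_eq[of c d] using nz by (simp add: field_simps)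
  also have "\<dots> = ?r + of_int (- (int k * carry a b * carry c d))"
    unfolding c using nz by (simp add: field_simps)
  finally have "cis (2 * pi * ?l) = cis (2 * pi * ?r)"
    by (rule cis_2pi_eq)
  then show ?thesis
    using abcd m by (simp add: omega_eq cis_mult distrib_left)
qed

lemma omega_unit: "\<lbrakk>a \<in> carrier \<Gamma>; c \<in> carrier \<Gamma>\<rbrakk> \<Longrightarrow> omega n k a 0 c = 1"
  using n_pos by (simp add: omega_eq carry_def) (simp add: carrier_eq)

text \<open>The carry is symmetric, so \<open>\<omega>(a, s, t)\<close> and the conjugate of
  \<open>\<omega>(s, a, t)\<close> cancel. What remains is the defect of \<open>phase\<close> in its
  second argument, namely \<open>\<omega>(s, t, a)\<close>.\<close>

lemma cnj_phase_mult:
  assumes ast: "a \<in> carrier \<Gamma>" "s \<in> carrier \<Gamma>" "t \<in> carrier \<Gamma>"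
  shows "cnj (phase a ((s + t) mod int n)) =
    omega n k a s t * cnj (phase a s) * cnj (omega n k s a t) * cnj (phase a t) * omega n k s t a"
proof -
  have nz: "real n \<noteq> 0"
    using n_pos by simp
  show ?thesis
    unfolding omega_eq[OF ast(1,2)] omega_eq[OF ast(2,1)] omega_eq[OF ast(2,3)] phase_def cis_cnj cis_mult mult_eq
      carry_commute[of s a]
    by (rule arg_cong[where f = cis]) (use nz in \<open>simp add: field_simps power2_eq_square\<close>)
qed

text \<open>The factors \<open>\<omega>(a, s, b)\<close> and the conjugate of
  \<open>\<omega>(s, a, b)\<close> cancel by symmetry of the carry. One conjugate of
  \<open>\<omega>(a, b, s)\<close> is present explicitly and the defect of \<open>phase\<close> in
  its first argument gives a second.\<close>

lemma omega_double:
  assumes abs: "a \<in> carrier \<Gamma>" "b \<in> carrier \<Gamma>" "s \<in> carrier \<Gamma>"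
  shows "cnj (omega n (2 * k) a b s) = phase ((a + b) mod int n) s *
    (cnj (omega n k a b s) * cnj (phase b s) * omega n k a s b * cnj (phase a s) * cnj (omega n k s a b))"
proof -
  have nz: "real n \<noteq> 0"
    using n_pos by simp
  show ?thesis
    unfolding omega_eq[OF abs(1,2)] omega_eq[OF abs(1,3)] omega_eq[OF abs(3,1)] phase_def cis_cnj cis_mult mult_eq
      carry_commute[of s a]
    by (rule arg_cong[where f = cis]) (use nz in \<open>simp add: field_simps power2_eq_square\<close>)
qed

end

theorem proposition5p2:
  fixes n k :: nat
    and C :: "('o, 'a) tensor_cat"
    and G :: "int \<Rightarrow> 'o set"
  assumes "n \<ge> 1"
    and "rigid_cstar_tensor_category C"
    and "graded C (integer_mod_group n) G"
    and "k \<in> {0..<n}"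
  shows "unitarily_monoidally_equivalent
    (center (twist C (integer_mod_group n) G (omega n k))
      :: (('o, 'a, 'i) center_obj, ('o, 'a, 'i) center_arr) tensor_cat)
    (twist (center_k n k C G) (integer_mod_group n) (center_grading C G) (omega n k)
      :: (('o, 'a, 'i) center_obj, ('o, 'a, 'i) center_arr) tensor_cat)"
proof -
  interpret cyclic_cocycle n k
    by standard (rule assms(1))
  interpret ind_category C
    by (rule ind_category.intro[OF assms(2)])
  let ?D = "ind C :: (('o, 'a, 'i) ind_obj, ('o, 'a, 'i) ind_arr) tensor_cat"
  let ?\<omega> = "omega n k"
  interpret T: twisted_ind_category C \<Gamma> G ?\<omega>
  proof (intro twisted_ind_category.intro twisted_star_tensor_category.intro twisted_star_tensor_category_axioms.intro)
    show "ind_category C" ..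
    show "graded_star_tensor_category C \<Gamma> G"
      by (rule graded_star_tensor_categoryI[OF assms(3)])
    show "cmod (?\<omega> a b c) = 1" if "a \<in> carrier \<Gamma>" "b \<in> carrier \<Gamma>" for a b c
      using that by (simp add: omega_eq)
    show "?\<omega> a b (c \<otimes>\<^bsub>\<Gamma>\<^esub> d) * ?\<omega> (a \<otimes>\<^bsub>\<Gamma>\<^esub> b) c d = ?\<omega> b c d * ?\<omega> a (b \<otimes>\<^bsub>\<Gamma>\<^esub> c) d * ?\<omega> a b c"
      if "a \<in> carrier \<Gamma>" "b \<in> carrier \<Gamma>" "c \<in> carrier \<Gamma>" "d \<in> carrier \<Gamma>" for a b c d
      using cocycle[OF that] by simp
    show "?\<omega> a \<one>\<^bsub>\<Gamma>\<^esub> c = 1" if "a \<in> carrier \<Gamma>" "c \<in> carrier \<Gamma>" for a c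
      using omega_unit[OF that] by simp
  qed
  have emb: "half_braided_category ?D C"
  proof (intro half_braided_category.intro half_braided_category_axioms.intro)
    show "star_tensor_category ?D"
      by (rule star_tensor_category_ind)
  qed (auto simp: emb_ind_obj emb_arr_hom emb_obj_tens)
  have emb': "half_braided_category (ind (twist C \<Gamma> G ?\<omega>) :: (('o, 'a, 'i) ind_obj, ('o, 'a, 'i) ind_arr) tensor_cat)
      (twist C \<Gamma> G ?\<omega>)"
  proof (intro half_braided_category.intro half_braided_category_axioms.intro)
    show "star_tensor_category (ind (twist C \<Gamma> G ?\<omega>) :: (('o, 'a, 'i) ind_obj, ('o, 'a, 'i) ind_arr) tensor_cat)"
      by (rule T.star_tensor_category_ind_twist)
  qed (auto simp: emb_ind_obj emb_arr_hom emb_obj_tens)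
  interpret Z: twisted_center ?D \<Gamma> C G ?\<omega> phase "\<lambda>a b s. cnj (omega n (2 * k) a b s)"
  proof (intro twisted_center.intro abelian_twisted_star_tensor_category.intro
      abelian_twisted_star_tensor_category_axioms.intro twisted_center_axioms.intro)
    show "twisted_star_tensor_category ?D \<Gamma> (ind_grading C G) ?\<omega>"
      by (rule T.twisted_star_tensor_category_ind)
    show "half_braided_category ?D C"
      by (rule emb)
    show "half_braided_category (ind (twist C \<Gamma> G ?\<omega>) :: (('o, 'a, 'i) ind_obj, ('o, 'a, 'i) ind_arr) tensor_cat)
      (twist C \<Gamma> G ?\<omega>)"
      by (rule emb')
    show "\<exists>p\<in>Hom C Y Y. grade_proj ?D \<Gamma> (ind_grading C G) s (emb_obj C Y) = emb_arr C p"
      if "Y \<in> Obj C" "s \<in> carrier \<Gamma>" for Y s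
      using T.grade_proj_emb[OF that] T.proj_hom[OF that] by blast
    show "Assoc (ind (twist C \<Gamma> G ?\<omega>)) U V W = Assoc (twist ?D \<Gamma> (ind_grading C G) ?\<omega>) U V W"
      if "U \<in> Obj ?D" "V \<in> Obj ?D" "W \<in> Obj ?D" for U V W
      using T.Assoc_ind_twist that by simp
    show "cmod (phase a s) = 1" for a s
      by (simp add: phase_def)
    show "phase \<one>\<^bsub>\<Gamma>\<^esub> s = 1" for s
      by (simp add: phase_def)
    show "cnj (phase a (s \<otimes>\<^bsub>\<Gamma>\<^esub> t)) =
        ?\<omega> a s t * cnj (phase a s) * cnj (?\<omega> s a t) * cnj (phase a t) * ?\<omega> s t a"
      if "a \<in> carrier \<Gamma>" "s \<in> carrier \<Gamma>" "t \<in> carrier \<Gamma>" for a s t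
      using cnj_phase_mult[OF that] by simp
    show "cnj (omega n (2 * k) a b s) = phase (a \<otimes>\<^bsub>\<Gamma>\<^esub> b) s *
        (cnj (?\<omega> a b s) * cnj (phase b s) * ?\<omega> a s b * cnj (phase a s) * cnj (?\<omega> s a b))"
      if "a \<in> carrier \<Gamma>" "b \<in> carrier \<Gamma>" "s \<in> carrier \<Gamma>" for a b s
      using omega_double[OF that] by simp
  qed (simp_all add: add.commute)
  \<comment> \<open>With the chosen \<open>\<tau>\<close> the two definitions unfold to the same
    term.\<close>
  have "hb_tensor_k n k C G = Z.weighted_hb_tensor"
    unfolding hb_tensor_k_def[abs_def] Z.weighted_hb_tensor_def[abs_def] Let_def by (rule refl)
  then have "center_k n k C G = Z.Z\<tau>"
    unfolding center_k_def by (rule arg_cong)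
  then show ?thesis
    unfolding \<open>center_k n k C G = Z.Z\<tau>\<close> by (intro Z.center_equivalence)
qed

end
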